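(* Let $M$ be a flat Coxeter matrix, $W=W(M)$, $W_+=W_+(M)$, and let $x\mapsto w(x)$ be a function attaching to every $x\in W$ a reduced word $w(x)$ in the letters $s_i$ representing $x$. Then the left $R$-modules $A(M)$ and $A_+(M)$ are free. Moreover, they carry a filtration $F^\bullet$, defined by the condition that $F^nA(M)$ (respectively $F^nA_+(M)$) is the left $R$-span of the elements $T_{w(x)}$ for $x\in W$ (respectively $x\in W_+$) of length $\le n$, and this filtration has the property that the $R$-modules $\mathrm{gr}_nA(M)=F^nA(M)/F^{n-1}A(M)$ and $\mathrm{gr}_nA_+(M)=F^nA_+(M)/F^{n-1}A_+(M)$ are finitely generated and free for all $n\geq 0$ (where $F^{-1}=0$).
   Context: A Coxeter matrix over a finite set $I$ is a collection $M$ of elements $m_{ij}\in\mathbb{Z}_{\ge 2}\cup\{\infty\}$, $i,j\in I$, $i\neq j$, with $m_{ij}=m_{ji}$. The Coxeter group $W(M)$ is generated by $s_i$, $i\in I$, with relations $s_i^2=1$ and $(s_is_j)^{m_{ij}}=1$ whenever $m_{ij}<\infty$; the length of an element is taken with respect to these generators. $W_+(M)\subset W(M)$ is the kernel of the sign character $s_i\mapsto -1$. Let $t_{ijk}$ ($i\ne j$ in $I$ with $m_{ij}<\infty$, $k\in\mathbb{Z}_{m_{ij}}=\mathbb{Z}/m_{ij}\mathbb{Z}$) be commuting invertible variables subject only to $t_{ijk}=t_{ji,-k}^{-1}$, and let $R=\mathbb{C}[t_{ijk}]$ be the commutative ring they generate (a Laurent polynomial ring). $A(M)$ is the $\mathbb{C}$-algebra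 with invertible generators $s_i$ ($i\in I$) and $t_{ijk}$, and relations $t_{ijk}=t_{ji,-k}^{-1}$, $s_i^2=1$, $\prod_{k=1}^{m_{ij}}(s_is_j-t_{ijk})=0$ if $m_{ij}<\infty$, $[t_{ijk},t_{i'j'k'}]=0$, $s_pt_{ijk}=t_{jik}s_p$. It is a left $R$-module via the $t_{ijk}$. $A_+(M)$ is the $R$-algebra generated by $a_{ij}$, $i\neq j$, with $a_{ij}=a_{ji}^{-1}$, and relations $\prod_{k=1}^{m_{ij}}(a_{ij}-t_{ijk})=0$ if $m_{ij}<\infty$, and $a_{ij}a_{jp}a_{pi}=1$ for distinct $i,j,p$. It is identified with the subalgebra of $A(M)$ generated by the $t_{ijk}$ and the $s_is_j$ via $a_{ij}\mapsto s_is_j$. For a word $w$ in the letters $s_i$, $T_w\in A(M)$ denotes the corresponding product of generators; if $w$ has even length, then $T_w\in A_+(M)$. Flatness: set $t_{ijk}=e^{2\pi \mathrm{i}k/m_{ij}}e^{\tau_{ijk}}$ with formal parameters $\tau_{ijk}$ (so $\tau_{ijk}=-\tau_{ji,-k}$), and $\hat R=\mathbb{C}[[\tau_{ijk}]]$. $\hat A_+(M)$ is the ($\tau$-adically complete) $\hat R$-algebra topologically generated by the same generators with the same relations as $A_+(M)$. $M$ is called flat if $\hat A_+(M)$ is a flat deformation of $\mathbb{C}[W_+(M)]$, i.e. if $\hat A_+(M)$ is a topologically free left $\hat R$-module (isomorphic to $V[[\tau]]$ for a complex vector space $V$). *)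

theory Defs
  imports Complex_Main "HOL-Library.Extended_Nat" "HOL-Library.Multiset"
    "HOL-Algebra.Algebra" "HOL-Algebra.Algebraic_Closure_Type"
begin

section \<open>Free modules, quotient modules\<close>

text \<open>HOL-Algebra has modules and submodules, but neither bases nor quotients.\<close>

definition module_span :: "('r, 'm) ring_scheme \<Rightarrow> ('r, 'a, 'n) module_scheme \<Rightarrow> 'a set \<Rightarrow> 'a set" where
  "module_span R M B =
     {finsum M (\<lambda>b. c b \<odot>\<^bsub>M\<^esub> b) S | c S. finite S \<and> S \<subseteq> B \<and> c \<in> S \<rightarrow> carrier R}"

definition module_independent ::
    "('r, 'm) ring_scheme \<Rightarrow> ('r, 'a, 'n) module_scheme \<Rightarrow> 'a set \<Rightarrow> bool" where
  "module_independent R M B \<longleftrightarrow>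
     (\<forall>S c. finite S \<and> S \<subseteq> B \<and> c \<in> S \<rightarrow> carrier R \<and>
        finsum M (\<lambda>b. c b \<odot>\<^bsub>M\<^esub> b) S = \<zero>\<^bsub>M\<^esub> \<longrightarrow> (\<forall>b\<in>S. c b = \<zero>\<^bsub>R\<^esub>))"

definition free_module :: "('r, 'm) ring_scheme \<Rightarrow> ('r, 'a, 'n) module_scheme \<Rightarrow> bool" where
  "free_module R M \<longleftrightarrow> module R M \<and>
     (\<exists>B \<subseteq> carrier M. module_independent R M B \<and> module_span R M B = carrier M)"

definition fin_gen_module :: "('r, 'm) ring_scheme \<Rightarrow> ('r, 'a, 'n) module_scheme \<Rightarrow> bool" where
  "fin_gen_module R M \<longleftrightarrow> module R M \<and>
     (\<exists>S. finite S \<and> S \<subseteq> carrier M \<and> module_span R M S = carrier M)"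

text \<open>The multiplicative fields of a \<^typ>\<open>('r, 'a) module\<close> play no role for modules, so they
  are left unspecified here.\<close>

definition quotient_module :: "('r, 'a, 'n) module_scheme \<Rightarrow> 'a set \<Rightarrow> ('r, 'a set) module" where
  "quotient_module M N =
     \<lparr>carrier = a_rcosets\<^bsub>M\<^esub> N, monoid.mult = undefined, monoid.one = undefined,
      ring.zero = N, add = set_add M,
      module.smult = (\<lambda>r Y. \<Union>x\<in>Y. N +>\<^bsub>M\<^esub> (r \<odot>\<^bsub>M\<^esub> x))\<rparr>"

text \<open>Filtrations are indexed by the integers, so that \<open>F (-1) = 0\<close> can be expressed.\<close>

definition module_filtration ::
    "('r, 'm) ring_scheme \<Rightarrow> ('r, 'a, 'n) module_scheme \<Rightarrow> (int \<Rightarrow> 'a set) \<Rightarrow> bool" where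
  "module_filtration R M F \<longleftrightarrow>
     (\<forall>n. submodule (F n) R M) \<and> (\<forall>n. F n \<subseteq> F (n + 1)) \<and>
     F (-1) = {\<zero>\<^bsub>M\<^esub>} \<and> (\<Union>n. F n) = carrier M"

definition gr_module ::
    "('r, 'a, 'n) module_scheme \<Rightarrow> (int \<Rightarrow> 'a set) \<Rightarrow> int \<Rightarrow> ('r, 'a set) module" where
  "gr_module M F n = quotient_module (M\<lparr>carrier := F n\<rparr>) (F (n - 1))"


section \<open>Algebras given by generators and relations\<close>

text \<open>The free associative algebra over \<open>K\<close> on \<open>Y\<close>: finitely supported functions from words
  in \<open>Y\<close> to \<open>K\<close>, with the convolution product.\<close>

definition free_algebra :: "('k, 'm) ring_scheme \<Rightarrow> 'x set \<Rightarrow> ('x list \<Rightarrow> 'k) ring" where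
  "free_algebra K Y =
     \<lparr>carrier = {f. (\<forall>u. f u \<in> carrier K) \<and> finite {u. f u \<noteq> \<zero>\<^bsub>K\<^esub>} \<and>
                    {u. f u \<noteq> \<zero>\<^bsub>K\<^esub>} \<subseteq> lists Y},
      monoid.mult = (\<lambda>f g u. \<Oplus>\<^bsub>K\<^esub>n\<in>{..length u}. f (take n u) \<otimes>\<^bsub>K\<^esub> g (drop n u)),
      monoid.one = (\<lambda>u. if u = [] then \<one>\<^bsub>K\<^esub> else \<zero>\<^bsub>K\<^esub>),
      ring.zero = (\<lambda>u. \<zero>\<^bsub>K\<^esub>),
      add = (\<lambda>f g u. f u \<oplus>\<^bsub>K\<^esub> g u)\<rparr>"

definition fa_const :: "('k, 'm) ring_scheme \<Rightarrow> 'k \<Rightarrow> 'x list \<Rightarrow> 'k" where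
  "fa_const K c = (\<lambda>u. if u = [] then c else \<zero>\<^bsub>K\<^esub>)"

definition fa_gen :: "('k, 'm) ring_scheme \<Rightarrow> 'x \<Rightarrow> 'x list \<Rightarrow> 'k" where
  "fa_gen K x = (\<lambda>u. if u = [x] then \<one>\<^bsub>K\<^esub> else \<zero>\<^bsub>K\<^esub>)"

text \<open>A relation \<open>l = r\<close> is represented by the pair \<open>(l, r)\<close>; note that \<^const>\<open>genideal\<close>
  generates two-sided ideals.\<close>

definition rel_ideal ::
    "('k, 'm) ring_scheme \<Rightarrow> 'x set \<Rightarrow> (('x list \<Rightarrow> 'k) \<times> ('x list \<Rightarrow> 'k)) set \<Rightarrow> ('x list \<Rightarrow> 'k) set" where
  "rel_ideal K Y E =
     genideal (free_algebra K Y) {l \<ominus>\<^bsub>free_algebra K Y\<^esub> r | l r. (l, r) \<in> E}"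

definition presented_algebra ::
    "('k, 'm) ring_scheme \<Rightarrow> 'x set \<Rightarrow> (('x list \<Rightarrow> 'k) \<times> ('x list \<Rightarrow> 'k)) set
      \<Rightarrow> ('x list \<Rightarrow> 'k) set ring" where
  "presented_algebra K Y E = free_algebra K Y Quot rel_ideal K Y E"

definition pa_class ::
    "('k, 'm) ring_scheme \<Rightarrow> 'x set \<Rightarrow> (('x list \<Rightarrow> 'k) \<times> ('x list \<Rightarrow> 'k)) set
      \<Rightarrow> ('x list \<Rightarrow> 'k) \<Rightarrow> ('x list \<Rightarrow> 'k) set" where
  "pa_class K Y E f = rel_ideal K Y E +>\<^bsub>free_algebra K Y\<^esub> f"

definition list_prod :: "('a, 'm) monoid_scheme \<Rightarrow> 'a list \<Rightarrow> 'a" where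
  "list_prod G xs = foldr (monoid.mult G) xs \<one>\<^bsub>G\<^esub>"

text \<open>A ring \<open>Q\<close> as a left module via a structure map \<open>\<phi>\<close> from the ring of scalars.\<close>

definition with_scalars :: "'a ring \<Rightarrow> ('r \<Rightarrow> 'a) \<Rightarrow> ('r, 'a) module" where
  "with_scalars Q \<phi> =
     \<lparr>carrier = carrier Q, monoid.mult = monoid.mult Q, monoid.one = \<one>\<^bsub>Q\<^esub>, ring.zero = \<zero>\<^bsub>Q\<^esub>, add = add Q,
      module.smult = (\<lambda>r x. \<phi> r \<otimes>\<^bsub>Q\<^esub> x)\<rparr>"

text \<open>The completion of \<open>Q\<close> along a descending sequence of ideals \<open>N 0, N 1, \<dots>\<close>, i.e. the
  inverse limit of the rings \<open>Q Quot N n\<close>. A coset of \<open>N (Suc n)\<close> maps to a coset of \<open>N n\<close>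
  precisely if it is contained in it.\<close>

definition completion :: "'a ring \<Rightarrow> ('r \<Rightarrow> 'a) \<Rightarrow> (nat \<Rightarrow> 'a set) \<Rightarrow> ('r, nat \<Rightarrow> 'a set) module" where
  "completion Q \<phi> N =
     \<lparr>carrier = {x. \<forall>n. x n \<in> carrier (Q Quot N n) \<and> x (Suc n) \<subseteq> x n},
      monoid.mult = (\<lambda>x y n. x n \<otimes>\<^bsub>Q Quot N n\<^esub> y n),
      monoid.one = (\<lambda>n. \<one>\<^bsub>Q Quot N n\<^esub>),
      ring.zero = (\<lambda>n. \<zero>\<^bsub>Q Quot N n\<^esub>),
      add = (\<lambda>x y n. x n \<oplus>\<^bsub>Q Quot N n\<^esub> y n),
      module.smult = (\<lambda>r x n. (N n +>\<^bsub>Q\<^esub> \<phi> r) \<otimes>\<^bsub>Q Quot N n\<^esub> x n)\<rparr>"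


section \<open>Coxeter matrices and Coxeter groups\<close>

text \<open>The diagonal entries of \<open>m\<close> are irrelevant.\<close>

definition coxeter_matrix :: "'i set \<Rightarrow> ('i \<Rightarrow> 'i \<Rightarrow> enat) \<Rightarrow> bool" where
  "coxeter_matrix I m \<longleftrightarrow> finite I \<and>
     (\<forall>i\<in>I. \<forall>j\<in>I. i \<noteq> j \<longrightarrow> 2 \<le> m i j \<and> m i j = m j i)"

text \<open>Since \<open>s\<^sub>i\<^sup>2 = 1\<close>, no formal inverses of the generators are needed: the monoid with the
  defining presentation of \<open>W\<close> is already a group. The letter \<open>i\<close> stands for \<open>s\<^sub>i\<close>.\<close>

inductive cox_eq :: "'i set \<Rightarrow> ('i \<Rightarrow> 'i \<Rightarrow> enat) \<Rightarrow> 'i list \<Rightarrow> 'i list \<Rightarrow> bool"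
  for I :: "'i set" and m :: "'i \<Rightarrow> 'i \<Rightarrow> enat" where
  refl: "u \<in> lists I \<Longrightarrow> cox_eq I m u u"
| sym: "cox_eq I m u v \<Longrightarrow> cox_eq I m v u"
| trans: "cox_eq I m u v \<Longrightarrow> cox_eq I m v v' \<Longrightarrow> cox_eq I m u v'"
| square: "u \<in> lists I \<Longrightarrow> v \<in> lists I \<Longrightarrow> i \<in> I \<Longrightarrow> cox_eq I m (u @ [i, i] @ v) (u @ v)"
| braid: "u \<in> lists I \<Longrightarrow> v \<in> lists I \<Longrightarrow> i \<in> I \<Longrightarrow> j \<in> I \<Longrightarrow> i \<noteq> j \<Longrightarrow> m i j = enat n \<Longrightarrow>
    cox_eq I m (u @ concat (replicate n [i, j]) @ v) (u @ v)"

text \<open>The elements of \<open>W\<close> are the equivalence classes of words.\<close>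

definition cox_group :: "'i set \<Rightarrow> ('i \<Rightarrow> 'i \<Rightarrow> enat) \<Rightarrow> 'i list set monoid" where
  "cox_group I m =
     \<lparr>carrier = lists I // {(u, v). cox_eq I m u v},
      monoid.mult = (\<lambda>x y. {w. \<exists>u\<in>x. \<exists>v\<in>y. cox_eq I m (u @ v) w}),
      monoid.one = {w. cox_eq I m [] w}\<rparr>"

definition cox_length :: "'i list set \<Rightarrow> nat" where
  "cox_length x = (LEAST n. \<exists>u\<in>x. length u = n)"

definition cox_sign :: "'i list set \<Rightarrow> int" where
  "cox_sign x = (THE e. \<forall>u\<in>x. e = (-1) ^ length u)"

definition cox_plus :: "'i set \<Rightarrow> ('i \<Rightarrow> 'i \<Rightarrow> enat) \<Rightarrow> 'i list set set" where
  "cox_plus I m = kernel (cox_group I m) sign_img cox_sign"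

definition reduced_word_for :: "'i list set \<Rightarrow> 'i list \<Rightarrow> bool" where
  "reduced_word_for x u \<longleftrightarrow> u \<in> x \<and> length u = cox_length x"


section \<open>The ring \<open>R\<close> and the algebra \<open>A(M)\<close>\<close>

abbreviation complex_ring :: "complex ring" where
  "complex_ring \<equiv> ring_of_type_algebra"

text \<open>The index \<open>k\<close> of \<open>t\<^sub>i\<^sub>j\<^sub>k\<close> lives in \<open>\<int>/m\<^sub>i\<^sub>j\<int>\<close>; the generator is labelled by the
  representative of \<open>k\<close> in \<open>{0..<m\<^sub>i\<^sub>j}\<close>.\<close>

definition t_index :: "'i set \<Rightarrow> ('i \<Rightarrow> 'i \<Rightarrow> enat) \<Rightarrow> ('i \<times> 'i \<times> int) set" where
  "t_index I m = {(i, j, k). i \<in> I \<and> j \<in> I \<and> i \<noteq> j \<and> m i j < \<infinity> \<and> 0 \<le> k \<and> k < int (the_enat (m i j))}"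

definition t_label :: "('i \<Rightarrow> 'i \<Rightarrow> enat) \<Rightarrow> 'i \<Rightarrow> 'i \<Rightarrow> int \<Rightarrow> 'i \<times> 'i \<times> int" where
  "t_label m i j k = (i, j, k mod int (the_enat (m i j)))"

datatype 'i agen = Sgen 'i | Tgen "'i \<times> 'i \<times> int"

definition s_elt :: "'i \<Rightarrow> 'i agen list \<Rightarrow> complex" where
  "s_elt i = fa_gen complex_ring (Sgen i)"

definition t_elt :: "('i \<Rightarrow> 'i \<Rightarrow> enat) \<Rightarrow> 'i \<Rightarrow> 'i \<Rightarrow> int \<Rightarrow> 'i agen list \<Rightarrow> complex" where
  "t_elt m i j k = fa_gen complex_ring (Tgen (t_label m i j k))"

definition R_gens :: "'i set \<Rightarrow> ('i \<Rightarrow> 'i \<Rightarrow> enat) \<Rightarrow> 'i agen set" where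
  "R_gens I m = Tgen ` t_index I m"

definition R_rels :: "'i set \<Rightarrow> ('i \<Rightarrow> 'i \<Rightarrow> enat)
    \<Rightarrow> (('i agen list \<Rightarrow> complex) \<times> ('i agen list \<Rightarrow> complex)) set" where
  "R_rels I m = (let F = free_algebra complex_ring (R_gens I m) in
     {(t_elt m i j k \<otimes>\<^bsub>F\<^esub> t_elt m j i (-k), \<one>\<^bsub>F\<^esub>) | i j k. (i, j, k) \<in> t_index I m} \<union>
     {(t_elt m i j k \<otimes>\<^bsub>F\<^esub> t_elt m i' j' k', t_elt m i' j' k' \<otimes>\<^bsub>F\<^esub> t_elt m i j k) | i j k i' j' k'.
        (i, j, k) \<in> t_index I m \<and> (i', j', k') \<in> t_index I m})"

definition R_ring :: "'i set \<Rightarrow> ('i \<Rightarrow> 'i \<Rightarrow> enat) \<Rightarrow> ('i agen list \<Rightarrow> complex) set ring" where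
  "R_ring I m = presented_algebra complex_ring (R_gens I m) (R_rels I m)"

definition R_t :: "'i set \<Rightarrow> ('i \<Rightarrow> 'i \<Rightarrow> enat) \<Rightarrow> 'i \<Rightarrow> 'i \<Rightarrow> int \<Rightarrow> ('i agen list \<Rightarrow> complex) set" where
  "R_t I m i j k = pa_class complex_ring (R_gens I m) (R_rels I m) (t_elt m i j k)"

definition A_gens :: "'i set \<Rightarrow> ('i \<Rightarrow> 'i \<Rightarrow> enat) \<Rightarrow> 'i agen set" where
  "A_gens I m = Sgen ` I \<union> R_gens I m"

text \<open>All generators are invertible by virtue of the first two families of relations.\<close>

definition A_rels :: "'i set \<Rightarrow> ('i \<Rightarrow> 'i \<Rightarrow> enat)
    \<Rightarrow> (('i agen list \<Rightarrow> complex) \<times> ('i agen list \<Rightarrow> complex)) set" where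
  "A_rels I m = (let F = free_algebra complex_ring (A_gens I m) in
     {(t_elt m i j k \<otimes>\<^bsub>F\<^esub> t_elt m j i (-k), \<one>\<^bsub>F\<^esub>) | i j k. (i, j, k) \<in> t_index I m} \<union>
     {(s_elt i \<otimes>\<^bsub>F\<^esub> s_elt i, \<one>\<^bsub>F\<^esub>) | i. i \<in> I} \<union>
     {(list_prod F (map (\<lambda>k. (s_elt i \<otimes>\<^bsub>F\<^esub> s_elt j) \<ominus>\<^bsub>F\<^esub> t_elt m i j k) [1..int n]), \<zero>\<^bsub>F\<^esub>) | i j n.
        i \<in> I \<and> j \<in> I \<and> i \<noteq> j \<and> m i j = enat n} \<union>
     {(t_elt m i j k \<otimes>\<^bsub>F\<^esub> t_elt m i' j' k', t_elt m i' j' k' \<otimes>\<^bsub>F\<^esub> t_elt m i j k) | i j k i' j' k'.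
        (i, j, k) \<in> t_index I m \<and> (i', j', k') \<in> t_index I m} \<union>
     {(s_elt p \<otimes>\<^bsub>F\<^esub> t_elt m i j k, t_elt m j i k \<otimes>\<^bsub>F\<^esub> s_elt p) | p i j k.
        p \<in> I \<and> (i, j, k) \<in> t_index I m})"

text \<open>The structure map \<open>R \<rightarrow> A(M)\<close>, \<open>t\<^sub>i\<^sub>j\<^sub>k \<mapsto> t\<^sub>i\<^sub>j\<^sub>k\<close>, sends the class \<open>r\<close> of \<open>f\<close> to the class
  of \<open>f\<close>.\<close>

definition A_alg :: "'i set \<Rightarrow> ('i \<Rightarrow> 'i \<Rightarrow> enat)
    \<Rightarrow> (('i agen list \<Rightarrow> complex) set, ('i agen list \<Rightarrow> complex) set) module" where
  "A_alg I m = with_scalars (presented_algebra complex_ring (A_gens I m) (A_rels I m))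
     (\<lambda>r. \<Union>f\<in>r. pa_class complex_ring (A_gens I m) (A_rels I m) f)"

definition T_A :: "'i set \<Rightarrow> ('i \<Rightarrow> 'i \<Rightarrow> enat) \<Rightarrow> 'i list \<Rightarrow> ('i agen list \<Rightarrow> complex) set" where
  "T_A I m u = list_prod (A_alg I m)
     (map (\<lambda>i. pa_class complex_ring (A_gens I m) (A_rels I m) (s_elt i)) u)"


section \<open>The algebra \<open>A\<^sub>+(M)\<close>\<close>

text \<open>The presentation of \<open>A\<^sub>+(M)\<close> over an arbitrary coefficient ring \<open>K\<close> containing elements
  \<open>t\<^sub>i\<^sub>j\<^sub>k\<close>; it is used both over \<open>R\<close> and over its completed version \<open>Rhat\<close>. The generator \<open>a\<^sub>i\<^sub>j\<close> is labelled \<open>(i, j)\<close>.\<close>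

definition Aplus_gens :: "'i set \<Rightarrow> ('i \<times> 'i) set" where
  "Aplus_gens I = {(i, j). i \<in> I \<and> j \<in> I \<and> i \<noteq> j}"

definition Aplus_rels :: "('k, 'n) ring_scheme \<Rightarrow> 'i set \<Rightarrow> ('i \<Rightarrow> 'i \<Rightarrow> enat) \<Rightarrow> ('i \<Rightarrow> 'i \<Rightarrow> int \<Rightarrow> 'k)
    \<Rightarrow> ((('i \<times> 'i) list \<Rightarrow> 'k) \<times> (('i \<times> 'i) list \<Rightarrow> 'k)) set" where
  "Aplus_rels K I m t = (let F = free_algebra K (Aplus_gens I); a = (\<lambda>i j. fa_gen K (i, j)) in
     {(a i j \<otimes>\<^bsub>F\<^esub> a j i, \<one>\<^bsub>F\<^esub>) | i j. i \<in> I \<and> j \<in> I \<and> i \<noteq> j} \<union>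
     {(list_prod F (map (\<lambda>k. a i j \<ominus>\<^bsub>F\<^esub> fa_const K (t i j k)) [1..int n]), \<zero>\<^bsub>F\<^esub>) | i j n.
        i \<in> I \<and> j \<in> I \<and> i \<noteq> j \<and> m i j = enat n} \<union>
     {(a i j \<otimes>\<^bsub>F\<^esub> a j p \<otimes>\<^bsub>F\<^esub> a p i, \<one>\<^bsub>F\<^esub>) | i j p.
        i \<in> I \<and> j \<in> I \<and> p \<in> I \<and> i \<noteq> j \<and> j \<noteq> p \<and> i \<noteq> p})"

definition Aplus_ring :: "('k, 'n) ring_scheme \<Rightarrow> 'i set \<Rightarrow> ('i \<Rightarrow> 'i \<Rightarrow> enat)
    \<Rightarrow> ('i \<Rightarrow> 'i \<Rightarrow> int \<Rightarrow> 'k) \<Rightarrow> (('i \<times> 'i) list \<Rightarrow> 'k) set ring" where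
  "Aplus_ring K I m t = presented_algebra K (Aplus_gens I) (Aplus_rels K I m t)"

definition Aplus_class :: "('k, 'n) ring_scheme \<Rightarrow> 'i set \<Rightarrow> ('i \<Rightarrow> 'i \<Rightarrow> enat)
    \<Rightarrow> ('i \<Rightarrow> 'i \<Rightarrow> int \<Rightarrow> 'k) \<Rightarrow> (('i \<times> 'i) list \<Rightarrow> 'k) \<Rightarrow> (('i \<times> 'i) list \<Rightarrow> 'k) set" where
  "Aplus_class K I m t = pa_class K (Aplus_gens I) (Aplus_rels K I m t)"

definition Aplus_alg :: "'i set \<Rightarrow> ('i \<Rightarrow> 'i \<Rightarrow> enat)
    \<Rightarrow> (('i agen list \<Rightarrow> complex) set, (('i \<times> 'i) list \<Rightarrow> ('i agen list \<Rightarrow> complex) set) set) module" where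
  "Aplus_alg I m = with_scalars (Aplus_ring (R_ring I m) I m (R_t I m))
     (\<lambda>r. Aplus_class (R_ring I m) I m (R_t I m) (fa_const (R_ring I m) r))"

text \<open>Under \<open>a\<^sub>i\<^sub>j \<mapsto> s\<^sub>i s\<^sub>j\<close>, the element \<open>T\<^sub>w\<close> of \<open>A(M)\<close>, for a word \<open>w = i\<^sub>1 j\<^sub>1 i\<^sub>2 j\<^sub>2 \<dots>\<close>
  of even length, corresponds to the product of the \<open>a i\<^sub>\<nu> j\<^sub>\<nu>\<close>, where \<open>a i i\<close> is \<open>1\<close> as
  \<open>s\<^sub>i\<^sup>2 = 1\<close>. The value at words of odd length is immaterial.\<close>

fun even_pairs :: "'i list \<Rightarrow> ('i \<times> 'i) list" where
  "even_pairs (i # j # u) = (i, j) # even_pairs u"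
| "even_pairs u = []"

definition T_Aplus :: "'i set \<Rightarrow> ('i \<Rightarrow> 'i \<Rightarrow> enat) \<Rightarrow> 'i list
    \<Rightarrow> (('i \<times> 'i) list \<Rightarrow> ('i agen list \<Rightarrow> complex) set) set" where
  "T_Aplus I m u = list_prod (Aplus_alg I m)
     (map (\<lambda>(i, j). if i = j then \<one>\<^bsub>Aplus_alg I m\<^esub>
              else Aplus_class (R_ring I m) I m (R_t I m) (fa_gen (R_ring I m) (i, j)))
        (even_pairs u))"


section \<open>The filtrations\<close>

definition filt_A :: "'i set \<Rightarrow> ('i \<Rightarrow> 'i \<Rightarrow> enat) \<Rightarrow> ('i list set \<Rightarrow> 'i list) \<Rightarrow> int
    \<Rightarrow> ('i agen list \<Rightarrow> complex) set set" where
  "filt_A I m w n = module_span (R_ring I m) (A_alg I m)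
     {T_A I m (w x) | x. x \<in> carrier (cox_group I m) \<and> int (cox_length x) \<le> n}"

definition filt_Aplus :: "'i set \<Rightarrow> ('i \<Rightarrow> 'i \<Rightarrow> enat) \<Rightarrow> ('i list set \<Rightarrow> 'i list) \<Rightarrow> int
    \<Rightarrow> (('i \<times> 'i) list \<Rightarrow> ('i agen list \<Rightarrow> complex) set) set set" where
  "filt_Aplus I m w n = module_span (R_ring I m) (Aplus_alg I m)
     {T_Aplus I m (w x) | x. x \<in> cox_plus I m \<and> int (cox_length x) \<le> n}"


section \<open>Flatness\<close>

text \<open>Formal power series in the (finitely many) variables \<open>Y\<close>, with monomials encoded as
  multisets of variables.\<close>

definition power_series_ring :: "'x set \<Rightarrow> ('x multiset \<Rightarrow> complex) ring" where
  "power_series_ring Y =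
     \<lparr>carrier = {f. \<forall>\<mu>. \<not> set_mset \<mu> \<subseteq> Y \<longrightarrow> f \<mu> = 0},
      monoid.mult = (\<lambda>f g \<mu>. \<Sum>\<alpha> | \<alpha> \<subseteq># \<mu>. f \<alpha> * g (\<mu> - \<alpha>)),
      monoid.one = (\<lambda>\<mu>. if \<mu> = {#} then 1 else 0),
      ring.zero = (\<lambda>\<mu>. 0),
      add = (\<lambda>f g \<mu>. f \<mu> + g \<mu>)\<rparr>"

definition ps_monom :: "'x multiset \<Rightarrow> 'x multiset \<Rightarrow> complex" where
  "ps_monom \<nu> = (\<lambda>\<mu>. if \<mu> = \<nu> then 1 else 0)"

text \<open>The exponential of a power series without constant term; its \<open>\<mu>\<close>-coefficient only
  involves the powers \<open>f^n\<close> with \<open>n \<le> size \<mu>\<close>.\<close>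

definition ps_exp :: "'x set \<Rightarrow> ('x multiset \<Rightarrow> complex) \<Rightarrow> 'x multiset \<Rightarrow> complex" where
  "ps_exp Y f = (\<lambda>\<mu>. \<Sum>n\<le>size \<mu>. (f [^]\<^bsub>power_series_ring Y\<^esub> n) \<mu> / fact n)"

text \<open>The module \<open>V[[Y]]\<close> of power series with coefficients in a complex vector space \<open>V\<close>.\<close>

definition power_series_module :: "'x set \<Rightarrow> (complex, 'v) module
    \<Rightarrow> ('x multiset \<Rightarrow> complex, 'x multiset \<Rightarrow> 'v) module" where
  "power_series_module Y V =
     \<lparr>carrier = {f. \<forall>\<mu>. f \<mu> \<in> carrier V \<and> (\<not> set_mset \<mu> \<subseteq> Y \<longrightarrow> f \<mu> = \<zero>\<^bsub>V\<^esub>)},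
      monoid.mult = undefined, monoid.one = undefined,
      ring.zero = (\<lambda>\<mu>. \<zero>\<^bsub>V\<^esub>),
      add = (\<lambda>f g \<mu>. f \<mu> \<oplus>\<^bsub>V\<^esub> g \<mu>),
      module.smult = (\<lambda>r f \<mu>. \<Oplus>\<^bsub>V\<^esub>\<alpha>\<in>{\<alpha>. \<alpha> \<subseteq># \<mu>}. r \<alpha> \<odot>\<^bsub>V\<^esub> f (\<mu> - \<alpha>))\<rparr>"

definition module_isomorphic ::
    "('r, 'm) ring_scheme \<Rightarrow> ('r, 'a, 'n) module_scheme \<Rightarrow> ('r, 'b, 'l) module_scheme \<Rightarrow> bool" where
  "module_isomorphic R M N \<longleftrightarrow>
     (\<exists>h. bij_betw h (carrier M) (carrier N) \<and>
        (\<forall>x\<in>carrier M. \<forall>y\<in>carrier M. h (x \<oplus>\<^bsub>M\<^esub> y) = h x \<oplus>\<^bsub>N\<^esub> h y) \<and>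
        (\<forall>r\<in>carrier R. \<forall>x\<in>carrier M. h (r \<odot>\<^bsub>M\<^esub> x) = r \<odot>\<^bsub>N\<^esub> h x))"

text \<open>Taking \<open>V\<close> over the same type as \<open>M\<close> is no restriction: \<open>V\<close> embeds into \<open>V[[Y]]\<close> as the
  constant series, hence into any module isomorphic to it.\<close>

definition topologically_free ::
    "'x set \<Rightarrow> ('x multiset \<Rightarrow> complex, 'a) module \<Rightarrow> bool" where
  "topologically_free Y M \<longleftrightarrow>
     (\<exists>V :: (complex, 'a) module. module complex_ring V \<and>
        module_isomorphic (power_series_ring Y) M (power_series_module Y V))"

text \<open>Because of \<open>\<tau>\<^sub>i\<^sub>j\<^sub>k = - \<tau>\<^sub>j\<^sub>i\<^sub>,\<^sub>-\<^sub>k\<close>, only one parameter from each pair is an independent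
  variable. Which ones are selected is immaterial: another choice changes signs only.\<close>

definition tau_vars :: "'i set \<Rightarrow> ('i \<Rightarrow> 'i \<Rightarrow> enat) \<Rightarrow> ('i \<times> 'i \<times> int) set" where
  "tau_vars I m = (SOME Y. Y \<subseteq> t_index I m \<and>
     (\<forall>(i, j, k)\<in>t_index I m. (i, j, k) \<in> Y \<longleftrightarrow> t_label m j i (-k) \<notin> Y))"

definition Rhat :: "'i set \<Rightarrow> ('i \<Rightarrow> 'i \<Rightarrow> enat) \<Rightarrow> (('i \<times> 'i \<times> int) multiset \<Rightarrow> complex) ring" where
  "Rhat I m = power_series_ring (tau_vars I m)"

definition tau :: "'i set \<Rightarrow> ('i \<Rightarrow> 'i \<Rightarrow> enat) \<Rightarrow> 'i \<Rightarrow> 'i \<Rightarrow> int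
    \<Rightarrow> ('i \<times> 'i \<times> int) multiset \<Rightarrow> complex" where
  "tau I m i j k = (if t_label m i j k \<in> tau_vars I m then ps_monom {#t_label m i j k#}
     else (\<lambda>\<mu>. - ps_monom {#t_label m j i (-k)#} \<mu>))"

definition t_hat :: "'i set \<Rightarrow> ('i \<Rightarrow> 'i \<Rightarrow> enat) \<Rightarrow> 'i \<Rightarrow> 'i \<Rightarrow> int
    \<Rightarrow> ('i \<times> 'i \<times> int) multiset \<Rightarrow> complex" where
  "t_hat I m i j k = (\<lambda>\<mu>. exp (2 * of_real pi * \<i> * of_int k / of_nat (the_enat (m i j))) *
     ps_exp (tau_vars I m) (tau I m i j k) \<mu>)"

text \<open>The ideals \<open>(\<tau>)^n\<close> of the uncompleted algebra \<open>Aplus_ring\<close> over \<open>Rhat\<close>; its completion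
  is the complete algebra topologically generated by the \<open>a\<^sub>i\<^sub>j\<close> with the given relations.\<close>

definition tau_ideal :: "'i set \<Rightarrow> ('i \<Rightarrow> 'i \<Rightarrow> enat) \<Rightarrow> nat
    \<Rightarrow> (('i \<times> 'i) list \<Rightarrow> ('i \<times> 'i \<times> int) multiset \<Rightarrow> complex) set set" where
  "tau_ideal I m n = genideal (Aplus_ring (Rhat I m) I m (t_hat I m))
     {Aplus_class (Rhat I m) I m (t_hat I m) (fa_const (Rhat I m) (ps_monom \<nu>)) | \<nu>.
        set_mset \<nu> \<subseteq> tau_vars I m \<and> size \<nu> = n}"

definition Aplus_hat :: "'i set \<Rightarrow> ('i \<Rightarrow> 'i \<Rightarrow> enat)
    \<Rightarrow> (('i \<times> 'i \<times> int) multiset \<Rightarrow> complex,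
        nat \<Rightarrow> (('i \<times> 'i) list \<Rightarrow> ('i \<times> 'i \<times> int) multiset \<Rightarrow> complex) set set) module" where
  "Aplus_hat I m = completion (Aplus_ring (Rhat I m) I m (t_hat I m))
     (\<lambda>r. Aplus_class (Rhat I m) I m (t_hat I m) (fa_const (Rhat I m) r))
     (tau_ideal I m)"

definition flat_coxeter_matrix :: "'i set \<Rightarrow> ('i \<Rightarrow> 'i \<Rightarrow> enat) \<Rightarrow> bool" where
  "flat_coxeter_matrix I m \<longleftrightarrow>
     coxeter_matrix I m \<and> topologically_free (tau_vars I m) (Aplus_hat I m)"

end

theory Submission
  imports Defs
begin

text \<open>Modulo words of smaller length, the relation \<open>\<Prod>\<^sub>k (s\<^sub>i s\<^sub>j - t\<^sub>i\<^sub>j\<^sub>k) = 0\<close> turns a braid move into multiplication by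
  a scalar of \<open>R\<close>. By Matsumoto's theorem, \<open>T\<^sub>u\<close> then depends on the reduced word \<open>u\<close> only up to such a scalar and
  shorter words, while non-reduced words reduce to shorter ones; hence the \<open>T\<^bsub>w(x)\<^esub>\<close> span, without any use of
  flatness.

  For their independence, \<open>A(M)\<close> is represented by two by two matrices over \<open>A\<^sub>+(M)\<close>, which separates the even
  and the odd part of a relation, so that only even words have to be considered. As \<open>R\<close> embeds into
  \<open>\<complex>[[\<tau>]]\<close>, a relation between even words gives one over \<open>\<complex>[[\<tau>]]\<close> in the completed algebra, which is
  isomorphic to \<open>V[[\<tau>]]\<close>. Its coefficients vanish by induction on the degree: the coefficients of lowest degree form
  a relation at \<open>\<tau> = 0\<close>, i.e. between the corresponding elements of \<open>\<complex>[W\<^sub>+]\<close>, which act on functions on \<open>W\<close> by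
  distinct translations.

  Both modules are therefore free with bases indexed by group elements. Each length bound is satisfied by
  finitely many of these, so the basis elements of length \<open>n\<close> give a finite basis of \<open>gr\<^sub>n\<close>.\<close>

text \<open>Two obstacles shape the argument. First, \<open>R\<close> is not treated as central in
  \<open>A(M)\<close>: \<open>s p\<close> turns \<open>t\<^sub>i\<^sub>j\<^sub>k\<close> into
  \<open>t\<^sub>j\<^sub>i\<^sub>k\<close>, so left multiplication by a letter is only semilinear,
  and every span argument has to move scalars past letters. For \<open>A_+(M)\<close> the spanning
  statement is not proved again but projected from \<open>A(M)\<close> through the even part of the
  matrix representation. Second, the uncompleted algebra over \<complex>[[\<tau>]] is not known to
  be torsion free or \<tau>-adically separated, and flatness supplies only a linear isomorphism of
  its completion with V[[\<tau>]], with no a priori relation to products. What it does give is that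
  an element whose constant coefficient in V vanishes lies in the ideal generated by the \<tau>'s;
  this isolates the lowest coefficients of a relation without any division by \<tau>.
  \<open>R\<close> embeds because distinct Laurent monomials become multiples of exponentials of
  distinct linear forms. Matsumoto's theorem needs the exact order of
  \<open>s\<^sub>i s\<^sub>j\<close>, which is read off from an explicit representation of
  W.\<close>

lemma (in abelian_monoid) finsum_mono_neutral_left:
  assumes "finite B" "A \<subseteq> B" "\<And>i. i \<in> B - A \<Longrightarrow> h i = \<zero>" "h \<in> B \<rightarrow> carrier G"
  shows "finsum G h A = finsum G h B"
  using assms by (intro add.finprod_mono_neutral_cong_left) auto

text \<open>Formulated for bare additive maps, because it is applied not only to ring homomorphisms
  but also to inclusions of submodules, quotient projections, matrix entries and coefficient
  functionals. For infinite \<open>A\<close> both sums are zero by convention.\<close>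

lemma additive_finsum:
  assumes "abelian_monoid G" "abelian_monoid H"
    and "\<And>x. x \<in> carrier G \<Longrightarrow> h x \<in> carrier H" "h \<zero>\<^bsub>G\<^esub> = \<zero>\<^bsub>H\<^esub>"
    and "\<And>x y. x \<in> carrier G \<Longrightarrow> y \<in> carrier G \<Longrightarrow> h (x \<oplus>\<^bsub>G\<^esub> y) = h x \<oplus>\<^bsub>H\<^esub> h y"
    and "f \<in> A \<rightarrow> carrier G"
  shows "h (finsum G f A) = finsum H (\<lambda>x. h (f x)) A"
proof -
  interpret G: abelian_monoid G by fact
  interpret H: abelian_monoid H by fact
  show ?thesis using assms(6)
  proof (induction A rule: infinite_finite_induct)
    case (insert x A)
    then show ?case
      using assms(3,5) by (simp add: Pi_iff)
  qed (simp_all add: assms(4))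
qed

lemma list_prod_simps [simp]:
  "list_prod G [] = \<one>\<^bsub>G\<^esub>" "list_prod G (x # xs) = x \<otimes>\<^bsub>G\<^esub> list_prod G xs"
  by (simp_all add: list_prod_def)

lemma (in monoid) list_prod_closed [intro, simp]:
  "set xs \<subseteq> carrier G \<Longrightarrow> list_prod G xs \<in> carrier G"
  by (induction xs) auto

lemma (in monoid) list_prod_append:
  "set xs \<subseteq> carrier G \<Longrightarrow> set ys \<subseteq> carrier G \<Longrightarrow>
    list_prod G (xs @ ys) = list_prod G xs \<otimes> list_prod G ys"
  by (induction xs) (auto simp: m_assoc)

lemma ring_hom_list_prod:
  assumes "monoid G" "h \<in> ring_hom G H" "set xs \<subseteq> carrier G"
  shows "h (list_prod G xs) = list_prod H (map h xs)"
proof -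
  interpret monoid G by fact
  show ?thesis using assms(2,3)
    by (induction xs) (auto simp: ring_hom_one ring_hom_mult)
qed

section \<open>Free algebras\<close>

text \<open>A monomial. Scalars, generators and the unit are all of this form, so one product rule
  serves them all.\<close>

definition fa_single :: "('k, 'm) ring_scheme \<Rightarrow> 'k \<Rightarrow> 'x list \<Rightarrow> 'x list \<Rightarrow> 'k" where
  "fa_single K c u = (\<lambda>v. if v = u then c else \<zero>\<^bsub>K\<^esub>)"

lemma fa_const_eq_single: "fa_const K c = fa_single K c []"
  and fa_gen_eq_single: "fa_gen K x = fa_single K \<one>\<^bsub>K\<^esub> [x]"
  and fa_one_eq_single: "\<one>\<^bsub>free_algebra K Y\<^esub> = fa_single K \<one>\<^bsub>K\<^esub> []"
  and fa_zero: "\<zero>\<^bsub>free_algebra K Y\<^esub> = (\<lambda>u. \<zero>\<^bsub>K\<^esub>)"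
  and fa_add: "f \<oplus>\<^bsub>free_algebra K Y\<^esub> g = (\<lambda>u. f u \<oplus>\<^bsub>K\<^esub> g u)"
  and fa_mult_def: "f \<otimes>\<^bsub>free_algebra K Y\<^esub> g =
    (\<lambda>u. \<Oplus>\<^bsub>K\<^esub>n\<in>{..length u}. f (take n u) \<otimes>\<^bsub>K\<^esub> g (drop n u))"
  by (auto simp: fa_const_def fa_gen_def fa_single_def free_algebra_def)

context ring
begin

lemma fa_carrier: "f \<in> carrier (free_algebra R Y) \<longleftrightarrow>
   (\<forall>u. f u \<in> carrier R) \<and> finite {u. f u \<noteq> \<zero>} \<and> {u. f u \<noteq> \<zero>} \<subseteq> lists Y"
  by (simp add: free_algebra_def)

lemma fa_coeff [intro]: "f \<in> carrier (free_algebra R Y) \<Longrightarrow> f u \<in> carrier R"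
  by (simp add: fa_carrier)

lemma fa_mult_Nil:
  "f [] \<in> carrier R \<Longrightarrow> g [] \<in> carrier R \<Longrightarrow> (f \<otimes>\<^bsub>free_algebra R Y\<^esub> g) [] = f [] \<otimes> g []"
  by (simp add: fa_mult_def)

text \<open>Splitting off the term in which \<open>f\<close> contributes the empty word leaves the
  product of the left derivative \<open>\<lambda>v. f (a # v)\<close> with \<open>g\<close>. This
  recursion makes associativity an induction on the word instead of a rearrangement of double
  sums.\<close>

lemma fa_mult_Cons:
  assumes "\<And>u. f u \<in> carrier R" "\<And>u. g u \<in> carrier R"
  shows "(f \<otimes>\<^bsub>free_algebra R Y\<^esub> g) (a # u) =
    f [] \<otimes> g (a # u) \<oplus> ((\<lambda>v. f (a # v)) \<otimes>\<^bsub>free_algebra R Y\<^esub> g) u"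
proof -
  have "(f \<otimes>\<^bsub>free_algebra R Y\<^esub> g) (a # u) =
    (\<Oplus>n\<in>{..length u}. f (take (Suc n) (a # u)) \<otimes> g (drop (Suc n) (a # u))) \<oplus>
      f (take 0 (a # u)) \<otimes> g (drop 0 (a # u))"
    unfolding fa_mult_def list.size add_Suc_right add_0_right using assms by (subst finsum_Suc2) auto
  also have "\<dots> = ((\<lambda>v. f (a # v)) \<otimes>\<^bsub>free_algebra R Y\<^esub> g) u \<oplus> f [] \<otimes> g (a # u)"
    by (simp add: fa_mult_def)
  finally show ?thesis
    using assms by (simp add: a_comm fa_mult_def)
qed

lemma fa_mult_coeff:
  "(\<And>u. f u \<in> carrier R) \<Longrightarrow> (\<And>u. g u \<in> carrier R) \<Longrightarrow> (f \<otimes>\<^bsub>free_algebra R Y\<^esub> g) u \<in> carrier R"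
  by (auto simp: fa_mult_def intro!: finsum_closed)

lemma fa_mult_closed:
  assumes f: "f \<in> carrier (free_algebra R Y)" and g: "g \<in> carrier (free_algebra R Y)"
  shows "f \<otimes>\<^bsub>free_algebra R Y\<^esub> g \<in> carrier (free_algebra R Y)"
proof -
  let ?A = "(\<lambda>(u, v). u @ v) ` ({u. f u \<noteq> \<zero>} \<times> {u. g u \<noteq> \<zero>})"
  have c: "f u \<in> carrier R" "g u \<in> carrier R" for u
    using f g by (auto simp: fa_carrier)
  have sub: "{u. (f \<otimes>\<^bsub>free_algebra R Y\<^esub> g) u \<noteq> \<zero>} \<subseteq> ?A"
  proof
    fix u assume "u \<in> {u. (f \<otimes>\<^bsub>free_algebra R Y\<^esub> g) u \<noteq> \<zero>}"
    then have "(\<Oplus>n\<in>{..length u}. f (take n u) \<otimes> g (drop n u)) \<noteq> \<zero>"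
      by (simp add: fa_mult_def)
    then obtain n where "f (take n u) \<otimes> g (drop n u) \<noteq> \<zero>"
      using add.finprod_one_eqI[of "{..length u}" "\<lambda>n. f (take n u) \<otimes> g (drop n u)"] by blast
    then have "f (take n u) \<noteq> \<zero>" "g (drop n u) \<noteq> \<zero>"
      using c by auto
    then show "u \<in> ?A"
      by (intro image_eqI[of _ _ "(take n u, drop n u)"]) auto
  qed
  have "finite ?A" "?A \<subseteq> lists Y"
    using f g unfolding fa_carrier by (fastforce simp: subset_iff simp del: in_lists_conv_set)+
  with sub show ?thesis
    using c finite_subset by (auto simp: fa_carrier intro!: fa_mult_coeff)
qed

lemma fa_zero_mult:
  assumes "\<And>u. g u \<in> carrier R"
  shows "(\<lambda>u. \<zero>) \<otimes>\<^bsub>free_algebra R Y\<^esub> g = (\<lambda>u. \<zero>)"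
  using assms by (auto simp: fa_mult_def fun_eq_iff)

lemma fa_l_distr:
  assumes "\<And>u. f u \<in> carrier R" "\<And>u. g u \<in> carrier R" "\<And>u. h u \<in> carrier R"
  shows "(\<lambda>u. f u \<oplus> g u) \<otimes>\<^bsub>free_algebra R Y\<^esub> h =
    (\<lambda>u. (f \<otimes>\<^bsub>free_algebra R Y\<^esub> h) u \<oplus> (g \<otimes>\<^bsub>free_algebra R Y\<^esub> h) u)"
  using assms by (simp add: fa_mult_def l_distr finsum_addf)

lemma fa_r_distr:
  assumes "\<And>u. f u \<in> carrier R" "\<And>u. g u \<in> carrier R" "\<And>u. h u \<in> carrier R"
  shows "h \<otimes>\<^bsub>free_algebra R Y\<^esub> (\<lambda>u. f u \<oplus> g u) =
    (\<lambda>u. (h \<otimes>\<^bsub>free_algebra R Y\<^esub> f) u \<oplus> (h \<otimes>\<^bsub>free_algebra R Y\<^esub> g) u)"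
  using assms by (simp add: fa_mult_def r_distr finsum_addf)

lemma fa_scale_mult:
  assumes "c \<in> carrier R" "\<And>u. f u \<in> carrier R" "\<And>u. g u \<in> carrier R"
  shows "(\<lambda>u. c \<otimes> f u) \<otimes>\<^bsub>free_algebra R Y\<^esub> g = (\<lambda>u. c \<otimes> (f \<otimes>\<^bsub>free_algebra R Y\<^esub> g) u)"
  using assms by (simp add: fa_mult_def m_assoc finsum_rdistr)

lemma fa_m_assoc:
  assumes "\<And>u. f u \<in> carrier R" "\<And>u. g u \<in> carrier R" "\<And>u. h u \<in> carrier R"
  shows "((f \<otimes>\<^bsub>free_algebra R Y\<^esub> g) \<otimes>\<^bsub>free_algebra R Y\<^esub> h) u =
    (f \<otimes>\<^bsub>free_algebra R Y\<^esub> (g \<otimes>\<^bsub>free_algebra R Y\<^esub> h)) u"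
  using assms(1)
proof (induction u arbitrary: f)
  case Nil
  then show ?case using assms by (simp add: fa_mult_Nil m_assoc)
next
  case (Cons a u)
  let ?F = "free_algebra R Y"
  note [simp] = Cons.prems assms(2,3) fa_mult_coeff
  have "((f \<otimes>\<^bsub>?F\<^esub> g) \<otimes>\<^bsub>?F\<^esub> h) (a # u) =
      (f [] \<otimes> g []) \<otimes> h (a # u) \<oplus> ((\<lambda>v. (f \<otimes>\<^bsub>?F\<^esub> g) (a # v)) \<otimes>\<^bsub>?F\<^esub> h) u"
    by (simp add: fa_mult_Cons fa_mult_Nil)
  \<comment> \<open>A Leibniz rule: the left derivative of \<open>f g\<close> is \<open>f []\<close>
    times the derivative of \<open>g\<close>, plus the derivative of \<open>f\<close> times
    \<open>g\<close>. The induction hypothesis applies to the derivative of \<open>f\<close>, which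
    is why \<open>f\<close> is generalised.\<close>
  also have "(\<lambda>v. (f \<otimes>\<^bsub>?F\<^esub> g) (a # v)) \<otimes>\<^bsub>?F\<^esub> h =
      (\<lambda>u. f [] \<otimes> ((\<lambda>v. g (a # v)) \<otimes>\<^bsub>?F\<^esub> h) u \<oplus> (((\<lambda>v. f (a # v)) \<otimes>\<^bsub>?F\<^esub> g) \<otimes>\<^bsub>?F\<^esub> h) u)"
    by (simp add: fa_mult_Cons fa_l_distr fa_scale_mult)
  also have "(((\<lambda>v. f (a # v)) \<otimes>\<^bsub>?F\<^esub> g) \<otimes>\<^bsub>?F\<^esub> h) u = ((\<lambda>v. f (a # v)) \<otimes>\<^bsub>?F\<^esub> (g \<otimes>\<^bsub>?F\<^esub> h)) u"
    by (rule Cons.IH) simp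
  finally show ?case
    by (simp add: fa_mult_Cons fa_mult_Nil m_assoc a_assoc r_distr)
qed

lemma fa_single_closed [intro]:
  assumes "c \<in> carrier R" "u \<in> lists Y"
  shows "fa_single R c u \<in> carrier (free_algebra R Y)"
  using assms by (auto simp: fa_carrier fa_single_def)

text \<open>The left derivative of a monomial is the monomial with its first letter removed, or
  zero; the claim follows from the recursion \<open>fa_mult_Cons\<close>.\<close>

lemma fa_single_mult_coeff:
  assumes "c \<in> carrier R" "\<And>u. g u \<in> carrier R"
  shows "(fa_single R c u \<otimes>\<^bsub>free_algebra R Y\<^esub> g) x =
    (if take (length u) x = u then c \<otimes> g (drop (length u) x) else \<zero>)"
proof -
  have coeff: "fa_single R c u v \<in> carrier R" for u v :: "'x list"
    using assms(1) by (simp add: fa_single_def)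
  have shift: "(\<lambda>v. fa_single R c u (a # v)) =
      (case u of [] \<Rightarrow> (\<lambda>v. \<zero>) | b # u \<Rightarrow> if a = b then fa_single R c u else (\<lambda>v. \<zero>))" for a u
    by (auto simp: fa_single_def fun_eq_iff split: list.split)
  show ?thesis
  proof (induction u arbitrary: x)
    case Nil
    show ?case
    proof (cases x)
      case Nil
      then show ?thesis using assms by (simp add: fa_mult_Nil fa_single_def)
    next
      case (Cons a y)
      then show ?thesis using assms
        by (simp add: fa_mult_Cons coeff shift fa_zero_mult) (simp add: fa_single_def)
    qed
  next
    case (Cons b u)
    note IH = Cons.IH
    show ?case
    proof (cases x)
      case Nil
      then show ?thesis using assms by (simp add: fa_mult_Nil fa_single_def)
    next
      case x: (Cons a y)
      have "fa_single R c (b # u) [] = \<zero>" by (simp add: fa_single_def)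
        with x show ?thesis using assms IH
        by (auto simp: fa_mult_Cons coeff shift fa_zero_mult)
    qed
  qed
qed

lemma fa_single_mult:
  assumes "c \<in> carrier R" "d \<in> carrier R"
  shows "fa_single R c u \<otimes>\<^bsub>free_algebra R Y\<^esub> fa_single R d v = fa_single R (c \<otimes> d) (u @ v)"
proof
  fix x
  have "x = u @ v \<longleftrightarrow> take (length u) x = u \<and> drop (length u) x = v"
    by (metis append_eq_conv_conj)
  then show "(fa_single R c u \<otimes>\<^bsub>free_algebra R Y\<^esub> fa_single R d v) x = fa_single R (c \<otimes> d) (u @ v) x"
    using assms by (subst fa_single_mult_coeff) (auto simp: fa_single_def)
qed

lemma fa_add_closed:
  assumes "f \<in> carrier (free_algebra R Y)" "g \<in> carrier (free_algebra R Y)"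
  shows "(\<lambda>u. f u \<oplus> g u) \<in> carrier (free_algebra R Y)"
proof -
  have sub: "{u. f u \<oplus> g u \<noteq> \<zero>} \<subseteq> {u. f u \<noteq> \<zero>} \<union> {u. g u \<noteq> \<zero>}" by auto
  have "finite {u. f u \<oplus> g u \<noteq> \<zero>}"
    using assms by (intro finite_subset[OF sub]) (auto simp: fa_carrier)
  moreover have "{u. f u \<oplus> g u \<noteq> \<zero>} \<subseteq> lists Y"
    using sub assms unfolding fa_carrier by blast
  ultimately show ?thesis
    using assms by (simp add: fa_carrier)
qed

lemma free_algebra_abelian_group: "abelian_group (free_algebra R Y)"
proof (rule abelian_groupI)
  show "f \<oplus>\<^bsub>free_algebra R Y\<^esub> g \<in> carrier (free_algebra R Y)"
    if "f \<in> carrier (free_algebra R Y)" "g \<in> carrier (free_algebra R Y)" for f g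
    unfolding fa_add using that by (rule fa_add_closed)
  show "\<exists>g\<in>carrier (free_algebra R Y). g \<oplus>\<^bsub>free_algebra R Y\<^esub> f = \<zero>\<^bsub>free_algebra R Y\<^esub>"
    if "f \<in> carrier (free_algebra R Y)" for f
  proof (intro bexI)
    have "(\<lambda>u. \<ominus> f u) u \<noteq> \<zero> \<longleftrightarrow> f u \<noteq> \<zero>" for u
      using that by (metis add.inv_eq_1_iff fa_coeff)
    with that show "(\<lambda>u. \<ominus> f u) \<in> carrier (free_algebra R Y)"
      by (simp add: fa_carrier)
    show "(\<lambda>u. \<ominus> f u) \<oplus>\<^bsub>free_algebra R Y\<^esub> f = \<zero>\<^bsub>free_algebra R Y\<^esub>"
      using that by (auto simp: fa_add fa_zero fa_carrier l_neg)
  qed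
qed (auto simp: fa_add fa_zero fa_carrier a_assoc intro!: ext a_comm)

lemma free_algebra_ring: "ring (free_algebra R Y)"
proof (rule ringI)
  show "monoid (free_algebra R Y)"
  proof (rule monoidI)
    show "\<one>\<^bsub>free_algebra R Y\<^esub> \<in> carrier (free_algebra R Y)"
      unfolding fa_one_eq_single by auto
    show "f \<otimes>\<^bsub>free_algebra R Y\<^esub> g \<otimes>\<^bsub>free_algebra R Y\<^esub> h =
        f \<otimes>\<^bsub>free_algebra R Y\<^esub> (g \<otimes>\<^bsub>free_algebra R Y\<^esub> h)"
      if "f \<in> carrier (free_algebra R Y)" "g \<in> carrier (free_algebra R Y)" "h \<in> carrier (free_algebra R Y)" for f g h
      using that by (intro ext fa_m_assoc) auto
    show "\<one>\<^bsub>free_algebra R Y\<^esub> \<otimes>\<^bsub>free_algebra R Y\<^esub> f = f" if "f \<in> carrier (free_algebra R Y)" for f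
      using that by (auto simp: fa_one_eq_single fa_single_mult_coeff fa_coeff)
    show "f \<otimes>\<^bsub>free_algebra R Y\<^esub> \<one>\<^bsub>free_algebra R Y\<^esub> = f" if f: "f \<in> carrier (free_algebra R Y)" for f
    proof
      fix u
      have c: "f v \<in> carrier R" for v using f by auto
      have "(f \<otimes>\<^bsub>free_algebra R Y\<^esub> \<one>\<^bsub>free_algebra R Y\<^esub>) u =
          (\<Oplus>n\<in>{..length u}. f (take n u) \<otimes> (if drop n u = [] then \<one> else \<zero>))"
        by (simp add: fa_mult_def fa_one_eq_single fa_single_def)
      also have "\<dots> = (\<Oplus>n\<in>{..length u}. if length u = n then f u else \<zero>)"
        using c by (intro finsum_cong') auto
      also have "\<dots> = f u"
        using c by (subst add.finprod_singleton) auto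
      finally show "(f \<otimes>\<^bsub>free_algebra R Y\<^esub> \<one>\<^bsub>free_algebra R Y\<^esub>) u = f u" .
    qed
  qed (rule fa_mult_closed)
qed (auto simp: free_algebra_abelian_group fa_add fa_coeff intro!: fa_l_distr fa_r_distr)

lemma fa_induct [consumes 1, case_names zero single add]:
  assumes f: "f \<in> carrier (free_algebra R Y)"
    and zero: "P (\<lambda>u. \<zero>)"
    and single: "\<And>c u. c \<in> carrier R \<Longrightarrow> u \<in> lists Y \<Longrightarrow> P (fa_single R c u)"
    and add: "\<And>f g. f \<in> carrier (free_algebra R Y) \<Longrightarrow> g \<in> carrier (free_algebra R Y) \<Longrightarrow>
      P f \<Longrightarrow> P g \<Longrightarrow> P (\<lambda>u. f u \<oplus> g u)"
  shows "P f"
proof -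
  \<comment> \<open>Induction over a finite set containing the support: setting the coefficient at
    one word to zero removes this word from \<open>S\<close>, and the removed part is a
    monomial.\<close>
  have "P f" if "finite S" "{u. f u \<noteq> \<zero>} \<subseteq> S" "f \<in> carrier (free_algebra R Y)" for S f
    using that
  proof (induction S arbitrary: f)
    case empty
    then have "f = (\<lambda>u. \<zero>)" by auto
    then show ?case using zero by simp
  next
    case (insert v S)
    let ?g = "f(v := \<zero>)"
    have g: "?g \<in> carrier (free_algebra R Y)"
    proof -
      have "{u. ?g u \<noteq> \<zero>} \<subseteq> {u. f u \<noteq> \<zero>}" by auto
      then have "finite {u. ?g u \<noteq> \<zero>}" "{u. ?g u \<noteq> \<zero>} \<subseteq> lists Y"
        using insert.prems(2) unfolding fa_carrier by (blast intro: finite_subset)+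
      then show ?thesis
        using insert.prems(2) by (simp add: fa_carrier)
    qed
    have "{u. ?g u \<noteq> \<zero>} \<subseteq> S"
      using insert.prems(1) by auto
    then have Pg: "P ?g"
      using insert.IH g by blast
    show ?case
    proof (cases "f v = \<zero>")
      case True
      then have "?g = f" by auto
      with Pg show ?thesis by simp
    next
      case False
      then have v: "v \<in> lists Y" "f v \<in> carrier R"
        using insert.prems by (auto simp: fa_carrier)
      have "P (\<lambda>u. ?g u \<oplus> fa_single R (f v) v u)"
        using v by (intro add g Pg single fa_single_closed)
      also have "(\<lambda>u. ?g u \<oplus> fa_single R (f v) v u) = f"
        using insert.prems by (auto simp: fa_single_def fa_carrier fun_eq_iff)
      finally show ?thesis .
    qed
  qed
  from this[of "{u. f u \<noteq> \<zero>}" f] f show ?thesis by (auto simp: fa_carrier)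
qed

lemma fa_single_eq_mult:
  assumes "c \<in> carrier R"
  shows "fa_single R c (x # u) = fa_gen R x \<otimes>\<^bsub>free_algebra R Y\<^esub> fa_single R c u"
  using assms by (simp add: fa_gen_eq_single fa_single_mult)

end

definition fa_eval :: "('k, 'm) ring_scheme \<Rightarrow> ('b, 'n) ring_scheme \<Rightarrow> ('k \<Rightarrow> 'b) \<Rightarrow> ('x \<Rightarrow> 'b) \<Rightarrow> ('x list \<Rightarrow> 'k) \<Rightarrow> 'b" where
  "fa_eval K B \<kappa> g f = (\<Oplus>\<^bsub>B\<^esub>u\<in>{u. f u \<noteq> \<zero>\<^bsub>K\<^esub>}. \<kappa> (f u) \<otimes>\<^bsub>B\<^esub> list_prod B (map g u))"

text \<open>The target is noncommutative, so coefficients can be collected in front of words only if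
  their images commute with the images of the generators.\<close>

locale fa_evaluation = K: ring K + B: ring B
  for K :: "('k, 'm) ring_scheme" and B :: "('b, 'n) ring_scheme" +
  fixes Y :: "'x set" and \<kappa> :: "'k \<Rightarrow> 'b" and g :: "'x \<Rightarrow> 'b"
  assumes \<kappa>: "\<kappa> \<in> ring_hom K B"
    and g: "\<And>x. x \<in> Y \<Longrightarrow> g x \<in> carrier B"
    and central: "\<And>c x. c \<in> carrier K \<Longrightarrow> x \<in> Y \<Longrightarrow> \<kappa> c \<otimes>\<^bsub>B\<^esub> g x = g x \<otimes>\<^bsub>B\<^esub> \<kappa> c"
begin

abbreviation "ev \<equiv> fa_eval K B \<kappa> g"
abbreviation "FA \<equiv> free_algebra K Y"

sublocale FA: ring FA by (rule K.free_algebra_ring)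

lemma kappa_closed [simp]: "c \<in> carrier K \<Longrightarrow> \<kappa> c \<in> carrier B"
  using \<kappa> by (rule ring_hom_closed)

lemma kappa_zero [simp]: "\<kappa> \<zero>\<^bsub>K\<^esub> = \<zero>\<^bsub>B\<^esub>"
  using \<kappa> ring_hom_zero K.ring_axioms B.ring_axioms by blast

lemma word_closed [simp]: "u \<in> lists Y \<Longrightarrow> list_prod B (map g u) \<in> carrier B"
  using g by (intro B.list_prod_closed) auto

lemma word_central:
  assumes "c \<in> carrier K" "u \<in> lists Y"
  shows "\<kappa> c \<otimes>\<^bsub>B\<^esub> list_prod B (map g u) = list_prod B (map g u) \<otimes>\<^bsub>B\<^esub> \<kappa> c"
  using assms(2)
proof (induction u)
  case (Cons x u)
  then show ?case using assms(1) g central[of c x]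
    by simp (metis (no_types, lifting) B.m_assoc kappa_closed word_closed)
qed (use assms in auto)

text \<open>The support of a sum may shrink by cancellation; evaluations are therefore compared over
  a common larger set of words.\<close>

lemma ev_superset:
  assumes "f \<in> carrier FA" "finite S" "{u. f u \<noteq> \<zero>\<^bsub>K\<^esub>} \<subseteq> S" "S \<subseteq> lists Y"
  shows "ev f = (\<Oplus>\<^bsub>B\<^esub>u\<in>S. \<kappa> (f u) \<otimes>\<^bsub>B\<^esub> list_prod B (map g u))"
  unfolding fa_eval_def using assms
  by (intro B.finsum_mono_neutral_left) (auto simp: K.fa_coeff Pi_iff subset_iff)

lemma ev_closed [simp]: "f \<in> carrier FA \<Longrightarrow> ev f \<in> carrier B"
  unfolding fa_eval_def by (intro B.finsum_closed) (auto simp: K.fa_carrier subset_iff)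

lemma ev_add:
  assumes "f \<in> carrier FA" "h \<in> carrier FA"
  shows "ev (f \<oplus>\<^bsub>FA\<^esub> h) = ev f \<oplus>\<^bsub>B\<^esub> ev h"
proof -
  let ?S = "{u. f u \<noteq> \<zero>\<^bsub>K\<^esub>} \<union> {u. h u \<noteq> \<zero>\<^bsub>K\<^esub>}"
  have S: "finite ?S" "?S \<subseteq> lists Y" using assms by (auto simp: K.fa_carrier)
  have c: "f u \<in> carrier K" "h u \<in> carrier K" for u using assms by (auto simp: K.fa_carrier)
  have "ev (f \<oplus>\<^bsub>FA\<^esub> h) = (\<Oplus>\<^bsub>B\<^esub>u\<in>?S. \<kappa> ((f \<oplus>\<^bsub>FA\<^esub> h) u) \<otimes>\<^bsub>B\<^esub> list_prod B (map g u))"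
    using assms S by (intro ev_superset FA.a_closed) (auto simp: fa_add)
  also have "\<dots> = (\<Oplus>\<^bsub>B\<^esub>u\<in>?S. \<kappa> (f u) \<otimes>\<^bsub>B\<^esub> list_prod B (map g u) \<oplus>\<^bsub>B\<^esub> \<kappa> (h u) \<otimes>\<^bsub>B\<^esub> list_prod B (map g u))"
    using S c by (intro B.finsum_cong')
      (auto simp: fa_add ring_hom_add[OF \<kappa>] B.l_distr subset_iff)
  also have "\<dots> = ev f \<oplus>\<^bsub>B\<^esub> ev h"
    using S c assms by (subst B.finsum_addf) (auto simp: subset_iff Pi_iff ev_superset[of _ ?S])
  finally show ?thesis .
qed

lemma ev_single:
  assumes "c \<in> carrier K" "u \<in> lists Y"
  shows "ev (fa_single K c u) = \<kappa> c \<otimes>\<^bsub>B\<^esub> list_prod B (map g u)"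
  using assms
  by (subst ev_superset[of _ "{u}"]) (auto simp: fa_single_def intro!: K.fa_single_closed[unfolded fa_single_def])

lemma ev_zero: "ev (\<lambda>u. \<zero>\<^bsub>K\<^esub>) = \<zero>\<^bsub>B\<^esub>"
  by (simp add: fa_eval_def)

lemma ev_mult_single:
  assumes "c \<in> carrier K" "u \<in> lists Y" "d \<in> carrier K" "v \<in> lists Y"
  shows "ev (fa_single K c u \<otimes>\<^bsub>FA\<^esub> fa_single K d v) = ev (fa_single K c u) \<otimes>\<^bsub>B\<^esub> ev (fa_single K d v)"
proof -
  let ?p = "list_prod B (map g u)" and ?q = "list_prod B (map g v)"
  have words: "list_prod B (map g (u @ v)) = ?p \<otimes>\<^bsub>B\<^esub> ?q"
    using assms g by (auto intro!: B.list_prod_append)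
  have "ev (fa_single K c u \<otimes>\<^bsub>FA\<^esub> fa_single K d v) = (\<kappa> c \<otimes>\<^bsub>B\<^esub> \<kappa> d) \<otimes>\<^bsub>B\<^esub> (?p \<otimes>\<^bsub>B\<^esub> ?q)"
    using assms words
    by (subst K.fa_single_mult) (auto simp: ev_single ring_hom_mult[OF \<kappa>] simp del: map_append)
  also have "\<dots> = \<kappa> c \<otimes>\<^bsub>B\<^esub> (\<kappa> d \<otimes>\<^bsub>B\<^esub> ?p) \<otimes>\<^bsub>B\<^esub> ?q"
    using assms by (simp add: B.m_assoc)
  also have "\<dots> = (\<kappa> c \<otimes>\<^bsub>B\<^esub> ?p) \<otimes>\<^bsub>B\<^esub> (\<kappa> d \<otimes>\<^bsub>B\<^esub> ?q)"
    using assms by (simp add: word_central[of d u] B.m_assoc)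
  finally show ?thesis using assms by (simp add: ev_single)
qed

lemma ev_mult:
  assumes f: "f \<in> carrier FA" and h: "h \<in> carrier FA"
  shows "ev (f \<otimes>\<^bsub>FA\<^esub> h) = ev f \<otimes>\<^bsub>B\<^esub> ev h"
  using f
proof (induction f rule: K.fa_induct)
  case zero
  then show ?case using h by (simp add: K.fa_zero_mult K.fa_coeff ev_zero)
next
  case (single c u)
  show ?case using h
  proof (induction h rule: K.fa_induct)
    case zero
    have "fa_single K c u \<otimes>\<^bsub>FA\<^esub> \<zero>\<^bsub>FA\<^esub> = \<zero>\<^bsub>FA\<^esub>"
      using single by (intro FA.r_null) auto
    then show ?case using single by (simp add: fa_zero ev_zero K.fa_single_closed)
  next
    case (single d v)
    then show ?case using ev_mult_single \<open>c \<in> carrier K\<close> \<open>u \<in> lists Y\<close> by blast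
  next
    case (add f h)
    have s: "fa_single K c u \<in> carrier FA" using single by auto
    have "ev (fa_single K c u \<otimes>\<^bsub>FA\<^esub> (f \<oplus>\<^bsub>FA\<^esub> h)) = ev (fa_single K c u) \<otimes>\<^bsub>B\<^esub> ev (f \<oplus>\<^bsub>FA\<^esub> h)"
      using add s by (simp add: FA.r_distr ev_add B.r_distr)
    then show ?case by (simp add: fa_add)
  qed
next
  case (add f f')
  have "ev ((f \<oplus>\<^bsub>FA\<^esub> f') \<otimes>\<^bsub>FA\<^esub> h) = ev (f \<oplus>\<^bsub>FA\<^esub> f') \<otimes>\<^bsub>B\<^esub> ev h"
    using add h by (simp add: FA.l_distr ev_add B.l_distr)
  then show ?case by (simp add: fa_add)
qed

lemma ev_hom: "ev \<in> ring_hom FA B"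
  using ring_hom_one[OF \<kappa>]
  by (intro ring_hom_memI) (auto simp: ev_mult ev_add ev_single fa_one_eq_single)

lemma ev_const: "c \<in> carrier K \<Longrightarrow> ev (fa_const K c) = \<kappa> c"
  by (simp add: fa_const_eq_single ev_single)

lemma ev_gen: "x \<in> Y \<Longrightarrow> ev (fa_gen K x) = g x"
  using g ring_hom_one[OF \<kappa>] by (simp add: fa_gen_eq_single ev_single)

end

section \<open>Presented algebras\<close>

lemma (in ring) fa_const_hom: "fa_const R \<in> ring_hom R (free_algebra R Y)"
  by (rule ring_hom_memI)
    (auto simp: fa_const_eq_single fa_single_mult fa_one_eq_single fa_add fun_eq_iff, auto simp: fa_single_def)

locale presentation = ring K for K (structure) +
  fixes Y :: "'x set" and E :: "(('x list \<Rightarrow> 'a) \<times> ('x list \<Rightarrow> 'a)) set"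
  assumes rel_closed: "(l, r) \<in> E \<Longrightarrow> l \<in> carrier (free_algebra K Y) \<and> r \<in> carrier (free_algebra K Y)"
begin

abbreviation "FA \<equiv> free_algebra K Y"
abbreviation "PA \<equiv> presented_algebra K Y E"
abbreviation "cls \<equiv> pa_class K Y E"

sublocale FA: ring FA by (rule free_algebra_ring)

lemma rel_ideal: "ideal (rel_ideal K Y E) FA"
  unfolding rel_ideal_def using rel_closed by (intro FA.genideal_ideal) auto

sublocale I: ideal "rel_ideal K Y E" FA by (rule rel_ideal)

sublocale PA: ring PA
  unfolding presented_algebra_def by (rule I.quotient_is_ring)

lemma cls_hom: "cls \<in> ring_hom FA PA"
  using I.rcos_ring_hom unfolding presented_algebra_def pa_class_def .

lemmas cls_mult = ring_hom_mult[OF cls_hom] and cls_add = ring_hom_add[OF cls_hom]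
  and cls_one = ring_hom_one[OF cls_hom]
  and cls_zero = ring_hom_zero[OF cls_hom FA.ring_axioms PA.ring_axioms]

lemma cls_closed [simp, intro]: "f \<in> carrier FA \<Longrightarrow> cls f \<in> carrier PA"
  using ring_hom_closed[OF cls_hom] .

lemma PA_cases:
  assumes "x \<in> carrier PA"
  obtains f where "f \<in> carrier FA" "x = cls f"
  using assms unfolding presented_algebra_def pa_class_def
  by (auto simp: FactRing_def A_RCOSETS_def RCOSETS_def a_r_coset_def)

lemma cls_eq_iff:
  assumes "f \<in> carrier FA" "h \<in> carrier FA"
  shows "cls f = cls h \<longleftrightarrow> f \<ominus>\<^bsub>FA\<^esub> h \<in> rel_ideal K Y E"
  using FA.quotient_eq_iff_same_a_r_cos[OF rel_ideal assms] by (auto simp: pa_class_def)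

lemma cls_rel: "(l, r) \<in> E \<Longrightarrow> cls l = cls r"
  using rel_closed[of l r] cls_eq_iff[of l r] FA.genideal_self[of "{l \<ominus>\<^bsub>FA\<^esub> r |l r. (l, r) \<in> E}"] rel_closed
  by (auto simp: rel_ideal_def)

lemma const_closed [simp, intro]: "c \<in> carrier K \<Longrightarrow> fa_const K c \<in> carrier FA"
  by (auto simp: fa_const_eq_single)

lemma gen_closed [simp, intro]: "x \<in> Y \<Longrightarrow> fa_gen K x \<in> carrier FA"
  by (auto simp: fa_gen_eq_single)

lemma const_hom: "(\<lambda>c. cls (fa_const K c)) \<in> ring_hom K PA"
  using ring_hom_trans[OF fa_const_hom cls_hom] by (simp add: comp_def)

text \<open>Replaces computations with polynomial representatives by a check on constants and
  generators. Centrality of constants, moving scalars past letters and the spanning statements are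
  proved in this way.\<close>

lemma PA_induct [consumes 1, case_names const gen add mult]:
  assumes x: "x \<in> carrier PA"
    and const: "\<And>c. c \<in> carrier K \<Longrightarrow> P (cls (fa_const K c))"
    and gen: "\<And>y. y \<in> Y \<Longrightarrow> P (cls (fa_gen K y))"
    and add: "\<And>x y. x \<in> carrier PA \<Longrightarrow> y \<in> carrier PA \<Longrightarrow> P x \<Longrightarrow> P y \<Longrightarrow> P (x \<oplus>\<^bsub>PA\<^esub> y)"
    and mult: "\<And>x y. x \<in> carrier PA \<Longrightarrow> y \<in> carrier PA \<Longrightarrow> P x \<Longrightarrow> P y \<Longrightarrow> P (x \<otimes>\<^bsub>PA\<^esub> y)"
  shows "P x"
proof -
  have "P (cls f)" if "f \<in> carrier FA" for f
    using that
  proof (induction f rule: fa_induct)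
    case zero
    then show ?case
      using const[of \<zero>] by (simp add: fa_const_def if_distrib cong: if_cong)
  next
    case (single c u)
    from single(2) show ?case
    proof (induction u)
      case Nil
      then show ?case using const[of c] single(1) by (simp add: fa_const_eq_single)
    next
      case (Cons y u)
      then have "cls (fa_single K c (y # u)) = cls (fa_gen K y) \<otimes>\<^bsub>PA\<^esub> cls (fa_single K c u)"
        using single(1)
        by (subst fa_single_eq_mult[of _ _ _ Y]) (auto intro!: cls_mult fa_single_closed)
      with Cons single(1) show ?case
        by (auto intro!: mult gen fa_single_closed)
    qed
  next
    case (add f g)
    then have "cls (f \<oplus>\<^bsub>FA\<^esub> g) = cls f \<oplus>\<^bsub>PA\<^esub> cls g"
      by (intro cls_add)
    with add show ?case
      using assms(4)[of "cls f" "cls g"] by (simp add: fa_add)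
  qed
  then show ?thesis
    using x by (metis PA_cases)
qed

text \<open>Formulated for an arbitrary homomorphism on the free algebra, not just for evaluations,
  so that it also yields the structure map of \<open>A(M)\<close>, where \<open>h\<close> is the
  class map of a larger presentation.\<close>

lemma PA_lift:
  assumes B: "ring B" and h: "h \<in> ring_hom FA B" and rel: "\<And>l r. (l, r) \<in> E \<Longrightarrow> h l = h r"
  obtains H where "H \<in> ring_hom PA B" "\<And>f. f \<in> carrier FA \<Longrightarrow> H (cls f) = h f"
proof -
  interpret B: ring B by fact
  interpret h: ring_hom_ring FA B h
    using FA.ring_axioms B h by (rule ring_hom_ringI2)
  have minus: "h (l \<ominus>\<^bsub>FA\<^esub> r) = h l \<ominus>\<^bsub>B\<^esub> h r" if "l \<in> carrier FA" "r \<in> carrier FA" for l r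
    using that by (simp add: a_minus_def)
  have mem: "l \<ominus>\<^bsub>FA\<^esub> r \<in> a_kernel FA B h" if "(l, r) \<in> E" for l r
  proof -
    have "l \<in> carrier FA" "r \<in> carrier FA" using rel_closed[OF that] by auto
    moreover from this have "h (l \<ominus>\<^bsub>FA\<^esub> r) = \<zero>\<^bsub>B\<^esub>"
      using rel[OF that] B.r_neg[OF h.hom_closed[of r]] by (simp only: minus B.minus_eq)
    ultimately show ?thesis unfolding a_kernel_def' by blast
  qed
  have ker: "rel_ideal K Y E \<subseteq> a_kernel FA B h"
    unfolding rel_ideal_def
  proof (rule FA.genideal_minimal)
    show "ideal (a_kernel FA B h) FA" by (rule h.kernel_is_ideal)
    show "{l \<ominus>\<^bsub>FA\<^esub> r |l r. (l, r) \<in> E} \<subseteq> a_kernel FA B h"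
      using mem by blast
  qed
  have eq: "h f = h g" if "f \<in> carrier FA" "g \<in> carrier FA" "cls f = cls g" for f g
  proof -
    have "h (f \<ominus>\<^bsub>FA\<^esub> g) = \<zero>\<^bsub>B\<^esub>"
      using cls_eq_iff[OF that(1,2)] that(3) ker unfolding a_kernel_def' by blast
    then show ?thesis
      using B.r_right_minus_eq[OF h.hom_closed h.hom_closed] that by (simp only: minus)
  qed
  \<comment> \<open>Any representative will do: by \<open>eq\<close>, \<open>h\<close> is constant
    on classes.\<close>
  define H where "H x = h (SOME f. f \<in> carrier FA \<and> cls f = x)" for x
  have H: "H (cls f) = h f" if "f \<in> carrier FA" for f
  proof -
    have "(SOME g. g \<in> carrier FA \<and> cls g = cls f) \<in> carrier FA \<and> cls (SOME g. g \<in> carrier FA \<and> cls g = cls f) = cls f"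
      by (rule someI[of _ f]) (use that in simp)
    then show ?thesis unfolding H_def using eq that by blast
  qed
  have "H \<in> ring_hom PA B"
  proof (rule ring_hom_memI)
    show "H x \<in> carrier B" if "x \<in> carrier PA" for x
      using that by (metis H PA_cases h.hom_closed)
    show "H (x \<otimes>\<^bsub>PA\<^esub> y) = H x \<otimes>\<^bsub>B\<^esub> H y" if "x \<in> carrier PA" "y \<in> carrier PA" for x y
    proof -
      obtain f g where "f \<in> carrier FA" "x = cls f" "g \<in> carrier FA" "y = cls g"
        using \<open>x \<in> carrier PA\<close> \<open>y \<in> carrier PA\<close> by (metis PA_cases)
      then show ?thesis
        using ring_hom_mult[OF h] H by (simp flip: cls_mult)
    qed
    show "H (x \<oplus>\<^bsub>PA\<^esub> y) = H x \<oplus>\<^bsub>B\<^esub> H y" if "x \<in> carrier PA" "y \<in> carrier PA" for x y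
    proof -
      obtain f g where "f \<in> carrier FA" "x = cls f" "g \<in> carrier FA" "y = cls g"
        using \<open>x \<in> carrier PA\<close> \<open>y \<in> carrier PA\<close> by (metis PA_cases)
      then show ?thesis
        using ring_hom_add[OF h] H by (simp flip: cls_add)
    qed
    show "H \<one>\<^bsub>PA\<^esub> = \<one>\<^bsub>B\<^esub>"
      using H[of "\<one>\<^bsub>FA\<^esub>"] by (simp add: cls_one)
  qed
  with H that show thesis by blast
qed

end

lemma pa_universal:
  assumes "presentation K Y E" "fa_evaluation K B Y \<kappa> g"
    and "\<And>l r. (l, r) \<in> E \<Longrightarrow> fa_eval K B \<kappa> g l = fa_eval K B \<kappa> g r"
  obtains H where "H \<in> ring_hom (presented_algebra K Y E) B"
    and "\<And>c. c \<in> carrier K \<Longrightarrow> H (pa_class K Y E (fa_const K c)) = \<kappa> c"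
    and "\<And>y. y \<in> Y \<Longrightarrow> H (pa_class K Y E (fa_gen K y)) = g y"
proof -
  interpret presentation K Y E by fact
  interpret e: fa_evaluation K B Y \<kappa> g by fact
  obtain H where "H \<in> ring_hom PA B" "\<And>f. f \<in> carrier FA \<Longrightarrow> H (cls f) = e.ev f"
    using PA_lift[OF e.B.ring_axioms e.ev_hom assms(3)] by blast
  then show thesis
    using that[of H] by (simp add: e.ev_const e.ev_gen)
qed

section \<open>Coxeter groups\<close>

fun alternating :: "'i \<Rightarrow> 'i \<Rightarrow> nat \<Rightarrow> 'i list" where
  "alternating i j 0 = []"
| "alternating i j (Suc n) = i # alternating j i n"

lemma length_alternating [simp]: "length (alternating i j n) = n"
  by (induction n arbitrary: i j) auto

lemma set_alternating: "set (alternating i j n) \<subseteq> {i, j}"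
  by (induction n arbitrary: i j) auto

lemma alternating_in_lists [simp]: "i \<in> I \<Longrightarrow> j \<in> I \<Longrightarrow> alternating i j n \<in> lists I"
  using set_alternating[of i j n] by auto

lemma alternating_snoc: "alternating i j n @ [if even n then i else j] = alternating i j (Suc n)"
  by (induction n arbitrary: i j) auto

text \<open>Reversing a word inverts the group element. This factorisation thus passes between the
  two forms of the braid relation: \<open>(s\<^sub>i s\<^sub>j)^n = 1\<close> says that the two
  alternating words of length \<open>n\<close> agree.\<close>

lemma alternating_double: "alternating i j (2 * n) = alternating i j n @ rev (alternating j i n)"
proof (induction n arbitrary: i j)
  case (Suc n)
  have "alternating i j (2 * Suc n) = i # (alternating j i (2 * n) @ [j])"
    using alternating_snoc[of j i "2 * n"] by simp
  then show ?case by (simp add: Suc)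
qed simp

lemma concat_replicate_pair: "concat (replicate n [i, j]) = alternating i j (2 * n)"
  by (induction n) auto

lemma alternating_add_even: "alternating i j (2 * n + k) = alternating i j (2 * n) @ alternating i j k"
  by (induction n) auto

lemma alternating_take: "k \<le> n \<Longrightarrow> take k (alternating i j n) = alternating i j k"
proof (induction n arbitrary: i j k)
  case (Suc n) then show ?case by (cases k) auto
qed simp

lemma alternating_nth: "k < n \<Longrightarrow> alternating i j n ! k = (if even k then i else j)"
proof (induction n arbitrary: i j k)
  case (Suc n) then show ?case by (cases k) auto
qed simp

text \<open>Conjugating a letter by the prefix in front of it gives a reflection; for alternating
  words these are the alternating words of odd length.\<close>

lemma alternating_reflection:
  "alternating i j k @ [if even k then i else j] @ rev (alternating i j k) = alternating i j (2 * k + 1)"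
proof -
  have "alternating i j k @ [if even k then i else j] @ rev (alternating i j k)
      = i # alternating j i k @ rev (alternating i j k)"
    using alternating_snoc[of i j k] by (metis (no_types, lifting) alternating.simps(2) append_Cons append_assoc)
  then show ?thesis by (simp flip: alternating_double)
qed

lemma sum_lessThan_double:
  fixes f :: "nat \<Rightarrow> nat"
  assumes "\<And>k. k < n \<Longrightarrow> f (k + n) = f k"
  shows "(\<Sum>k<2*n. f k) = 2 * (\<Sum>k<n. f k)"
proof -
  have "{..<2*n} = {..<n} \<union> {n..<n+n}" by auto
  then have "(\<Sum>k<2*n. f k) = (\<Sum>k<n. f k) + sum f {n..<n+n}"
    by (simp add: sum.union_disjoint ivl_disj_int)
  also have "sum f {n..<n+n} = (\<Sum>k<n. f (k + n))"
    using sum.shift_bounds_nat_ivl[of f 0 n n] by (simp add: lessThan_atLeast0)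
  finally show ?thesis using assms by simp
qed

locale coxeter =
  fixes I :: "'i set" and m :: "'i \<Rightarrow> 'i \<Rightarrow> enat"
  assumes coxeter_matrix: "coxeter_matrix I m"
begin

abbreviation eqv :: "'i list \<Rightarrow> 'i list \<Rightarrow> bool" (infix "\<doteq>" 50) where
  "u \<doteq> v \<equiv> cox_eq I m u v"

lemma finite_I: "finite I"
  and m_sym: "i \<in> I \<Longrightarrow> j \<in> I \<Longrightarrow> i \<noteq> j \<Longrightarrow> m i j = m j i"
  and m_ge_2: "i \<in> I \<Longrightarrow> j \<in> I \<Longrightarrow> i \<noteq> j \<Longrightarrow> 2 \<le> m i j"
  using coxeter_matrix by (auto simp: coxeter_matrix_def)

lemma eqv_lists: "u \<doteq> v \<Longrightarrow> u \<in> lists I" "u \<doteq> v \<Longrightarrow> v \<in> lists I"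
  by (induction rule: cox_eq.induct) (auto simp: concat_replicate_pair dest: subsetD[OF set_alternating])

lemmas eqv_refl = cox_eq.refl[of _ I m] and eqv_sym = cox_eq.sym[of I m] and eqv_trans [trans] = cox_eq.trans[of I m]

lemma eqv_append_left: "u \<doteq> v \<Longrightarrow> w \<in> lists I \<Longrightarrow> w @ u \<doteq> w @ v"
proof (induction rule: cox_eq.induct)
  case (square u v i)
  then show ?case using cox_eq.square[of "w @ u" I v i m] by auto
next
  case (braid u v i j n)
  then show ?case using cox_eq.braid[of "w @ u" I v i j m n] by auto
next
  case (refl u)
  then show ?case by (intro cox_eq.refl) auto
qed (blast intro: cox_eq.intros)+

lemma eqv_append_right: "u \<doteq> v \<Longrightarrow> w \<in> lists I \<Longrightarrow> u @ w \<doteq> v @ w"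
proof (induction rule: cox_eq.induct)
  case (square u v i)
  then show ?case using cox_eq.square[of u I "v @ w" i m] by auto
next
  case (braid u v i j n)
  then show ?case using cox_eq.braid[of u I "v @ w" i j m n] by auto
next
  case (refl u)
  then show ?case by (intro cox_eq.refl) auto
qed (blast intro: cox_eq.intros)+

lemma eqv_append: "u \<doteq> u' \<Longrightarrow> v \<doteq> v' \<Longrightarrow> u @ v \<doteq> u' @ v'"
  by (meson eqv_append_left eqv_append_right eqv_lists eqv_trans)

lemma eqv_Cons: "u \<doteq> v \<Longrightarrow> i \<in> I \<Longrightarrow> i # u \<doteq> i # v"
  using eqv_append_left[of u v "[i]"] by simp

lemma eqv_square: "u \<in> lists I \<Longrightarrow> i \<in> I \<Longrightarrow> i # i # u \<doteq> u"
  using cox_eq.square[of "[]" I u i m] by simp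

lemma eqv_rev_append: "u \<in> lists I \<Longrightarrow> v \<in> lists I \<Longrightarrow> rev u @ u @ v \<doteq> v"
proof (induction u arbitrary: v)
  case (Cons i u)
  then have "rev u @ ([i, i] @ (u @ v)) \<doteq> rev u @ (u @ v)"
    by (intro cox_eq.square) auto
  with Cons show ?case by (auto intro: eqv_trans)
qed (auto intro: eqv_refl)

lemma rev_lists: "u \<in> lists I \<Longrightarrow> rev u \<in> lists I"
  by auto

lemma eqv_append_rev: "u \<in> lists I \<Longrightarrow> v \<in> lists I \<Longrightarrow> u @ rev u @ v \<doteq> v"
  using eqv_rev_append[OF rev_lists, of u v] by simp

lemma eqv_cancel_left: "w @ u \<doteq> w @ v \<Longrightarrow> u \<doteq> v"
proof -
  assume *: "w @ u \<doteq> w @ v"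
  then have l: "w \<in> lists I" "u \<in> lists I" "v \<in> lists I"
    using eqv_lists[OF *] by auto
  have "u \<doteq> rev w @ w @ u" using l by (intro eqv_sym[OF eqv_rev_append])
  also have "\<dots> \<doteq> rev w @ w @ v" using * l(1) by (rule eqv_append_left[OF _ rev_lists])
  also have "\<dots> \<doteq> v" using l by (intro eqv_rev_append)
  finally show ?thesis .
qed

lemma eqv_conj_iff:
  assumes "u \<in> lists I" "s \<in> lists I" "t \<in> lists I"
  shows "s \<doteq> rev u @ t @ u \<longleftrightarrow> u @ s @ rev u \<doteq> t"
proof
  assume *: "s \<doteq> rev u @ t @ u"
  have "u @ s @ rev u \<doteq> u @ (rev u @ t @ u) @ rev u"
    using * assms by (intro eqv_append eqv_refl) auto
  also have "u @ (rev u @ t @ u) @ rev u \<doteq> t @ u @ rev u @ []"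
    using assms eqv_append_rev[of u "t @ u @ rev u"] by (simp add: rev_lists)
  also have "\<dots> \<doteq> t @ []"
    using assms by (intro eqv_append_left eqv_append_rev) auto
  finally show "u @ s @ rev u \<doteq> t" by simp
next
  assume *: "u @ s @ rev u \<doteq> t"
  have "s @ [] \<doteq> s @ rev u @ u @ []"
    using assms by (intro eqv_append_left eqv_sym[OF eqv_rev_append]) auto
  also have "\<dots> \<doteq> rev u @ u @ (s @ rev u @ u @ [])"
    using assms by (intro eqv_sym[OF eqv_rev_append]) auto
  also have "\<dots> = rev u @ (u @ s @ rev u) @ u" by simp
  also have "\<dots> \<doteq> rev u @ t @ u"
    using * assms by (intro eqv_append eqv_refl) auto
  finally show "s \<doteq> rev u @ t @ u" by simp
qed

lemma eqv_parity: "u \<doteq> v \<Longrightarrow> even (length u) = even (length v)"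
  by (induction rule: cox_eq.induct) (auto simp: concat_replicate_pair)

lemma eqv_braid_power: "i \<in> I \<Longrightarrow> j \<in> I \<Longrightarrow> i \<noteq> j \<Longrightarrow> m i j = enat n \<Longrightarrow> alternating i j (2 * n) \<doteq> []"
  using cox_eq.braid[of "[]" I "[]" i j m n] by (simp add: concat_replicate_pair)

lemma eqv_braid:
  assumes "i \<in> I" "j \<in> I" "i \<noteq> j" "m i j = enat n"
  shows "alternating i j n \<doteq> alternating j i n"
proof -
  have "alternating i j n \<doteq> alternating i j n @ rev (alternating j i n) @ alternating j i n @ []"
  proof -
    have "alternating i j n @ [] \<doteq> alternating i j n @ rev (alternating j i n) @ alternating j i n @ []"
      using assms by (intro eqv_append_left eqv_sym[OF eqv_rev_append] alternating_in_lists) auto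
    then show ?thesis by simp
  qed
  also have "\<dots> = alternating i j (2 * n) @ alternating j i n" by (simp add: alternating_double)
  also have "\<dots> \<doteq> [] @ alternating j i n"
    using assms by (intro eqv_append_right eqv_braid_power) auto
  finally show ?thesis by simp
qed

subsection \<open>The exchange condition\<close>

text \<open>Counts the positions of \<open>u\<close> whose letter, conjugated by the prefix in front
  of it, equals \<open>t\<close> in W. The number depends on the word, but its parity only on the
  group element; this is the classical source of the exchange condition.\<close>

primrec reflection_count :: "'i list \<Rightarrow> 'i list \<Rightarrow> nat" where
  "reflection_count [] t = 0"
| "reflection_count (i # u) t = (if [i] \<doteq> t then 1 else 0) + reflection_count u (i # t @ [i])"

lemma reflection_count_append:
  "reflection_count (u @ v) t = reflection_count u t + reflection_count v (rev u @ t @ u)"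
  by (induction u arbitrary: t) auto

lemma reflection_count_cong: "t \<doteq> t' \<Longrightarrow> u \<in> lists I \<Longrightarrow> reflection_count u t = reflection_count u t'"
proof (induction u arbitrary: t t')
  case (Cons i u)
  then have "i # t @ [i] \<doteq> i # t' @ [i]"
    by (auto intro!: eqv_Cons eqv_append_right)
  moreover have "[i] \<doteq> t \<longleftrightarrow> [i] \<doteq> t'"
    using Cons.prems eqv_trans eqv_sym by blast
  ultimately show ?case using Cons by simp
qed simp

lemma reflection_count_alternating:
  assumes "i \<in> I" "j \<in> I" "t \<in> lists I"
  shows "reflection_count (alternating i j n) t = (\<Sum>k<n. if alternating i j (2 * k + 1) \<doteq> t then 1 else 0)"
  using assms
proof (induction n arbitrary: i j t)
  case (Suc n)
  have *: "alternating j i (2 * k + 1) \<doteq> i # t @ [i] \<longleftrightarrow> alternating i j (2 * Suc k + 1) \<doteq> t" for k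
    using eqv_conj_iff[of "[i]" "alternating j i (2 * k + 1)" t] Suc.prems
      alternating_snoc[of j i "2 * k + 1"] by simp
  have "reflection_count (alternating i j (Suc n)) t =
      (if [i] \<doteq> t then 1 else 0) + (\<Sum>k<n. if alternating j i (2 * k + 1) \<doteq> i # t @ [i] then 1 else 0)"
    using Suc by simp
  also have "\<dots> = (\<Sum>k<Suc n. if alternating i j (2 * k + 1) \<doteq> t then 1 else 0)"
    unfolding * sum.lessThan_Suc_shift by simp
  finally show ?case .
qed simp

text \<open>The positions \<open>k\<close> and \<open>k + n\<close> of the relator give the same
  reflection, since the odd alternating words belonging to them differ by the factor
  \<open>(s\<^sub>i s\<^sub>j)^n = 1\<close>. Every reflection is counted twice.\<close>

lemma even_reflection_count_braid:
  assumes "i \<in> I" "j \<in> I" "i \<noteq> j" "m i j = enat n" "t \<in> lists I"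
  shows "even (reflection_count (alternating i j (2 * n)) t)"
proof -
  have "alternating i j (2 * (k + n) + 1) \<doteq> t \<longleftrightarrow> alternating i j (2 * k + 1) \<doteq> t" for k
  proof -
    have "alternating i j (2 * (k + n) + 1) = alternating i j (2 * n) @ alternating i j (2 * k + 1)"
      using alternating_add_even[of i j n "2 * k + 1"] by (simp add: algebra_simps)
    also have "\<dots> \<doteq> [] @ alternating i j (2 * k + 1)"
      using assms by (intro eqv_append_right eqv_braid_power alternating_in_lists)
    finally show ?thesis
      by (metis append_Nil eqv_sym eqv_trans)
  qed
  then show ?thesis
    using assms by (subst reflection_count_alternating) (auto simp: sum_lessThan_double)
qed

text \<open>A relator inserted between \<open>u\<close> and \<open>v\<close> represents the
  identity, so \<open>v\<close> still sees the same conjugate of \<open>t\<close>. Only the letters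
  of the relator contribute to the difference, and they contribute an even number.\<close>

lemma reflection_count_parity:
  "u \<doteq> v \<Longrightarrow> t \<in> lists I \<Longrightarrow> even (reflection_count u t) = even (reflection_count v t)"
proof (induction arbitrary: t rule: cox_eq.induct)
  case (square u v i)
  let ?t = "rev u @ t @ u"
  have "i # i # ?t @ [i, i] \<doteq> ?t @ [i, i]"
    using square by (intro eqv_square) auto
  also have "?t @ [i, i] \<doteq> ?t @ []"
    using square by (intro eqv_append_left eqv_square) auto
  finally have "i # i # ?t @ [i, i] \<doteq> ?t" by simp
  then have 1: "reflection_count v (rev (u @ [i, i]) @ t @ (u @ [i, i])) = reflection_count v ?t"
    using square by (intro reflection_count_cong) auto
  \<comment> \<open>The two inserted letters detect the same reflection, so together they count 0 or
    2.\<close>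
  have "[i] \<doteq> i # ?t @ [i] \<longleftrightarrow> [i, i, i] \<doteq> ?t"
  proof -
    have "?t \<in> lists I" "[i] \<in> lists I" using square by auto
    then show ?thesis using eqv_conj_iff[of "[i]" "[i]" ?t] by simp
  qed
  also have "\<dots> \<longleftrightarrow> [i] \<doteq> ?t"
    using eqv_square[of "[i]" i] square by (meson eqv_sym eqv_trans lists.simps)
  finally have 2: "even (reflection_count [i, i] ?t)" by simp
  have "reflection_count (u @ [i, i] @ v) t = reflection_count u t + reflection_count [i, i] ?t +
      reflection_count v (rev (u @ [i, i]) @ t @ (u @ [i, i]))"
    by (simp only: append_assoc[symmetric] reflection_count_append)
  then show ?case using 1 2 by (simp add: reflection_count_append)
next
  case (braid u v i j n)
  let ?t = "rev u @ t @ u" and ?b = "alternating i j (2 * n)"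
  have l: "?b \<in> lists I" using braid by (intro alternating_in_lists)
  have t: "?t \<in> lists I" using braid by auto
  have "rev ?b \<doteq> []"
  proof -
    have "?b \<doteq> []" using braid by (intro eqv_braid_power)
    from eqv_append_left[OF eqv_sym[OF this] rev_lists[OF l]]
    have "rev ?b @ [] \<doteq> rev ?b @ ?b @ []" by simp
    also have "\<dots> \<doteq> []" using l by (intro eqv_rev_append) auto
    finally show ?thesis by simp
  qed
  then have "rev ?b @ ?t @ ?b \<doteq> [] @ ?t @ []"
    using braid by (intro eqv_append eqv_refl[OF t] eqv_braid_power)
  then have 1: "reflection_count v (rev (u @ ?b) @ t @ (u @ ?b)) = reflection_count v ?t"
    using braid by (intro reflection_count_cong) auto
  have 2: "even (reflection_count ?b ?t)"
    using braid t by (intro even_reflection_count_braid) auto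
  have "reflection_count (u @ ?b @ v) t = reflection_count u t + reflection_count ?b ?t +
      reflection_count v (rev (u @ ?b) @ t @ (u @ ?b))"
    by (simp only: append_assoc[symmetric] reflection_count_append)
  then show ?case using 1 2 by (simp add: reflection_count_append concat_replicate_pair)
qed auto

lemma reflection_count_pos:
  assumes "reflection_count u t > 0" "u \<in> lists I" "t \<in> lists I"
  obtains k where "k < length u" "take k u @ [u ! k] @ rev (take k u) \<doteq> t"
proof -
  have "\<exists>k<length u. take k u @ [u ! k] @ rev (take k u) \<doteq> t"
    using assms
  proof (induction u arbitrary: t)
    case (Cons i u)
    show ?case
    proof (cases "[i] \<doteq> t")
      case True
      then show ?thesis by (intro exI[of _ 0]) auto
    next
      case False
      then have "\<exists>k<length u. take k u @ [u ! k] @ rev (take k u) \<doteq> i # t @ [i]"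
        using Cons.prems by (intro Cons.IH) auto
      then obtain k where k: "k < length u" "take k u @ [u ! k] @ rev (take k u) \<doteq> i # t @ [i]"
        by blast
      then have "i # (take k u @ [u ! k] @ rev (take k u)) @ [i] \<doteq> t"
        using eqv_conj_iff[of "[i]" "take k u @ [u ! k] @ rev (take k u)" t] Cons.prems
          eqv_lists(1)[OF k(2)] by simp
      then show ?thesis using k(1) by (intro exI[of _ "Suc k"]) simp
    qed
  qed simp
  with that show thesis by blast
qed

definition reduced :: "'i list \<Rightarrow> bool" where
  "reduced u \<longleftrightarrow> u \<in> lists I \<and> (\<forall>v. u \<doteq> v \<longrightarrow> length u \<le> length v)"

lemma reduced_lists: "reduced u \<Longrightarrow> u \<in> lists I"
  by (simp add: reduced_def)

lemma reduced_eqv_length: "reduced u \<Longrightarrow> reduced v \<Longrightarrow> u \<doteq> v \<Longrightarrow> length u = length v"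
  by (meson eqv_sym le_antisym reduced_def)

lemma reduced_eqv: "reduced u \<Longrightarrow> u \<doteq> v \<Longrightarrow> length v \<le> length u \<Longrightarrow> reduced v"
  unfolding reduced_def by (meson eqv_lists eqv_trans le_trans)

lemma reduced_exists:
  assumes "u \<in> lists I"
  obtains v where "reduced v" "u \<doteq> v"
proof -
  obtain v where "u \<doteq> v" "\<And>w. u \<doteq> w \<Longrightarrow> length v \<le> length w"
    using ex_has_least_nat[of "\<lambda>v. u \<doteq> v" u length] eqv_refl[OF assms] by blast
  then show thesis
    using that[of v] unfolding reduced_def by (meson eqv_lists eqv_trans)
qed

lemma reduced_suffix: "reduced (u @ v) \<Longrightarrow> reduced v"
  unfolding reduced_def
  by (metis append_in_lists_conv eqv_append_left length_append nat_add_left_cancel_le)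

text \<open>A reduced word \<open>v\<close> for \<open>i # u\<close> is shorter than
  \<open>u\<close> by parity, and \<open>u \<doteq> i # v\<close>. In \<open>i # v\<close> the
  reflection \<open>[i]\<close> occurs at the first letter; a further occurrence inside
  \<open>v\<close> would shorten \<open>u\<close>. So its count is odd for \<open>i # v\<close>,
  hence for \<open>u\<close>, and deleting a position where it occurs in \<open>u\<close> multiplies
  by \<open>i\<close>. The equation for the reflection is part of the conclusion because
  \<open>extend_alternating\<close> reads off a relation from it.\<close>

lemma exchange:
  assumes "reduced u" "i \<in> I" "\<not> reduced (i # u)"
  obtains k where "k < length u" "take k u @ [u ! k] @ rev (take k u) \<doteq> [i]"
    "i # u \<doteq> take k u @ drop (Suc k) u"
proof -
  have u: "u \<in> lists I" using assms by (simp add: reduced_def)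
  obtain v where v: "reduced v" "i # u \<doteq> v"
    using reduced_exists[of "i # u"] assms u by auto
  have v': "v \<in> lists I" using v by (simp add: reduced_def)
  have "length v \<noteq> Suc (length u)"
    using reduced_eqv[OF v(1) eqv_sym[OF v(2)]] assms(3) by auto
  moreover have "length v \<le> Suc (length u)"
    using v eqv_sym by (fastforce simp: reduced_def)
  moreover have "even (length v) \<noteq> even (length u)"
    using eqv_parity[OF v(2)] by simp
  ultimately have len: "length v < length u"
    by (metis le_Suc_eq le_neq_implies_less)
  have iv: "u \<doteq> i # v"
    using v(2) eqv_square[OF u assms(2)] assms(2) by (meson eqv_Cons eqv_sym eqv_trans)
  \<comment> \<open>If the reflection at position \<open>k\<close> of \<open>w\<close> is
    \<open>[i]\<close>, multiplication by it cancels the letter at this position.\<close>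
  have del: "i # w \<doteq> take k w @ drop (Suc k) w"
    if k: "k < length w" "take k w @ [w ! k] @ rev (take k w) \<doteq> [i]" and w: "w \<in> lists I" for k w
  proof -
    have t: "take k w \<in> lists I" "drop k w \<in> lists I" "drop (Suc k) w \<in> lists I" "w ! k \<in> I"
      using w k(1) by (auto dest: in_set_takeD in_set_dropD)
    have w_eq: "w = take k w @ w ! k # drop (Suc k) w"
      using k(1) by (simp add: id_take_nth_drop)
    have "[i] @ w \<doteq> (take k w @ [w ! k] @ rev (take k w)) @ w"
      using w by (intro eqv_append_right eqv_sym[OF k(2)]) auto
    also have "(take k w @ [w ! k] @ rev (take k w)) @ w =
        (take k w @ [w ! k]) @ rev (take k w) @ take k w @ w ! k # drop (Suc k) w"
      by (subst (2) w_eq) simp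
    also have "\<dots> \<doteq> (take k w @ [w ! k]) @ w ! k # drop (Suc k) w"
      using t by (intro eqv_append_left eqv_rev_append) auto
    also have "\<dots> = take k w @ w ! k # w ! k # drop (Suc k) w" by simp
    also have "\<dots> \<doteq> take k w @ drop (Suc k) w"
      using t by (intro eqv_append_left eqv_square)
    finally show ?thesis by simp
  qed
  \<comment> \<open>The recursion for \<open>reflection_count (i # v) [i]\<close> conjugates
    \<open>[i]\<close> by \<open>i\<close>, which gives the word \<open>[i, i, i]\<close> rather
    than \<open>[i]\<close>.\<close>
  have "reflection_count v [i, i, i] = 0"
  proof (rule ccontr)
    assume "reflection_count v [i, i, i] \<noteq> 0"
    then obtain k where k: "k < length v" "take k v @ [v ! k] @ rev (take k v) \<doteq> [i, i, i]"
      using reflection_count_pos[of v "[i, i, i]"] v' assms(2) by auto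
    then have "take k v @ [v ! k] @ rev (take k v) \<doteq> [i]"
      using eqv_square[of "[i]" i] assms(2) eqv_trans by (metis lists.simps)
    then have "i # v \<doteq> take k v @ drop (Suc k) v"
      using k v' by (intro del)
    then have "u \<doteq> take k v @ drop (Suc k) v"
      using iv eqv_trans by blast
    then have "length u \<le> length (take k v @ drop (Suc k) v)"
      using assms(1) unfolding reduced_def by blast
    then show False using len by simp
  qed
  then have "odd (reflection_count (i # v) [i])"
    using assms(2) eqv_refl[of "[i]"] by simp
  then have "odd (reflection_count u [i])"
    using reflection_count_parity[OF iv, of "[i]"] assms(2) by simp
  then obtain k where "k < length u" "take k u @ [u ! k] @ rev (take k u) \<doteq> [i]"
    using reflection_count_pos[of u "[i]"] u assms(2) odd_pos by auto
  with del u that show thesis by blast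
qed

end

text \<open>The \<open>n\<close> angles with step \<open>2 * \<theta>\<close> go once around the
  circle. After multiplication by \<open>2 * sin \<theta>\<close> the sum telescopes to a difference
  of two cosines one period apart.\<close>

lemma sin_progression_sum_zero:
  fixes a \<theta> :: real
  assumes "real n * \<theta> = pi" "sin \<theta> \<noteq> 0"
  shows "(\<Sum>q<n. sin (a + 2 * real q * \<theta>)) = 0"
proof -
  have tele: "(\<Sum>q<k. 2 * sin \<theta> * sin (a + 2 * real q * \<theta>)) = cos (a - \<theta>) - cos (a + (2 * real k - 1) * \<theta>)" for k
  proof (induction k)
    case (Suc k)
    have "2 * sin \<theta> * sin (a + 2 * real k * \<theta>) = cos (a + 2 * real k * \<theta> - \<theta>) - cos (a + 2 * real k * \<theta> + \<theta>)"
      by (simp add: cos_add cos_diff)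
    with Suc show ?case by (simp add: algebra_simps)
  qed simp
  have "a + (2 * real n - 1) * \<theta> = a - \<theta> + 2 * pi"
    using assms(1) by (simp add: algebra_simps)
  then have "cos (a + (2 * real n - 1) * \<theta>) = cos (a - \<theta>)"
    by (metis cos_periodic)
  then have "2 * sin \<theta> * (\<Sum>q<n. sin (a + 2 * real q * \<theta>)) = 0"
    unfolding sum_distrib_left tele by linarith
  with assms(2) show ?thesis by simp
qed

context coxeter
begin

subsection \<open>The order of a product of two generators\<close>

text \<open>Twice the Gram matrix of the canonical bilinear form; the value \<open>- 2\<close> for
  an infinite label is the limit of \<open>- 2 * cos (pi / n)\<close>.\<close>

definition cartan :: "'i \<Rightarrow> 'i \<Rightarrow> real" where
  "cartan i j = (if i = j then 2 else case m i j of enat n \<Rightarrow> - 2 * cos (pi / real n) | \<infinity> \<Rightarrow> - 2)"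

text \<open>The dual geometric representation of \<open>W\<close>.\<close>

definition fire :: "'i \<Rightarrow> ('i \<Rightarrow> real) \<Rightarrow> 'i \<Rightarrow> real" where
  "fire i f p = f p - (if p \<in> I then cartan i p * f i else 0)"

primrec fire_word :: "'i list \<Rightarrow> ('i \<Rightarrow> real) \<Rightarrow> 'i \<Rightarrow> real" where
  "fire_word [] f = f"
| "fire_word (i # u) f = fire i (fire_word u f)"

lemma fire_word_append: "fire_word (u @ v) f = fire_word u (fire_word v f)"
  by (induction u) auto

lemma fire_fire: "i \<in> I \<Longrightarrow> fire i (fire i f) = f"
  by (auto simp: fire_def cartan_def fun_eq_iff)

lemma cartan_sym: "i \<in> I \<Longrightarrow> j \<in> I \<Longrightarrow> cartan i j = cartan j i"
  by (auto simp: cartan_def m_sym)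

text \<open>Under alternating firings of \<open>j\<close> and \<open>i\<close> only the coordinates
  at these two letters drive the process, and the values fired in turn form a linear recurrence of
  order two. Every other coordinate accumulates multiples of the fired values. Keeping the solution
  \<open>U\<close> abstract covers the trigonometric case of a finite label as well as
  \<open>U = real\<close> for an infinite one.\<close>

lemma fire_word_alternating:
  fixes c :: real and U :: "nat \<Rightarrow> real"
  assumes ij: "i \<in> I" "j \<in> I" "i \<noteq> j" and c: "cartan i j = - 2 * c"
    and U: "U 0 = - f i" "U 1 = f j" "\<And>n. U (n + 2) = 2 * c * U (n + 1) - U n"
  shows "fire_word (alternating i j (2 * k)) f p =
    f p - (if p \<in> I then cartan j p * (\<Sum>q<k. U (2 * q + 1)) + cartan i p * (\<Sum>q<k. U (2 * q + 2)) else 0)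
    \<and> fire_word (alternating i j (2 * k)) f i = - U (2 * k)
    \<and> fire_word (alternating i j (2 * k)) f j = U (2 * k + 1)"
proof (induction k arbitrary: p)
  case 0
  then show ?case using U by simp
next
  case (Suc k)
  let ?g = "fire_word (alternating i j (2 * k)) f"
  let ?h = "fire j ?g"
  have step: "fire_word (alternating i j (2 * Suc k)) f = fire i ?h"
    by simp
  have C: "cartan j i = - 2 * c" "cartan i i = 2" "cartan j j = 2"
    using c ij cartan_sym by (auto simp: cartan_def[of i i] cartan_def[of j j])
  have g: "?g i = - U (2 * k)" "?g j = U (2 * k + 1)"
    using Suc[of p] by blast+
  have U2: "U (2 * k + 2) = 2 * c * U (2 * k + 1) - U (2 * k)"
    and U3: "U (2 * k + 3) = 2 * c * U (2 * k + 2) - U (2 * k + 1)"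
    using U(3)[of "2 * k"] U(3)[of "2 * k + 1"] by (simp_all add: numeral_3_eq_3)
  have h: "?h i = U (2 * k + 2)" "?h j = - U (2 * k + 1)"
    using g C ij by (simp_all add: fire_def U2[simplified])
  have "fire i ?h i = - U (2 * k + 2)" "fire i ?h j = U (2 * k + 3)"
    using h C ij c by (simp_all add: fire_def[of i] U3)
  moreover have "fire i ?h p = ?g p - (if p \<in> I then cartan j p * U (2 * k + 1) + cartan i p * U (2 * k + 2) else 0)"
    using h(1) g(2) by (simp add: fire_def[of i]) (simp add: fire_def)
  ultimately show ?case
    unfolding step using Suc[of p]
    by (cases "p \<in> I") (simp_all add: algebra_simps numeral_3_eq_3)
qed

text \<open>The solution of this recurrence for \<open>c = cos \<theta>\<close> that starts with
  \<open>- x\<close> and \<open>y\<close>: a combination of Chebyshev polynomials of the second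
  kind, \<open>sin (n \<theta>) / sin \<theta>\<close>, at \<open>cos \<theta>\<close>.\<close>

definition dihedral_solution :: "real \<Rightarrow> real \<Rightarrow> real \<Rightarrow> nat \<Rightarrow> real" where
  "dihedral_solution \<theta> x y n = (sin (real n * \<theta>) * y + sin (real n * \<theta> - \<theta>) * x) / sin \<theta>"

lemma dihedral_solution_rec:
  assumes "sin \<theta> \<noteq> 0"
  shows "dihedral_solution \<theta> x y 0 = - x" "dihedral_solution \<theta> x y 1 = y"
    "dihedral_solution \<theta> x y (n + 2) = 2 * cos \<theta> * dihedral_solution \<theta> x y (n + 1) - dihedral_solution \<theta> x y n"
proof -
  have *: "sin (a + 2 * \<theta>) = 2 * cos \<theta> * sin (a + \<theta>) - sin a" for a
    using sin_add[of "a + \<theta>" \<theta>] sin_diff[of "a + \<theta>" \<theta>] by (simp add: algebra_simps)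
  have args: "real (n + 2) * \<theta> = real n * \<theta> + 2 * \<theta>" "real (n + 1) * \<theta> = real n * \<theta> + \<theta>"
    "real n * \<theta> + 2 * \<theta> - \<theta> = real n * \<theta> - \<theta> + 2 * \<theta>" "real n * \<theta> + \<theta> - \<theta> = real n * \<theta> - \<theta> + \<theta>"
    by (simp_all add: algebra_simps)
  have "sin (real n * \<theta> + 2 * \<theta>) * y + sin (real n * \<theta> - \<theta> + 2 * \<theta>) * x =
      2 * cos \<theta> * (sin (real n * \<theta> + \<theta>) * y + sin (real n * \<theta> - \<theta> + \<theta>) * x) -
      (sin (real n * \<theta>) * y + sin (real n * \<theta> - \<theta>) * x)"
    unfolding * by (simp add: algebra_simps)
  then show "dihedral_solution \<theta> x y (n + 2) = 2 * cos \<theta> * dihedral_solution \<theta> x y (n + 1) - dihedral_solution \<theta> x y n"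
    unfolding dihedral_solution_def args by (simp add: diff_divide_distrib)
qed (use assms in \<open>auto simp: dihedral_solution_def\<close>)

lemma finite_label:
  assumes "i \<in> I" "j \<in> I" "i \<noteq> j" "m i j = enat n"
  shows "2 \<le> n" "sin (pi / real n) > 0" "cartan i j = - 2 * cos (pi / real n)"
proof -
  show n: "2 \<le> n" using m_ge_2[OF assms(1-3)] assms(4) by (simp add: numeral_eq_enat)
  have "pi / real n < pi" using n by (simp add: field_simps)
  then show "sin (pi / real n) > 0" using n by (intro sin_gt_zero) auto
qed (use assms in \<open>simp add: cartan_def\<close>)

text \<open>The displacement of each coordinate is a combination of the sums of \<open>U\<close>
  over \<open>n\<close> consecutive odd and \<open>n\<close> consecutive even indices. Both are sums
  of sines over a full turn and vanish.\<close>

lemma fire_word_braid: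
  assumes ij: "i \<in> I" "j \<in> I" "i \<noteq> j" and n: "m i j = enat n"
  shows "fire_word (alternating i j (2 * n)) f = f"
proof
  fix p
  define \<theta> where "\<theta> = pi / real n"
  have \<theta>: "sin \<theta> \<noteq> 0" "real n * \<theta> = pi" "cartan i j = - 2 * cos \<theta>"
    using finite_label[OF assms] by (auto simp: \<theta>_def)
  let ?U = "dihedral_solution \<theta> (f i) (f j)"
  have "(\<Sum>q<n. ?U (2 * q + k)) = 0" for k
  proof -
    have 1: "(\<Sum>q<n. sin (real (2 * q + k) * \<theta>)) = 0"
      using sin_progression_sum_zero[OF \<theta>(2,1), of "real k * \<theta>"] by (simp add: algebra_simps)
    have 2: "(\<Sum>q<n. sin (real (2 * q + k) * \<theta> - \<theta>)) = 0"
      using sin_progression_sum_zero[OF \<theta>(2,1), of "real k * \<theta> - \<theta>"] by (simp add: algebra_simps)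
    have "(\<Sum>q<n. ?U (2 * q + k)) =
      ((\<Sum>q<n. sin (real (2 * q + k) * \<theta>)) * f j + (\<Sum>q<n. sin (real (2 * q + k) * \<theta> - \<theta>)) * f i) / sin \<theta>"
      by (simp only: dihedral_solution_def sum_divide_distrib[symmetric] sum.distrib sum_distrib_right)
    then show ?thesis by (simp only: 1 2) simp
  qed
  from this[of 1] this[of 2] show "fire_word (alternating i j (2 * n)) f p = f p"
    using fire_word_alternating[OF ij \<theta>(3), of ?U f n p] dihedral_solution_rec[OF \<theta>(1)] by simp
qed

lemma fire_word_cong: "u \<doteq> v \<Longrightarrow> fire_word u = fire_word v"
proof (induction rule: cox_eq.induct)
  case (braid u v i j n)
  then show ?case
    by (auto simp: fun_eq_iff fire_word_append concat_replicate_pair fire_word_braid)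
qed (auto simp: fun_eq_iff fire_word_append fire_fire)

text \<open>The defining relations bound the order of \<open>s\<^sub>i s\<^sub>j\<close> only from
  above; the lower bound comes from the representation. For the indicator function of
  \<open>j\<close> the recurrence is \<open>sin (n \<theta>) / sin \<theta>\<close>, and its return
  to the initial values after \<open>2 * k\<close> steps makes \<open>2 * k * \<theta>\<close> a
  positive multiple of \<open>2 * pi\<close>. For an infinite label it is \<open>U n = n\<close>,
  which never returns.\<close>

lemma order_product:
  assumes ij: "i \<in> I" "j \<in> I" "i \<noteq> j" and k: "0 < k" "alternating i j (2 * k) \<doteq> []"
  obtains n where "m i j = enat n" "n \<le> k"
proof -
  define f :: "'i \<Rightarrow> real" where "f p = (if p = j then 1 else 0)" for p
  have f: "f i = 0" "f j = 1" using ij(3) by (simp_all add: f_def)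
  have fixed: "fire_word (alternating i j (2 * k)) f p = f p" for p
    by (simp only: fire_word_cong[OF k(2)] fire_word.simps)
  show thesis
  proof (cases "m i j")
    case (enat n)
    define \<theta> where "\<theta> = pi / real n"
    have n: "2 \<le> n" and \<theta>: "sin \<theta> > 0" "real n * \<theta> = pi" "cartan i j = - 2 * cos \<theta>"
      using finite_label[OF ij enat] by (auto simp: \<theta>_def)
    have \<theta>0: "\<theta> > 0" using n by (simp add: \<theta>_def)
    let ?U = "dihedral_solution \<theta> 0 1"
    have s0: "sin \<theta> \<noteq> 0" using \<theta>(1) by simp
    have "?U (2 * k) = 0" "?U (2 * k + 1) = 1"
      using fire_word_alternating[OF ij \<theta>(3), of ?U f k i] dihedral_solution_rec[OF s0, of 0 1]
      unfolding fixed f by simp_all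
    then have s: "sin (2 * real k * \<theta>) = 0" "sin (2 * real k * \<theta> + \<theta>) = sin \<theta>"
      using \<theta>(1) by (auto simp: dihedral_solution_def algebra_simps)
    then have "cos (2 * real k * \<theta>) = 1"
      using \<theta>(1) by (simp add: sin_add)
    then obtain r :: int where r: "2 * real k * \<theta> = of_int r * 2 * pi"
      using cos_one_2pi_int by blast
    moreover have "2 * real k * \<theta> > 0" using k(1) \<theta>0 by simp
    ultimately have "0 < real_of_int r * (2 * pi)" using r by (simp only: mult.assoc)
    then have "r > 0" using zero_less_mult_pos2[of "real_of_int r" "2 * pi"] by simp
    then have "real k * \<theta> \<ge> pi" using r by simp
    then have "real n * \<theta> \<le> real k * \<theta>" using \<theta>(2) by simp
    then have "n \<le> k" using \<theta>0 by simp
    with enat that show thesis by blast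
  next
    case infinity
    then have c: "cartan i j = - 2 * 1" using ij by (simp add: cartan_def)
    have "fire_word (alternating i j (2 * k)) f i = - real (2 * k)"
      using fire_word_alternating[OF ij c, of real f k i] f by simp
    with fixed f k show thesis by simp
  qed
qed

subsection \<open>Matsumoto's theorem\<close>

lemma reduced_tl: "reduced (i # u) \<Longrightarrow> reduced u"
  using reduced_suffix[of "[i]" u] by simp

text \<open>The exchange condition for \<open>j\<close> deletes one letter of the word. If this
  letter belonged to the alternating prefix, \<open>(s\<^sub>j s\<^sub>i)^(r+1) = 1\<close> would
  hold for some \<open>r < k\<close>, contradicting the order of the product. So it is deleted from
  \<open>z\<close>, and \<open>j\<close> can be put in front of the prefix.\<close>

lemma extend_alternating:
  assumes ij: "i \<in> I" "j \<in> I" "i \<noteq> j" and red: "reduced (alternating i j k @ z)"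
    and desc: "\<not> reduced (j # alternating i j k @ z)" and k: "\<not> m i j \<le> enat k"
  obtains z' where "reduced (alternating j i (Suc k) @ z')" "alternating j i (Suc k) @ z' \<doteq> alternating i j k @ z"
proof -
  let ?u = "alternating i j k @ z"
  obtain r where r: "r < length ?u" "take r ?u @ [?u ! r] @ rev (take r ?u) \<doteq> [j]"
    "j # ?u \<doteq> take r ?u @ drop (Suc r) ?u"
    using exchange[OF red ij(2) desc] by blast
  \<comment> \<open>A deleted position inside the prefix equates \<open>[j]\<close> with an odd
    alternating word starting with \<open>i\<close>; one more letter \<open>j\<close> in front turns
    this into a power of \<open>s\<^sub>j s\<^sub>i\<close>.\<close>
  have "\<not> r < k"
  proof
    assume rk: "r < k"
    then have "take r ?u @ [?u ! r] @ rev (take r ?u) = alternating i j (2 * r + 1)"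
      using alternating_reflection[of i j r] by (simp add: nth_append alternating_take alternating_nth)
    then have "j # alternating i j (2 * r + 1) \<doteq> [j, j]"
      using r(2) ij eqv_Cons by metis
    also have "[j, j] \<doteq> []" using eqv_square[of "[]" j] ij by simp
    finally have "alternating j i (2 * Suc r) \<doteq> []" by simp
    then obtain n where "m j i = enat n" "n \<le> Suc r"
      using order_product[of j i "Suc r"] ij by auto
    with k rk ij show False by (simp add: m_sym)
  qed
  then have rk: "k \<le> r" by simp
  define z' where "z' = take (r - k) z @ drop (Suc r - k) z"
  have "take r ?u @ drop (Suc r) ?u = alternating i j k @ z'"
    using rk by (simp add: z'_def)
  then have "j # ?u \<doteq> alternating i j k @ z'" using r by simp
  then have "j # j # ?u \<doteq> alternating j i (Suc k) @ z'"
    using ij(2) eqv_Cons by fastforce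
  then have eq: "?u \<doteq> alternating j i (Suc k) @ z'"
    using eqv_square[of ?u j] ij reduced_lists[OF red] by (meson eqv_sym eqv_trans)
  moreover have "length z' < length z"
    using r(1) rk by (simp add: z'_def)
  ultimately have "reduced (alternating j i (Suc k) @ z')"
    by (intro reduced_eqv[OF red]) auto
  with eq that show thesis by (meson eqv_sym)
qed

text \<open>The braid hypothesis carries an arbitrary suffix, so \<open>Q\<close> only has to be
  compatible with letters added on the left, and symmetry is not among the assumptions. Words with
  equal first letter are handled by cancelling it. Otherwise both first letters are descents, and
  \<open>u\<close> has reduced words starting with either alternating word of length
  \<open>m i j\<close>. Then \<open>u\<close> and \<open>v\<close> are linked by a chain of three
  steps: equal first letter, one braid move, equal first letter.\<close>

theorem matsumoto:
  assumes refl: "\<And>u. u \<in> lists I \<Longrightarrow> Q u u"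
    and trans: "\<And>u v v'. Q u v \<Longrightarrow> Q v v' \<Longrightarrow> Q u v'"
    and Cons: "\<And>i u v. i \<in> I \<Longrightarrow> u \<in> lists I \<Longrightarrow> v \<in> lists I \<Longrightarrow> length u = length v \<Longrightarrow> Q u v \<Longrightarrow> Q (i # u) (i # v)"
    and braid: "\<And>i j n z. i \<in> I \<Longrightarrow> j \<in> I \<Longrightarrow> i \<noteq> j \<Longrightarrow> m i j = enat n \<Longrightarrow> z \<in> lists I \<Longrightarrow>
      Q (alternating i j n @ z) (alternating j i n @ z)"
    and "reduced u" "reduced v" "u \<doteq> v"
  shows "Q u v"
  using assms(5-)
proof (induction "length u" arbitrary: u v)
  case 0
  then have "u = []" "v = []" using reduced_eqv_length[OF "0.prems"] by simp_all
  then show ?case using refl by simp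
next
  case (Suc l)
  have same_head: "Q x y" if xy: "reduced x" "reduced y" "x \<doteq> u" "y \<doteq> u"
    and hd: "x = i # x'" "y = i # y'" for x y x' y' i
  proof -
    have "x \<doteq> y" using eqv_trans[OF xy(3) eqv_sym[OF xy(4)]] .
    then have eq: "x' \<doteq> y'" using eqv_cancel_left[of "[i]" x' y'] hd by simp
    have red: "reduced x'" "reduced y'" using xy(1,2) hd reduced_tl by simp_all
    have "length x = length u"
      by (rule reduced_eqv_length[OF xy(1) Suc.prems(1) xy(3)])
    then have "l = length x'" using hd Suc.hyps(2) by simp
    then have "Q x' y'" by (rule Suc.hyps(1)[OF _ red eq])
    moreover have "i \<in> I" using reduced_lists[OF xy(1)] hd by simp
    ultimately show "Q x y"
      unfolding hd using reduced_lists[OF red(1)] reduced_lists[OF red(2)] reduced_eqv_length[OF red eq]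
      by (intro Cons)
  qed
  have len: "length v = length u"
    using reduced_eqv_length[OF Suc.prems] by simp
  obtain i u' where u: "u = i # u'" using Suc.hyps(2) by (cases u) auto
  obtain j v' where v: "v = j # v'" using Suc.hyps(2) len by (cases v) auto
  have I: "i \<in> I" "j \<in> I" "u' \<in> lists I" "v' \<in> lists I"
    using reduced_lists[OF Suc.prems(1)] reduced_lists[OF Suc.prems(2)] u v by auto
  have vu: "v \<doteq> u" using eqv_sym[OF Suc.prems(3)] .
  have uu: "u \<doteq> u" using eqv_refl[OF reduced_lists[OF Suc.prems(1)]] .
  show ?case
  proof (cases "i = j")
    case True
    then show ?thesis using same_head[OF Suc.prems(1,2) uu vu u] v by simp
  next
    case False
    \<comment> \<open>A letter that begins some reduced word of the element shortens it when
      multiplied from the left.\<close>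
    have descent: "\<not> reduced (a # x)" if "x \<doteq> u" "a # w \<doteq> u" "reduced (a # w)" for a x w
    proof
      assume red: "reduced (a # x)"
      have aw: "w \<in> lists I" "a \<in> I" using eqv_lists(1)[OF that(2)] by auto
      have "x \<doteq> a # w" using eqv_trans[OF that(1) eqv_sym[OF that(2)]] .
      then have "a # x \<doteq> a # a # w" using aw(2) by (rule eqv_Cons)
      also have "\<dots> \<doteq> w" using aw by (intro eqv_square)
      finally have "length (a # x) \<le> length w"
        using red unfolding reduced_def by blast
      moreover have "length (a # w) \<le> length x"
        using that(3) eqv_trans[OF that(2) eqv_sym[OF that(1)]] unfolding reduced_def by blast
      ultimately show False by simp
    qed
    \<comment> \<open>Both prefixes have to be carried along: extending the one that starts with
      \<open>i\<close> yields the longer one that starts with \<open>j\<close>, and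
      conversely.\<close>
    define both where "both k \<longleftrightarrow>
      (\<exists>z. reduced (alternating i j k @ z) \<and> alternating i j k @ z \<doteq> u) \<and>
      (\<exists>z. reduced (alternating j i k @ z) \<and> alternating j i k @ z \<doteq> u)" for k
    have both: "both (Suc k)" if "enat (Suc k) \<le> m i j" for k
      using that
    proof (induction k)
      case 0
      have "both 1"
        unfolding both_def using Suc.prems u v uu vu by (intro conjI exI[of _ u'] exI[of _ v']) auto
      then show ?case by simp
    next
      case (Suc k)
      have "enat (Suc k) \<le> m i j"
        by (rule order_trans[OF _ Suc.prems]) simp
      then have "both (Suc k)" by (rule Suc.IH)
      then obtain z z' where z: "reduced (alternating i j (Suc k) @ z)" "alternating i j (Suc k) @ z \<doteq> u"
        and z': "reduced (alternating j i (Suc k) @ z')" "alternating j i (Suc k) @ z' \<doteq> u"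
        unfolding both_def by blast
      have k: "\<not> m i j \<le> enat (Suc k)" "\<not> m j i \<le> enat (Suc k)"
        using less_le_trans[OF _ Suc.prems, of "enat (Suc k)"] m_sym[OF I(1,2) False] by (simp_all add: not_le)
      obtain y where "reduced (alternating j i (Suc (Suc k)) @ y)"
        "alternating j i (Suc (Suc k)) @ y \<doteq> alternating i j (Suc k) @ z"
        using extend_alternating[OF I(1,2) False z(1) descent[OF z(2), of j v'] k(1)] vu v \<open>reduced v\<close> by auto
      moreover obtain y' where "reduced (alternating i j (Suc (Suc k)) @ y')"
        "alternating i j (Suc (Suc k)) @ y' \<doteq> alternating j i (Suc k) @ z'"
        using extend_alternating[OF I(2,1) False[symmetric] z'(1) descent[OF z'(2), of i u'] k(2)] uu u \<open>reduced u\<close> by auto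
      ultimately show ?case
        unfolding both_def using eqv_trans[OF _ z(2)] eqv_trans[OF _ z'(2)] by blast
    qed
    show ?thesis
    proof (cases "m i j")
      case (enat n)
      have n: "n \<ge> 2" using finite_label(1)[OF I(1,2) False enat] .
      then obtain n' where n': "n = Suc n'" by (cases n) auto
      obtain z where z: "reduced (alternating i j n @ z)" "alternating i j n @ z \<doteq> u"
        using both[of n'] enat n' unfolding both_def by auto
      have zI: "z \<in> lists I" using reduced_lists[OF z(1)] by auto
      have eq: "alternating i j n @ z \<doteq> alternating j i n @ z"
        using I False enat zI by (intro eqv_append_right eqv_braid)
      then have z': "reduced (alternating j i n @ z)" "alternating j i n @ z \<doteq> u"
        using reduced_eqv[OF z(1) eq] eqv_trans[OF eqv_sym[OF eq] z(2)] by simp_all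
      have "Q u (alternating i j n @ z)"
        using same_head[OF Suc.prems(1) z(1) uu z(2) u] n' by simp
      moreover have "Q (alternating i j n @ z) (alternating j i n @ z)"
        using I False enat zI by (intro braid)
      moreover have "Q (alternating j i n @ z) v"
        using same_head[OF z'(1) Suc.prems(2) z'(2) vu _ v] n' by simp
      ultimately show ?thesis using trans by blast
    next
      \<comment> \<open>Without a bound on the prefix length, a reduced word for \<open>u\<close>
        would have to be longer than \<open>u\<close>.\<close>
      case infinity
      then obtain z where "reduced (alternating i j (Suc (length u)) @ z)" "alternating i j (Suc (length u)) @ z \<doteq> u"
        using both[of "length u"] unfolding both_def by auto
      then have "length (alternating i j (Suc (length u)) @ z) = length u"
        using Suc.prems(1) by (intro reduced_eqv_length)
      then show ?thesis by simp
    qed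
  qed
qed

text \<open>Take the shortest suffix \<open>i # v\<close> that is not reduced. Exchange gives
  another reduced word for \<open>v\<close> that begins with \<open>i\<close>, so that after
  rewriting \<open>v\<close> a square \<open>i i\<close> appears in the word.\<close>

lemma nonreduced_cases:
  assumes "u \<in> lists I" "\<not> reduced u"
  obtains p i v v' where "u = p @ i # v" "i \<in> I" "reduced v" "reduced (i # v')" "v \<doteq> i # v'"
proof -
  have "\<exists>p i v. u = p @ i # v \<and> reduced v \<and> \<not> reduced (i # v)"
    using assms
  proof (induction u)
    case Nil
    then show ?case by (simp add: reduced_def)
  next
    case (Cons i u)
    show ?case
    proof (cases "reduced u")
      case True
      then show ?thesis using Cons.prems by blast
    next
      case False
      then obtain p i' v where "u = p @ i' # v" "reduced v" "\<not> reduced (i' # v)"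
        using Cons by auto
      then show ?thesis by (intro exI[of _ "i # p"]) auto
    qed
  qed
  then obtain p i v where v: "u = p @ i # v" "reduced v" "\<not> reduced (i # v)" by blast
  then have i: "i \<in> I" using assms(1) by auto
  obtain k where k: "k < length v" "i # v \<doteq> take k v @ drop (Suc k) v"
    using exchange[OF v(2) i v(3)] by blast
  let ?v' = "take k v @ drop (Suc k) v"
  have "i # i # v \<doteq> i # ?v'"
    using k(2) i by (intro eqv_Cons)
  then have eq: "v \<doteq> i # ?v'"
    using eqv_square[OF reduced_lists[OF v(2)] i] eqv_sym eqv_trans by blast
  moreover have "reduced (i # ?v')"
    using k(1) by (intro reduced_eqv[OF v(2) eq]) auto
  ultimately show thesis using that v i by blast
qed

subsection \<open>The classes of words\<close>

definition word_class :: "'i list \<Rightarrow> 'i list set" where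
  "word_class u = {v. u \<doteq> v}"

lemma word_class_eq_iff: "u \<in> lists I \<Longrightarrow> word_class u = word_class v \<longleftrightarrow> u \<doteq> v"
  unfolding word_class_def using eqv_refl eqv_sym eqv_trans by blast

lemma carrier_cox_group: "carrier (cox_group I m) = word_class ` lists I"
  by (auto simp: cox_group_def quotient_def word_class_def)

lemma cox_length_word_class: "reduced u \<Longrightarrow> cox_length (word_class u) = length u"
  unfolding cox_length_def word_class_def
  by (rule Least_equality) (auto simp: reduced_def intro: eqv_refl)

lemma reduced_word_for_class:
  assumes "u \<in> lists I" "reduced_word_for (word_class u) v"
  shows "reduced v" "u \<doteq> v" "word_class v = word_class u"
proof -
  show uv: "u \<doteq> v" using assms by (simp add: reduced_word_for_def word_class_def)
  obtain v' where v': "reduced v'" "u \<doteq> v'" using reduced_exists[OF assms(1)] .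
  show vu: "word_class v = word_class u"
    using uv word_class_eq_iff[of v u] eqv_lists eqv_sym by blast
  have "length v = length v'"
    using assms v' cox_length_word_class[OF v'(1)] word_class_eq_iff[OF assms(1), of v'] by (simp add: reduced_word_for_def)
  then show "reduced v"
    using reduced_eqv[OF v'(1), of v] v' uv eqv_sym eqv_trans by (metis order_refl)
qed

lemma cox_sign_word_class: "u \<in> lists I \<Longrightarrow> cox_sign (word_class u) = (-1) ^ length u"
  unfolding cox_sign_def word_class_def
proof (rule the_equality)
  show "\<forall>v\<in>{v. u \<doteq> v}. (- 1) ^ length u = (- 1 :: int) ^ length v"
    using eqv_parity by (auto simp: minus_one_power_iff)
qed (auto intro: eqv_refl)

lemma word_class_in_cox_plus: "u \<in> lists I \<Longrightarrow> word_class u \<in> cox_plus I m \<longleftrightarrow> even (length u)"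
  by (auto simp: cox_plus_def kernel_def carrier_cox_group cox_sign_word_class sign_img_def minus_one_power_iff)

lemma finite_words_length: "finite {u \<in> lists I. length u \<le> n}"
  using finite_lists_length_le[OF finite_I, of n] by (simp add: lists_eq_set)

end

section \<open>Modules\<close>

lemma quotient_module_simps:
  "carrier (quotient_module M N) = (\<lambda>x. N +>\<^bsub>M\<^esub> x) ` carrier M"
  "\<zero>\<^bsub>quotient_module M N\<^esub> = N"
  "add (quotient_module M N) = set_add M"
  "r \<odot>\<^bsub>quotient_module M N\<^esub> U = (\<Union>x\<in>U. N +>\<^bsub>M\<^esub> (r \<odot>\<^bsub>M\<^esub> x))"
  by (auto simp: quotient_module_def A_RCOSETS_def RCOSETS_def a_r_coset_def)

context module
begin

lemma submodule_finsum:
  assumes N: "submodule N R M" and "f \<in> S \<rightarrow> N"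
  shows "finsum M f S \<in> N"
proof -
  interpret submodule N R M by fact
  have "f x \<in> carrier M" if "x \<in> S" for x using that assms(2) subset by auto
  moreover have "\<zero>\<^bsub>M\<^esub> \<in> N" using one_closed by simp
  moreover have "x \<oplus>\<^bsub>M\<^esub> y \<in> N" if "x \<in> N" "y \<in> N" for x y using m_closed[OF that] by simp
  ultimately show ?thesis
    using assms(2)
    by (induction S rule: infinite_finite_induct) (auto simp: Pi_iff)
qed

lemma span_subset_carrier: "B \<subseteq> carrier M \<Longrightarrow> module_span R M B \<subseteq> carrier M"
  unfolding module_span_def by (auto intro!: finsum_closed)

lemma span_extend:
  assumes "B \<subseteq> carrier M" "finite S" "S \<subseteq> T" "finite T" "T \<subseteq> B" "c \<in> S \<rightarrow> carrier R"
  shows "(\<Oplus>\<^bsub>M\<^esub>b\<in>S. c b \<odot>\<^bsub>M\<^esub> b) = (\<Oplus>\<^bsub>M\<^esub>b\<in>T. (if b \<in> S then c b else \<zero>) \<odot>\<^bsub>M\<^esub> b)"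
proof -
  have "(\<Oplus>\<^bsub>M\<^esub>b\<in>S. c b \<odot>\<^bsub>M\<^esub> b) = (\<Oplus>\<^bsub>M\<^esub>b\<in>S. (if b \<in> S then c b else \<zero>) \<odot>\<^bsub>M\<^esub> b)"
    using assms by (intro M.finsum_cong') (auto simp: Pi_iff subset_iff)
  also have "\<dots> = (\<Oplus>\<^bsub>M\<^esub>b\<in>T. (if b \<in> S then c b else \<zero>) \<odot>\<^bsub>M\<^esub> b)"
    using assms by (intro M.finsum_mono_neutral_left) (auto simp: Pi_iff subset_iff)
  finally show ?thesis .
qed

lemma span_base:
  assumes "B \<subseteq> carrier M" "b \<in> B"
  shows "b \<in> module_span R M B"
  unfolding module_span_def using assms
  by (intro CollectI exI[of _ "\<lambda>_. \<one>"] exI[of _ "{b}"]) auto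

lemma span_mono: "B \<subseteq> C \<Longrightarrow> module_span R M B \<subseteq> module_span R M C"
  unfolding module_span_def by blast

lemma span_submodule:
  assumes B: "B \<subseteq> carrier M"
  shows "submodule (module_span R M B) R M"
proof -
  have smult: "a \<odot>\<^bsub>M\<^esub> x \<in> module_span R M B" if "a \<in> carrier R" "x \<in> module_span R M B" for a x
  proof -
    obtain c S where x: "x = (\<Oplus>\<^bsub>M\<^esub>b\<in>S. c b \<odot>\<^bsub>M\<^esub> b)" "finite S" "S \<subseteq> B" "c \<in> S \<rightarrow> carrier R"
      using \<open>x \<in> module_span R M B\<close> by (auto simp: module_span_def)
    have "a \<odot>\<^bsub>M\<^esub> x = (\<Oplus>\<^bsub>M\<^esub>b\<in>S. a \<odot>\<^bsub>M\<^esub> (c b \<odot>\<^bsub>M\<^esub> b))"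
      unfolding x(1) using x B that by (intro finsum_smult_ldistr) (auto simp: Pi_iff subset_iff)
    also have "\<dots> = (\<Oplus>\<^bsub>M\<^esub>b\<in>S. (a \<otimes> c b) \<odot>\<^bsub>M\<^esub> b)"
      using x B that by (intro M.finsum_cong') (auto simp: Pi_iff subset_iff smult_assoc1)
    finally show ?thesis
      unfolding module_span_def using x that
      by (intro CollectI exI[of _ "\<lambda>b. a \<otimes> c b"] exI[of _ S]) auto
  qed
  show ?thesis
  proof (rule submoduleI)
    show "module_span R M B \<subseteq> carrier M" using B by (rule span_subset_carrier)
    show "\<zero>\<^bsub>M\<^esub> \<in> module_span R M B"
      unfolding module_span_def by (intro CollectI exI[of _ "\<lambda>_. \<one>"] exI[of _ "{}"]) auto
    show "x \<oplus>\<^bsub>M\<^esub> y \<in> module_span R M B" if xy: "x \<in> module_span R M B" "y \<in> module_span R M B" for x y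
    proof -
      obtain c S where x: "x = (\<Oplus>\<^bsub>M\<^esub>b\<in>S. c b \<odot>\<^bsub>M\<^esub> b)" "finite S" "S \<subseteq> B" "c \<in> S \<rightarrow> carrier R"
        using xy by (auto simp: module_span_def)
      obtain d T where y: "y = (\<Oplus>\<^bsub>M\<^esub>b\<in>T. d b \<odot>\<^bsub>M\<^esub> b)" "finite T" "T \<subseteq> B" "d \<in> T \<rightarrow> carrier R"
        using xy by (auto simp: module_span_def)
      let ?c = "\<lambda>b. if b \<in> S then c b else \<zero>" and ?d = "\<lambda>b. if b \<in> T then d b else \<zero>"
      have cd: "?c b \<in> carrier R" "?d b \<in> carrier R" for b using x y by auto
      have "x \<oplus>\<^bsub>M\<^esub> y = (\<Oplus>\<^bsub>M\<^esub>b\<in>S \<union> T. ?c b \<odot>\<^bsub>M\<^esub> b) \<oplus>\<^bsub>M\<^esub> (\<Oplus>\<^bsub>M\<^esub>b\<in>S \<union> T. ?d b \<odot>\<^bsub>M\<^esub> b)"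
        using x y span_extend[OF B, of S "S \<union> T" c] span_extend[OF B, of T "S \<union> T" d] by simp
      also have "\<dots> = (\<Oplus>\<^bsub>M\<^esub>b\<in>S \<union> T. ?c b \<odot>\<^bsub>M\<^esub> b \<oplus>\<^bsub>M\<^esub> ?d b \<odot>\<^bsub>M\<^esub> b)"
        using x y B cd by (intro M.finsum_addf[symmetric]) (auto simp: Pi_iff subset_iff)
      also have "\<dots> = (\<Oplus>\<^bsub>M\<^esub>b\<in>S \<union> T. (?c b \<oplus> ?d b) \<odot>\<^bsub>M\<^esub> b)"
        using x y B cd by (intro M.finsum_cong' smult_l_distr[symmetric]) (auto simp: Pi_iff subset_iff)
      finally have "x \<oplus>\<^bsub>M\<^esub> y = (\<Oplus>\<^bsub>M\<^esub>b\<in>S \<union> T. (?c b \<oplus> ?d b) \<odot>\<^bsub>M\<^esub> b)" .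
      moreover have "(\<lambda>b. ?c b \<oplus> ?d b) \<in> S \<union> T \<rightarrow> carrier R" using cd by (intro funcsetI R.a_closed)
      moreover have "finite (S \<union> T)" "S \<union> T \<subseteq> B" using x y by auto
      ultimately show ?thesis
        unfolding module_span_def by (intro CollectI exI[of _ "\<lambda>b. ?c b \<oplus> ?d b"] exI[of _ "S \<union> T"] conjI)
    qed
    \<comment> \<open>Negation is scalar multiplication by minus one.\<close>
    show "\<ominus>\<^bsub>M\<^esub> x \<in> module_span R M B" if "x \<in> module_span R M B" for x
      using smult[of "\<ominus> \<one>" x] that span_subset_carrier[OF B] by (auto simp: smult_l_minus)
  qed (rule smult)
qed

lemma span_minimal:
  assumes "submodule N R M" "B \<subseteq> N"
  shows "module_span R M B \<subseteq> N"
proof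
  fix x assume "x \<in> module_span R M B"
  then obtain c S where x: "x = (\<Oplus>\<^bsub>M\<^esub>b\<in>S. c b \<odot>\<^bsub>M\<^esub> b)" "S \<subseteq> B" "c \<in> S \<rightarrow> carrier R"
    by (auto simp: module_span_def)
  then show "x \<in> N"
    unfolding x(1) using assms submoduleE(4)[OF assms(1)] by (intro submodule_finsum) (auto simp: Pi_iff subset_iff)
qed

text \<open>Bases are sets of module elements, whereas the natural index set here is the Coxeter
  group. Equal values at two indices would give a relation with coefficients \<open>1\<close> and
  \<open>-1\<close>, so independence of the family forces injectivity as soon as \<open>1\<close>
  differs from \<open>0\<close>.\<close>

lemma independent_family:
  assumes v: "v \<in> U \<rightarrow> carrier M" and one: "\<one> \<noteq> \<zero>"
    and ind: "\<And>S c. finite S \<Longrightarrow> S \<subseteq> U \<Longrightarrow> c \<in> S \<rightarrow> carrier R \<Longrightarrow>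
      (\<Oplus>\<^bsub>M\<^esub>x\<in>S. c x \<odot>\<^bsub>M\<^esub> v x) = \<zero>\<^bsub>M\<^esub> \<Longrightarrow> \<forall>x\<in>S. c x = \<zero>"
  shows "inj_on v U" "module_independent R M (v ` U)"
proof -
  show inj: "inj_on v U"
  proof (rule inj_onI, rule ccontr)
    fix x y assume xy: "x \<in> U" "y \<in> U" "v x = v y" "x \<noteq> y"
    let ?c = "\<lambda>z. if z = x then \<one> else \<ominus> \<one>"
    have vy: "v y \<in> carrier M" using v xy by auto
    have "(\<Oplus>\<^bsub>M\<^esub>z\<in>{x, y}. ?c z \<odot>\<^bsub>M\<^esub> v z) = v y \<oplus>\<^bsub>M\<^esub> (\<ominus> \<one>) \<odot>\<^bsub>M\<^esub> v y"
      using xy vy by (subst M.finsum_insert) auto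
    also have "\<dots> = \<zero>\<^bsub>M\<^esub>" using vy by (simp add: smult_l_minus M.r_neg)
    finally have "\<forall>z\<in>{x, y}. ?c z = \<zero>" using xy by (intro ind) auto
    with one show False by auto
  qed
  show "module_independent R M (v ` U)"
    unfolding module_independent_def
  proof (intro allI impI)
    fix S c
    assume *: "finite S \<and> S \<subseteq> v ` U \<and> c \<in> S \<rightarrow> carrier R \<and> (\<Oplus>\<^bsub>M\<^esub>b\<in>S. c b \<odot>\<^bsub>M\<^esub> b) = \<zero>\<^bsub>M\<^esub>"
    then obtain S' where S': "finite S'" "S' \<subseteq> U" "S = v ` S'"
      by (meson finite_subset_image)
    have "(\<Oplus>\<^bsub>M\<^esub>b\<in>S. c b \<odot>\<^bsub>M\<^esub> b) = (\<Oplus>\<^bsub>M\<^esub>x\<in>S'. c (v x) \<odot>\<^bsub>M\<^esub> v x)"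
      unfolding S'(3) using * S' v inj
      by (intro M.finsum_reindex) (auto simp: Pi_iff subset_iff intro: inj_on_subset)
    then have "\<forall>x\<in>S'. c (v x) = \<zero>" using * S' by (intro ind) auto
    with S' show "\<forall>b\<in>S. c b = \<zero>" by auto
  qed
qed

lemma module_independentD:
  "module_independent R M B \<Longrightarrow> finite S \<Longrightarrow> S \<subseteq> B \<Longrightarrow> c \<in> S \<rightarrow> carrier R \<Longrightarrow>
    (\<Oplus>\<^bsub>M\<^esub>b\<in>S. c b \<odot>\<^bsub>M\<^esub> b) = \<zero>\<^bsub>M\<^esub> \<Longrightarrow> b \<in> S \<Longrightarrow> c b = \<zero>"
  unfolding module_independent_def by blast

text \<open>\<open>finsum\<close> refers to the carrier of its structure, so sums in a submodule
  have to be identified with those in the ambient module. The graded pieces are quotients of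
  submodules and rely on this.\<close>

lemma finsum_submodule:
  assumes N: "submodule N R M" and "f \<in> S \<rightarrow> N"
  shows "finsum (M\<lparr>carrier := N\<rparr>) f S = finsum M f S"
proof -
  interpret N: module R "M\<lparr>carrier := N\<rparr>"
    using N submodule.submodule_is_module module_axioms by blast
  have "N \<subseteq> carrier M" using submoduleE(1)[OF N] .
  then show ?thesis
    using additive_finsum[of "M\<lparr>carrier := N\<rparr>" M "\<lambda>x. x" f S] assms(2) N.abelian_monoid_axioms M.abelian_monoid_axioms
    by auto
qed

lemma span_in_submodule:
  assumes N: "submodule N R M" and B: "B \<subseteq> N"
  shows "module_span R (M\<lparr>carrier := N\<rparr>) B = module_span R M B"
proof -
  have "finsum (M\<lparr>carrier := N\<rparr>) (\<lambda>b. c b \<odot>\<^bsub>M\<^esub> b) S = finsum M (\<lambda>b. c b \<odot>\<^bsub>M\<^esub> b) S"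
    if "S \<subseteq> B" "c \<in> S \<rightarrow> carrier R" for S c
    using that B submoduleE(4)[OF N] by (intro finsum_submodule[OF N]) (auto simp: Pi_iff subset_iff)
  then show ?thesis unfolding module_span_def by (intro Collect_cong ex_cong1) auto
qed

lemma independent_in_submodule:
  assumes N: "submodule N R M" and B: "B \<subseteq> N" and ind: "module_independent R M B"
  shows "module_independent R (M\<lparr>carrier := N\<rparr>) B"
  unfolding module_independent_def
proof (intro allI impI)
  fix S c
  assume *: "finite S \<and> S \<subseteq> B \<and> c \<in> S \<rightarrow> carrier R \<and>
    (\<Oplus>\<^bsub>M\<lparr>carrier := N\<rparr>\<^esub>b\<in>S. c b \<odot>\<^bsub>M\<lparr>carrier := N\<rparr>\<^esub> b) = \<zero>\<^bsub>M\<lparr>carrier := N\<rparr>\<^esub>"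
  then have "finsum (M\<lparr>carrier := N\<rparr>) (\<lambda>b. c b \<odot>\<^bsub>M\<^esub> b) S = finsum M (\<lambda>b. c b \<odot>\<^bsub>M\<^esub> b) S"
    using B submoduleE(4)[OF N] by (intro finsum_submodule[OF N]) (auto simp: Pi_iff subset_iff)
  with * show "\<forall>b\<in>S. c b = \<zero>" using module_independentD[OF ind, of S c] by simp
qed

lemma quotient_module_hom:
  assumes N: "submodule N R M"
  shows "x \<in> carrier M \<Longrightarrow> y \<in> carrier M \<Longrightarrow>
      (N +>\<^bsub>M\<^esub> x) \<oplus>\<^bsub>quotient_module M N\<^esub> (N +>\<^bsub>M\<^esub> y) = N +>\<^bsub>M\<^esub> (x \<oplus>\<^bsub>M\<^esub> y)"
    and "r \<in> carrier R \<Longrightarrow> x \<in> carrier M \<Longrightarrow> r \<odot>\<^bsub>quotient_module M N\<^esub> (N +>\<^bsub>M\<^esub> x) = N +>\<^bsub>M\<^esub> (r \<odot>\<^bsub>M\<^esub> x)"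
    and "x \<in> carrier M \<Longrightarrow> N +>\<^bsub>M\<^esub> x = N \<longleftrightarrow> x \<in> N"
    and "abelian_group (quotient_module M N)"
proof -
  have sg: "additive_subgroup N M"
    using N submodule.axioms(1) by (auto intro: additive_subgroup.intro)
  interpret N: abelian_subgroup N M
    by (rule abelian_subgroupI3[OF sg M.abelian_group_axioms])
  have Nc: "N \<subseteq> carrier M" using submoduleE(1)[OF N] .
  show add: "(N +>\<^bsub>M\<^esub> x) \<oplus>\<^bsub>quotient_module M N\<^esub> (N +>\<^bsub>M\<^esub> y) = N +>\<^bsub>M\<^esub> (x \<oplus>\<^bsub>M\<^esub> y)"
    if "x \<in> carrier M" "y \<in> carrier M" for x y
    using that by (simp add: quotient_module_simps N.a_rcos_sum)
  show "N +>\<^bsub>M\<^esub> x = N \<longleftrightarrow> x \<in> N" if "x \<in> carrier M" for x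
    using that N.a_rcos_self N.a_rcos_const by metis
  show "r \<odot>\<^bsub>quotient_module M N\<^esub> (N +>\<^bsub>M\<^esub> x) = N +>\<^bsub>M\<^esub> (r \<odot>\<^bsub>M\<^esub> x)" if rx: "r \<in> carrier R" "x \<in> carrier M" for r x
  proof -
    \<comment> \<open>The scalar multiple of a coset is defined as a union; all members of the union
      are the same coset.\<close>
    have "N +>\<^bsub>M\<^esub> (r \<odot>\<^bsub>M\<^esub> y) = N +>\<^bsub>M\<^esub> (r \<odot>\<^bsub>M\<^esub> x)" if y: "y \<in> N +>\<^bsub>M\<^esub> x" for y
    proof -
      obtain n where n: "n \<in> N" "y = n \<oplus>\<^bsub>M\<^esub> x" using y by (auto simp: a_r_coset_def')
      then have "r \<odot>\<^bsub>M\<^esub> y = r \<odot>\<^bsub>M\<^esub> n \<oplus>\<^bsub>M\<^esub> r \<odot>\<^bsub>M\<^esub> x" using rx Nc by (auto simp: smult_r_distr)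
      moreover have "r \<odot>\<^bsub>M\<^esub> n \<in> N" using submoduleE(4)[OF N] n rx by blast
      ultimately have "r \<odot>\<^bsub>M\<^esub> y \<in> N +>\<^bsub>M\<^esub> (r \<odot>\<^bsub>M\<^esub> x)" by (auto simp: a_r_coset_def')
      then show ?thesis using rx M.a_repr_independence[OF _ _ N.a_subgroup] by (metis smult_closed)
    qed
    then show ?thesis
      using N.a_rcos_self[OF rx(2)] unfolding quotient_module_simps by blast
  qed
  have Nzero: "N = N +>\<^bsub>M\<^esub> \<zero>\<^bsub>M\<^esub>" using N.a_rcos_const[of "\<zero>\<^bsub>M\<^esub>"] by simp
  let ?Q = "quotient_module M N"
  have rep: "\<exists>x\<in>carrier M. U = N +>\<^bsub>M\<^esub> x" if "U \<in> carrier ?Q" for U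
    using that by (auto simp: quotient_module_simps)
  have cl: "N +>\<^bsub>M\<^esub> x \<in> carrier ?Q" if "x \<in> carrier M" for x
    using that by (auto simp: quotient_module_simps)
  have z: "\<zero>\<^bsub>?Q\<^esub> = N +>\<^bsub>M\<^esub> \<zero>\<^bsub>M\<^esub>" using Nzero by (simp add: quotient_module_simps)
  show "abelian_group ?Q"
  proof (rule abelian_groupI)
    fix U Y assume "U \<in> carrier ?Q" "Y \<in> carrier ?Q"
    then obtain x y where x: "x \<in> carrier M" "U = N +>\<^bsub>M\<^esub> x" and y: "y \<in> carrier M" "Y = N +>\<^bsub>M\<^esub> y"
      using rep by meson
    show "U \<oplus>\<^bsub>?Q\<^esub> Y \<in> carrier ?Q" using x y add cl by simp
    show "U \<oplus>\<^bsub>?Q\<^esub> Y = Y \<oplus>\<^bsub>?Q\<^esub> U" using x y add by (simp add: M.a_comm)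
    fix Z assume "Z \<in> carrier ?Q"
    then obtain z where z: "z \<in> carrier M" "Z = N +>\<^bsub>M\<^esub> z" using rep by meson
    show "U \<oplus>\<^bsub>?Q\<^esub> Y \<oplus>\<^bsub>?Q\<^esub> Z = U \<oplus>\<^bsub>?Q\<^esub> (Y \<oplus>\<^bsub>?Q\<^esub> Z)" using x y z add by (simp add: M.a_assoc)
  next
    fix U assume "U \<in> carrier ?Q"
    then obtain x where x: "x \<in> carrier M" "U = N +>\<^bsub>M\<^esub> x" using rep by meson
    show "\<zero>\<^bsub>?Q\<^esub> \<oplus>\<^bsub>?Q\<^esub> U = U" using x add unfolding z by simp
    show "\<exists>Y\<in>carrier ?Q. Y \<oplus>\<^bsub>?Q\<^esub> U = \<zero>\<^bsub>?Q\<^esub>"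
      using x add cl unfolding z by (intro bexI[of _ "N +>\<^bsub>M\<^esub> (\<ominus>\<^bsub>M\<^esub> x)"]) (auto simp: M.l_neg)
  qed (use z cl in auto)
qed

lemma quotient_module_module:
  assumes N: "submodule N R M"
  shows "module R (quotient_module M N)"
proof -
  let ?Q = "quotient_module M N"
  note hom = quotient_module_hom[OF N]
  have rep: "\<exists>x\<in>carrier M. U = N +>\<^bsub>M\<^esub> x" if "U \<in> carrier ?Q" for U
    using that by (auto simp: quotient_module_simps)
  have cl: "N +>\<^bsub>M\<^esub> x \<in> carrier ?Q" if "x \<in> carrier M" for x
    using that by (auto simp: quotient_module_simps)
  show ?thesis
  proof (rule moduleI[OF R.is_cring hom(4)])
    fix a U assume a: "a \<in> carrier R" and "U \<in> carrier ?Q"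
    then obtain x where x: "x \<in> carrier M" "U = N +>\<^bsub>M\<^esub> x" using rep by meson
    show "a \<odot>\<^bsub>?Q\<^esub> U \<in> carrier ?Q" using a x cl by (simp add: hom)
    fix b assume b: "b \<in> carrier R"
    show "(a \<oplus> b) \<odot>\<^bsub>?Q\<^esub> U = a \<odot>\<^bsub>?Q\<^esub> U \<oplus>\<^bsub>?Q\<^esub> b \<odot>\<^bsub>?Q\<^esub> U" using a b x by (simp add: hom smult_l_distr)
    show "(a \<otimes> b) \<odot>\<^bsub>?Q\<^esub> U = a \<odot>\<^bsub>?Q\<^esub> (b \<odot>\<^bsub>?Q\<^esub> U)" using a b x by (simp add: hom smult_assoc1)
  next
    fix a U Y assume a: "a \<in> carrier R" and "U \<in> carrier ?Q" "Y \<in> carrier ?Q"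
    then obtain x y where "x \<in> carrier M" "U = N +>\<^bsub>M\<^esub> x" "y \<in> carrier M" "Y = N +>\<^bsub>M\<^esub> y" using rep by meson
    then show "a \<odot>\<^bsub>?Q\<^esub> (U \<oplus>\<^bsub>?Q\<^esub> Y) = a \<odot>\<^bsub>?Q\<^esub> U \<oplus>\<^bsub>?Q\<^esub> a \<odot>\<^bsub>?Q\<^esub> Y" using a by (simp add: hom smult_r_distr)
  next
    fix U assume "U \<in> carrier ?Q"
    then obtain x where "x \<in> carrier M" "U = N +>\<^bsub>M\<^esub> x" using rep by meson
    then show "\<one> \<odot>\<^bsub>?Q\<^esub> U = U" by (simp add: hom)
  qed
qed

text \<open>The classes of the elements of \<open>B - B0\<close> form a basis. A relation between
  them lifts to an equation between a combination over \<open>B - B0\<close> and one over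
  \<open>B0\<close>, and these two index sets are disjoint.\<close>

lemma quotient_by_partial_basis:
  assumes B: "B \<subseteq> carrier M" "module_span R M B = carrier M" "module_independent R M B"
    and B0: "B0 \<subseteq> B" and one: "\<one> \<noteq> \<zero>"
  defines "Q \<equiv> quotient_module M (module_span R M B0)"
  shows "free_module R Q" "finite (B - B0) \<Longrightarrow> fin_gen_module R Q"
proof -
  define N where "N = module_span R M B0"
  have N: "submodule N R M" unfolding N_def using B B0 by (intro span_submodule) auto
  note hom = quotient_module_hom[OF N]
  have Q: "Q = quotient_module M N" by (simp add: Q_def N_def)
  interpret Q: module R Q unfolding Q by (rule quotient_module_module[OF N])
  let ?p = "\<lambda>x. N +>\<^bsub>M\<^esub> x"
  have p: "?p x \<in> carrier Q" if "x \<in> carrier M" for x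
    using that by (auto simp: Q quotient_module_simps)
  have pzero: "?p x = \<zero>\<^bsub>Q\<^esub> \<longleftrightarrow> x \<in> N" if "x \<in> carrier M" for x
    using hom(3)[OF that] by (simp add: Q quotient_module_simps)
  have psum: "?p (finsum M f S) = finsum Q (\<lambda>x. ?p (f x)) S" if "f \<in> S \<rightarrow> carrier M" for f and S :: "'c set"
    using that p hom(1) pzero[of "\<zero>\<^bsub>M\<^esub>"] submodule.axioms(1)[OF N]
    by (intro additive_finsum M.abelian_monoid_axioms Q.M.abelian_monoid_axioms)
      (auto simp: Q subgroup_def)
  have pcomb: "?p (\<Oplus>\<^bsub>M\<^esub>x\<in>S. c x \<odot>\<^bsub>M\<^esub> x) = (\<Oplus>\<^bsub>Q\<^esub>x\<in>S. c x \<odot>\<^bsub>Q\<^esub> ?p x)"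
    if "S \<subseteq> B" "c \<in> S \<rightarrow> carrier R" for S c
  proof -
    have S: "x \<in> S \<Longrightarrow> x \<in> carrier M \<and> c x \<in> carrier R" for x using that B by auto
    have smult: "c x \<odot>\<^bsub>Q\<^esub> ?p x = ?p (c x \<odot>\<^bsub>M\<^esub> x)" if "x \<in> S" for x
      using hom(2) S[OF that] by (simp add: Q)
    have "?p (\<Oplus>\<^bsub>M\<^esub>x\<in>S. c x \<odot>\<^bsub>M\<^esub> x) = (\<Oplus>\<^bsub>Q\<^esub>x\<in>S. ?p (c x \<odot>\<^bsub>M\<^esub> x))"
      using S by (intro psum) auto
    also have "\<dots> = (\<Oplus>\<^bsub>Q\<^esub>x\<in>S. c x \<odot>\<^bsub>Q\<^esub> ?p x)"
      using S smult p by (intro Q.M.finsum_cong' funcsetI) (simp_all only: smult_closed Q.smult_closed refl)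
    finally show ?thesis .
  qed
  have ind: "\<forall>x\<in>S. c x = \<zero>"
    if S: "finite S" "S \<subseteq> B - B0" "c \<in> S \<rightarrow> carrier R" "(\<Oplus>\<^bsub>Q\<^esub>x\<in>S. c x \<odot>\<^bsub>Q\<^esub> ?p x) = \<zero>\<^bsub>Q\<^esub>" for S c
  proof -
    let ?x = "\<Oplus>\<^bsub>M\<^esub>x\<in>S. c x \<odot>\<^bsub>M\<^esub> x"
    have SM: "x \<in> S \<Longrightarrow> x \<in> carrier M \<and> c x \<in> carrier R" for x using S B by auto
    have x: "?x \<in> carrier M" using SM by (intro M.finsum_closed) auto
    have "?p ?x = \<zero>\<^bsub>Q\<^esub>" using S by (subst pcomb) auto
    then have "?x \<in> N" using pzero x by simp
    then obtain d T where T: "?x = (\<Oplus>\<^bsub>M\<^esub>x\<in>T. d x \<odot>\<^bsub>M\<^esub> x)" "finite T" "T \<subseteq> B0" "d \<in> T \<rightarrow> carrier R"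
      by (auto simp: N_def module_span_def)
    have TM: "x \<in> T \<Longrightarrow> x \<in> carrier M \<and> d x \<in> carrier R" for x using T B B0 by auto
    \<comment> \<open>Coefficients of the difference of both sides, a single relation over
      \<open>S \<union> T\<close> inside the basis \<open>B\<close>.\<close>
    let ?e = "\<lambda>x. if x \<in> S then c x else \<ominus> d x"
    have disj: "S \<inter> T = {}" using S T by auto
    have "(\<Oplus>\<^bsub>M\<^esub>x\<in>S \<union> T. ?e x \<odot>\<^bsub>M\<^esub> x) = (\<Oplus>\<^bsub>M\<^esub>x\<in>S. ?e x \<odot>\<^bsub>M\<^esub> x) \<oplus>\<^bsub>M\<^esub> (\<Oplus>\<^bsub>M\<^esub>x\<in>T. ?e x \<odot>\<^bsub>M\<^esub> x)"
      using S T disj SM TM by (intro M.finsum_Un_disjoint) auto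
    also have "(\<Oplus>\<^bsub>M\<^esub>x\<in>S. ?e x \<odot>\<^bsub>M\<^esub> x) = ?x"
      using SM by (intro M.finsum_cong') auto
    also have "(\<Oplus>\<^bsub>M\<^esub>x\<in>T. ?e x \<odot>\<^bsub>M\<^esub> x) = (\<Oplus>\<^bsub>M\<^esub>x\<in>T. (\<ominus> \<one>) \<odot>\<^bsub>M\<^esub> (d x \<odot>\<^bsub>M\<^esub> x))"
      using TM disj by (intro M.finsum_cong') (auto simp: smult_l_minus)
    also have "\<dots> = (\<ominus> \<one>) \<odot>\<^bsub>M\<^esub> ?x"
      unfolding T(1) using T TM by (intro finsum_smult_ldistr[symmetric]) auto
    also have "?x \<oplus>\<^bsub>M\<^esub> (\<ominus> \<one>) \<odot>\<^bsub>M\<^esub> ?x = \<zero>\<^bsub>M\<^esub>"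
      using x by (simp add: smult_l_minus M.r_neg)
    finally have "?e x = \<zero>" if "x \<in> S" for x
      using that S T B0 SM TM by (intro module_independentD[OF B(3), of "S \<union> T"]) auto
    then show ?thesis by auto
  qed
  have gen: "module_span R Q (?p ` (B - B0)) = carrier Q"
  proof
    have pB: "?p ` (B - B0) \<subseteq> carrier Q" using p B by auto
    then show "module_span R Q (?p ` (B - B0)) \<subseteq> carrier Q" by (rule Q.span_subset_carrier)
    have sub: "submodule (module_span R Q (?p ` (B - B0))) R Q" using pB by (rule Q.span_submodule)
    show "carrier Q \<subseteq> module_span R Q (?p ` (B - B0))"
    proof
      fix U assume "U \<in> carrier Q"
      then obtain x where x: "x \<in> module_span R M B" "U = ?p x"
        using B(2) by (auto simp: Q quotient_module_simps)
      then obtain c S where S: "x = (\<Oplus>\<^bsub>M\<^esub>x\<in>S. c x \<odot>\<^bsub>M\<^esub> x)" "S \<subseteq> B" "c \<in> S \<rightarrow> carrier R"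
        by (auto simp: module_span_def)
      have "c b \<odot>\<^bsub>Q\<^esub> ?p b \<in> module_span R Q (?p ` (B - B0))" if b: "b \<in> S" for b
      proof -
        have bM: "b \<in> carrier M" "c b \<in> carrier R" using b S B by auto
        have "?p b \<in> module_span R Q (?p ` (B - B0))"
        proof (cases "b \<in> B0")
          case True
          then have "?p b = \<zero>\<^bsub>Q\<^esub>" using bM pzero B B0 span_base[of B0 b] by (auto simp: N_def)
          then show ?thesis using Q.submodule_finsum[OF sub, of "\<lambda>_. _" "{}"] by simp
        next
          case False
          then show ?thesis using b S pB by (intro Q.span_base) auto
        qed
        then show ?thesis using bM Q.submoduleE(4)[OF sub] by blast
      qed
      then show "U \<in> module_span R Q (?p ` (B - B0))"
        unfolding x(2) S(1) pcomb[OF S(2,3)] by (intro Q.submodule_finsum[OF sub]) auto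
    qed
  qed
  have pB: "?p \<in> (B - B0) \<rightarrow> carrier Q" using p B by auto
  have "module_independent R Q (?p ` (B - B0))"
    by (rule Q.independent_family(2)[OF pB one]) (rule ind)
  then show "free_module R Q"
    unfolding free_module_def using gen pB Q.module_axioms by blast
  show "fin_gen_module R Q" if "finite (B - B0)"
    unfolding fin_gen_module_def using that gen pB Q.module_axioms by blast
qed

text \<open>Collects the module theory of the theorem: it remains to show that a family spans and is
  independent, and that only finitely many indices satisfy each length bound. It is applied to the
  elements of W and of \<open>W_+\<close> with their lengths.\<close>

lemma free_filtration:
  fixes l :: "'x \<Rightarrow> nat"
  assumes v: "v \<in> U \<rightarrow> carrier M" and one: "\<one> \<noteq> \<zero>"
    and ind: "\<And>S c. finite S \<Longrightarrow> S \<subseteq> U \<Longrightarrow> c \<in> S \<rightarrow> carrier R \<Longrightarrow>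
      (\<Oplus>\<^bsub>M\<^esub>x\<in>S. c x \<odot>\<^bsub>M\<^esub> v x) = \<zero>\<^bsub>M\<^esub> \<Longrightarrow> \<forall>x\<in>S. c x = \<zero>"
    and gen: "carrier M \<subseteq> module_span R M (v ` U)"
    and fin: "\<And>n. finite {x \<in> U. l x \<le> n}"
  defines "F \<equiv> \<lambda>n :: int. module_span R M {v x | x. x \<in> U \<and> int (l x) \<le> n}"
  shows "free_module R M" "module_filtration R M F"
    and "fin_gen_module R (gr_module M F n)" "free_module R (gr_module M F n)"
proof -
  have indv: "inj_on v U" "module_independent R M (v ` U)"
    by (rule independent_family[OF v one]; rule ind; assumption)+
  have vX: "v ` U \<subseteq> carrier M" using v by auto
  have span: "module_span R M (v ` U) = carrier M"
    using gen span_subset_carrier[OF vX] by blast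
  show "free_module R M"
    unfolding free_module_def using indv(2) span vX module_axioms by blast
  define B where "B n = {v x | x. x \<in> U \<and> int (l x) \<le> n}" for n
  have F: "F n = module_span R M (B n)" for n by (simp add: F_def B_def)
  have B: "B n \<subseteq> v ` U" "B n \<subseteq> carrier M" for n using vX by (auto simp: B_def)
  have Bmono: "B n \<subseteq> B k" if "n \<le> k" for n k
    using that unfolding B_def by (blast intro: order_trans)
  have Fsub: "submodule (F n) R M" for n unfolding F using B by (intro span_submodule)
  show "module_filtration R M F"
    unfolding module_filtration_def
  proof (intro conjI allI)
    show "F n \<subseteq> F (n + 1)" for n unfolding F by (intro span_mono Bmono) simp
    have "B (-1) = {}" by (auto simp: B_def)
    then show "F (-1) = {\<zero>\<^bsub>M\<^esub>}" unfolding F by (auto simp: module_span_def)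
    show "(\<Union>n. F n) = carrier M"
    proof
      show "(\<Union>n. F n) \<subseteq> carrier M" using submoduleE(1)[OF Fsub] by auto
      show "carrier M \<subseteq> (\<Union>n. F n)"
      proof
        fix y assume "y \<in> carrier M"
        then obtain c S where S: "y = (\<Oplus>\<^bsub>M\<^esub>x\<in>S. c x \<odot>\<^bsub>M\<^esub> x)" "finite S" "S \<subseteq> v ` U" "c \<in> S \<rightarrow> carrier R"
          using span unfolding module_span_def by blast
        then obtain S' where S': "finite S'" "S' \<subseteq> U" "S = v ` S'" by (meson finite_subset_image)
        \<comment> \<open>Any common bound for the finitely many lengths would do; their sum is
          one.\<close>
        have "S \<subseteq> B (\<Sum>x\<in>S'. int (l x))"
        proof
          fix b assume "b \<in> S"
          then obtain x where x: "x \<in> S'" "b = v x" using S'(3) by blast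
          have "int (l x) \<le> (\<Sum>x\<in>S'. int (l x))" using x(1) S'(1) by (intro member_le_sum) auto
          with x S'(2) show "b \<in> B (\<Sum>x\<in>S'. int (l x))" unfolding B_def by blast
        qed
        then have "y \<in> F (\<Sum>x\<in>S'. int (l x))"
          unfolding F module_span_def using S by blast
        then show "y \<in> (\<Union>n. F n)" by blast
      qed
    qed
  qed (rule Fsub)
  interpret Fn: module R "M\<lparr>carrier := F n\<rparr>"
    using submodule.submodule_is_module[OF Fsub module_axioms] .
  have BF: "B n \<subseteq> F n" unfolding F using span_base[OF B(2)] by blast
  have "module_independent R M (B n)"
    using indv(2) B(1)[of n] unfolding module_independent_def by (meson order_trans)
  then have ind': "module_independent R (M\<lparr>carrier := F n\<rparr>) (B n)"
    by (rule independent_in_submodule[OF Fsub BF])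
  have span': "module_span R (M\<lparr>carrier := F n\<rparr>) (B n) = carrier (M\<lparr>carrier := F n\<rparr>)"
    using span_in_submodule[OF Fsub BF] by (simp add: F)
  have B': "B (n - 1) \<subseteq> B n" by (rule Bmono) simp
  have gr: "gr_module M F n = quotient_module (M\<lparr>carrier := F n\<rparr>) (module_span R (M\<lparr>carrier := F n\<rparr>) (B (n - 1)))"
    unfolding gr_module_def using span_in_submodule[OF Fsub, of "B (n - 1)" n] B' BF by (simp add: F)
  note quot = Fn.quotient_by_partial_basis[OF _ span' ind' B' one]
  show "free_module R (gr_module M F n)" unfolding gr by (rule quot(1)) (use BF in simp)
  have "B n \<subseteq> v ` {x \<in> U. l x \<le> nat n}" unfolding B_def by fastforce
  then have "finite (B n - B (n - 1))" using fin[of "nat n"] finite_surj by blast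
  then show "fin_gen_module R (gr_module M F n)" unfolding gr by (intro quot(2)) (use BF in simp)
qed

end

lemma (in module) submodule_by_closure:
  assumes "H \<subseteq> carrier M" "\<zero>\<^bsub>M\<^esub> \<in> H"
    and "\<And>x y. x \<in> H \<Longrightarrow> y \<in> H \<Longrightarrow> x \<oplus>\<^bsub>M\<^esub> y \<in> H"
    and "\<And>r x. r \<in> carrier R \<Longrightarrow> x \<in> H \<Longrightarrow> r \<odot>\<^bsub>M\<^esub> x \<in> H"
  shows "submodule H R M"
proof (rule submoduleI)
  show "\<ominus>\<^bsub>M\<^esub> x \<in> H" if "x \<in> H" for x
    using assms(4)[of "\<ominus> \<one>" x] that assms(1) by (auto simp: smult_l_minus)
qed (use assms in auto)

lemma (in module) span_insert:
  assumes "B \<subseteq> carrier M" "b \<in> carrier M" "x \<in> module_span R M (insert b B)"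
  obtains r g where "r \<in> carrier R" "g \<in> module_span R M B" "x = r \<odot>\<^bsub>M\<^esub> b \<oplus>\<^bsub>M\<^esub> g"
proof -
  note sub = span_submodule[OF assms(1)]
  let ?N = "{r \<odot>\<^bsub>M\<^esub> b \<oplus>\<^bsub>M\<^esub> g | r g. r \<in> carrier R \<and> g \<in> module_span R M B}"
  have gM: "g \<in> carrier M" if "g \<in> module_span R M B" for g using that span_subset_carrier[OF assms(1)] by auto
  have zero: "\<zero>\<^bsub>M\<^esub> \<in> module_span R M B" using submodule_finsum[OF sub, of "\<lambda>_. b" "{}"] by simp
  have "submodule ?N R M"
  proof (rule submodule_by_closure)
    show "?N \<subseteq> carrier M" using assms gM by auto
    have "\<zero>\<^bsub>M\<^esub> = \<zero> \<odot>\<^bsub>M\<^esub> b \<oplus>\<^bsub>M\<^esub> \<zero>\<^bsub>M\<^esub>" using assms by simp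
    then show "\<zero>\<^bsub>M\<^esub> \<in> ?N" using zero by blast
  next
    fix x y assume "x \<in> ?N" "y \<in> ?N"
    then obtain r g r' g' where x: "x = r \<odot>\<^bsub>M\<^esub> b \<oplus>\<^bsub>M\<^esub> g" "r \<in> carrier R" "g \<in> module_span R M B"
      and y: "y = r' \<odot>\<^bsub>M\<^esub> b \<oplus>\<^bsub>M\<^esub> g'" "r' \<in> carrier R" "g' \<in> module_span R M B" by blast
    then have "x \<oplus>\<^bsub>M\<^esub> y = (r \<oplus> r') \<odot>\<^bsub>M\<^esub> b \<oplus>\<^bsub>M\<^esub> (g \<oplus>\<^bsub>M\<^esub> g')"
      using gM assms by (simp add: smult_l_distr M.a_ac)
    moreover have "g \<oplus>\<^bsub>M\<^esub> g' \<in> module_span R M B" using x y submoduleE(5)[OF sub] by blast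
    ultimately show "x \<oplus>\<^bsub>M\<^esub> y \<in> ?N" using x y by blast
  next
    fix s x assume s: "s \<in> carrier R" and "x \<in> ?N"
    then obtain r g where x: "x = r \<odot>\<^bsub>M\<^esub> b \<oplus>\<^bsub>M\<^esub> g" "r \<in> carrier R" "g \<in> module_span R M B" by blast
    then have "s \<odot>\<^bsub>M\<^esub> x = (s \<otimes> r) \<odot>\<^bsub>M\<^esub> b \<oplus>\<^bsub>M\<^esub> (s \<odot>\<^bsub>M\<^esub> g)"
      using gM assms s by (simp add: smult_r_distr smult_assoc1)
    moreover have "s \<odot>\<^bsub>M\<^esub> g \<in> module_span R M B" using x s submoduleE(4)[OF sub] by blast
    ultimately show "s \<odot>\<^bsub>M\<^esub> x \<in> ?N" using x s by blast
  qed
  moreover have "insert b B \<subseteq> ?N"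
  proof
    fix y assume "y \<in> insert b B"
    then consider "y = b" | "y \<in> B" by blast
    then show "y \<in> ?N"
    proof cases
      case 1
      then have "y = \<one> \<odot>\<^bsub>M\<^esub> b \<oplus>\<^bsub>M\<^esub> \<zero>\<^bsub>M\<^esub>" using assms by simp
      then show ?thesis using zero by blast
    next
      case 2
      then have "y = \<zero> \<odot>\<^bsub>M\<^esub> b \<oplus>\<^bsub>M\<^esub> y" "y \<in> module_span R M B" using assms span_base[OF assms(1) 2] by auto
      then show ?thesis by blast
    qed
  qed
  ultimately have "x \<in> ?N" using span_minimal assms(3) by blast
  with that show thesis by blast
qed

section \<open>Rings as left modules along a ring homomorphism\<close>

lemma finsum_with_scalars [simp]: "finsum (with_scalars Q \<phi>) = finsum Q"
  by (simp add: fun_eq_iff with_scalars_def finsum_def finprod_def)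

lemma with_scalars_simps [simp]:
  "carrier (with_scalars Q \<phi>) = carrier Q" "\<zero>\<^bsub>with_scalars Q \<phi>\<^esub> = \<zero>\<^bsub>Q\<^esub>" "\<one>\<^bsub>with_scalars Q \<phi>\<^esub> = \<one>\<^bsub>Q\<^esub>"
  "x \<oplus>\<^bsub>with_scalars Q \<phi>\<^esub> y = x \<oplus>\<^bsub>Q\<^esub> y" "x \<otimes>\<^bsub>with_scalars Q \<phi>\<^esub> y = x \<otimes>\<^bsub>Q\<^esub> y"
  "r \<odot>\<^bsub>with_scalars Q \<phi>\<^esub> x = \<phi> r \<otimes>\<^bsub>Q\<^esub> x"
  by (simp_all add: with_scalars_def)

text \<open>The axioms of a left module involve only multiplication by scalars from the left. This
  matters for \<open>A(M)\<close>, where the letters commute with scalars only up to a swap of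
  indices.\<close>

lemma with_scalars_module:
  assumes "cring R" "ring Q" "\<phi> \<in> ring_hom R Q"
  shows "module R (with_scalars Q \<phi>)"
proof -
  interpret Q: ring Q by fact
  show ?thesis
    using assms(3)
    by (intro moduleI[OF assms(1)] abelian_groupI)
      (auto simp: Q.a_assoc Q.a_comm Q.a_lcomm Q.l_distr Q.r_distr Q.m_assoc ring_hom_closed ring_hom_add ring_hom_mult ring_hom_one
        intro!: bexI[of _ "\<ominus>\<^bsub>Q\<^esub> _"] Q.l_neg)
qed

section \<open>Formal power series\<close>

lemma finite_submultisets: "finite {\<alpha>. \<alpha> \<subseteq># \<mu>}"
proof (induction \<mu>)
  case (add x \<mu>)
  have "{\<alpha>. \<alpha> \<subseteq># add_mset x \<mu>} \<subseteq> {\<alpha>. \<alpha> \<subseteq># \<mu>} \<union> add_mset x ` {\<alpha>. \<alpha> \<subseteq># \<mu>}"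
  proof
    fix \<alpha> assume "\<alpha> \<in> {\<alpha>. \<alpha> \<subseteq># add_mset x \<mu>}"
    then have \<alpha>: "\<alpha> \<subseteq># add_mset x \<mu>" by simp
    show "\<alpha> \<in> {\<alpha>. \<alpha> \<subseteq># \<mu>} \<union> add_mset x ` {\<alpha>. \<alpha> \<subseteq># \<mu>}"
    proof (cases "x \<in># \<alpha>")
      case True
      then obtain \<beta> where "\<alpha> = add_mset x \<beta>" by (metis mset_add)
      with \<alpha> show ?thesis by simp
    next
      case False
      with \<alpha> have "\<alpha> \<subseteq># \<mu>"
        by (metis diff_single_trivial subset_eq_diff_conv union_mset_add_mset_right add.right_neutral)
      then show ?thesis by simp
    qed
  qed
  then show ?case by (rule finite_subset) (use add in simp)
qed simp

lemma ps_carrier: "f \<in> carrier (power_series_ring Y) \<longleftrightarrow> (\<forall>\<mu>. \<not> set_mset \<mu> \<subseteq> Y \<longrightarrow> f \<mu> = 0)"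
  and ps_mult: "(f \<otimes>\<^bsub>power_series_ring Y\<^esub> g) \<mu> = (\<Sum>\<alpha> | \<alpha> \<subseteq># \<mu>. f \<alpha> * g (\<mu> - \<alpha>))"
  and ps_one: "\<one>\<^bsub>power_series_ring Y\<^esub> = ps_monom {#}"
  and ps_zero: "\<zero>\<^bsub>power_series_ring Y\<^esub> = (\<lambda>\<mu>. 0)"
  and ps_add: "f \<oplus>\<^bsub>power_series_ring Y\<^esub> g = (\<lambda>\<mu>. f \<mu> + g \<mu>)"
  by (simp_all add: power_series_ring_def ps_monom_def)

lemma ps_mult_comm: "f \<otimes>\<^bsub>power_series_ring Y\<^esub> g = g \<otimes>\<^bsub>power_series_ring Y\<^esub> f"
proof
  fix \<mu>
  show "(f \<otimes>\<^bsub>power_series_ring Y\<^esub> g) \<mu> = (g \<otimes>\<^bsub>power_series_ring Y\<^esub> f) \<mu>"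
    unfolding ps_mult
    by (rule sum.reindex_bij_witness[of _ "\<lambda>\<alpha>. \<mu> - \<alpha>" "\<lambda>\<alpha>. \<mu> - \<alpha>"])
      (auto simp: mult.commute subset_mset.diff_diff_right)
qed

text \<open>Both sides sum over the ordered decompositions of \<open>\<mu>\<close> into three
  multisets. They are parametrised on the left by the sum of the first two parts and the first part,
  on the right by the first part and the second.\<close>

lemma ps_mult_assoc:
  "(f \<otimes>\<^bsub>power_series_ring Y\<^esub> g) \<otimes>\<^bsub>power_series_ring Y\<^esub> h =
    f \<otimes>\<^bsub>power_series_ring Y\<^esub> (g \<otimes>\<^bsub>power_series_ring Y\<^esub> h)"
proof
  fix \<mu>
  have diff: "\<mu> - \<beta> - (\<alpha> - \<beta>) = \<mu> - \<alpha>" if "\<beta> \<subseteq># \<alpha>" for \<alpha> \<beta> :: "'a multiset"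
    using that by (metis diff_diff_add_mset subset_mset.add_diff_inverse)
  have "(\<Sum>\<alpha> | \<alpha> \<subseteq># \<mu>. \<Sum>\<beta> | \<beta> \<subseteq># \<alpha>. f \<beta> * g (\<alpha> - \<beta>) * h (\<mu> - \<alpha>)) =
      (\<Sum>(\<alpha>, \<beta>)\<in>Sigma {\<alpha>. \<alpha> \<subseteq># \<mu>} (\<lambda>\<alpha>. {\<beta>. \<beta> \<subseteq># \<alpha>}). f \<beta> * g (\<alpha> - \<beta>) * h (\<mu> - \<alpha>))"
    by (simp add: sum.Sigma finite_submultisets)
  also have "\<dots> = (\<Sum>(\<alpha>, \<beta>)\<in>Sigma {\<alpha>. \<alpha> \<subseteq># \<mu>} (\<lambda>\<alpha>. {\<beta>. \<beta> \<subseteq># \<mu> - \<alpha>}). f \<alpha> * (g \<beta> * h (\<mu> - \<alpha> - \<beta>)))"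
    by (rule sum.reindex_bij_witness[of _ "\<lambda>(\<alpha>, \<beta>). (\<alpha> + \<beta>, \<alpha>)" "\<lambda>(\<alpha>, \<beta>). (\<beta>, \<alpha> - \<beta>)"])
      (auto simp: diff subset_mset.add_diff_inverse mult.assoc,
       auto simp: subseteq_mset_def le_diff_conv2 add.commute intro: diff_le_mono order_trans)
  also have "\<dots> = (\<Sum>\<alpha> | \<alpha> \<subseteq># \<mu>. \<Sum>\<beta> | \<beta> \<subseteq># \<mu> - \<alpha>. f \<alpha> * (g \<beta> * h (\<mu> - \<alpha> - \<beta>)))"
    by (simp add: sum.Sigma finite_submultisets)
  finally show "((f \<otimes>\<^bsub>power_series_ring Y\<^esub> g) \<otimes>\<^bsub>power_series_ring Y\<^esub> h) \<mu> =
      (f \<otimes>\<^bsub>power_series_ring Y\<^esub> (g \<otimes>\<^bsub>power_series_ring Y\<^esub> h)) \<mu>"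
    by (simp add: ps_mult sum_distrib_left sum_distrib_right)
qed

lemma ps_monom_mult:
  "((\<lambda>\<mu>. c * ps_monom \<nu> \<mu>) \<otimes>\<^bsub>power_series_ring Y\<^esub> f) \<mu> = (if \<nu> \<subseteq># \<mu> then c * f (\<mu> - \<nu>) else 0)"
proof -
  have "(\<Sum>\<alpha> | \<alpha> \<subseteq># \<mu>. c * ps_monom \<nu> \<alpha> * f (\<mu> - \<alpha>)) =
      (\<Sum>\<alpha> | \<alpha> \<subseteq># \<mu>. if \<alpha> = \<nu> then c * f (\<mu> - \<nu>) else 0)"
    by (intro sum.cong) (auto simp: ps_monom_def)
  then show ?thesis
    by (simp add: ps_mult finite_submultisets sum.delta)
qed

lemma ps_one_mult: "\<one>\<^bsub>power_series_ring Y\<^esub> \<otimes>\<^bsub>power_series_ring Y\<^esub> f = f"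
  using ps_monom_mult[where c = 1 and \<nu> = "{#}" and f = f] by (auto simp: ps_one fun_eq_iff)

lemma ps_mult_closed:
  assumes "f \<in> carrier (power_series_ring Y)" "g \<in> carrier (power_series_ring Y)"
  shows "f \<otimes>\<^bsub>power_series_ring Y\<^esub> g \<in> carrier (power_series_ring Y)"
  unfolding ps_carrier ps_mult
proof (intro allI impI sum.neutral ballI)
  fix \<mu> \<alpha> assume "\<not> set_mset \<mu> \<subseteq> Y" "\<alpha> \<in> {\<alpha>. \<alpha> \<subseteq># \<mu>}"
  then have "\<not> set_mset \<alpha> \<subseteq> Y \<or> \<not> set_mset (\<mu> - \<alpha>) \<subseteq> Y"
    by (metis (no_types, lifting) Un_subset_iff mem_Collect_eq set_mset_union subset_mset.add_diff_inverse)
  then show "f \<alpha> * g (\<mu> - \<alpha>) = 0"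
    using assms by (auto simp: ps_carrier)
qed

lemma power_series_cring: "cring (power_series_ring Y)"
proof (rule cringI)
  show "abelian_group (power_series_ring Y)"
  proof (rule abelian_groupI)
    show "\<exists>g\<in>carrier (power_series_ring Y). g \<oplus>\<^bsub>power_series_ring Y\<^esub> f = \<zero>\<^bsub>power_series_ring Y\<^esub>"
      if "f \<in> carrier (power_series_ring Y)" for f
      using that by (intro bexI[of _ "\<lambda>\<mu>. - f \<mu>"]) (auto simp: ps_add ps_zero ps_carrier)
  qed (auto simp: ps_add ps_zero ps_carrier)
  show "comm_monoid (power_series_ring Y)"
  proof (rule comm_monoidI)
    show "\<one>\<^bsub>power_series_ring Y\<^esub> \<in> carrier (power_series_ring Y)"
      by (auto simp: ps_one ps_carrier ps_monom_def)
  qed (rule ps_mult_closed ps_mult_assoc ps_one_mult ps_mult_comm; assumption?)+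
  show "(f \<oplus>\<^bsub>power_series_ring Y\<^esub> g) \<otimes>\<^bsub>power_series_ring Y\<^esub> h =
      f \<otimes>\<^bsub>power_series_ring Y\<^esub> h \<oplus>\<^bsub>power_series_ring Y\<^esub> g \<otimes>\<^bsub>power_series_ring Y\<^esub> h" for f g h
    by (rule ext) (simp only: ps_mult ps_add sum.distrib distrib_right)
qed

lemma ps_finsum:
  assumes "F \<in> S \<rightarrow> carrier (power_series_ring Y)"
  shows "finsum (power_series_ring Y) F S \<mu> = (\<Sum>s\<in>S. F s \<mu>)"
proof -
  interpret cring "power_series_ring Y" by (rule power_series_cring)
  show ?thesis using assms
    by (induction S rule: infinite_finite_induct) (auto simp: ps_add ps_zero Pi_iff)
qed

definition ps_const :: "complex \<Rightarrow> 'x multiset \<Rightarrow> complex" where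
  "ps_const c = (\<lambda>\<mu>. c * ps_monom {#} \<mu>)"

lemma ps_const_mult: "ps_const c \<otimes>\<^bsub>power_series_ring Y\<^esub> f = (\<lambda>\<mu>. c * f \<mu>)"
  unfolding ps_const_def by (rule ext) (simp add: ps_monom_mult)

lemma ps_const_closed [simp]: "ps_const c \<in> carrier (power_series_ring Y)"
  by (auto simp: ps_const_def ps_monom_def ps_carrier)

lemma complex_ring_simps [simp]:
  "carrier complex_ring = UNIV" "\<zero>\<^bsub>complex_ring\<^esub> = 0" "\<one>\<^bsub>complex_ring\<^esub> = 1"
  "x \<oplus>\<^bsub>complex_ring\<^esub> y = x + y" "x \<otimes>\<^bsub>complex_ring\<^esub> y = x * y"
  by (simp_all add: ring_of_type_algebra_def)

lemma complex_cring: "cring complex_ring" by (rule cring_from_type_algebra)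

lemma ps_const_hom: "ps_const \<in> ring_hom complex_ring (power_series_ring Y)"
proof (rule ring_hom_memI)
  show "ps_const (x \<otimes>\<^bsub>complex_ring\<^esub> y) = ps_const x \<otimes>\<^bsub>power_series_ring Y\<^esub> ps_const y" for x y
    unfolding ps_const_mult by (simp add: ps_const_def mult.assoc)
qed (simp_all only: ps_const_closed, auto simp: ps_const_def ps_add ps_one distrib_right)

lemma ps_monom_closed: "set_mset \<nu> \<subseteq> Y \<Longrightarrow> ps_monom \<nu> \<in> carrier (power_series_ring Y)"
  by (auto simp: ps_monom_def ps_carrier)

subsection \<open>Exponential series\<close>

text \<open>The series \<open>exp (\<Sum>y\<in>Y. n y * y)\<close>.\<close>

definition ps_exp_linear :: "'x set \<Rightarrow> ('x \<Rightarrow> int) \<Rightarrow> 'x multiset \<Rightarrow> complex" where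
  "ps_exp_linear Y n = (\<lambda>\<mu>. if set_mset \<mu> \<subseteq> Y then
     \<Prod>y\<in>Y. of_int (n y) ^ count \<mu> y / fact (count \<mu> y) else 0)"

lemma ps_exp_linear_closed: "ps_exp_linear Y n \<in> carrier (power_series_ring Y)"
  by (simp add: ps_exp_linear_def ps_carrier)

lemma ps_exp_linear_empty: "ps_exp_linear Y n {#} = 1"
  by (simp add: ps_exp_linear_def)

lemma ps_exp_linear_0: "finite Y \<Longrightarrow> ps_exp_linear Y (\<lambda>_. 0) = \<one>\<^bsub>power_series_ring Y\<^esub>"
proof
  fix \<mu> assume Y: "finite Y"
  show "ps_exp_linear Y (\<lambda>_. 0) \<mu> = \<one>\<^bsub>power_series_ring Y\<^esub> \<mu>"
  proof (cases "\<mu> = {#}")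
    case False
    then obtain y where "y \<in># \<mu>" by auto
    then have "set_mset \<mu> \<subseteq> Y \<Longrightarrow> \<exists>y\<in>Y. (0::complex) ^ count \<mu> y / fact (count \<mu> y) = 0"
      by (intro bexI[of _ y]) auto
    with False Y show ?thesis by (auto simp: ps_exp_linear_def ps_one ps_monom_def)
  qed (simp add: ps_exp_linear_empty ps_one ps_monom_def)
qed

lemma ps_scaled_monom_power:
  "((\<lambda>\<mu>. c * ps_monom {#y#} \<mu>) [^]\<^bsub>power_series_ring Y\<^esub> k) = (\<lambda>\<mu>. c ^ k * ps_monom (replicate_mset k y) \<mu>)"
  (is "?f [^]\<^bsub>?P\<^esub> k = _")
proof (induction k)
  case 0
  then show ?case by (simp add: ps_one)
next
  case (Suc k)
  have "?f [^]\<^bsub>?P\<^esub> Suc k = ?f \<otimes>\<^bsub>?P\<^esub> (?f [^]\<^bsub>?P\<^esub> k)"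
    by (simp add: ps_mult_comm)
  also have "\<dots> = (\<lambda>\<mu>. c ^ Suc k * ps_monom (replicate_mset (Suc k) y) \<mu>)"
    unfolding Suc by (rule ext) (simp add: ps_monom_mult, auto simp: ps_monom_def elim!: mset_add)
  finally show ?case .
qed

lemma ps_exp_scaled_monom:
  "ps_exp Y (\<lambda>\<mu>. c * ps_monom {#y#} \<mu>) \<mu> =
    (if \<mu> = replicate_mset (size \<mu>) y then c ^ size \<mu> / fact (size \<mu>) else 0)"
proof -
  have "ps_exp Y (\<lambda>\<mu>. c * ps_monom {#y#} \<mu>) \<mu> =
      (\<Sum>k\<le>size \<mu>. if k = size \<mu> then (if \<mu> = replicate_mset (size \<mu>) y then c ^ size \<mu> / fact (size \<mu>) else 0) else 0)"
    unfolding ps_exp_def ps_scaled_monom_power by (intro sum.cong) (auto simp: ps_monom_def)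
  then show ?thesis by (simp add: sum.delta)
qed

text \<open>The functional equation of the exponential. One variable in the left factor suffices,
  because each \<open>\<tau>\<^sub>i\<^sub>j\<^sub>k\<close> is a single independent variable up to
  sign; the coefficients then reduce to the binomial theorem in that variable.\<close>

lemma ps_exp_scaled_monom_mult:
  assumes Y: "finite Y" "y \<in> Y"
  shows "ps_exp Y (\<lambda>\<mu>. of_int c * ps_monom {#y#} \<mu>) \<otimes>\<^bsub>power_series_ring Y\<^esub> ps_exp_linear Y n =
    ps_exp_linear Y (n(y := n y + c))" (is "?e \<otimes>\<^bsub>_\<^esub> _ = _")
proof
  fix \<mu>
  show "(?e \<otimes>\<^bsub>power_series_ring Y\<^esub> ps_exp_linear Y n) \<mu> = ps_exp_linear Y (n(y := n y + c)) \<mu>"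
  proof (cases "set_mset \<mu> \<subseteq> Y")
    case False
    have "?e \<in> carrier (power_series_ring Y)"
      unfolding ps_carrier ps_exp_scaled_monom using Y(2)
      by (metis in_replicate_mset subsetI)
    then show ?thesis
      using ps_mult_closed[OF _ ps_exp_linear_closed, of ?e Y n] False by (simp add: ps_carrier ps_exp_linear_def)
  next
    case True
    let ?N = "count \<mu> y"
    let ?rest = "\<Prod>z\<in>Y - {y}. of_int (n z) ^ count \<mu> z / fact (count \<mu> z) :: complex"
    have split: "ps_exp_linear Y k \<nu> =
        of_int (k y) ^ count \<nu> y / fact (count \<nu> y) * (\<Prod>z\<in>Y - {y}. of_int (k z) ^ count \<nu> z / fact (count \<nu> z))"
      if "set_mset \<nu> \<subseteq> Y" for k \<nu>
      using that Y by (simp add: ps_exp_linear_def prod.remove)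
    have sub: "replicate_mset k y \<subseteq># \<mu> \<longleftrightarrow> k \<le> ?N" for k
      by (simp add: count_le_replicate_mset_subset_eq)
    have lin: "ps_exp_linear Y n (\<mu> - replicate_mset k y) = of_int (n y) ^ (?N - k) / fact (?N - k) * ?rest" for k
      using True by (subst split) (auto dest: in_diffD)
    \<comment> \<open>Only powers of \<open>y\<close> occur in the left factor, so the sum over
      submultisets becomes a sum over exponents up to the multiplicity of \<open>y\<close>.\<close>
    have img: "{\<alpha>. \<alpha> \<subseteq># \<mu> \<and> \<alpha> = replicate_mset (size \<alpha>) y} = (\<lambda>k. replicate_mset k y) ` {..?N}"
    proof
      show "{\<alpha>. \<alpha> \<subseteq># \<mu> \<and> \<alpha> = replicate_mset (size \<alpha>) y} \<subseteq> (\<lambda>k. replicate_mset k y) ` {..?N}"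
      proof
        fix \<alpha> assume "\<alpha> \<in> {\<alpha>. \<alpha> \<subseteq># \<mu> \<and> \<alpha> = replicate_mset (size \<alpha>) y}"
        then have "\<alpha> = replicate_mset (size \<alpha>) y" "size \<alpha> \<in> {..?N}"
          using sub[of "size \<alpha>"] by simp_all
        then show "\<alpha> \<in> (\<lambda>k. replicate_mset k y) ` {..?N}" by (rule image_eqI)
      qed
    qed (use sub in auto)
    have inj: "inj_on (\<lambda>k. replicate_mset k y) {..?N}"
      by (rule inj_on_inverseI[of _ size]) simp
    have "(?e \<otimes>\<^bsub>power_series_ring Y\<^esub> ps_exp_linear Y n) \<mu> =
        (\<Sum>\<alpha> | \<alpha> \<subseteq># \<mu> \<and> \<alpha> = replicate_mset (size \<alpha>) y. of_int c ^ size \<alpha> / fact (size \<alpha>) * ps_exp_linear Y n (\<mu> - \<alpha>))"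
      unfolding ps_mult ps_exp_scaled_monom
      by (rule sum.mono_neutral_cong_right) (auto simp: finite_submultisets)
    also have "\<dots> = (\<Sum>k\<le>?N. of_int c ^ k / fact k * (of_int (n y) ^ (?N - k) / fact (?N - k) * ?rest))"
      unfolding img by (subst sum.reindex[OF inj]) (simp add: lin mult_ac)
    also have "\<dots> = (\<Sum>k\<le>?N. of_nat (?N choose k) * of_int c ^ k * of_int (n y) ^ (?N - k)) / fact ?N * ?rest"
      unfolding sum_divide_distrib sum_distrib_right
      by (intro sum.cong) (auto simp: binomial_fact mult_ac)
    also have "\<dots> = of_int (n y + c) ^ ?N / fact ?N * ?rest"
      using binomial_ring[of "of_int c :: complex" "of_int (n y)" ?N] by (simp add: add.commute)
    also have "\<dots> = ps_exp_linear Y (n(y := n y + c)) \<mu>"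
      using True by (subst split) auto
    finally show ?thesis .
  qed
qed

text \<open>Independence of evaluations at distinct points, in the style of Dedekind's lemma. If the
  coordinate \<open>y\<close> separates \<open>n\<close> from \<open>n0\<close>, the relation for
  \<open>y\<close> times a monomial minus \<open>n0 y\<close> times the relation for the monomial
  eliminates \<open>n0\<close> and keeps a nonzero multiple of the coefficient of
  \<open>n\<close>.\<close>

lemma exponents_separated:
  fixes c :: "('x \<Rightarrow> int) \<Rightarrow> complex"
  assumes "finite S" "\<And>n n'. n \<in> S \<Longrightarrow> n' \<in> S \<Longrightarrow> n \<noteq> n' \<Longrightarrow> \<exists>y\<in>Y. n y \<noteq> n' y"
    and "\<And>\<mu>. set_mset \<mu> \<subseteq> Y \<Longrightarrow> (\<Sum>n\<in>S. c n * (\<Prod>y\<in>#\<mu>. of_int (n y))) = 0"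
  shows "\<forall>n\<in>S. c n = 0"
  using assms
proof (induction S arbitrary: c rule: finite_induct)
  case (insert n0 S)
  have zero: "c n = 0" if n: "n \<in> S" for n
  proof -
    have "n \<noteq> n0" using insert.hyps n by auto
    then obtain y where y: "y \<in> Y" "n y \<noteq> n0 y" using insert.prems(1)[of n n0] n by auto
    let ?c = "\<lambda>k. c k * (of_int (k y) - of_int (n0 y))"
    have "(\<Sum>k\<in>S. ?c k * (\<Prod>y\<in>#\<mu>. of_int (k y))) = 0" if \<mu>: "set_mset \<mu> \<subseteq> Y" for \<mu>
    proof -
      have "(\<Sum>k\<in>insert n0 S. ?c k * (\<Prod>y\<in>#\<mu>. of_int (k y))) =
        (\<Sum>k\<in>insert n0 S. c k * (\<Prod>y\<in>#add_mset y \<mu>. of_int (k y))) -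
        of_int (n0 y) * (\<Sum>k\<in>insert n0 S. c k * (\<Prod>y\<in>#\<mu>. of_int (k y)))"
        by (simp add: sum_distrib_left sum_subtractf algebra_simps del: sum.insert)
      also have "\<dots> = 0"
        using insert.prems(2)[of \<mu>] insert.prems(2)[of "add_mset y \<mu>"] \<mu> y(1) by simp
      finally show ?thesis using insert.hyps by simp
    qed
    then have "\<forall>k\<in>S. ?c k = 0"
      using insert.prems(1) by (intro insert.IH) auto
    with n y show ?thesis by auto
  qed
  moreover have "c n0 = 0"
    using insert.prems(2)[of "{#}"] insert.hyps zero by simp
  ultimately show ?case by simp
qed simp

text \<open>Up to factorials, the coefficient at \<open>\<mu>\<close> of the exponential with
  exponents \<open>n\<close> is the monomial \<open>\<mu>\<close> evaluated at the point
  \<open>n\<close>. Independence of exponentials is thereby separation of points by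
  monomials.\<close>

lemma ps_exp_linear_independent:
  assumes Y: "finite Y" and S: "finite S" "\<And>n n'. n \<in> S \<Longrightarrow> n' \<in> S \<Longrightarrow> n \<noteq> n' \<Longrightarrow> \<exists>y\<in>Y. n y \<noteq> n' y"
    and zero: "\<And>\<mu>. (\<Sum>n\<in>S. c n * ps_exp_linear Y n \<mu>) = 0" and n: "n \<in> S"
  shows "c n = 0"
proof -
  have "(\<Sum>n\<in>S. c n * (\<Prod>y\<in>#\<mu>. of_int (n y))) = 0" if \<mu>: "set_mset \<mu> \<subseteq> Y" for \<mu>
  proof -
    have "(\<Prod>y\<in>#\<mu>. of_int (n y)) = (\<Prod>y\<in>Y. fact (count \<mu> y)) * ps_exp_linear Y n \<mu>" for n
    proof -
      have "(\<Prod>y\<in>#\<mu>. of_int (n y)) = (\<Prod>y\<in>set_mset \<mu>. of_int (n y) ^ count \<mu> y :: complex)"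
        by (rule image_prod_mset_multiplicity)
      also have "\<dots> = (\<Prod>y\<in>Y. of_int (n y) ^ count \<mu> y)"
        using \<mu> Y by (intro prod.mono_neutral_left) (auto simp: not_in_iff)
      also have "\<dots> = (\<Prod>y\<in>Y. fact (count \<mu> y)) * ps_exp_linear Y n \<mu>"
        using \<mu> by (simp add: ps_exp_linear_def flip: prod.distrib)
      finally show ?thesis .
    qed
    then have "(\<Sum>n\<in>S. c n * (\<Prod>y\<in>#\<mu>. of_int (n y))) =
        (\<Prod>y\<in>Y. fact (count \<mu> y)) * (\<Sum>n\<in>S. c n * ps_exp_linear Y n \<mu>)"
      by (simp add: sum_distrib_left mult_ac)
    then show ?thesis using zero by simp
  qed
  then show ?thesis using exponents_separated[OF S, of c] n by blast
qed

section \<open>The ring \<open>R\<close> and its embedding into the power series\<close>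

lemma (in presentation) const_central:
  assumes "cring K" "c \<in> carrier K" "x \<in> carrier PA"
  shows "cls (fa_const K c) \<otimes>\<^bsub>PA\<^esub> x = x \<otimes>\<^bsub>PA\<^esub> cls (fa_const K c)"
  using assms(3)
proof (induction x rule: PA_induct)
  case (const d)
  have "c \<otimes> d = d \<otimes> c" using assms(1,2) const by (metis cring.cring_simprules(14))
  with assms(2) const show ?case by (simp flip: ring_hom_mult[OF const_hom])
next
  case (gen y)
  have "fa_const K c \<otimes>\<^bsub>FA\<^esub> fa_gen K y = fa_gen K y \<otimes>\<^bsub>FA\<^esub> fa_const K c"
    using assms(2) by (simp add: fa_const_eq_single fa_gen_eq_single fa_single_mult)
  then show ?case using assms(2) gen by (simp flip: cls_mult)
next
  case (add x y)
  with assms(2) show ?case by (simp add: PA.l_distr PA.r_distr)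
next
  case (mult x y)
  have [simp]: "cls (fa_const K c) \<in> carrier PA" using assms(2) by auto
  have "cls (fa_const K c) \<otimes>\<^bsub>PA\<^esub> (x \<otimes>\<^bsub>PA\<^esub> y) = (x \<otimes>\<^bsub>PA\<^esub> cls (fa_const K c)) \<otimes>\<^bsub>PA\<^esub> y"
    using mult by (simp flip: PA.m_assoc)
  also have "\<dots> = x \<otimes>\<^bsub>PA\<^esub> y \<otimes>\<^bsub>PA\<^esub> cls (fa_const K c)"
    using mult by (simp add: PA.m_assoc)
  finally show ?case .
qed

lemma (in presentation) PA_cring:
  assumes "cring K"
    and gens: "\<And>x y. x \<in> Y \<Longrightarrow> y \<in> Y \<Longrightarrow> cls (fa_gen K x) \<otimes>\<^bsub>PA\<^esub> cls (fa_gen K y) = cls (fa_gen K y) \<otimes>\<^bsub>PA\<^esub> cls (fa_gen K x)"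
  shows "cring PA"
proof -
  have step: "x \<otimes>\<^bsub>PA\<^esub> z = z \<otimes>\<^bsub>PA\<^esub> x"
    if x: "x \<in> carrier PA" and z: "z \<in> carrier PA"
      and zg: "\<And>y. y \<in> Y \<Longrightarrow> cls (fa_gen K y) \<otimes>\<^bsub>PA\<^esub> z = z \<otimes>\<^bsub>PA\<^esub> cls (fa_gen K y)" for x z
    using x
  proof (induction x rule: PA_induct)
    case (const c)
    then show ?case using const_central[OF assms(1)] z by simp
  next
    case (add x y)
    with z show ?case by (simp add: PA.l_distr PA.r_distr)
  next
    case (mult x y)
    have "x \<otimes>\<^bsub>PA\<^esub> y \<otimes>\<^bsub>PA\<^esub> z = x \<otimes>\<^bsub>PA\<^esub> z \<otimes>\<^bsub>PA\<^esub> y"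
      using mult(1,2,4) z by (simp add: PA.m_assoc)
    also have "\<dots> = z \<otimes>\<^bsub>PA\<^esub> (x \<otimes>\<^bsub>PA\<^esub> y)"
      using mult(1,2,3) z by (simp flip: PA.m_assoc)
    finally show ?case .
  qed (rule zg)
  have "x \<otimes>\<^bsub>PA\<^esub> y = y \<otimes>\<^bsub>PA\<^esub> x" if "x \<in> carrier PA" "y \<in> carrier PA" for x y
    using that step[of x y] step[of y "cls (fa_gen K _)"] gens by (metis cls_closed gen_closed)
  then show ?thesis
    by (intro cring.intro comm_monoid.intro comm_monoid_axioms.intro)
      (auto simp: PA.ring_axioms PA.monoid_axioms)
qed

section \<open>Indices of the parameters, and \<open>R\<close> as a commutative ring\<close>

context coxeter
begin

text \<open>The index of the inverse generator. This involution has no fixed points since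
  \<open>i \<noteq> j\<close>, even when \<open>k = 0\<close>; hence the parameters fall into
  pairs.\<close>

definition t_star :: "'i \<times> 'i \<times> int \<Rightarrow> 'i \<times> 'i \<times> int" where
  "t_star = (\<lambda>(i, j, k). t_label m j i (- k))"

lemma t_label_index:
  assumes "i \<in> I" "j \<in> I" "i \<noteq> j" "m i j = enat n"
  shows "t_label m i j k = (i, j, k mod int n)" "t_label m i j k \<in> t_index I m" "n > 0"
proof -
  show "n > 0" using m_ge_2[OF assms(1-3)] assms(4) by (cases n) (auto simp: zero_enat_def[symmetric])
  then show "t_label m i j k = (i, j, k mod int n)" "t_label m i j k \<in> t_index I m"
    using assms by (auto simp: t_label_def t_index_def)
qed

lemma t_indexE:
  assumes "a \<in> t_index I m"
  obtains i j n k where "a = (i, j, k)" "i \<in> I" "j \<in> I" "i \<noteq> j" "m i j = enat n" "m j i = enat n" "0 \<le> k" "k < int n"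
proof -
  obtain i j k where a: "a = (i, j, k)" by (cases a) auto
  with assms obtain n where "m i j = enat n" by (cases "m i j") (auto simp: t_index_def)
  with assms a that m_sym show thesis by (auto simp: t_index_def)
qed

lemma t_index_label: "(i, j, k) \<in> t_index I m \<Longrightarrow> t_label m i j k = (i, j, k)"
  by (auto simp: t_index_def t_label_def)

lemma t_star_closed [simp]: "a \<in> t_index I m \<Longrightarrow> t_star a \<in> t_index I m"
  by (erule t_indexE) (auto simp: t_star_def intro!: t_label_index(2))

lemma t_star_star [simp]: "a \<in> t_index I m \<Longrightarrow> t_star (t_star a) = a"
  by (erule t_indexE) (auto simp: t_star_def t_label_def mod_minus_eq)

lemma finite_t_index: "finite (t_index I m)"
proof (rule finite_subset)
  show "t_index I m \<subseteq> (\<Union>(i, j)\<in>I \<times> I. {i} \<times> {j} \<times> {0..<int (the_enat (m i j))})"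
    by (auto simp: t_index_def)
qed (use finite_I in auto)

text \<open>The choice behind \<open>tau_vars\<close> has the intended properties once one
  admissible set exists. An injection \<open>e\<close> of \<open>I\<close> into the naturals
  provides it: from each pair keep the index whose first letter has the smaller value.\<close>

lemma tau_vars: "tau_vars I m \<subseteq> t_index I m" "a \<in> t_index I m \<Longrightarrow> a \<in> tau_vars I m \<longleftrightarrow> t_star a \<notin> tau_vars I m"
proof -
  obtain e :: "'i \<Rightarrow> nat" where e: "inj_on e I"
    using finite_imp_inj_to_nat_seg[OF finite_I] by auto
  let ?P = "\<lambda>Y. Y \<subseteq> t_index I m \<and> (\<forall>a\<in>t_index I m. a \<in> Y \<longleftrightarrow> t_star a \<notin> Y)"
  let ?Y = "{a \<in> t_index I m. e (fst a) < e (fst (snd a))}"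
  have "a \<in> ?Y \<longleftrightarrow> t_star a \<notin> ?Y" if a: "a \<in> t_index I m" for a
  proof -
    obtain i j k where ijk: "a = (i, j, k)" "i \<in> I" "j \<in> I" "i \<noteq> j" using a by (rule t_indexE)
    then have "e i \<noteq> e j" using e by (auto dest: inj_onD)
    moreover have "fst (t_star a) = j" "fst (snd (t_star a)) = i" using ijk by (simp_all add: t_star_def t_label_def)
    ultimately show ?thesis using a ijk(1) by auto
  qed
  then have "?P ?Y" by blast
  then have "?P (SOME Y. ?P Y)" by (rule someI)
  moreover have "tau_vars I m = (SOME Y. ?P Y)"
    unfolding tau_vars_def t_star_def case_prod_unfold by simp
  ultimately have "?P (tau_vars I m)" by metis
  then show "tau_vars I m \<subseteq> t_index I m" "a \<in> t_index I m \<Longrightarrow> a \<in> tau_vars I m \<longleftrightarrow> t_star a \<notin> tau_vars I m"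
    by blast+
qed

lemma finite_tau_vars: "finite (tau_vars I m)"
  using finite_subset[OF tau_vars(1) finite_t_index] .

lemma t_elt_index: "(i, j, k) \<in> t_index I m \<Longrightarrow> t_elt m i j k = fa_gen complex_ring (Tgen (i, j, k))"
  by (simp add: t_elt_def t_index_label)

lemma t_elt_star: "t_elt m j i (- k) = fa_gen complex_ring (Tgen (t_star (i, j, k)))"
  by (simp add: t_elt_def t_star_def)

sublocale C: cring complex_ring by (rule complex_cring)

lemma R_rels_cases:
  assumes "(l, r) \<in> R_rels I m"
  defines "F \<equiv> free_algebra complex_ring (R_gens I m)"
  obtains a where "a \<in> t_index I m"
      "l = fa_gen complex_ring (Tgen a) \<otimes>\<^bsub>F\<^esub> fa_gen complex_ring (Tgen (t_star a))" "r = \<one>\<^bsub>F\<^esub>"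
  | a b where "a \<in> t_index I m" "b \<in> t_index I m"
      "l = fa_gen complex_ring (Tgen a) \<otimes>\<^bsub>F\<^esub> fa_gen complex_ring (Tgen b)"
      "r = fa_gen complex_ring (Tgen b) \<otimes>\<^bsub>F\<^esub> fa_gen complex_ring (Tgen a)"
  using assms(1) unfolding R_rels_def Let_def F_def[symmetric]
  by (auto simp: t_elt_index t_elt_star)

lemma R_rels_intro:
  assumes "a \<in> t_index I m"
  defines "F \<equiv> free_algebra complex_ring (R_gens I m)"
  shows "(fa_gen complex_ring (Tgen a) \<otimes>\<^bsub>F\<^esub> fa_gen complex_ring (Tgen (t_star a)), \<one>\<^bsub>F\<^esub>) \<in> R_rels I m"
    and "b \<in> t_index I m \<Longrightarrow> (fa_gen complex_ring (Tgen a) \<otimes>\<^bsub>F\<^esub> fa_gen complex_ring (Tgen b),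
      fa_gen complex_ring (Tgen b) \<otimes>\<^bsub>F\<^esub> fa_gen complex_ring (Tgen a)) \<in> R_rels I m"
proof -
  obtain i j k where a: "a = (i, j, k)" by (cases a) auto
  show "(fa_gen complex_ring (Tgen a) \<otimes>\<^bsub>F\<^esub> fa_gen complex_ring (Tgen (t_star a)), \<one>\<^bsub>F\<^esub>) \<in> R_rels I m"
    unfolding R_rels_def Let_def F_def[symmetric] using assms(1)
    by (intro UnI1 CollectI exI[of _ i] exI[of _ j] exI[of _ k]) (simp add: a t_elt_index t_elt_star)
  assume b: "b \<in> t_index I m"
  obtain i' j' k' where b': "b = (i', j', k')" by (cases b) auto
  show "(fa_gen complex_ring (Tgen a) \<otimes>\<^bsub>F\<^esub> fa_gen complex_ring (Tgen b),
      fa_gen complex_ring (Tgen b) \<otimes>\<^bsub>F\<^esub> fa_gen complex_ring (Tgen a)) \<in> R_rels I m"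
    unfolding R_rels_def Let_def F_def[symmetric] using assms(1) b
    by (intro UnI2 CollectI exI[of _ i] exI[of _ j] exI[of _ k] exI[of _ i'] exI[of _ j'] exI[of _ k'])
      (simp add: a b' t_elt_index)
qed

lemma Tgen_in_R_gens [simp]: "Tgen a \<in> R_gens I m \<longleftrightarrow> a \<in> t_index I m"
  by (auto simp: R_gens_def)

sublocale Rp: presentation complex_ring "R_gens I m" "R_rels I m"
proof unfold_locales
  interpret F: ring "free_algebra complex_ring (R_gens I m)"
    by (rule C.free_algebra_ring)
  have gen: "fa_gen complex_ring (Tgen a) \<in> carrier (free_algebra complex_ring (R_gens I m))" if "a \<in> t_index I m" for a
    using that unfolding fa_gen_eq_single by (intro C.fa_single_closed) auto
  show "l \<in> carrier (free_algebra complex_ring (R_gens I m)) \<and> r \<in> carrier (free_algebra complex_ring (R_gens I m))"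
    if "(l, r) \<in> R_rels I m" for l r
    using that by (cases rule: R_rels_cases) (auto intro!: F.m_closed gen)
qed

lemma R_ring: "R_ring I m = Rp.PA"
  by (simp add: R_ring_def)

abbreviation "t_R a \<equiv> Rp.cls (fa_gen complex_ring (Tgen a))"

lemma t_R_closed [simp]: "a \<in> t_index I m \<Longrightarrow> t_R a \<in> carrier (R_ring I m)"
  unfolding R_ring by (intro Rp.cls_closed Rp.gen_closed) simp

lemma t_R_star: "a \<in> t_index I m \<Longrightarrow> t_R a \<otimes>\<^bsub>R_ring I m\<^esub> t_R (t_star a) = \<one>\<^bsub>R_ring I m\<^esub>"
  unfolding R_ring using Rp.cls_rel[OF R_rels_intro(1)]
  by (simp add: Rp.cls_one flip: Rp.cls_mult)

sublocale R: cring "R_ring I m"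
  unfolding R_ring
proof (rule Rp.PA_cring)
  fix x y assume "x \<in> R_gens I m" "y \<in> R_gens I m"
  then obtain a b where "a \<in> t_index I m" "b \<in> t_index I m" "x = Tgen a" "y = Tgen b"
    by (auto simp: R_gens_def)
  then show "Rp.cls (fa_gen complex_ring x) \<otimes>\<^bsub>Rp.PA\<^esub> Rp.cls (fa_gen complex_ring y) =
      Rp.cls (fa_gen complex_ring y) \<otimes>\<^bsub>Rp.PA\<^esub> Rp.cls (fa_gen complex_ring x)"
    using Rp.cls_rel[OF R_rels_intro(2)] by (simp flip: Rp.cls_mult)
qed (rule complex_cring)

subsection \<open>The series \<open>t\<^sub>i\<^sub>j\<^sub>k\<close>\<close>

abbreviation "Yt \<equiv> tau_vars I m"

sublocale Rhat: cring "Rhat I m"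
  unfolding Rhat_def by (rule power_series_cring)

text \<open>With \<open>t_sgn\<close>, this writes each \<tau> as a signed independent variable, so
  that the same formulas hold for both members of a pair.\<close>

definition t_var :: "'i \<times> 'i \<times> int \<Rightarrow> 'i \<times> 'i \<times> int" where
  "t_var a = (if a \<in> Yt then a else t_star a)"

definition t_sgn :: "'i \<times> 'i \<times> int \<Rightarrow> int" where
  "t_sgn a = (if a \<in> Yt then 1 else - 1)"

definition t_root :: "'i \<times> 'i \<times> int \<Rightarrow> complex" where
  "t_root = (\<lambda>(i, j, k). exp (2 * of_real pi * \<i> * of_int k / of_nat (the_enat (m i j))))"

definition t_series :: "'i \<times> 'i \<times> int \<Rightarrow> ('i \<times> 'i \<times> int) multiset \<Rightarrow> complex" where
  "t_series a = (\<lambda>\<mu>. t_root a * ps_exp Yt (\<lambda>\<mu>. of_int (t_sgn a) * ps_monom {#t_var a#} \<mu>) \<mu>)"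

lemma exp_root_mod:
  assumes "n > 0"
  shows "exp (2 * of_real pi * \<i> * of_int (k mod int n) / of_nat n) = exp (2 * of_real pi * \<i> * of_int k / of_nat n)"
proof -
  have "of_int k = (of_int (k mod int n) + of_nat n * of_int (k div int n) :: complex)"
    by (metis add.commute mod_mult_div_eq of_int_add of_int_mult of_int_of_nat_eq)
  then have "2 * of_real pi * \<i> * of_int k / of_nat n =
      2 * of_real pi * \<i> * of_int (k mod int n) / of_nat n + of_int (k div int n) * (2 * of_real pi * \<i> :: complex)"
    using assms by (simp add: field_simps)
  then show ?thesis
    by (simp only: exp_add exp_power_int[symmetric] exp_two_pi_i) simp
qed

text \<open>\<open>t_hat\<close> accepts every integer \<open>k\<close>, while generators carry
  residues. Both agree because the root of unity depends on \<open>k\<close> only modulo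
  \<open>n\<close> and \<open>tau\<close> is defined through labels.\<close>

lemma t_hat_eq_series:
  assumes "i \<in> I" "j \<in> I" "i \<noteq> j" "m i j = enat n"
  shows "t_hat I m i j k = t_series (t_label m i j k)"
proof -
  have "t_label m j i (- k) = t_star (t_label m i j k)"
    using assms m_sym[of i j] by (simp add: t_star_def t_label_def mod_minus_eq)
  then have "tau I m i j k = (\<lambda>\<mu>. of_int (t_sgn (t_label m i j k)) * ps_monom {#t_var (t_label m i j k)#} \<mu>)"
    by (auto simp: tau_def t_sgn_def t_var_def)
  moreover have "t_root (t_label m i j k) = exp (2 * of_real pi * \<i> * of_int k / of_nat n)"
    using exp_root_mod[of n k] t_label_index(1)[OF assms, of k] t_label_index(3)[OF assms] assms(4) by (simp add: t_root_def)
  ultimately show ?thesis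
    unfolding t_hat_def t_series_def using assms(4) by simp
qed

lemma t_var_closed: "a \<in> t_index I m \<Longrightarrow> t_var a \<in> Yt"
  using tau_vars(2)[of a] by (auto simp: t_var_def)

text \<open>Constant multiples of exponentials of linear forms are stable under multiplication by
  each \<open>t_series a\<close>. A word in the generators is therefore evaluated by updating one
  exponent and one constant per letter.\<close>

lemma t_series_mult:
  assumes "a \<in> t_index I m"
  shows "t_series a \<otimes>\<^bsub>Rhat I m\<^esub> (\<lambda>\<mu>. c * ps_exp_linear Yt n \<mu>) =
    (\<lambda>\<mu>. t_root a * c * ps_exp_linear Yt (n(t_var a := n (t_var a) + t_sgn a)) \<mu>)"
proof -
  have scale: "(\<lambda>\<mu>. d * f \<mu>) \<otimes>\<^bsub>power_series_ring Y\<^esub> (\<lambda>\<mu>. c * g \<mu>) = (\<lambda>\<mu>. d * c * (f \<otimes>\<^bsub>power_series_ring Y\<^esub> g) \<mu>)"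
    for d c f g and Y :: "('i \<times> 'i \<times> int) set"
    by (rule ext) (simp add: ps_mult sum_distrib_left mult_ac)
  show ?thesis
    unfolding t_series_def Rhat_def scale
    by (simp add: ps_exp_scaled_monom_mult[OF finite_tau_vars t_var_closed[OF assms]])
qed

lemma t_series_eq: "a \<in> t_index I m \<Longrightarrow>
    t_series a = (\<lambda>\<mu>. t_root a * ps_exp_linear Yt ((\<lambda>_. 0)(t_var a := t_sgn a)) \<mu>)"
  using t_series_mult[of a 1 "\<lambda>_. 0"] ps_exp_linear_0[OF finite_tau_vars]
    ps_mult_comm[where f = "t_series a" and Y = Yt and g = "\<one>\<^bsub>power_series_ring Yt\<^esub>"]
    ps_one_mult[where Y = Yt and f = "t_series a"]
  by (simp add: Rhat_def)

lemma t_series_closed: "a \<in> t_index I m \<Longrightarrow> t_series a \<in> carrier (Rhat I m)"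
  unfolding t_series_eq Rhat_def using ps_exp_linear_closed[of Yt] by (simp add: ps_carrier)

lemma t_var_star: "a \<in> t_index I m \<Longrightarrow> t_var (t_star a) = t_var a" "a \<in> t_index I m \<Longrightarrow> t_sgn (t_star a) = - t_sgn a"
  using tau_vars(2)[of a] by (auto simp: t_var_def t_sgn_def)

lemma t_root_nonzero: "t_root a \<noteq> 0"
  by (auto simp: t_root_def split: prod.split)

lemma t_root_star:
  assumes "a \<in> t_index I m"
  shows "t_root a * t_root (t_star a) = 1"
  using assms
proof (cases rule: t_indexE)
  case (1 i j n k)
  have "t_root (t_star a) = exp (2 * of_real pi * \<i> * of_int (-k) / of_nat n)"
    using exp_root_mod[of n "-k"] t_label_index(1)[of j i n "-k"] t_label_index(3)[of j i n] 1 by (simp add: t_star_def t_root_def)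
  then show ?thesis using 1 by (simp add: t_root_def flip: exp_add)
qed

lemma t_series_star:
  assumes "a \<in> t_index I m"
  shows "t_series a \<otimes>\<^bsub>Rhat I m\<^esub> t_series (t_star a) = \<one>\<^bsub>Rhat I m\<^esub>"
proof -
  have [simp]: "(\<lambda>_. 0 :: int)(y := 0) = (\<lambda>_. 0)" for y :: "'i \<times> 'i \<times> int" by auto
  have "t_series a \<otimes>\<^bsub>Rhat I m\<^esub> t_series (t_star a) = ps_exp_linear Yt (\<lambda>_. 0)"
    using assms
    by (subst t_series_eq[of "t_star a"]) (simp_all add: t_series_mult t_var_star t_root_star)
  then show ?thesis by (simp add: ps_exp_linear_0[OF finite_tau_vars] Rhat_def)
qed

fun gen_series :: "'i agen \<Rightarrow> ('i \<times> 'i \<times> int) multiset \<Rightarrow> complex" where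
  "gen_series (Tgen a) = t_series a"
| "gen_series (Sgen i) = (\<lambda>_. 0)"

sublocale Rev: fa_evaluation complex_ring "Rhat I m" "R_gens I m" ps_const gen_series
proof
  show "ps_const \<in> ring_hom complex_ring (Rhat I m)" unfolding Rhat_def by (rule ps_const_hom)
  show g: "gen_series x \<in> carrier (Rhat I m)" if "x \<in> R_gens I m" for x
    using that by (auto simp: R_gens_def t_series_closed)
  show "ps_const c \<otimes>\<^bsub>Rhat I m\<^esub> gen_series x = gen_series x \<otimes>\<^bsub>Rhat I m\<^esub> ps_const c" for c x
    unfolding Rhat_def by (rule ps_mult_comm)
qed

lemma Rev_rel: "(l, r) \<in> R_rels I m \<Longrightarrow> Rev.ev l = Rev.ev r"
proof (erule R_rels_cases)
  fix a assume "a \<in> t_index I m" "l = fa_gen complex_ring (Tgen a) \<otimes>\<^bsub>Rp.FA\<^esub> fa_gen complex_ring (Tgen (t_star a))" "r = \<one>\<^bsub>Rp.FA\<^esub>"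
  then show ?thesis
    using ring_hom_one[OF Rev.ev_hom] by (simp add: Rev.ev_mult Rev.ev_gen t_series_star)
next
  fix a b assume "a \<in> t_index I m" "b \<in> t_index I m"
    "l = fa_gen complex_ring (Tgen a) \<otimes>\<^bsub>Rp.FA\<^esub> fa_gen complex_ring (Tgen b)"
    "r = fa_gen complex_ring (Tgen b) \<otimes>\<^bsub>Rp.FA\<^esub> fa_gen complex_ring (Tgen a)"
  then show ?thesis
    by (simp add: Rev.ev_mult Rev.ev_gen t_series_closed Rhat.m_comm)
qed

text \<open>The exponent vector of the Laurent monomial that a word represents in the independent
  variables. Together with \<open>word_root\<close>, the value at \<tau> = 0, it determines the
  series of the word.\<close>

fun exponents :: "'i agen list \<Rightarrow> 'i \<times> 'i \<times> int \<Rightarrow> int" where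
  "exponents [] = (\<lambda>_. 0)"
| "exponents (Tgen a # u) = (exponents u)(t_var a := exponents u (t_var a) + t_sgn a)"
| "exponents (Sgen i # u) = exponents u"

fun word_root :: "'i agen list \<Rightarrow> complex" where
  "word_root [] = 1"
| "word_root (Tgen a # u) = t_root a * word_root u"
| "word_root (Sgen i # u) = word_root u"

lemma word_root_nonzero: "word_root u \<noteq> 0"
  by (induction u rule: word_root.induct) (auto simp: t_root_nonzero)

lemma series_word:
  "u \<in> lists (R_gens I m) \<Longrightarrow>
    list_prod (Rhat I m) (map gen_series u) = (\<lambda>\<mu>. word_root u * ps_exp_linear Yt (exponents u) \<mu>)"
proof (induction u)
  case Nil
  show ?case by (simp add: ps_exp_linear_0[OF finite_tau_vars] Rhat_def)
next
  case (Cons x u)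
  then obtain a where "x = Tgen a" "a \<in> t_index I m" by (auto simp: R_gens_def)
  with Cons show ?case by (simp add: t_series_mult mult.assoc fun_upd_def)
qed

section \<open>Laurent monomials in \<open>R\<close> and the injectivity of the embedding\<close>

abbreviation "R_monom u \<equiv> Rp.cls (fa_single complex_ring 1 u)"

lemma R_monom_append:
  assumes "u \<in> lists (R_gens I m)" "v \<in> lists (R_gens I m)"
  shows "R_monom (u @ v) = R_monom u \<otimes>\<^bsub>R_ring I m\<^esub> R_monom v"
proof -
  have "fa_single complex_ring 1 (u @ v) = fa_single complex_ring 1 u \<otimes>\<^bsub>Rp.FA\<^esub> fa_single complex_ring 1 v"
    by (simp add: C.fa_single_mult)
  then show ?thesis
    unfolding R_ring using assms by (simp only: Rp.cls_mult C.fa_single_closed complex_ring_simps UNIV_I)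
qed

lemma R_monom_closed [simp]: "u \<in> lists (R_gens I m) \<Longrightarrow> R_monom u \<in> carrier (R_ring I m)"
  unfolding R_ring by (intro Rp.cls_closed C.fa_single_closed) simp_all

lemma R_monom_Nil: "R_monom [] = \<one>\<^bsub>R_ring I m\<^esub>"
  unfolding R_ring using Rp.cls_one by (simp add: fa_one_eq_single)

lemma R_monom_single: "R_monom [Tgen a] = t_R a"
  by (simp add: fa_gen_eq_single)

text \<open>If the inverse of \<open>a\<close> does not occur, all letters with the variable of
  \<open>a\<close> equal \<open>a\<close>, so their contributions cannot cancel. Hence a word with
  exponent zero that begins with \<open>a\<close> also contains the inverse letter.\<close>

lemma exponents_sign:
  assumes a: "a \<in> t_index I m"
  shows "u \<in> lists (R_gens I m) \<Longrightarrow> Tgen (t_star a) \<notin> set u \<Longrightarrow> t_sgn a * exponents u (t_var a) \<ge> 0"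
proof (induction u)
  case (Cons x u)
  then obtain b where b: "x = Tgen b" "b \<in> t_index I m" by (auto simp: R_gens_def)
  then have bs: "b \<noteq> t_star a" using Cons.prems(2) by auto
  have "t_sgn a * t_sgn b \<ge> 0" if "t_var b = t_var a"
  proof -
    have "b = a"
      using that b bs a tau_vars(2)[OF a] tau_vars(2)[OF b(2)]
      by (auto simp: t_var_def split: if_splits) (metis t_star_star)+
    then show ?thesis by simp
  qed
  with Cons b show ?case by (auto simp: distrib_left)
qed simp

lemma exponents_append: "exponents (u @ v) y = exponents u y + exponents v y"
  by (induction u rule: exponents.induct) auto

text \<open>The inverse of the first letter occurs further on by \<open>exponents_sign\<close>;
  commutativity moves the two together, they cancel, and the remaining word is shorter by two
  letters with the same exponents.\<close>

lemma R_monom_eq_one: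
  "u \<in> lists (R_gens I m) \<Longrightarrow> (\<And>y. exponents u y = 0) \<Longrightarrow> R_monom u = \<one>\<^bsub>R_ring I m\<^esub>"
proof (induction "length u" arbitrary: u rule: less_induct)
  case less
  show ?case
  proof (cases u)
    case Nil
    then show ?thesis using R_monom_Nil by simp
  next
    case (Cons x v)
    then obtain a where a: "x = Tgen a" "a \<in> t_index I m" using less.prems(1) by (auto simp: R_gens_def)
    have v: "v \<in> lists (R_gens I m)" using Cons less.prems(1) by simp
    have "Tgen (t_star a) \<in> set v"
    proof (rule ccontr)
      assume "Tgen (t_star a) \<notin> set v"
      then have "t_sgn a * exponents v (t_var a) \<ge> 0" using exponents_sign a v by blast
      moreover have "exponents v (t_var a) = - t_sgn a" using less.prems(2)[of "t_var a"] Cons a by simp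
      ultimately show False by (auto simp: t_sgn_def split: if_splits)
    qed
    then obtain p q where pq: "v = p @ Tgen (t_star a) # q" by (meson split_list)
    have l: "p \<in> lists (R_gens I m)" "q \<in> lists (R_gens I m)" using v pq by auto
    have exp0: "exponents (p @ q) y = 0" for y
      using less.prems(2)[of y] Cons a pq t_var_star[OF a(2)] by (auto simp: exponents_append split: if_splits)
    have "u = [Tgen a] @ p @ [Tgen (t_star a)] @ q" using Cons a pq by simp
    then have "R_monom u = t_R a \<otimes>\<^bsub>R_ring I m\<^esub> (R_monom p \<otimes>\<^bsub>R_ring I m\<^esub> (t_R (t_star a) \<otimes>\<^bsub>R_ring I m\<^esub> R_monom q))"
      using l a by (simp add: R_monom_append R_monom_single[symmetric] del: append_Cons)
    also have "\<dots> = (t_R a \<otimes>\<^bsub>R_ring I m\<^esub> t_R (t_star a)) \<otimes>\<^bsub>R_ring I m\<^esub> (R_monom p \<otimes>\<^bsub>R_ring I m\<^esub> R_monom q)"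
      using l a by (simp add: R.m_ac)
    also have "\<dots> = R_monom (p @ q)"
      using l a by (simp add: t_R_star R_monom_append)
    also have "\<dots> = \<one>\<^bsub>R_ring I m\<^esub>"
      using Cons pq l exp0 by (intro less.hyps) auto
    finally show ?thesis .
  qed
qed

lemma R_monom_eq:
  assumes u: "u \<in> lists (R_gens I m)" and v: "v \<in> lists (R_gens I m)" and eq: "exponents u = exponents v"
  shows "R_monom u = R_monom v"
proof -
  have "\<exists>v'\<in>lists (R_gens I m). exponents v' = (\<lambda>y. - exponents v y)"
    using v
  proof (induction v)
    case (Cons x v)
    then obtain v' a where v': "v' \<in> lists (R_gens I m)" "exponents v' = (\<lambda>y. - exponents v y)"
      "x = Tgen a" "a \<in> t_index I m" by (auto simp: R_gens_def)
    have "exponents (Tgen (t_star a) # v') y = - exponents (x # v) y" for y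
      using v' by (simp add: t_var_star)
    with v' show ?case
      by (intro bexI[of _ "Tgen (t_star a) # v'"] ext) simp_all
  qed (intro bexI[of _ "[]"], auto)
  then obtain v' where v': "v' \<in> lists (R_gens I m)" "exponents v' = (\<lambda>y. - exponents v y)" by blast
  have "R_monom (u @ v') = \<one>\<^bsub>R_ring I m\<^esub>" "R_monom (v' @ v) = \<one>\<^bsub>R_ring I m\<^esub>"
    using u v v' eq by (auto intro!: R_monom_eq_one simp: exponents_append)
  then have "R_monom u \<otimes>\<^bsub>R_ring I m\<^esub> R_monom v' = \<one>\<^bsub>R_ring I m\<^esub>" "R_monom v' \<otimes>\<^bsub>R_ring I m\<^esub> R_monom v = \<one>\<^bsub>R_ring I m\<^esub>"
    using u v v' by (simp_all add: R_monom_append)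
  then show ?thesis
    using u v v' by (metis R.l_one R.m_assoc R.r_one R_monom_closed)
qed

text \<open>Injectivity on representatives, by induction on the number of words in the support. Two
  words with equal exponents represent the same element of \<open>R\<close> and are merged. If all
  exponents are distinct, the words evaluate to nonzero multiples of independent exponentials, and
  the polynomial is zero.\<close>

lemma R_cls_zero:
  assumes f: "f \<in> carrier Rp.FA" and zero: "Rev.ev f = \<zero>\<^bsub>Rhat I m\<^esub>"
  shows "Rp.cls f = \<zero>\<^bsub>R_ring I m\<^esub>"
  using assms
proof (induction "card {u. f u \<noteq> 0}" arbitrary: f rule: less_induct)
  case less
  let ?S = "\<lambda>f. {u. f u \<noteq> (0::complex)}"
  have S: "finite (?S f)" "?S f \<subseteq> lists (R_gens I m)"
    using less.prems(1) by (simp_all add: C.fa_carrier)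
  show ?case
  proof (cases "inj_on exponents (?S f)")
    case False
    then obtain u v where uv: "u \<in> ?S f" "v \<in> ?S f" "u \<noteq> v" "exponents u = exponents v"
      by (auto simp: inj_on_def)
    then have l: "u \<in> lists (R_gens I m)" "v \<in> lists (R_gens I m)" using S by auto
    \<comment> \<open>The coefficient of \<open>u\<close> is shifted to \<open>v\<close>; this
      changes neither the class in \<open>R\<close> nor the value in the power series.\<close>
    define g where "g = f(u := 0, v := f v + f u)"
    have Sg: "?S g \<subseteq> ?S f - {u}" using uv by (auto simp: g_def)
    have "g \<in> carrier Rp.FA"
      using S Sg unfolding C.fa_carrier by (auto intro: finite_subset)
    have fu: "fa_single complex_ring (f u) u \<in> carrier Rp.FA" and fv: "fa_single complex_ring (f u) v \<in> carrier Rp.FA"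
      using l by (auto intro!: C.fa_single_closed)
    have eq: "g \<oplus>\<^bsub>Rp.FA\<^esub> fa_single complex_ring (f u) u = f \<oplus>\<^bsub>Rp.FA\<^esub> fa_single complex_ring (f u) v"
      using uv by (auto simp: g_def fa_add fa_single_def fun_eq_iff)
    have scale: "fa_single complex_ring (f u) w = fa_const complex_ring (f u) \<otimes>\<^bsub>Rp.FA\<^esub> fa_single complex_ring 1 w" for w
      by (simp add: fa_const_eq_single C.fa_single_mult)
    have cls_eq: "Rp.cls (fa_single complex_ring (f u) u) = Rp.cls (fa_single complex_ring (f u) v)"
      unfolding scale using l R_monom_eq[OF l uv(4)]
      by (subst (1 2) Rp.cls_mult) (auto intro!: C.fa_single_closed)
    have "Rev.ev (fa_single complex_ring (f u) u) = Rev.ev (fa_single complex_ring (f u) v)"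
    proof -
      obtain H where H: "H \<in> ring_hom Rp.PA (Rhat I m)" "\<And>f. f \<in> carrier Rp.FA \<Longrightarrow> H (Rp.cls f) = Rev.ev f"
        using Rp.PA_lift[OF Rhat.ring_axioms Rev.ev_hom Rev_rel] by blast
      show ?thesis using cls_eq H(2)[OF fu] H(2)[OF fv] by simp
    qed
    moreover have "Rev.ev g \<oplus>\<^bsub>Rhat I m\<^esub> Rev.ev (fa_single complex_ring (f u) u) =
        Rev.ev f \<oplus>\<^bsub>Rhat I m\<^esub> Rev.ev (fa_single complex_ring (f u) v)"
      using \<open>g \<in> _\<close> less.prems(1) fu fv arg_cong[OF eq, of Rev.ev] by (simp only: Rev.ev_add)
    ultimately have "Rev.ev g = \<zero>\<^bsub>Rhat I m\<^esub>"
      using less.prems \<open>g \<in> _\<close> fu fv by simp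
    moreover have "card (?S g) < card (?S f)"
      using Sg S uv(1) by (intro psubset_card_mono) auto
    ultimately have "Rp.cls g = \<zero>\<^bsub>R_ring I m\<^esub>"
      using \<open>g \<in> _\<close> by (intro less.hyps)
    moreover have "Rp.cls g \<oplus>\<^bsub>Rp.PA\<^esub> Rp.cls (fa_single complex_ring (f u) u) =
        Rp.cls f \<oplus>\<^bsub>Rp.PA\<^esub> Rp.cls (fa_single complex_ring (f u) v)"
      using \<open>g \<in> _\<close> less.prems(1) fu fv arg_cong[OF eq, of Rp.cls] by (simp only: Rp.cls_add)
    ultimately show ?thesis
      using less.prems(1) \<open>g \<in> _\<close> fu fv cls_eq unfolding R_ring
      by (metis Rp.PA.add.r_cancel Rp.cls_closed)
  next
    case True
    have "f u = 0" for u
    proof (rule ccontr)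
      assume u: "f u \<noteq> 0"
      let ?c = "\<lambda>u. f u * word_root u"
      let ?inv = "the_inv_into (?S f) exponents"
      have "(\<Sum>n\<in>exponents ` ?S f. ?c (?inv n) * ps_exp_linear Yt n \<mu>) = 0" for \<mu>
      proof -
        have "(\<Sum>n\<in>exponents ` ?S f. ?c (?inv n) * ps_exp_linear Yt n \<mu>) =
            (\<Sum>u\<in>?S f. ?c u * ps_exp_linear Yt (exponents u) \<mu>)"
          using True by (subst sum.reindex) (auto simp: the_inv_into_f_f)
        also have "\<dots> = (\<Sum>u\<in>?S f. (ps_const (f u) \<otimes>\<^bsub>Rhat I m\<^esub> list_prod (Rhat I m) (map gen_series u)) \<mu>)"
        proof (intro sum.cong)
          fix u assume "u \<in> ?S f"
          then have u: "u \<in> lists (R_gens I m)" using S(2) by blast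
          then show "?c u * ps_exp_linear Yt (exponents u) \<mu> =
              (ps_const (f u) \<otimes>\<^bsub>Rhat I m\<^esub> list_prod (Rhat I m) (map gen_series u)) \<mu>"
            unfolding series_word[OF u] by (simp add: Rhat_def ps_const_mult)
        qed simp
        also have "\<dots> = Rev.ev f \<mu>"
          unfolding fa_eval_def complex_ring_simps Rhat_def
          using Rev.word_closed S ps_mult_closed unfolding Rhat_def
          by (subst ps_finsum) (auto intro!: ps_mult_closed)
        also have "\<dots> = 0" using less.prems(2) by (simp add: Rhat_def ps_zero)
        finally show ?thesis .
      qed
      then have "?c (?inv (exponents u)) = 0"
      proof (rule ps_exp_linear_independent[OF finite_tau_vars, rotated 2])
        \<comment> \<open>Exponents vanish outside the independent variables, so distinct exponent
          vectors differ already on \<open>Yt\<close>.\<close>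
        show "\<exists>y\<in>Yt. n y \<noteq> n' y" if "n \<in> exponents ` ?S f" "n' \<in> exponents ` ?S f" "n \<noteq> n'" for n n'
        proof -
          have vanish: "exponents w y = 0" if "w \<in> lists (R_gens I m)" "y \<notin> Yt" for w y
            using that t_var_closed by (induction w) (auto simp: R_gens_def)
          obtain w w' where w: "w \<in> lists (R_gens I m)" "n = exponents w" "w' \<in> lists (R_gens I m)" "n' = exponents w'"
            using \<open>n \<in> _\<close> \<open>n' \<in> _\<close> S(2) by blast
          then have "n y = n' y" if "y \<notin> Yt" for y
            using vanish[OF w(1) that] vanish[OF w(3) that] by simp
          with \<open>n \<noteq> n'\<close> show ?thesis by (metis ext)
        qed
      qed (use S u in auto)
      then show False
        using u True word_root_nonzero by (simp add: the_inv_into_f_f)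
    qed
    then have "f = \<zero>\<^bsub>Rp.FA\<^esub>" by (auto simp: fa_zero)
    then show ?thesis unfolding R_ring using Rp.cls_zero by simp
  qed
qed

lemma R_to_Rhat:
  obtains \<gamma> where "\<gamma> \<in> ring_hom (R_ring I m) (Rhat I m)"
    and "\<And>a. a \<in> t_index I m \<Longrightarrow> \<gamma> (t_R a) = t_series a"
    and "\<And>r. r \<in> carrier (R_ring I m) \<Longrightarrow> \<gamma> r = \<zero>\<^bsub>Rhat I m\<^esub> \<Longrightarrow> r = \<zero>\<^bsub>R_ring I m\<^esub>"
proof -
  obtain H where H: "H \<in> ring_hom Rp.PA (Rhat I m)" "\<And>f. f \<in> carrier Rp.FA \<Longrightarrow> H (Rp.cls f) = Rev.ev f"
    using Rp.PA_lift[OF Rhat.ring_axioms Rev.ev_hom Rev_rel] by blast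
  show thesis
  proof (rule that[of H])
    show "H (t_R a) = t_series a" if "a \<in> t_index I m" for a
      using that H(2) by (simp add: Rev.ev_gen)
    show "r = \<zero>\<^bsub>R_ring I m\<^esub>" if "r \<in> carrier (R_ring I m)" "H r = \<zero>\<^bsub>Rhat I m\<^esub>" for r
      using that R_cls_zero H(2) unfolding R_ring by (metis Rp.PA_cases)
  qed (use H(1) R_ring in simp)
qed

lemma Rhat_one_not_zero: "\<one>\<^bsub>Rhat I m\<^esub> \<noteq> \<zero>\<^bsub>Rhat I m\<^esub>"
  by (auto simp: Rhat_def ps_one ps_zero ps_monom_def fun_eq_iff)

lemma R_one_not_zero: "\<one>\<^bsub>R_ring I m\<^esub> \<noteq> \<zero>\<^bsub>R_ring I m\<^esub>"
proof -
  obtain \<gamma> where \<gamma>: "\<gamma> \<in> ring_hom (R_ring I m) (Rhat I m)" by (rule R_to_Rhat) (rule that)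
  have "\<gamma> \<one>\<^bsub>R_ring I m\<^esub> \<noteq> \<gamma> \<zero>\<^bsub>R_ring I m\<^esub>"
    unfolding ring_hom_one[OF \<gamma>] ring_hom_zero[OF \<gamma> R.ring_axioms Rhat.ring_axioms] by (rule Rhat_one_not_zero)
  then show ?thesis by auto
qed

end

section \<open>The algebra \<open>A\<^sub>+\<close> over a coefficient ring\<close>

lemma ring_hom_minus:
  assumes "h \<in> ring_hom R S" "ring R" "ring S" "x \<in> carrier R" "y \<in> carrier R"
  shows "h (x \<ominus>\<^bsub>R\<^esub> y) = h x \<ominus>\<^bsub>S\<^esub> h y"
proof -
  interpret ring_hom_ring R S h by (rule ring_hom_ringI2[OF assms(2,3,1)])
  show ?thesis using assms(4,5) by (simp add: a_minus_def)
qed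

text \<open>Instantiated twice, as \<open>P\<close> over \<open>R\<close> and as \<open>Q\<close>
  over the power series, so that the calculus of the \<open>a\<^sub>i\<^sub>j\<close> is developed
  once.\<close>

locale aplus = coxeter I m + K: cring K
  for I :: "'i set" and m :: "'i \<Rightarrow> 'i \<Rightarrow> enat" and K :: "('k, 'n) ring_scheme" +
  fixes t :: "'i \<Rightarrow> 'i \<Rightarrow> int \<Rightarrow> 'k"
  assumes t_closed: "i \<in> I \<Longrightarrow> j \<in> I \<Longrightarrow> i \<noteq> j \<Longrightarrow> m i j = enat n \<Longrightarrow> t i j k \<in> carrier K"
begin

abbreviation "FAp \<equiv> free_algebra K (Aplus_gens I)"

lemma Aplus_rels_cases:
  assumes "(l, r) \<in> Aplus_rels K I m t"
  obtains i j where "i \<in> I" "j \<in> I" "i \<noteq> j"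
      "l = fa_gen K (i, j) \<otimes>\<^bsub>FAp\<^esub> fa_gen K (j, i)" "r = \<one>\<^bsub>FAp\<^esub>"
  | i j n where "i \<in> I" "j \<in> I" "i \<noteq> j" "m i j = enat n"
      "l = list_prod FAp (map (\<lambda>k. fa_gen K (i, j) \<ominus>\<^bsub>FAp\<^esub> fa_const K (t i j k)) [1..int n])" "r = \<zero>\<^bsub>FAp\<^esub>"
  | i j p where "i \<in> I" "j \<in> I" "p \<in> I" "i \<noteq> j" "j \<noteq> p" "i \<noteq> p"
      "l = fa_gen K (i, j) \<otimes>\<^bsub>FAp\<^esub> fa_gen K (j, p) \<otimes>\<^bsub>FAp\<^esub> fa_gen K (p, i)" "r = \<one>\<^bsub>FAp\<^esub>"
  using assms unfolding Aplus_rels_def Let_def by auto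

lemma fa_gen_pair_closed: "i \<in> I \<Longrightarrow> j \<in> I \<Longrightarrow> i \<noteq> j \<Longrightarrow> fa_gen K (i, j) \<in> carrier FAp"
  unfolding fa_gen_eq_single by (intro K.fa_single_closed) (auto simp: Aplus_gens_def)

lemma fa_const_t_closed: "i \<in> I \<Longrightarrow> j \<in> I \<Longrightarrow> i \<noteq> j \<Longrightarrow> m i j = enat n \<Longrightarrow> fa_const K (t i j k) \<in> carrier FAp"
  unfolding fa_const_eq_single using t_closed by (intro K.fa_single_closed) auto

sublocale P: presentation K "Aplus_gens I" "Aplus_rels K I m t"
proof
  interpret F: ring FAp by (rule K.free_algebra_ring)
  show "l \<in> carrier FAp \<and> r \<in> carrier FAp" if "(l, r) \<in> Aplus_rels K I m t" for l r
    using that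
    by (cases rule: Aplus_rels_cases)
      (auto intro!: F.m_closed F.list_prod_closed F.minus_closed fa_gen_pair_closed fa_const_t_closed)
qed

lemma Aplus_ring: "Aplus_ring K I m t = P.PA"
  and Aplus_class: "Aplus_class K I m t = P.cls"
  by (simp_all add: Aplus_ring_def Aplus_class_def)

text \<open>The value \<open>1\<close> on the diagonal corresponds to
  \<open>s\<^sub>i s\<^sub>i = 1\<close>. It turns the inverse and triangle relations into the
  single cocycle identity \<open>a_mult\<close>, valid without distinctness assumptions.\<close>

definition a :: "'i \<Rightarrow> 'i \<Rightarrow> (('i \<times> 'i) list \<Rightarrow> 'k) set" where
  "a i j = (if i = j then \<one>\<^bsub>P.PA\<^esub> else P.cls (fa_gen K (i, j)))"

abbreviation "con c \<equiv> P.cls (fa_const K c)"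

lemma con_closed [simp]: "c \<in> carrier K \<Longrightarrow> con c \<in> carrier P.PA"
  using ring_hom_closed[OF P.const_hom] .

lemma con_central: "c \<in> carrier K \<Longrightarrow> x \<in> carrier P.PA \<Longrightarrow> con c \<otimes>\<^bsub>P.PA\<^esub> x = x \<otimes>\<^bsub>P.PA\<^esub> con c"
  by (rule P.const_central[OF K.is_cring])

lemma a_closed [simp]: "i \<in> I \<Longrightarrow> j \<in> I \<Longrightarrow> a i j \<in> carrier P.PA"
  by (auto simp: a_def intro!: P.cls_closed fa_gen_pair_closed)

lemma a_refl [simp]: "a i i = \<one>\<^bsub>P.PA\<^esub>"
  by (simp add: a_def)

lemma a_inverse: "i \<in> I \<Longrightarrow> j \<in> I \<Longrightarrow> a i j \<otimes>\<^bsub>P.PA\<^esub> a j i = \<one>\<^bsub>P.PA\<^esub>"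
proof (cases "i = j")
  case False
  assume ij: "i \<in> I" "j \<in> I"
  then have "(fa_gen K (i, j) \<otimes>\<^bsub>FAp\<^esub> fa_gen K (j, i), \<one>\<^bsub>FAp\<^esub>) \<in> Aplus_rels K I m t"
    using False unfolding Aplus_rels_def Let_def by blast
  from P.cls_rel[OF this] show ?thesis
    using ij False by (simp add: a_def P.cls_mult fa_gen_pair_closed P.cls_one)
qed simp

lemma a_mult: "i \<in> I \<Longrightarrow> j \<in> I \<Longrightarrow> p \<in> I \<Longrightarrow> a i j \<otimes>\<^bsub>P.PA\<^esub> a j p = a i p"
proof (cases "i = j \<or> j = p \<or> i = p")
  case False
  assume I: "i \<in> I" "j \<in> I" "p \<in> I"
  have neq: "i \<noteq> j" "j \<noteq> p" "i \<noteq> p" "p \<noteq> i" using False by auto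
  have "(fa_gen K (i, j) \<otimes>\<^bsub>FAp\<^esub> fa_gen K (j, p) \<otimes>\<^bsub>FAp\<^esub> fa_gen K (p, i), \<one>\<^bsub>FAp\<^esub>) \<in> Aplus_rels K I m t"
    using I neq unfolding Aplus_rels_def Let_def by blast
  from P.cls_rel[OF this] have "a i j \<otimes>\<^bsub>P.PA\<^esub> a j p \<otimes>\<^bsub>P.PA\<^esub> a p i = \<one>\<^bsub>P.PA\<^esub>"
    using I neq by (simp add: a_def P.cls_mult fa_gen_pair_closed P.cls_one)
  then have "a i j \<otimes>\<^bsub>P.PA\<^esub> a j p \<otimes>\<^bsub>P.PA\<^esub> (a p i \<otimes>\<^bsub>P.PA\<^esub> a i p) = a i p"
    using I by (simp flip: P.PA.m_assoc)
  then show ?thesis using I by (simp add: a_inverse)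
qed (auto simp: a_inverse)

lemma a_polynomial:
  assumes "i \<in> I" "j \<in> I" "i \<noteq> j" "m i j = enat n"
  shows "list_prod P.PA (map (\<lambda>k. a i j \<ominus>\<^bsub>P.PA\<^esub> con (t i j k)) [1..int n]) = \<zero>\<^bsub>P.PA\<^esub>"
proof -
  have "(list_prod FAp (map (\<lambda>k. fa_gen K (i, j) \<ominus>\<^bsub>FAp\<^esub> fa_const K (t i j k)) [1..int n]), \<zero>\<^bsub>FAp\<^esub>) \<in> Aplus_rels K I m t"
    using assms unfolding Aplus_rels_def Let_def by blast
  from P.cls_rel[OF this]
  have "P.cls (list_prod FAp (map (\<lambda>k. fa_gen K (i, j) \<ominus>\<^bsub>FAp\<^esub> fa_const K (t i j k)) [1..int n])) = \<zero>\<^bsub>P.PA\<^esub>"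
    by (simp add: P.cls_zero)
  also have "P.cls (list_prod FAp (map (\<lambda>k. fa_gen K (i, j) \<ominus>\<^bsub>FAp\<^esub> fa_const K (t i j k)) [1..int n])) =
      list_prod P.PA (map P.cls (map (\<lambda>k. fa_gen K (i, j) \<ominus>\<^bsub>FAp\<^esub> fa_const K (t i j k)) [1..int n]))"
    using assms fa_gen_pair_closed fa_const_t_closed
    by (intro ring_hom_list_prod[OF P.FA.monoid_axioms P.cls_hom]) auto
  also have "map P.cls (map (\<lambda>k. fa_gen K (i, j) \<ominus>\<^bsub>FAp\<^esub> fa_const K (t i j k)) [1..int n]) =
      map (\<lambda>k. a i j \<ominus>\<^bsub>P.PA\<^esub> con (t i j k)) [1..int n]"
    using assms fa_gen_pair_closed fa_const_t_closed
    by (simp add: a_def ring_hom_minus[OF P.cls_hom P.FA.ring_axioms P.PA.ring_axioms])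
  finally show ?thesis .
qed

definition even_word :: "'i list \<Rightarrow> (('i \<times> 'i) list \<Rightarrow> 'k) set" where
  "even_word u = list_prod P.PA (map (\<lambda>(i, j). a i j) (even_pairs u))"

lemma even_word_simps [simp]:
  "even_word [] = \<one>\<^bsub>P.PA\<^esub>" "even_word [i] = \<one>\<^bsub>P.PA\<^esub>" "even_word (i # j # u) = a i j \<otimes>\<^bsub>P.PA\<^esub> even_word u"
  by (simp_all add: even_word_def)

lemma even_word_closed [simp]: "u \<in> lists I \<Longrightarrow> even_word u \<in> carrier P.PA"
  by (induction u rule: even_pairs.induct) auto

text \<open>The universal property in terms of the cocycle identity. It serves for the change of
  coefficients from \<open>R\<close> to the power series and for the specialization at \<tau> =
  0.\<close>

lemma hom_out:
  assumes B: "ring B" and \<kappa>: "\<kappa> \<in> ring_hom K B"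
    and g: "\<And>i j. i \<in> I \<Longrightarrow> j \<in> I \<Longrightarrow> g i j \<in> carrier B"
    and central: "\<And>c i j. c \<in> carrier K \<Longrightarrow> i \<in> I \<Longrightarrow> j \<in> I \<Longrightarrow> \<kappa> c \<otimes>\<^bsub>B\<^esub> g i j = g i j \<otimes>\<^bsub>B\<^esub> \<kappa> c"
    and g_refl: "\<And>i. i \<in> I \<Longrightarrow> g i i = \<one>\<^bsub>B\<^esub>"
    and g_mult: "\<And>i j p. i \<in> I \<Longrightarrow> j \<in> I \<Longrightarrow> p \<in> I \<Longrightarrow> g i j \<otimes>\<^bsub>B\<^esub> g j p = g i p"
    and poly: "\<And>i j n. i \<in> I \<Longrightarrow> j \<in> I \<Longrightarrow> i \<noteq> j \<Longrightarrow> m i j = enat n \<Longrightarrow>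
      list_prod B (map (\<lambda>k. g i j \<ominus>\<^bsub>B\<^esub> \<kappa> (t i j k)) [1..int n]) = \<zero>\<^bsub>B\<^esub>"
  obtains H where "H \<in> ring_hom P.PA B" "\<And>c. c \<in> carrier K \<Longrightarrow> H (con c) = \<kappa> c"
    "\<And>i j. i \<in> I \<Longrightarrow> j \<in> I \<Longrightarrow> H (a i j) = g i j"
    "\<And>u. u \<in> lists I \<Longrightarrow> H (even_word u) = list_prod B (map (\<lambda>(i, j). g i j) (even_pairs u))"
proof -
  interpret B: ring B by fact
  interpret E: fa_evaluation K B "Aplus_gens I" \<kappa> "\<lambda>(i, j). g i j"
    by unfold_locales (use \<kappa> g central in \<open>auto simp: Aplus_gens_def\<close>)
  have gen: "E.ev (fa_gen K (i, j)) = g i j" if "i \<in> I" "j \<in> I" "i \<noteq> j" for i j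
    using that by (subst E.ev_gen) (auto simp: Aplus_gens_def)
  have rel: "E.ev l = E.ev r" if "(l, r) \<in> Aplus_rels K I m t" for l r
    using that
  proof (cases rule: Aplus_rels_cases)
    case (1 i j)
    then show ?thesis
      using ring_hom_one[OF E.ev_hom] by (simp add: E.ev_mult fa_gen_pair_closed gen g_mult g_refl)
  next
    case (2 i j n)
    have "E.ev l = list_prod B (map E.ev (map (\<lambda>k. fa_gen K (i, j) \<ominus>\<^bsub>FAp\<^esub> fa_const K (t i j k)) [1..int n]))"
      unfolding 2 using 2 fa_gen_pair_closed fa_const_t_closed
      by (intro ring_hom_list_prod[OF P.FA.monoid_axioms E.ev_hom]) auto
    also have "map E.ev (map (\<lambda>k. fa_gen K (i, j) \<ominus>\<^bsub>FAp\<^esub> fa_const K (t i j k)) [1..int n]) =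
        map (\<lambda>k. g i j \<ominus>\<^bsub>B\<^esub> \<kappa> (t i j k)) [1..int n]"
      using 2 fa_gen_pair_closed fa_const_t_closed t_closed
      by (simp add: gen E.ev_const ring_hom_minus[OF E.ev_hom P.FA.ring_axioms B])
    finally show ?thesis
      using 2 poly ring_hom_zero[OF E.ev_hom P.FA.ring_axioms B] by simp
  next
    case (3 i j p)
    then show ?thesis
      using ring_hom_one[OF E.ev_hom] by (simp add: E.ev_mult fa_gen_pair_closed gen g_mult g_refl)
  qed
  obtain H where H: "H \<in> ring_hom P.PA B" "\<And>c. c \<in> carrier K \<Longrightarrow> H (con c) = \<kappa> c"
    "\<And>y. y \<in> Aplus_gens I \<Longrightarrow> H (P.cls (fa_gen K y)) = (case y of (i, j) \<Rightarrow> g i j)"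
    using pa_universal[OF P.presentation_axioms E.fa_evaluation_axioms rel] by blast
  have Ha: "H (a i j) = g i j" if "i \<in> I" "j \<in> I" for i j
    using that H(3)[of "(i, j)"] ring_hom_one[OF H(1)] g_refl by (auto simp: a_def Aplus_gens_def)
  have "H (even_word u) = list_prod B (map (\<lambda>(i, j). g i j) (even_pairs u))" if "u \<in> lists I" for u
    using that
    by (induction u rule: even_pairs.induct) (auto simp: ring_hom_one[OF H(1)] ring_hom_mult[OF H(1)] Ha)
  with H Ha that show thesis by blast
qed

end

lemma (in aplus) even_word_append:
  assumes "u \<in> lists I" "v \<in> lists I" "even (length u)"
  shows "even_word (u @ v) = even_word u \<otimes>\<^bsub>P.PA\<^esub> even_word v"
  using assms by (induction u rule: even_pairs.induct) (auto simp: P.PA.m_assoc)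

section \<open>Two by two matrices\<close>

definition mat2_ring :: "('b, 'n) ring_scheme \<Rightarrow> ('b \<times> 'b \<times> 'b \<times> 'b) ring" where
  "mat2_ring B = \<lparr>carrier = carrier B \<times> carrier B \<times> carrier B \<times> carrier B,
     monoid.mult = (\<lambda>(p, q, r, s) (p', q', r', s').
       (p \<otimes>\<^bsub>B\<^esub> p' \<oplus>\<^bsub>B\<^esub> q \<otimes>\<^bsub>B\<^esub> r', p \<otimes>\<^bsub>B\<^esub> q' \<oplus>\<^bsub>B\<^esub> q \<otimes>\<^bsub>B\<^esub> s',
        r \<otimes>\<^bsub>B\<^esub> p' \<oplus>\<^bsub>B\<^esub> s \<otimes>\<^bsub>B\<^esub> r', r \<otimes>\<^bsub>B\<^esub> q' \<oplus>\<^bsub>B\<^esub> s \<otimes>\<^bsub>B\<^esub> s')),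
     monoid.one = (\<one>\<^bsub>B\<^esub>, \<zero>\<^bsub>B\<^esub>, \<zero>\<^bsub>B\<^esub>, \<one>\<^bsub>B\<^esub>),
     ring.zero = (\<zero>\<^bsub>B\<^esub>, \<zero>\<^bsub>B\<^esub>, \<zero>\<^bsub>B\<^esub>, \<zero>\<^bsub>B\<^esub>),
     add = (\<lambda>(p, q, r, s) (p', q', r', s'). (p \<oplus>\<^bsub>B\<^esub> p', q \<oplus>\<^bsub>B\<^esub> q', r \<oplus>\<^bsub>B\<^esub> r', s \<oplus>\<^bsub>B\<^esub> s'))\<rparr>"

lemma mat2_simps:
  "x \<in> carrier (mat2_ring B) \<longleftrightarrow> (case x of (p, q, r, s) \<Rightarrow> p \<in> carrier B \<and> q \<in> carrier B \<and> r \<in> carrier B \<and> s \<in> carrier B)"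
  "(p, q, r, s) \<otimes>\<^bsub>mat2_ring B\<^esub> (p', q', r', s') =
     (p \<otimes>\<^bsub>B\<^esub> p' \<oplus>\<^bsub>B\<^esub> q \<otimes>\<^bsub>B\<^esub> r', p \<otimes>\<^bsub>B\<^esub> q' \<oplus>\<^bsub>B\<^esub> q \<otimes>\<^bsub>B\<^esub> s',
      r \<otimes>\<^bsub>B\<^esub> p' \<oplus>\<^bsub>B\<^esub> s \<otimes>\<^bsub>B\<^esub> r', r \<otimes>\<^bsub>B\<^esub> q' \<oplus>\<^bsub>B\<^esub> s \<otimes>\<^bsub>B\<^esub> s')"
  "\<one>\<^bsub>mat2_ring B\<^esub> = (\<one>\<^bsub>B\<^esub>, \<zero>\<^bsub>B\<^esub>, \<zero>\<^bsub>B\<^esub>, \<one>\<^bsub>B\<^esub>)"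
  "\<zero>\<^bsub>mat2_ring B\<^esub> = (\<zero>\<^bsub>B\<^esub>, \<zero>\<^bsub>B\<^esub>, \<zero>\<^bsub>B\<^esub>, \<zero>\<^bsub>B\<^esub>)"
  "(p, q, r, s) \<oplus>\<^bsub>mat2_ring B\<^esub> (p', q', r', s') = (p \<oplus>\<^bsub>B\<^esub> p', q \<oplus>\<^bsub>B\<^esub> q', r \<oplus>\<^bsub>B\<^esub> r', s \<oplus>\<^bsub>B\<^esub> s')"
  by (auto simp: mat2_ring_def)

context ring
begin

lemma mat2_ring: "ring (mat2_ring R)"
proof (rule ringI)
  show "abelian_group (mat2_ring R)"
  proof (rule abelian_groupI)
    fix x assume "x \<in> carrier (mat2_ring R)"
    then obtain p q r s where x: "x = (p, q, r, s)" "p \<in> carrier R" "q \<in> carrier R" "r \<in> carrier R" "s \<in> carrier R"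
      by (cases x) (auto simp: mat2_simps)
    then show "\<exists>y\<in>carrier (mat2_ring R). y \<oplus>\<^bsub>mat2_ring R\<^esub> x = \<zero>\<^bsub>mat2_ring R\<^esub>"
      by (intro bexI[of _ "(\<ominus> p, \<ominus> q, \<ominus> r, \<ominus> s)"]) (auto simp: mat2_simps l_neg)
  qed (auto simp: mat2_simps a_assoc intro: a_comm)
  show "monoid (mat2_ring R)"
    by (rule monoidI) (auto simp: mat2_simps l_distr r_distr m_assoc a_ac)
qed (auto simp: mat2_simps l_distr r_distr a_ac)

lemma mat2_diag_minus:
  assumes "p \<in> carrier R" "s \<in> carrier R" "p' \<in> carrier R" "s' \<in> carrier R"
  shows "(p, \<zero>, \<zero>, s) \<ominus>\<^bsub>mat2_ring R\<^esub> (p', \<zero>, \<zero>, s') = (p \<ominus> p', \<zero>, \<zero>, s \<ominus> s')"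
proof -
  interpret M: ring "mat2_ring R" by (rule mat2_ring)
  have "\<ominus>\<^bsub>mat2_ring R\<^esub> (p', \<zero>, \<zero>, s') = (\<ominus> p', \<zero>, \<zero>, \<ominus> s')"
    using assms by (intro M.minus_equality) (auto simp: mat2_simps l_neg)
  then show ?thesis using assms by (simp add: a_minus_def mat2_simps)
qed

lemma mat2_diag_list_prod:
  assumes "\<And>k. k \<in> set ks \<Longrightarrow> f k \<in> carrier R" "\<And>k. k \<in> set ks \<Longrightarrow> g k \<in> carrier R"
  shows "list_prod (mat2_ring R) (map (\<lambda>k. (f k, \<zero>, \<zero>, g k)) ks) =
    (list_prod R (map f ks), \<zero>, \<zero>, list_prod R (map g ks))"
  using assms
proof (induction ks)
  case (Cons k ks)
  then have "list_prod R (map f ks) \<in> carrier R" "list_prod R (map g ks) \<in> carrier R"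
    by (auto intro!: list_prod_closed)
  with Cons show ?case by (simp add: mat2_simps)
qed (simp add: mat2_simps)

text \<open>A polynomial whose roots commute with \<open>g\<close> can be conjugated by
  \<open>g\<close> factor by factor. In the lower diagonal block of the matrices, the polynomial
  relation appears in such a conjugated form.\<close>

lemma list_prod_conjugate:
  assumes x: "x \<in> carrier R" and g: "g \<in> carrier R" "g' \<in> carrier R" "g \<otimes> g' = \<one>" "g' \<otimes> g = \<one>"
    and c: "\<And>k. k \<in> set ks \<Longrightarrow> c k \<in> carrier R" "\<And>k. k \<in> set ks \<Longrightarrow> c k \<otimes> g = g \<otimes> c k"
  shows "list_prod R (map (\<lambda>k. g \<otimes> x \<otimes> g' \<ominus> c k) ks) = g \<otimes> list_prod R (map (\<lambda>k. x \<ominus> c k) ks) \<otimes> g'"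
  using c
proof (induction ks)
  case Nil
  then show ?case using g by simp
next
  case (Cons k ks)
  let ?p = "list_prod R (map (\<lambda>k. x \<ominus> c k) ks)"
  have p: "?p \<in> carrier R" using x Cons.prems by (intro list_prod_closed) auto
  have ck: "c k \<in> carrier R" "c k \<otimes> g = g \<otimes> c k" using Cons.prems by auto
  have "c k = g \<otimes> c k \<otimes> g'" using g ck by (metis m_assoc r_one)
  then have "g \<otimes> x \<otimes> g' \<ominus> c k = g \<otimes> x \<otimes> g' \<ominus> g \<otimes> c k \<otimes> g'" by simp
  also have "\<dots> = g \<otimes> (x \<ominus> c k) \<otimes> g'"
    using x g ck by (simp add: minus_eq l_distr r_distr l_minus r_minus)
  finally have "list_prod R (map (\<lambda>k. g \<otimes> x \<otimes> g' \<ominus> c k) (k # ks)) =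
      g \<otimes> (x \<ominus> c k) \<otimes> g' \<otimes> (g \<otimes> ?p \<otimes> g')"
    using Cons by simp
  also have "\<dots> = g \<otimes> (x \<ominus> c k) \<otimes> (g' \<otimes> g) \<otimes> ?p \<otimes> g'"
    using x g(1,2) ck(1) p by (simp only: m_assoc m_closed minus_closed)
  also have "\<dots> = g \<otimes> ((x \<ominus> c k) \<otimes> ?p) \<otimes> g'"
    using x g ck(1) p by (simp add: m_assoc)
  finally show ?case by simp
qed

end

section \<open>The algebra \<open>A(M)\<close>\<close>

text \<open>The operations do not refer to the set of generators; only the carrier does.
  Representatives of elements of \<open>R\<close> are thereby also representatives of elements of
  \<open>A(M)\<close>, with the same sums and products.\<close>

lemma free_algebra_ops:
  "f \<otimes>\<^bsub>free_algebra K Y\<^esub> g = f \<otimes>\<^bsub>free_algebra K Z\<^esub> g"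
  "f \<oplus>\<^bsub>free_algebra K Y\<^esub> g = f \<oplus>\<^bsub>free_algebra K Z\<^esub> g"
  "\<one>\<^bsub>free_algebra K Y\<^esub> = \<one>\<^bsub>free_algebra K Z\<^esub>"
  by (simp_all add: free_algebra_def)

locale coxeter_algebras = coxeter I m for I :: "'i set" and m :: "'i \<Rightarrow> 'i \<Rightarrow> enat"
begin

lemma R_t_eq: "R_t I m i j k = t_R (t_label m i j k)"
  by (simp add: R_t_def t_elt_def)

sublocale P: aplus I m "R_ring I m" "R_t I m"
  by unfold_locales (auto simp: R_t_eq intro!: t_R_closed t_label_index(2))

sublocale Q: aplus I m "Rhat I m" "t_hat I m"
  by unfold_locales (auto simp: t_hat_eq_series intro!: t_series_closed t_label_index(2))

abbreviation "FAA \<equiv> free_algebra complex_ring (A_gens I m)"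
abbreviation "tg b \<equiv> fa_gen complex_ring (Tgen b) :: 'i agen list \<Rightarrow> complex"

lemma A_rels_cases:
  assumes "(l, r) \<in> A_rels I m"
  obtains b where "b \<in> t_index I m" "l = tg b \<otimes>\<^bsub>FAA\<^esub> tg (t_star b)" "r = \<one>\<^bsub>FAA\<^esub>"
  | i where "i \<in> I" "l = s_elt i \<otimes>\<^bsub>FAA\<^esub> s_elt i" "r = \<one>\<^bsub>FAA\<^esub>"
  | i j n where "i \<in> I" "j \<in> I" "i \<noteq> j" "m i j = enat n"
      "l = list_prod FAA (map (\<lambda>k. (s_elt i \<otimes>\<^bsub>FAA\<^esub> s_elt j) \<ominus>\<^bsub>FAA\<^esub> tg (t_label m i j k)) [1..int n])" "r = \<zero>\<^bsub>FAA\<^esub>"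
  | b c where "b \<in> t_index I m" "c \<in> t_index I m" "l = tg b \<otimes>\<^bsub>FAA\<^esub> tg c" "r = tg c \<otimes>\<^bsub>FAA\<^esub> tg b"
  | p i j n k where "p \<in> I" "i \<in> I" "j \<in> I" "i \<noteq> j" "m i j = enat n"
      "l = s_elt p \<otimes>\<^bsub>FAA\<^esub> tg (t_label m i j k)" "r = tg (t_label m j i k) \<otimes>\<^bsub>FAA\<^esub> s_elt p"
proof -
  show thesis
    using assms unfolding A_rels_def Let_def
  proof (elim UnE CollectE exE conjE, goal_cases)
    case (1 i j k)
    then show ?thesis using that(1)[of "(i, j, k)"] by (simp add: t_elt_index t_elt_star)
  next
    case (2 i)
    then show ?thesis using that(2)[of i] by simp
  next
    case (3 i j n)
    then show ?thesis using that(3)[of i j n] by (simp add: t_elt_def)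
  next
    case (4 i j k i' j' k')
    then show ?thesis using that(4)[of "(i, j, k)" "(i', j', k')"] by (simp add: t_elt_index)
  next
    case (5 p i j k)
    then show ?thesis using that(5)[of p i j _ k] t_indexE[of "(i, j, k)"] by (simp add: t_elt_def) blast
  qed
qed

lemma A_rels_intro:
  "b \<in> t_index I m \<Longrightarrow> (tg b \<otimes>\<^bsub>FAA\<^esub> tg (t_star b), \<one>\<^bsub>FAA\<^esub>) \<in> A_rels I m"
  "i \<in> I \<Longrightarrow> (s_elt i \<otimes>\<^bsub>FAA\<^esub> s_elt i, \<one>\<^bsub>FAA\<^esub>) \<in> A_rels I m"
  "i \<in> I \<Longrightarrow> j \<in> I \<Longrightarrow> i \<noteq> j \<Longrightarrow> m i j = enat n \<Longrightarrow>
      (list_prod FAA (map (\<lambda>k. (s_elt i \<otimes>\<^bsub>FAA\<^esub> s_elt j) \<ominus>\<^bsub>FAA\<^esub> tg (t_label m i j k)) [1..int n]), \<zero>\<^bsub>FAA\<^esub>) \<in> A_rels I m"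
  "b \<in> t_index I m \<Longrightarrow> c \<in> t_index I m \<Longrightarrow> (tg b \<otimes>\<^bsub>FAA\<^esub> tg c, tg c \<otimes>\<^bsub>FAA\<^esub> tg b) \<in> A_rels I m"
  "p \<in> I \<Longrightarrow> (i, j, k) \<in> t_index I m \<Longrightarrow>
      (s_elt p \<otimes>\<^bsub>FAA\<^esub> tg (i, j, k), tg (j, i, k) \<otimes>\<^bsub>FAA\<^esub> s_elt p) \<in> A_rels I m"
proof -
  show "(tg b \<otimes>\<^bsub>FAA\<^esub> tg (t_star b), \<one>\<^bsub>FAA\<^esub>) \<in> A_rels I m" if b: "b \<in> t_index I m"
  proof -
    obtain i j k where ijk: "b = (i, j, k)" by (cases b) auto
    have "tg b = t_elt m i j k" "tg (t_star b) = t_elt m j i (-k)"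
      using b by (simp_all add: ijk t_elt_index t_elt_star)
    then show ?thesis using b unfolding A_rels_def Let_def
      by (intro UnI1 CollectI exI[of _ i] exI[of _ j] exI[of _ k]) (simp only: ijk simp_thms)
  qed
  show "(s_elt i \<otimes>\<^bsub>FAA\<^esub> s_elt i, \<one>\<^bsub>FAA\<^esub>) \<in> A_rels I m" if "i \<in> I"
    using that unfolding A_rels_def Let_def by (rule_tac UnI1, rule_tac UnI1, rule_tac UnI1, rule_tac UnI2) blast
  show "(list_prod FAA (map (\<lambda>k. (s_elt i \<otimes>\<^bsub>FAA\<^esub> s_elt j) \<ominus>\<^bsub>FAA\<^esub> tg (t_label m i j k)) [1..int n]), \<zero>\<^bsub>FAA\<^esub>) \<in> A_rels I m"
    if "i \<in> I" "j \<in> I" "i \<noteq> j" "m i j = enat n"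
    using that unfolding A_rels_def Let_def t_elt_def by (rule_tac UnI1, rule_tac UnI1, rule_tac UnI2) blast
  show "(tg b \<otimes>\<^bsub>FAA\<^esub> tg c, tg c \<otimes>\<^bsub>FAA\<^esub> tg b) \<in> A_rels I m" if b: "b \<in> t_index I m" and c: "c \<in> t_index I m"
  proof -
    obtain i j k where ijk: "b = (i, j, k)" by (cases b) auto
    obtain i' j' k' where ijk': "c = (i', j', k')" by (cases c) auto
    have "tg b = t_elt m i j k" "tg c = t_elt m i' j' k'"
      using b c by (simp_all add: ijk ijk' t_elt_index)
    then show ?thesis using b c unfolding A_rels_def Let_def
      by (rule_tac UnI1, rule_tac UnI2, intro CollectI exI[of _ i] exI[of _ j] exI[of _ k] exI[of _ i'] exI[of _ j'] exI[of _ k'])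
        (simp only: ijk ijk' simp_thms)
  qed
  show "(s_elt p \<otimes>\<^bsub>FAA\<^esub> tg (i, j, k), tg (j, i, k) \<otimes>\<^bsub>FAA\<^esub> s_elt p) \<in> A_rels I m"
    if p: "p \<in> I" and b: "(i, j, k) \<in> t_index I m"
  proof -
    have "(j, i, k) \<in> t_index I m" using b m_sym by (auto simp: t_index_def)
    then have "tg (i, j, k) = t_elt m i j k" "tg (j, i, k) = t_elt m j i k"
      using b by (simp_all add: t_elt_index)
    then show ?thesis using p b unfolding A_rels_def Let_def
      by (rule_tac UnI2, intro CollectI exI[of _ p] exI[of _ i] exI[of _ j] exI[of _ k]) (simp only: simp_thms)
  qed
qed

lemma A_gens_in [simp]: "Sgen i \<in> A_gens I m \<longleftrightarrow> i \<in> I" "Tgen b \<in> A_gens I m \<longleftrightarrow> b \<in> t_index I m"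
  by (auto simp: A_gens_def R_gens_def)

lemma tg_closed: "b \<in> t_index I m \<Longrightarrow> tg b \<in> carrier FAA"
  unfolding fa_gen_eq_single by (intro C.fa_single_closed) auto

lemma s_elt_closed: "i \<in> I \<Longrightarrow> s_elt i \<in> carrier FAA"
  unfolding s_elt_def fa_gen_eq_single by (intro C.fa_single_closed) auto

sublocale Ap: presentation complex_ring "A_gens I m" "A_rels I m"
proof
  interpret F: ring FAA by (rule C.free_algebra_ring)
  show "l \<in> carrier FAA \<and> r \<in> carrier FAA" if "(l, r) \<in> A_rels I m" for l r
    using that
  proof (cases rule: A_rels_cases)
    case (1 b)
    then show ?thesis by (simp only: F.m_closed tg_closed t_star_closed F.one_closed simp_thms)
  next
    case (2 i)
    then show ?thesis by (simp only: F.m_closed s_elt_closed F.one_closed simp_thms)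
  next
    case (3 i j n)
    have "(s_elt i \<otimes>\<^bsub>FAA\<^esub> s_elt j) \<ominus>\<^bsub>FAA\<^esub> tg (t_label m i j k) \<in> carrier FAA" for k
      using 3 by (intro F.minus_closed F.m_closed s_elt_closed tg_closed t_label_index(2))
    then have "l \<in> carrier FAA" unfolding 3 by (intro F.list_prod_closed) auto
    then show ?thesis using 3 by simp
  next
    case (4 b c)
    then show ?thesis by (simp only: F.m_closed tg_closed simp_thms)
  next
    case (5 p i j n k)
    have "t_label m i j k \<in> t_index I m" "t_label m j i k \<in> t_index I m"
      using 5 t_label_index(2)[of i j n k] t_label_index(2)[of j i n k] m_sym[of i j] by simp_all
    with 5 show ?thesis by (simp only: F.m_closed tg_closed s_elt_closed simp_thms)
  qed
qed

abbreviation "A \<equiv> Ap.PA"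
abbreviation "s i \<equiv> Ap.cls (s_elt i)"
abbreviation "tA b \<equiv> Ap.cls (tg b)"

lemma s_closed [simp]: "i \<in> I \<Longrightarrow> s i \<in> carrier A"
  by (intro Ap.cls_closed s_elt_closed)

lemma s_square: "i \<in> I \<Longrightarrow> s i \<otimes>\<^bsub>A\<^esub> s i = \<one>\<^bsub>A\<^esub>"
  using Ap.cls_rel[OF A_rels_intro(2)] by (simp add: Ap.cls_mult s_elt_closed Ap.cls_one)

lemma s_tA: "p \<in> I \<Longrightarrow> (i, j, k) \<in> t_index I m \<Longrightarrow> s p \<otimes>\<^bsub>A\<^esub> tA (i, j, k) = tA (j, i, k) \<otimes>\<^bsub>A\<^esub> s p"
proof -
  assume *: "p \<in> I" "(i, j, k) \<in> t_index I m"
  then have "(j, i, k) \<in> t_index I m" using m_sym by (auto simp: t_index_def)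
  with * Ap.cls_rel[OF A_rels_intro(5)[OF *]] show ?thesis
    by (simp add: Ap.cls_mult s_elt_closed tg_closed)
qed

lemma s_polynomial:
  assumes "i \<in> I" "j \<in> I" "i \<noteq> j" "m i j = enat n"
  shows "list_prod A (map (\<lambda>k. s i \<otimes>\<^bsub>A\<^esub> s j \<ominus>\<^bsub>A\<^esub> tA (t_label m i j k)) [1..int n]) = \<zero>\<^bsub>A\<^esub>"
proof -
  let ?f = "\<lambda>k. (s_elt i \<otimes>\<^bsub>FAA\<^esub> s_elt j) \<ominus>\<^bsub>FAA\<^esub> tg (t_label m i j k)"
  have f: "?f k \<in> carrier FAA" for k
    using assms by (intro Ap.FA.minus_closed Ap.FA.m_closed s_elt_closed tg_closed t_label_index(2))
  have "Ap.cls (?f k) = s i \<otimes>\<^bsub>A\<^esub> s j \<ominus>\<^bsub>A\<^esub> tA (t_label m i j k)" for k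
    using assms t_label_index(2)[OF assms, of k]
    by (subst ring_hom_minus[OF Ap.cls_hom Ap.FA.ring_axioms Ap.PA.ring_axioms])
      (auto intro!: s_elt_closed tg_closed simp: Ap.cls_mult s_elt_closed)
  then have "list_prod A (map (\<lambda>k. s i \<otimes>\<^bsub>A\<^esub> s j \<ominus>\<^bsub>A\<^esub> tA (t_label m i j k)) [1..int n]) =
      list_prod A (map Ap.cls (map ?f [1..int n]))" by (simp add: comp_def)
  also have "\<dots> = Ap.cls (list_prod FAA (map ?f [1..int n]))"
    using f by (intro ring_hom_list_prod[symmetric, OF Ap.FA.monoid_axioms Ap.cls_hom]) auto
  also have "\<dots> = \<zero>\<^bsub>A\<^esub>"
    using Ap.cls_rel[OF A_rels_intro(3)[OF assms]] by (simp add: Ap.cls_zero)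
  finally show ?thesis .
qed

section \<open>\<open>A(M)\<close> as a left module over \<open>R\<close>\<close>

definition phi :: "('i agen list \<Rightarrow> complex) set \<Rightarrow> ('i agen list \<Rightarrow> complex) set" where
  "phi r = (\<Union>f\<in>r. Ap.cls f)"

lemma Rp_FA_subset: "f \<in> carrier Rp.FA \<Longrightarrow> f \<in> carrier FAA"
  unfolding C.fa_carrier A_gens_def by auto

text \<open>The union in the definition of \<open>phi\<close> runs over members of one class of
  \<open>R\<close>. The relations of \<open>R\<close> hold in \<open>A(M)\<close>, so all members
  have the same image and the union agrees with the map given by the universal property.\<close>

lemma phi: "phi \<in> ring_hom (R_ring I m) A" "f \<in> carrier Rp.FA \<Longrightarrow> phi (Rp.cls f) = Ap.cls f"
proof -
  note ops = free_algebra_ops[where K = complex_ring and Y = "R_gens I m" and Z = "A_gens I m"]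
  have hom: "Ap.cls \<in> ring_hom Rp.FA A"
    using Rp_FA_subset by (intro ring_hom_memI) (simp_all add: ops Ap.cls_mult Ap.cls_add Ap.cls_one)
  have rel: "Ap.cls l = Ap.cls r" if "(l, r) \<in> R_rels I m" for l r
    using that
    by (cases rule: R_rels_cases)
      (auto simp: ops intro!: Ap.cls_rel A_rels_intro)
  obtain H where H: "H \<in> ring_hom (R_ring I m) A" "\<And>f. f \<in> carrier Rp.FA \<Longrightarrow> H (Rp.cls f) = Ap.cls f"
    using Rp.PA_lift[OF Ap.PA.ring_axioms hom rel] unfolding R_ring by blast
  have phi_H: "phi (Rp.cls f) = H (Rp.cls f)" if f: "f \<in> carrier Rp.FA" for f
  proof -
    have "Ap.cls g = H (Rp.cls f)" if g: "g \<in> Rp.cls f" for g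
    proof -
      have "g \<in> carrier Rp.FA"
        using g f Rp.I.a_Hcarr by (auto simp: pa_class_def a_r_coset_def' )
      moreover have "Rp.cls g = Rp.cls f"
        using Rp.FA.a_repr_independence'[OF _ f Rp.I.a_subgroup, of g] g
        by (simp add: pa_class_def a_r_coset_def)
      ultimately show ?thesis using H(2) by metis
    qed
    moreover have "f \<in> Rp.cls f" using Rp.I.a_rcos_self[OF f] by (simp add: pa_class_def)
    ultimately show ?thesis unfolding phi_def by blast
  qed
  then have phi_eq: "phi r = H r" if "r \<in> carrier (R_ring I m)" for r
    using that unfolding R_ring by (metis Rp.PA_cases)
  show "phi \<in> ring_hom (R_ring I m) A"
    using H(1) by (intro ring_hom_memI) (simp_all add: phi_eq ring_hom_closed ring_hom_mult ring_hom_add ring_hom_one)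
  show "phi (Rp.cls f) = Ap.cls f" if "f \<in> carrier Rp.FA"
    using phi_H H(2) that by simp
qed

lemmas phi_closed [simp] = ring_hom_closed[OF phi(1)] and phi_mult = ring_hom_mult[OF phi(1)]
  and phi_add = ring_hom_add[OF phi(1)] and phi_one = ring_hom_one[OF phi(1)]

lemma phi_t: "b \<in> t_index I m \<Longrightarrow> phi (t_R b) = tA b"
  by (intro phi(2)) simp

lemma A_alg_eq: "A_alg I m = with_scalars A phi"
  by (simp add: A_alg_def phi_def[abs_def])

sublocale MA: module "R_ring I m" "A_alg I m"
  unfolding A_alg_eq by (intro with_scalars_module R.is_cring Ap.PA.ring_axioms phi(1))

lemma A_alg_simps [simp]:
  "carrier (A_alg I m) = carrier A" "\<zero>\<^bsub>A_alg I m\<^esub> = \<zero>\<^bsub>A\<^esub>"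
  "x \<oplus>\<^bsub>A_alg I m\<^esub> y = x \<oplus>\<^bsub>A\<^esub> y" "r \<odot>\<^bsub>A_alg I m\<^esub> x = phi r \<otimes>\<^bsub>A\<^esub> x"
  by (simp_all add: A_alg_eq)

definition T :: "'i list \<Rightarrow> ('i agen list \<Rightarrow> complex) set" where
  "T u = list_prod A (map s u)"

lemma T_A_eq: "T_A I m u = T u"
  unfolding T_A_def T_def A_alg_eq list_prod_def by (simp add: with_scalars_def)

lemma T_simps [simp]: "T [] = \<one>\<^bsub>A\<^esub>" "T (i # u) = s i \<otimes>\<^bsub>A\<^esub> T u"
  by (simp_all add: T_def)

lemma T_closed [simp]: "u \<in> lists I \<Longrightarrow> T u \<in> carrier A"
  by (induction u) auto

lemma T_append: "u \<in> lists I \<Longrightarrow> v \<in> lists I \<Longrightarrow> T (u @ v) = T u \<otimes>\<^bsub>A\<^esub> T v"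
  by (induction u) (auto simp: Ap.PA.m_assoc)

lemma T_rev: "u \<in> lists I \<Longrightarrow> T (rev u) \<otimes>\<^bsub>A\<^esub> T u = \<one>\<^bsub>A\<^esub>"
proof (induction u)
  case (Cons i u)
  then have "T (rev (i # u)) \<otimes>\<^bsub>A\<^esub> T (i # u) = T (rev u) \<otimes>\<^bsub>A\<^esub> ((s i \<otimes>\<^bsub>A\<^esub> s i) \<otimes>\<^bsub>A\<^esub> T u)"
    by (simp add: T_append rev_lists Ap.PA.m_assoc)
  with Cons show ?case by (simp add: s_square)
qed simp

text \<open>Letters pass scalars at the price of a twist that swaps \<open>i\<close> and
  \<open>j\<close> in the parameters. Only the existence of the new scalar is recorded, because
  spans are insensitive to which scalar appears.\<close>

lemma s_phi:
  assumes p: "p \<in> I" and r: "r \<in> carrier (R_ring I m)"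
  shows "\<exists>r'\<in>carrier (R_ring I m). s p \<otimes>\<^bsub>A\<^esub> phi r = phi r' \<otimes>\<^bsub>A\<^esub> s p"
  using r unfolding R_ring
proof (induction r rule: Rp.PA_induct)
  case (const c)
  have "phi (Rp.cls (fa_const complex_ring c)) = Ap.cls (fa_const complex_ring c)"
    by (intro phi(2) Rp.const_closed const)
  then show ?case
    using Ap.const_central[OF complex_cring const s_closed[OF p]] const
    by (intro bexI[of _ "Rp.cls (fa_const complex_ring c)"]) auto
next
  case (gen y)
  then obtain i j k where y: "y = Tgen (i, j, k)" "(i, j, k) \<in> t_index I m" by (auto simp: R_gens_def)
  have "(j, i, k) \<in> t_index I m" using y(2) m_sym by (auto simp: t_index_def)
  then show ?case
    using y s_tA[OF p y(2)] t_R_closed unfolding R_ring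
    by (intro bexI[of _ "t_R (j, i, k)"]) (simp_all add: phi_t)
next
  case (add x y)
  note [simp] = add(1,2)[folded R_ring]
  obtain x' y' where "x' \<in> carrier (R_ring I m)" "s p \<otimes>\<^bsub>A\<^esub> phi x = phi x' \<otimes>\<^bsub>A\<^esub> s p"
    "y' \<in> carrier (R_ring I m)" "s p \<otimes>\<^bsub>A\<^esub> phi y = phi y' \<otimes>\<^bsub>A\<^esub> s p"
    using add(3,4) unfolding R_ring by blast
  then show ?case
    unfolding R_ring[symmetric] using p
    by (intro bexI[of _ "x' \<oplus>\<^bsub>R_ring I m\<^esub> y'"]) (simp_all add: phi_add Ap.PA.l_distr Ap.PA.r_distr)
next
  case (mult x y)
  note [simp] = mult(1,2)[folded R_ring]
  obtain x' y' where xy: "x' \<in> carrier (R_ring I m)" "s p \<otimes>\<^bsub>A\<^esub> phi x = phi x' \<otimes>\<^bsub>A\<^esub> s p"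
    "y' \<in> carrier (R_ring I m)" "s p \<otimes>\<^bsub>A\<^esub> phi y = phi y' \<otimes>\<^bsub>A\<^esub> s p"
    using mult(3,4) unfolding R_ring by blast
  have "s p \<otimes>\<^bsub>A\<^esub> phi (x \<otimes>\<^bsub>R_ring I m\<^esub> y) = (s p \<otimes>\<^bsub>A\<^esub> phi x) \<otimes>\<^bsub>A\<^esub> phi y"
    using p by (simp add: phi_mult Ap.PA.m_assoc)
  also have "\<dots> = phi x' \<otimes>\<^bsub>A\<^esub> (s p \<otimes>\<^bsub>A\<^esub> phi y)"
    using p xy(1) by (simp add: xy(2) Ap.PA.m_assoc)
  also have "\<dots> = phi (x' \<otimes>\<^bsub>R_ring I m\<^esub> y') \<otimes>\<^bsub>A\<^esub> s p"
    using p xy(1,3) by (simp add: xy(4) Ap.PA.m_assoc phi_mult)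
  finally show ?case
    unfolding R_ring[symmetric] using xy by (intro bexI[of _ "x' \<otimes>\<^bsub>R_ring I m\<^esub> y'"]) simp_all
qed

section \<open>Left spans of words and the length filtration\<close>

abbreviation "rspan B \<equiv> module_span (R_ring I m) (A_alg I m) B"
abbreviation "submod N \<equiv> submodule N (R_ring I m) (A_alg I m)"

lemma submodD:
  assumes "submod N"
  shows "N \<subseteq> carrier A" "\<zero>\<^bsub>A\<^esub> \<in> N" "x \<in> N \<Longrightarrow> y \<in> N \<Longrightarrow> x \<oplus>\<^bsub>A\<^esub> y \<in> N"
    "r \<in> carrier (R_ring I m) \<Longrightarrow> x \<in> N \<Longrightarrow> phi r \<otimes>\<^bsub>A\<^esub> x \<in> N"
  using MA.submoduleE[OF assms] MA.submodule_finsum[OF assms, of "\<lambda>_. undefined" "{}"] by auto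

text \<open>Although left multiplication by \<open>s p\<close> is not linear, \<open>s_phi\<close>
  makes the preimage of a submodule a submodule; it is therefore enough to look at
  generators.\<close>

lemma span_left_mult:
  assumes B: "B \<subseteq> carrier A" and N: "submod N" and p: "p \<in> I"
    and gen: "\<And>b. b \<in> B \<Longrightarrow> s p \<otimes>\<^bsub>A\<^esub> b \<in> N" and x: "x \<in> rspan B"
  shows "s p \<otimes>\<^bsub>A\<^esub> x \<in> N"
proof -
  let ?H = "{x \<in> carrier A. s p \<otimes>\<^bsub>A\<^esub> x \<in> N}"
  have "submod ?H"
  proof (rule MA.submodule_by_closure)
    fix r x assume r: "r \<in> carrier (R_ring I m)" and x: "x \<in> ?H"
    obtain r' where r': "r' \<in> carrier (R_ring I m)" "s p \<otimes>\<^bsub>A\<^esub> phi r = phi r' \<otimes>\<^bsub>A\<^esub> s p"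
      using s_phi[OF p r] by blast
    have "s p \<otimes>\<^bsub>A\<^esub> (phi r \<otimes>\<^bsub>A\<^esub> x) = phi r' \<otimes>\<^bsub>A\<^esub> (s p \<otimes>\<^bsub>A\<^esub> x)"
      using p r r' x by (simp flip: Ap.PA.m_assoc)
    then show "r \<odot>\<^bsub>A_alg I m\<^esub> x \<in> ?H" using x r r' submodD(4)[OF N] by simp
  qed (use p submodD[OF N] in \<open>auto simp: Ap.PA.r_distr\<close>)
  moreover have "B \<subseteq> ?H" using B gen by auto
  ultimately show ?thesis using MA.span_minimal x by blast
qed

lemma span_right_mult:
  assumes B: "B \<subseteq> carrier A" and N: "submod N" and y: "y \<in> carrier A"
    and gen: "\<And>b. b \<in> B \<Longrightarrow> b \<otimes>\<^bsub>A\<^esub> y \<in> N" and x: "x \<in> rspan B"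
  shows "x \<otimes>\<^bsub>A\<^esub> y \<in> N"
proof -
  let ?H = "{x \<in> carrier A. x \<otimes>\<^bsub>A\<^esub> y \<in> N}"
  have "submod ?H"
    by (rule MA.submodule_by_closure) (use y submodD[OF N] in \<open>auto simp: Ap.PA.l_distr Ap.PA.m_assoc\<close>)
  moreover have "B \<subseteq> ?H" using B gen by auto
  ultimately show ?thesis using MA.span_minimal x by blast
qed

definition lower :: "nat \<Rightarrow> ('i agen list \<Rightarrow> complex) set set" where
  "lower n = rspan (T ` {u \<in> lists I. length u < n})"

lemma T_subset: "U \<subseteq> lists I \<Longrightarrow> T ` U \<subseteq> carrier A"
  using T_closed by blast

lemma span_T_submod: "U \<subseteq> lists I \<Longrightarrow> submod (rspan (T ` U))"
  using T_subset by (intro MA.span_submodule) simp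

lemma span_T_base: "U \<subseteq> lists I \<Longrightarrow> u \<in> U \<Longrightarrow> T u \<in> rspan (T ` U)"
  using T_subset by (intro MA.span_base) auto

lemma lower_submod: "submod (lower n)"
  unfolding lower_def by (rule span_T_submod) auto

lemma lower_base: "u \<in> lists I \<Longrightarrow> length u < n \<Longrightarrow> T u \<in> lower n"
  unfolding lower_def by (rule span_T_base) auto

lemma lower_subset: "lower n \<subseteq> carrier A"
  using submodD(1)[OF lower_submod] .

lemma lower_left:
  assumes p: "p \<in> I" and x: "x \<in> lower n"
  shows "s p \<otimes>\<^bsub>A\<^esub> x \<in> lower (Suc n)"
proof (rule span_left_mult[OF T_subset lower_submod p _ x[unfolded lower_def]])
  fix b assume "b \<in> T ` {u \<in> lists I. length u < n}"
  then obtain u where "u \<in> lists I" "length u < n" "b = T u" by blast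
  then show "s p \<otimes>\<^bsub>A\<^esub> b \<in> lower (Suc n)" using lower_base[of "p # u" "Suc n"] p by simp
qed auto

lemma lower_right:
  assumes z: "z \<in> lists I" and x: "x \<in> lower n"
  shows "x \<otimes>\<^bsub>A\<^esub> T z \<in> lower (n + length z)"
proof (rule span_right_mult[OF T_subset lower_submod T_closed[OF z] _ x[unfolded lower_def]])
  fix b assume "b \<in> T ` {u \<in> lists I. length u < n}"
  then obtain u where u: "u \<in> lists I" "length u < n" "b = T u" by blast
  then have "T (u @ z) \<in> lower (n + length z)" using z by (intro lower_base) auto
  then show "b \<otimes>\<^bsub>A\<^esub> T z \<in> lower (n + length z)" using u z by (simp add: T_append)
qed auto

text \<open>The letters at the junction cancel in pairs until one factor is used up, and an
  alternating word of length \<open>|n - 2 l|\<close> remains. For \<open>0 < l < n\<close> this is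
  shorter than \<open>n\<close>, while \<open>l = 0\<close> leaves the second factor
  unchanged.\<close>

lemma T_alternating_reduce:
  assumes ij: "i \<in> I" "j \<in> I" and l: "l < n"
  shows "T (alternating i j (2 * l)) \<otimes>\<^bsub>A\<^esub> T (alternating j i n) \<in>
    rspan (T ` (insert (alternating j i n) {u \<in> lists I. length u < n}))" (is "_ \<in> ?D")
proof -
  have sub: "insert (alternating j i n) {u \<in> lists I. length u < n} \<subseteq> lists I"
    using alternating_in_lists[OF ij(2,1)] by auto
  have al: "alternating i j k \<in> lists I" "alternating j i k \<in> lists I" for k
    using ij alternating_in_lists by metis+
  have rev_alt: "alternating i j (2 * l) = rev (alternating j i (2 * l))" for l
  proof -
    have "rev (alternating j i (2 * l)) = rev (alternating j i l @ rev (alternating i j l))"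
      by (simp only: alternating_double)
    then show ?thesis by (simp add: alternating_double)
  qed
  show ?thesis
  proof (cases "l = 0")
    case True
    then show ?thesis using al span_T_base[OF sub] by simp
  next
    case False
    show ?thesis
    proof (cases "2 * l \<le> n")
      case True
      let ?z = "alternating j i (n - 2 * l)"
      have "alternating j i n = alternating j i (2 * l) @ ?z"
        using alternating_add_even[of j i l "n - 2 * l"] True by simp
      then have "T (alternating i j (2 * l)) \<otimes>\<^bsub>A\<^esub> T (alternating j i n) =
          (T (rev (alternating j i (2 * l))) \<otimes>\<^bsub>A\<^esub> T (alternating j i (2 * l))) \<otimes>\<^bsub>A\<^esub> T ?z"
        using al rev_lists[OF al(2)] by (simp add: T_append rev_alt Ap.PA.m_assoc)
      also have "\<dots> = T ?z" using al by (simp add: T_rev)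
      finally show ?thesis using al span_T_base[OF sub, of ?z] False l True by simp
    next
      case 2: False
      let ?x = "take (2 * l - n) (alternating i j (2 * l))"
      have x: "?x = alternating i j (2 * l - n)"
        by (simp add: alternating_take)
      have "drop (2 * l - n) (alternating i j (2 * l)) = rev (take n (alternating j i (2 * l)))"
        unfolding rev_alt[of l] using 2 by (simp add: rev_take)
      also have "take n (alternating j i (2 * l)) = alternating j i n"
        using 2 by (simp add: alternating_take)
      finally have "alternating i j (2 * l) = alternating i j (2 * l - n) @ rev (alternating j i n)"
        using append_take_drop_id[of "2 * l - n" "alternating i j (2 * l)"] x by simp
      then have "T (alternating i j (2 * l)) \<otimes>\<^bsub>A\<^esub> T (alternating j i n) =
          T (alternating i j (2 * l - n)) \<otimes>\<^bsub>A\<^esub> (T (rev (alternating j i n)) \<otimes>\<^bsub>A\<^esub> T (alternating j i n))"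
        using al rev_lists[OF al(2)] by (simp add: T_append Ap.PA.m_assoc)
      also have "\<dots> = T (alternating i j (2 * l - n))" using al by (simp add: T_rev)
      moreover have "alternating i j (2 * l - n) \<in> {u \<in> lists I. length u < n}"
        using al l 2 by simp
      ultimately show ?thesis using span_T_base[OF sub, of "alternating i j (2 * l - n)"] by simp
    qed
  qed
qed

text \<open>Expansion of the product with coefficients on the left: a monic leading power of
  \<open>s\<^sub>i s\<^sub>j\<close> and a combination of lower powers. It is stated for arbitrary
  lists of labels to allow induction.\<close>

lemma polynomial_leading_term:
  assumes ij: "i \<in> I" "j \<in> I" "i \<noteq> j" "m i j = enat n"
  shows "\<exists>g\<in>rspan (T ` ((\<lambda>l. alternating i j (2 * l)) ` {..<length ks})).
    list_prod A (map (\<lambda>k. s i \<otimes>\<^bsub>A\<^esub> s j \<ominus>\<^bsub>A\<^esub> tA (t_label m i j k)) ks) = T (alternating i j (2 * length ks)) \<oplus>\<^bsub>A\<^esub> g"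
proof (induction ks)
  case Nil
  have "\<zero>\<^bsub>A\<^esub> \<in> rspan {}" using MA.span_submodule[of "{}"] submodD(2) by blast
  then show ?case by (intro bexI[of _ "\<zero>\<^bsub>A\<^esub>"]) auto
next
  case (Cons k ks)
  let ?W = "\<lambda>r. (\<lambda>l. alternating i j (2 * l)) ` {..<r}" and ?r = "length ks"
  have W: "?W r \<subseteq> lists I" for r using alternating_in_lists[OF ij(1,2)] by (simp add: image_subset_iff del: in_lists_conv_set)
  note sub = span_T_submod[OF W]
  obtain g where g: "g \<in> rspan (T ` ?W ?r)"
    and eq: "list_prod A (map (\<lambda>k. s i \<otimes>\<^bsub>A\<^esub> s j \<ominus>\<^bsub>A\<^esub> tA (t_label m i j k)) ks) = T (alternating i j (2 * ?r)) \<oplus>\<^bsub>A\<^esub> g"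
    using Cons by blast
  let ?b = "t_label m i j k" and ?p = "T (alternating i j (2 * ?r))"
  have b: "?b \<in> t_index I m" using t_label_index(2)[OF ij] .
  have gA: "g \<in> carrier A" using g submodD(1)[OF sub] by blast
  have pA: "?p \<in> carrier A" using ij by (intro T_closed alternating_in_lists)
  have mono: "rspan (T ` ?W ?r) \<subseteq> rspan (T ` ?W (Suc ?r))"
    by (intro MA.span_mono image_mono) auto
  \<comment> \<open>Each letter twists the coefficients, so the factors \<open>s j\<close> and
    \<open>s i\<close> are applied separately, passing through words that start with
    \<open>j\<close>.\<close>
  have step: "s i \<otimes>\<^bsub>A\<^esub> (s j \<otimes>\<^bsub>A\<^esub> x) \<in> rspan (T ` ?W (Suc ?r))" if x: "x \<in> rspan (T ` ?W ?r)" for x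
  proof -
    let ?V = "(\<lambda>l. j # alternating i j (2 * l)) ` {..<?r}"
    have V: "?V \<subseteq> lists I"
      using ij alternating_in_lists[OF ij(1,2)] by (simp add: image_subset_iff del: in_lists_conv_set)
    have "s j \<otimes>\<^bsub>A\<^esub> x \<in> rspan (T ` ?V)"
    proof (rule span_left_mult[OF T_subset[OF W] span_T_submod[OF V] ij(2) _ x])
      show "s j \<otimes>\<^bsub>A\<^esub> y \<in> rspan (T ` ?V)" if y: "y \<in> T ` ?W ?r" for y
      proof -
        obtain l where "l < ?r" "y = T (alternating i j (2 * l))" using y by auto
        then show ?thesis using span_T_base[OF V, of "j # alternating i j (2 * l)"] by simp
      qed
    qed
    then show ?thesis
    proof (rule span_left_mult[OF T_subset[OF V] sub ij(1), rotated])
      show "s i \<otimes>\<^bsub>A\<^esub> y \<in> rspan (T ` ?W (Suc ?r))" if y: "y \<in> T ` ?V" for y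
      proof -
        obtain l where l: "l < ?r" "y = T (j # alternating i j (2 * l))" using y by auto
        then have "s i \<otimes>\<^bsub>A\<^esub> y = T (alternating i j (2 * Suc l))" by simp
        moreover have "alternating i j (2 * Suc l) \<in> ?W (Suc ?r)" using l by blast
        ultimately show ?thesis using span_T_base[OF W] by metis
      qed
    qed
  qed
  let ?h = "s i \<otimes>\<^bsub>A\<^esub> (s j \<otimes>\<^bsub>A\<^esub> g) \<ominus>\<^bsub>A\<^esub> (tA ?b \<otimes>\<^bsub>A\<^esub> (?p \<oplus>\<^bsub>A\<^esub> g))"
  have "list_prod A (map (\<lambda>k. s i \<otimes>\<^bsub>A\<^esub> s j \<ominus>\<^bsub>A\<^esub> tA (t_label m i j k)) (k # ks)) =
      (s i \<otimes>\<^bsub>A\<^esub> s j \<ominus>\<^bsub>A\<^esub> tA ?b) \<otimes>\<^bsub>A\<^esub> (?p \<oplus>\<^bsub>A\<^esub> g)"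
    by (simp add: eq)
  also have "\<dots> = s i \<otimes>\<^bsub>A\<^esub> (s j \<otimes>\<^bsub>A\<^esub> ?p) \<oplus>\<^bsub>A\<^esub> ?h"
    using ij b gA pA
    by (simp add: Ap.PA.minus_eq Ap.PA.l_distr Ap.PA.r_distr Ap.PA.l_minus Ap.PA.m_assoc Ap.PA.minus_add Ap.PA.a_ac)
  also have "s i \<otimes>\<^bsub>A\<^esub> (s j \<otimes>\<^bsub>A\<^esub> ?p) = T (alternating i j (2 * length (k # ks)))" by simp
  finally have eq': "list_prod A (map (\<lambda>k. s i \<otimes>\<^bsub>A\<^esub> s j \<ominus>\<^bsub>A\<^esub> tA (t_label m i j k)) (k # ks)) =
      T (alternating i j (2 * length (k # ks))) \<oplus>\<^bsub>A\<^esub> ?h" .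
  have "?p \<in> rspan (T ` ?W (Suc ?r))" by (rule span_T_base[OF W]) auto
  then have "?p \<oplus>\<^bsub>A\<^esub> g \<in> rspan (T ` ?W (Suc ?r))" using g mono submodD(3)[OF sub] by blast
  then have "phi (\<ominus>\<^bsub>R_ring I m\<^esub> t_R ?b) \<otimes>\<^bsub>A\<^esub> (?p \<oplus>\<^bsub>A\<^esub> g) \<in> rspan (T ` ?W (Suc ?r))"
    using b by (intro submodD(4)[OF sub]) auto
  also have "phi (\<ominus>\<^bsub>R_ring I m\<^esub> t_R ?b) = \<ominus>\<^bsub>A\<^esub> tA ?b"
  proof -
    interpret phi: ring_hom_ring "R_ring I m" A phi
      by (rule ring_hom_ringI2[OF R.ring_axioms Ap.PA.ring_axioms phi(1)])
    show ?thesis using b by (simp add: phi_t)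
  qed
  finally have "\<ominus>\<^bsub>A\<^esub> tA ?b \<otimes>\<^bsub>A\<^esub> (?p \<oplus>\<^bsub>A\<^esub> g) \<in> rspan (T ` ?W (Suc ?r))" .
  then have "?h \<in> rspan (T ` ?W (length (k # ks)))"
    using submodD(3)[OF sub step[OF g]] b gA pA by (simp add: Ap.PA.minus_eq Ap.PA.l_minus)
  with eq' show ?case by blast
qed

text \<open>The polynomial relation is multiplied from the right by the alternating word of length
  \<open>n\<close> starting with \<open>j\<close>. It cancels the second half of the leading word,
  leaving the alternating word that starts with \<open>i\<close>. The lower powers become shorter
  words, except for the zeroth power, which is the source of the multiple of the other alternating
  word.\<close>

lemma T_braid:
  assumes ij: "i \<in> I" "j \<in> I" "i \<noteq> j" "m i j = enat n"
  obtains r g where "r \<in> carrier (R_ring I m)" "g \<in> lower n"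
    "T (alternating i j n) = phi r \<otimes>\<^bsub>A\<^esub> T (alternating j i n) \<oplus>\<^bsub>A\<^esub> g"
proof -
  let ?D = "rspan (T ` (insert (alternating j i n) {u \<in> lists I. length u < n}))"
  let ?W = "(\<lambda>l. alternating i j (2 * l)) ` {..<n}"
  have W: "?W \<subseteq> lists I" using alternating_in_lists[OF ij(1,2)] by (simp add: image_subset_iff del: in_lists_conv_set)
  have al: "alternating i j k \<in> lists I" "alternating j i k \<in> lists I" for k
    using ij alternating_in_lists by metis+
  have D: "submod ?D" by (rule span_T_submod) (use al in auto)
  obtain g where g: "g \<in> rspan (T ` ?W)" "T (alternating i j (2 * n)) \<oplus>\<^bsub>A\<^esub> g = \<zero>\<^bsub>A\<^esub>"
    using polynomial_leading_term[OF ij, of "[1..int n]"] s_polynomial[OF ij] by auto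
  have gA: "g \<in> carrier A" using g submodD(1)[OF span_T_submod[OF W]] by blast
  let ?y = "T (alternating j i n)"
  have yA: "?y \<in> carrier A" using al by simp
  have gy: "g \<otimes>\<^bsub>A\<^esub> ?y \<in> ?D"
    using span_right_mult[OF T_subset[OF W] D yA _ g(1)] T_alternating_reduce[OF ij(1,2)] by auto
  have "T (alternating i j (2 * n)) \<otimes>\<^bsub>A\<^esub> ?y = T (alternating i j n) \<otimes>\<^bsub>A\<^esub> (T (rev (alternating j i n)) \<otimes>\<^bsub>A\<^esub> ?y)"
    unfolding alternating_double using al rev_lists[OF al(2)] by (simp add: T_append Ap.PA.m_assoc)
  also have "\<dots> = T (alternating i j n)" using al by (simp add: T_rev)
  finally have "T (alternating i j n) \<oplus>\<^bsub>A\<^esub> g \<otimes>\<^bsub>A\<^esub> ?y = \<zero>\<^bsub>A\<^esub>"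
    using g(2) gA yA al by (metis Ap.PA.l_distr Ap.PA.l_null T_closed)
  then have "T (alternating i j n) = \<ominus>\<^bsub>A\<^esub> (g \<otimes>\<^bsub>A\<^esub> ?y)"
    using gA yA al by (metis Ap.PA.m_closed Ap.PA.minus_equality T_closed)
  also have "\<dots> = \<ominus>\<^bsub>A_alg I m\<^esub> (g \<otimes>\<^bsub>A\<^esub> ?y)"
    by (simp add: a_inv_def m_inv_def A_alg_eq)
  also have "\<dots> \<in> ?D" using MA.submoduleE(3)[OF D gy] .
  finally have "T (alternating i j n) \<in> rspan (insert ?y (T ` {u \<in> lists I. length u < n}))" by simp
  then obtain r h where "r \<in> carrier (R_ring I m)" "h \<in> lower n" "T (alternating i j n) = phi r \<otimes>\<^bsub>A\<^esub> ?y \<oplus>\<^bsub>A\<^esub> h"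
    unfolding lower_def using MA.span_insert[of "T ` {u \<in> lists I. length u < n}" ?y] yA T_subset by auto
  with that show thesis by blast
qed

definition congruent_mod_lower :: "'i list \<Rightarrow> 'i list \<Rightarrow> bool" where
  "congruent_mod_lower u v \<longleftrightarrow> u \<in> lists I \<and> v \<in> lists I \<and> length u = length v \<and>
    (\<exists>r\<in>carrier (R_ring I m). \<exists>g\<in>lower (length u). T u = phi r \<otimes>\<^bsub>A\<^esub> T v \<oplus>\<^bsub>A\<^esub> g)"

lemma congruent_Cons:
  assumes i: "i \<in> I" and c: "congruent_mod_lower u v"
  shows "congruent_mod_lower (i # u) (i # v)"
proof -
  obtain r g where uv: "u \<in> lists I" "v \<in> lists I" "length u = length v" "r \<in> carrier (R_ring I m)"
    "g \<in> lower (length u)" "T u = phi r \<otimes>\<^bsub>A\<^esub> T v \<oplus>\<^bsub>A\<^esub> g" using c by (auto simp: congruent_mod_lower_def)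
  obtain r' where r': "r' \<in> carrier (R_ring I m)" "s i \<otimes>\<^bsub>A\<^esub> phi r = phi r' \<otimes>\<^bsub>A\<^esub> s i"
    using s_phi[OF i uv(4)] by blast
  have gA: "g \<in> carrier A" using uv lower_subset by blast
  have "T (i # u) = (s i \<otimes>\<^bsub>A\<^esub> phi r) \<otimes>\<^bsub>A\<^esub> T v \<oplus>\<^bsub>A\<^esub> s i \<otimes>\<^bsub>A\<^esub> g"
    using i uv gA by (simp add: Ap.PA.r_distr Ap.PA.m_assoc)
  also have "(s i \<otimes>\<^bsub>A\<^esub> phi r) \<otimes>\<^bsub>A\<^esub> T v = phi r' \<otimes>\<^bsub>A\<^esub> T (i # v)"
    unfolding r'(2) using i r' uv by (simp add: Ap.PA.m_assoc)
  finally have eq: "T (i # u) = phi r' \<otimes>\<^bsub>A\<^esub> T (i # v) \<oplus>\<^bsub>A\<^esub> s i \<otimes>\<^bsub>A\<^esub> g" .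
  have "s i \<otimes>\<^bsub>A\<^esub> g \<in> lower (length (i # u))" using lower_left[OF i uv(5)] by simp
  with eq uv(1-3) r'(1) i show ?thesis unfolding congruent_mod_lower_def by auto
qed

lemma reduced_congruent:
  assumes "reduced u" "reduced v" "u \<doteq> v"
  shows "congruent_mod_lower u v"
proof (rule matsumoto[OF _ _ _ _ assms])
  show "congruent_mod_lower u u" if "u \<in> lists I" for u
    unfolding congruent_mod_lower_def using that submodD(2)[OF lower_submod]
    by (intro conjI bexI[of _ "\<one>\<^bsub>R_ring I m\<^esub>"] bexI[of _ "\<zero>\<^bsub>A\<^esub>"]) (auto simp: phi_one)
next
  fix u v v' assume "congruent_mod_lower u v" "congruent_mod_lower v v'"
  then obtain r g r' g' where uv: "u \<in> lists I" "v \<in> lists I" "length u = length v" "r \<in> carrier (R_ring I m)"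
    "g \<in> lower (length u)" "T u = phi r \<otimes>\<^bsub>A\<^esub> T v \<oplus>\<^bsub>A\<^esub> g"
    and vv: "v' \<in> lists I" "length v = length v'" "r' \<in> carrier (R_ring I m)"
    "g' \<in> lower (length v)" "T v = phi r' \<otimes>\<^bsub>A\<^esub> T v' \<oplus>\<^bsub>A\<^esub> g'"
    by (auto simp: congruent_mod_lower_def)
  have gA: "g \<in> carrier A" "g' \<in> carrier A" using uv vv lower_subset by blast+
  have "T u = phi (r \<otimes>\<^bsub>R_ring I m\<^esub> r') \<otimes>\<^bsub>A\<^esub> T v' \<oplus>\<^bsub>A\<^esub> (phi r \<otimes>\<^bsub>A\<^esub> g' \<oplus>\<^bsub>A\<^esub> g)"
    unfolding uv(6) vv(5) using uv(1-5) vv(1-4) gA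
    by (simp add: phi_mult Ap.PA.r_distr Ap.PA.m_assoc Ap.PA.a_assoc)
  moreover have "phi r \<otimes>\<^bsub>A\<^esub> g' \<oplus>\<^bsub>A\<^esub> g \<in> lower (length u)"
    using uv vv submodD(3,4)[OF lower_submod] by simp
  ultimately show "congruent_mod_lower u v'"
    unfolding congruent_mod_lower_def using uv vv R.m_closed by auto
next
  show "congruent_mod_lower (i # u) (i # v)" if "i \<in> I" "congruent_mod_lower u v" for i u v
    using that by (rule congruent_Cons)
next
  fix i j n z assume ij: "i \<in> I" "j \<in> I" "i \<noteq> j" "m i j = enat n" and z: "z \<in> lists I"
  have al: "alternating i j n \<in> lists I" "alternating j i n \<in> lists I"
    using ij alternating_in_lists by metis+
  obtain r g where rg: "r \<in> carrier (R_ring I m)" "g \<in> lower n"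
    "T (alternating i j n) = phi r \<otimes>\<^bsub>A\<^esub> T (alternating j i n) \<oplus>\<^bsub>A\<^esub> g" by (rule T_braid[OF ij])
  have gA: "g \<in> carrier A" using rg lower_subset by blast
  have "T (alternating i j n @ z) = phi r \<otimes>\<^bsub>A\<^esub> T (alternating j i n @ z) \<oplus>\<^bsub>A\<^esub> g \<otimes>\<^bsub>A\<^esub> T z"
    using al z rg(1) gA by (simp add: T_append rg(3) Ap.PA.l_distr Ap.PA.m_assoc)
  moreover have "g \<otimes>\<^bsub>A\<^esub> T z \<in> lower (length (alternating i j n @ z))"
    using lower_right[OF z rg(2)] by simp
  ultimately show "congruent_mod_lower (alternating i j n @ z) (alternating j i n @ z)"
    unfolding congruent_mod_lower_def using al z rg(1) by auto
qed

text \<open>After a nonreduced suffix is split off by \<open>nonreduced_cases\<close>, its tail is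
  rewritten, modulo shorter words, to begin with the letter \<open>i\<close> that precedes it. The
  square \<open>s\<^sub>i s\<^sub>i = 1\<close> then removes two letters.\<close>

lemma nonreduced_lower:
  assumes u: "u \<in> lists I" "\<not> reduced u"
  shows "T u \<in> lower (length u)"
proof -
  obtain p i v v' where v: "u = p @ i # v" "i \<in> I" "reduced v" "reduced (i # v')" "v \<doteq> i # v'"
    using nonreduced_cases[OF u] by blast
  have l: "v \<in> lists I" "v' \<in> lists I" "p \<in> lists I"
    using reduced_lists[OF v(3)] reduced_lists[OF v(4)] u v(1) by auto
  obtain r g where rg: "length v = Suc (length v')" "r \<in> carrier (R_ring I m)" "g \<in> lower (length v)"
    "T v = phi r \<otimes>\<^bsub>A\<^esub> (s i \<otimes>\<^bsub>A\<^esub> T v') \<oplus>\<^bsub>A\<^esub> g"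
    using reduced_congruent[OF v(3,4,5)] by (auto simp: congruent_mod_lower_def)
  obtain r' where r': "r' \<in> carrier (R_ring I m)" "s i \<otimes>\<^bsub>A\<^esub> phi r = phi r' \<otimes>\<^bsub>A\<^esub> s i"
    using s_phi[OF v(2) rg(2)] by blast
  have gA: "g \<in> carrier A" using rg lower_subset by blast
  have "T (i # v) = (s i \<otimes>\<^bsub>A\<^esub> phi r) \<otimes>\<^bsub>A\<^esub> (s i \<otimes>\<^bsub>A\<^esub> T v') \<oplus>\<^bsub>A\<^esub> s i \<otimes>\<^bsub>A\<^esub> g"
    using v l rg(2) gA by (simp add: rg(4) Ap.PA.r_distr Ap.PA.m_assoc)
  also have "(s i \<otimes>\<^bsub>A\<^esub> phi r) \<otimes>\<^bsub>A\<^esub> (s i \<otimes>\<^bsub>A\<^esub> T v') = phi r' \<otimes>\<^bsub>A\<^esub> ((s i \<otimes>\<^bsub>A\<^esub> s i) \<otimes>\<^bsub>A\<^esub> T v')"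
    unfolding r'(2) using v l r' by (simp add: Ap.PA.m_assoc)
  also have "(s i \<otimes>\<^bsub>A\<^esub> s i) \<otimes>\<^bsub>A\<^esub> T v' = T v'" using v l by (simp add: s_square)
  finally have eq: "T (i # v) = phi r' \<otimes>\<^bsub>A\<^esub> T v' \<oplus>\<^bsub>A\<^esub> s i \<otimes>\<^bsub>A\<^esub> g" .
  have "T v' \<in> lower (Suc (length v))" using l rg(1) by (intro lower_base) auto
  then have iv: "T (i # v) \<in> lower (length (i # v))"
    unfolding eq using lower_left[OF v(2) rg(3)] r' submodD(3,4)[OF lower_submod] by simp
  have "T (p @ i # v) \<in> lower (length (p @ i # v))"
    using l(3)
  proof (induction p)
    case Nil
    then show ?case using iv by simp
  next
    case (Cons q p)
    then show ?case using lower_left[of q "T (p @ i # v)"] by simp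
  qed
  with v show ?thesis by simp
qed

section \<open>Chosen reduced words span \<open>A(M)\<close>\<close>

lemma w_lists:
  assumes "\<And>x. x \<in> carrier (cox_group I m) \<Longrightarrow> reduced_word_for x (w x)"
  shows "w ` carrier (cox_group I m) \<subseteq> lists I"
proof
  fix v assume "v \<in> w ` carrier (cox_group I m)"
  then obtain u where "u \<in> lists I" "v = w (word_class u)" "word_class u \<in> carrier (cox_group I m)"
    unfolding carrier_cox_group by blast
  then show "v \<in> lists I"
    using reduced_lists[OF reduced_word_for_class(1)[of u v]] assms[of "word_class u"] by blast
qed

lemma T_in_span_reduced:
  assumes w: "\<And>x. x \<in> carrier (cox_group I m) \<Longrightarrow> reduced_word_for x (w x)" and u: "u \<in> lists I"
  shows "T u \<in> rspan (T ` w ` carrier (cox_group I m))"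
  using u
proof (induction "length u" arbitrary: u rule: less_induct)
  case less
  let ?W = "w ` carrier (cox_group I m)"
  have W: "?W \<subseteq> lists I"
    by (rule w_lists[OF w])
  note sub = span_T_submod[OF W]
  have low: "lower (length u) \<subseteq> rspan (T ` ?W)"
    unfolding lower_def using less.hyps by (intro MA.span_minimal[OF sub]) auto
  show ?case
  proof (cases "reduced u")
    case False
    then show ?thesis using nonreduced_lower less.prems low by blast
  next
    case True
    have x: "word_class u \<in> carrier (cox_group I m)" using less.prems by (auto simp: carrier_cox_group)
    let ?v = "w (word_class u)"
    have "reduced ?v" "u \<doteq> ?v" using reduced_word_for_class[OF less.prems w[OF x]] by auto
    then obtain r g where "r \<in> carrier (R_ring I m)" "g \<in> lower (length u)" "T u = phi r \<otimes>\<^bsub>A\<^esub> T ?v \<oplus>\<^bsub>A\<^esub> g"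
      using reduced_congruent[OF True, of ?v] by (auto simp: congruent_mod_lower_def)
    moreover have "T ?v \<in> rspan (T ` ?W)" using x by (intro span_T_base[OF W]) auto
    ultimately show ?thesis using low submodD(3,4)[OF sub] by auto
  qed
qed

text \<open>The span of all words contains the constants and the generators. It is closed under
  products: right multiplication is linear, which reduces the left factor to a word, and a word acts
  from the left one letter at a time.\<close>

lemma A_spanned:
  assumes w: "\<And>x. x \<in> carrier (cox_group I m) \<Longrightarrow> reduced_word_for x (w x)"
  shows "carrier A \<subseteq> rspan (T ` w ` carrier (cox_group I m))"
proof -
  let ?S = "rspan (T ` lists I)"
  note sub = span_T_submod[OF order_refl]
  have one: "\<one>\<^bsub>A\<^esub> \<in> ?S" using span_T_base[OF order_refl, of "[]"] by simp
  have left: "T u \<otimes>\<^bsub>A\<^esub> y \<in> ?S" if "u \<in> lists I" "y \<in> ?S" for u y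
    using that(1)
  proof (induction u)
    case Nil
    then show ?case using that submodD(1)[OF sub] by auto
  next
    case (Cons i u)
    have yA: "y \<in> carrier A" using that submodD(1)[OF sub] by auto
    have "s i \<otimes>\<^bsub>A\<^esub> (T u \<otimes>\<^bsub>A\<^esub> y) \<in> ?S"
    proof (rule span_left_mult[OF T_subset[OF order_refl] sub])
      show "s i \<otimes>\<^bsub>A\<^esub> b \<in> ?S" if b: "b \<in> T ` lists I" for b
      proof -
        obtain v where "v \<in> lists I" "b = T v" using b by blast
        then show ?thesis using span_T_base[OF order_refl, of "i # v"] Cons.hyps by simp
      qed
    qed (use Cons in auto)
    then show ?case using Cons.hyps yA by (simp add: Ap.PA.m_assoc)
  qed
  have "x \<in> ?S" if "x \<in> carrier A" for x
    using that
  proof (induction x rule: Ap.PA_induct)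
    case (const c)
    have "Ap.cls (fa_const complex_ring c) = phi (Rp.cls (fa_const complex_ring c)) \<otimes>\<^bsub>A\<^esub> \<one>\<^bsub>A\<^esub>"
      using const by (simp add: phi(2))
    moreover have "Rp.cls (fa_const complex_ring c) \<in> carrier (R_ring I m)"
      unfolding R_ring using const by (intro Rp.cls_closed Rp.const_closed)
    ultimately show ?case using submodD(4)[OF sub _ one] by (simp only:)
  next
    case (gen y)
    then consider i where "i \<in> I" "y = Sgen i" | b where "b \<in> t_index I m" "y = Tgen b"
      by (auto simp: A_gens_def R_gens_def)
    then show ?case
    proof cases
      case 1
      then show ?thesis using span_T_base[OF order_refl, of "[i]"] by (simp add: s_elt_def)
    next
      case 2
      then have "Ap.cls (fa_gen complex_ring y) = phi (t_R b) \<otimes>\<^bsub>A\<^esub> \<one>\<^bsub>A\<^esub>" by (simp add: phi_t)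
      then show ?thesis using submodD(4)[OF sub t_R_closed[OF 2(1)] one] by (simp only:)
    qed
  next
    case (add x y)
    then show ?case using submodD(3)[OF sub] by blast
  next
    case (mult x y)
    then show ?case
      using left by (intro span_right_mult[OF T_subset[OF order_refl] sub _ _ mult(3)]) auto
  qed
  moreover have "?S \<subseteq> rspan (T ` w ` carrier (cox_group I m))"
  proof (rule MA.span_minimal)
    have "w ` carrier (cox_group I m) \<subseteq> lists I"
      by (rule w_lists[OF w])
    then show "submod (rspan (T ` w ` carrier (cox_group I m)))" by (rule span_T_submod)
  qed (use T_in_span_reduced[OF w] in auto)
  ultimately show ?thesis by blast
qed

end

section \<open>From \<open>A(M)\<close> to matrices over \<open>A\<^sub>+(M)\<close>\<close>

text \<open>\<open>A(M)\<close> is the crossed product of \<open>A\<^sub>+(M)\<close> with the group of order two generated by a fixed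
  \<open>s\<^sub>0\<close>. Writing an element as \<open>x + y s\<^sub>0\<close> makes it act on the left of the free \<open>A\<^sub>+(M)\<close>-module with
  basis \<open>1, s\<^sub>0\<close>; the matrices below describe this action, and their first row is \<open>(x, y)\<close>.\<close>

context coxeter_algebras
begin

text \<open>The letter \<open>s\<^sub>0\<close>. For empty \<open>I\<close> the choice is arbitrary,
  so membership is always deduced from the presence of some letter.\<close>

definition base :: 'i where
  "base = (SOME i. i \<in> I)"

lemma base_in: "i \<in> I \<Longrightarrow> base \<in> I"
  unfolding base_def by (rule someI)

fun t_swap :: "'i \<times> 'i \<times> int \<Rightarrow> 'i \<times> 'i \<times> int" where
  "t_swap (i, j, k) = (j, i, k)"

lemma t_swap_closed [simp]: "b \<in> t_index I m \<Longrightarrow> t_swap b \<in> t_index I m"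
  using m_sym by (cases b) (auto simp: t_index_def)

lemma t_swap_star: "b \<in> t_index I m \<Longrightarrow> t_swap (t_star b) = t_star (t_swap b)"
  by (erule t_indexE) (simp add: t_star_def t_label_def)

lemma t_swap_label: "i \<in> I \<Longrightarrow> j \<in> I \<Longrightarrow> i \<noteq> j \<Longrightarrow> t_label m j i k = t_swap (t_label m i j k)"
  using m_sym by (simp add: t_label_def)

abbreviation "AP \<equiv> P.P.PA"
abbreviation "M2 \<equiv> mat2_ring AP"

sublocale M2: ring M2 by (rule P.P.PA.mat2_ring)

text \<open>The rows are the coordinates of \<open>x\<close> and of \<open>s\<^sub>0 x\<close> with
  respect to \<open>1, s\<^sub>0\<close>. The entries come from
  \<open>s\<^sub>i = a\<^sub>i\<^sub>0 s\<^sub>0\<close>, from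
  \<open>s\<^sub>0 s\<^sub>i = a\<^sub>0\<^sub>i\<close>, and from
  \<open>s\<^sub>0 t\<^sub>b = t\<^sub>b\<^sub>' s\<^sub>0\<close> with the swapped index
  \<open>b'\<close>.\<close>

fun mat_gen :: "'i agen \<Rightarrow> _" where
  "mat_gen (Sgen i) = (\<zero>\<^bsub>AP\<^esub>, P.a i base, P.a base i, \<zero>\<^bsub>AP\<^esub>)"
| "mat_gen (Tgen b) = (P.con (t_R b), \<zero>\<^bsub>AP\<^esub>, \<zero>\<^bsub>AP\<^esub>, P.con (t_R (t_swap b)))"

definition mat_const :: "complex \<Rightarrow> _" where
  "mat_const c = (let d = P.con (Rp.cls (fa_const complex_ring c)) in (d, \<zero>\<^bsub>AP\<^esub>, \<zero>\<^bsub>AP\<^esub>, d))"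

lemma R_const_closed [simp]: "Rp.cls (fa_const complex_ring c) \<in> carrier (R_ring I m)"
  unfolding R_ring by (intro Rp.cls_closed Rp.const_closed) simp

lemma con_const_hom: "(\<lambda>c. P.con (Rp.cls (fa_const complex_ring c))) \<in> ring_hom complex_ring AP"
  using ring_hom_trans[OF Rp.const_hom[folded R_ring] P.P.const_hom] by (simp add: comp_def)

lemmas con_mult = ring_hom_mult[OF P.P.const_hom] and con_add = ring_hom_add[OF P.P.const_hom]
  and con_one = ring_hom_one[OF P.P.const_hom]

lemma mat_const_hom: "mat_const \<in> ring_hom complex_ring M2"
proof (rule ring_hom_memI)
  fix x y
  show "mat_const (x \<otimes>\<^bsub>complex_ring\<^esub> y) = mat_const x \<otimes>\<^bsub>M2\<^esub> mat_const y"
    using ring_hom_mult[OF con_const_hom, of x y] by (simp add: mat_const_def Let_def mat2_simps)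
  show "mat_const (x \<oplus>\<^bsub>complex_ring\<^esub> y) = mat_const x \<oplus>\<^bsub>M2\<^esub> mat_const y"
    using ring_hom_add[OF con_const_hom, of x y] by (simp add: mat_const_def Let_def mat2_simps)
  show "mat_const x \<in> carrier M2"
    by (simp add: mat_const_def Let_def mat2_simps)
next
  show "mat_const \<one>\<^bsub>complex_ring\<^esub> = \<one>\<^bsub>M2\<^esub>"
    using ring_hom_one[OF con_const_hom] by (simp add: mat_const_def Let_def mat2_simps)
qed

lemma A_gens_cases:
  assumes "x \<in> A_gens I m"
  obtains i where "i \<in> I" "base \<in> I" "x = Sgen i" | b where "b \<in> t_index I m" "x = Tgen b"
  using assms base_in unfolding A_gens_def R_gens_def by blast

lemma mat_gen_closed: "x \<in> A_gens I m \<Longrightarrow> mat_gen x \<in> carrier M2"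
  by (erule A_gens_cases) (simp_all add: mat2_simps)

sublocale Mev: fa_evaluation complex_ring M2 "A_gens I m" mat_const mat_gen
proof
  show "mat_const c \<otimes>\<^bsub>M2\<^esub> mat_gen x = mat_gen x \<otimes>\<^bsub>M2\<^esub> mat_const c" if "x \<in> A_gens I m" for c x
  proof -
    let ?d = "P.con (Rp.cls (fa_const complex_ring c))"
    have central: "?d \<otimes>\<^bsub>AP\<^esub> y = y \<otimes>\<^bsub>AP\<^esub> ?d" if "y \<in> carrier AP" for y
      using that by (intro P.con_central) simp_all
    show ?thesis
      using \<open>x \<in> A_gens I m\<close>
    proof (cases rule: A_gens_cases)
      case (1 i)
      then show ?thesis using central[of "P.a i base"] central[of "P.a base i"]
        by (simp add: mat_const_def Let_def mat2_simps)
    next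
      case (2 b)
      then show ?thesis using central[of "P.con (t_R b)"] central[of "P.con (t_R (t_swap b))"]
        by (simp add: mat_const_def Let_def mat2_simps)
    qed
  qed
qed (use mat_const_hom mat_gen_closed in auto)

lemma Mev_s: "i \<in> I \<Longrightarrow> Mev.ev (s_elt i) = mat_gen (Sgen i)"
  unfolding s_elt_def by (intro Mev.ev_gen) simp

lemma Mev_t: "b \<in> t_index I m \<Longrightarrow> Mev.ev (tg b) = mat_gen (Tgen b)"
  by (intro Mev.ev_gen) simp

lemma mat_s_mult:
  assumes "i \<in> I" "j \<in> I"
  shows "mat_gen (Sgen i) \<otimes>\<^bsub>M2\<^esub> mat_gen (Sgen j) =
    (P.a i j, \<zero>\<^bsub>AP\<^esub>, \<zero>\<^bsub>AP\<^esub>, P.a base i \<otimes>\<^bsub>AP\<^esub> P.a j base)"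
  using assms base_in[OF assms(1)] by (simp add: mat2_simps P.a_mult)

lemma Mev_rel:
  assumes "(l, r) \<in> A_rels I m"
  shows "Mev.ev l = Mev.ev r"
  using assms
proof (cases rule: A_rels_cases)
  case (1 b)
  have "P.con (t_R c) \<otimes>\<^bsub>AP\<^esub> P.con (t_R (t_star c)) = \<one>\<^bsub>AP\<^esub>" if "c \<in> t_index I m" for c
    using that t_R_star[OF that] by (simp add: con_one flip: con_mult)
  then have "mat_gen (Tgen b) \<otimes>\<^bsub>M2\<^esub> mat_gen (Tgen (t_star b)) = \<one>\<^bsub>M2\<^esub>"
    using 1(1) by (simp add: mat2_simps t_swap_star)
  then show ?thesis
    unfolding 1 using 1(1) ring_hom_one[OF Mev.ev_hom] by (simp add: Mev.ev_mult tg_closed Mev_t del: mat_gen.simps)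
next
  case (2 i)
  have "mat_gen (Sgen i) \<otimes>\<^bsub>M2\<^esub> mat_gen (Sgen i) = \<one>\<^bsub>M2\<^esub>"
    using 2(1) base_in[OF 2(1)] unfolding mat_s_mult[OF 2(1,1)] by (simp add: mat2_simps P.a_mult)
  then show ?thesis
    unfolding 2 using 2(1) ring_hom_one[OF Mev.ev_hom] by (simp add: Mev.ev_mult s_elt_closed Mev_s del: mat_gen.simps)
next
  case (3 i j n)
  let ?b = "t_label m i j"
  have b: "?b k \<in> t_index I m" for k using t_label_index(2) 3 by blast
  have base: "base \<in> I" using base_in 3(1) by blast
  let ?f = "\<lambda>k. s_elt i \<otimes>\<^bsub>FAA\<^esub> s_elt j \<ominus>\<^bsub>FAA\<^esub> tg (?b k)"
  let ?y = "P.a base i \<otimes>\<^bsub>AP\<^esub> P.a j base"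
  have y: "?y \<in> carrier AP" using 3 base by simp
  have fc: "?f k \<in> carrier FAA" for k
    using 3 b by (intro Ap.FA.minus_closed Ap.FA.m_closed s_elt_closed tg_closed)
  have f: "Mev.ev (?f k) = (P.a i j \<ominus>\<^bsub>AP\<^esub> P.con (t_R (?b k)), \<zero>\<^bsub>AP\<^esub>, \<zero>\<^bsub>AP\<^esub>, ?y \<ominus>\<^bsub>AP\<^esub> P.con (t_R (t_swap (?b k))))" for k
  proof -
    have "Mev.ev (?f k) = mat_gen (Sgen i) \<otimes>\<^bsub>M2\<^esub> mat_gen (Sgen j) \<ominus>\<^bsub>M2\<^esub> mat_gen (Tgen (?b k))"
      using 3 b[of k]
      by (simp add: ring_hom_minus[OF Mev.ev_hom Ap.FA.ring_axioms M2.ring_axioms] Mev.ev_mult s_elt_closed tg_closed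
        Mev_s Mev_t del: mat_gen.simps)
    also have "\<dots> = (P.a i j, \<zero>\<^bsub>AP\<^esub>, \<zero>\<^bsub>AP\<^esub>, ?y) \<ominus>\<^bsub>M2\<^esub> (P.con (t_R (?b k)), \<zero>\<^bsub>AP\<^esub>, \<zero>\<^bsub>AP\<^esub>, P.con (t_R (t_swap (?b k))))"
      unfolding mat_s_mult[OF 3(1,2)] by simp
    also have "\<dots> = (P.a i j \<ominus>\<^bsub>AP\<^esub> P.con (t_R (?b k)), \<zero>\<^bsub>AP\<^esub>, \<zero>\<^bsub>AP\<^esub>, ?y \<ominus>\<^bsub>AP\<^esub> P.con (t_R (t_swap (?b k))))"
      using 3 b[of k] y by (intro P.P.PA.mat2_diag_minus) simp_all
    finally show ?thesis .
  qed
  have "Mev.ev l = list_prod M2 (map Mev.ev (map ?f [1..int n]))"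
    unfolding 3 using fc by (intro ring_hom_list_prod[OF Ap.FA.monoid_axioms Mev.ev_hom]) auto
  also have "\<dots> = list_prod M2 (map (\<lambda>k. (P.a i j \<ominus>\<^bsub>AP\<^esub> P.con (t_R (?b k)), \<zero>\<^bsub>AP\<^esub>, \<zero>\<^bsub>AP\<^esub>,
      ?y \<ominus>\<^bsub>AP\<^esub> P.con (t_R (t_swap (?b k))))) [1..int n])"
    by (simp add: f comp_def)
  also have "\<dots> = (list_prod AP (map (\<lambda>k. P.a i j \<ominus>\<^bsub>AP\<^esub> P.con (t_R (?b k))) [1..int n]), \<zero>\<^bsub>AP\<^esub>, \<zero>\<^bsub>AP\<^esub>,
      list_prod AP (map (\<lambda>k. ?y \<ominus>\<^bsub>AP\<^esub> P.con (t_R (t_swap (?b k)))) [1..int n]))"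
    using 3 b y by (intro P.P.PA.mat2_diag_list_prod P.P.PA.minus_closed) simp_all
  also have "list_prod AP (map (\<lambda>k. P.a i j \<ominus>\<^bsub>AP\<^esub> P.con (t_R (?b k))) [1..int n]) = \<zero>\<^bsub>AP\<^esub>"
    using P.a_polynomial[OF 3(1-4)] by (simp add: R_t_eq)
  \<comment> \<open>The lower block is \<open>a\<^sub>0\<^sub>i a\<^sub>j\<^sub>0\<close>, the
    conjugate of \<open>a\<^sub>j\<^sub>i\<close> by \<open>a\<^sub>0\<^sub>i\<close>, and the
    swapped parameters are exactly those of the relation for
    \<open>a\<^sub>j\<^sub>i\<close>.\<close>
  also have "list_prod AP (map (\<lambda>k. ?y \<ominus>\<^bsub>AP\<^esub> P.con (t_R (t_swap (?b k)))) [1..int n]) = \<zero>\<^bsub>AP\<^esub>"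
  proof -
    let ?g = "P.a base i" and ?g' = "P.a i base" and ?x = "P.a j i"
    have "?y = ?g \<otimes>\<^bsub>AP\<^esub> ?x \<otimes>\<^bsub>AP\<^esub> ?g'"
      using 3 base by (simp add: P.P.PA.m_assoc P.a_mult)
    then have "list_prod AP (map (\<lambda>k. ?y \<ominus>\<^bsub>AP\<^esub> P.con (t_R (t_swap (?b k)))) [1..int n]) =
        ?g \<otimes>\<^bsub>AP\<^esub> list_prod AP (map (\<lambda>k. ?x \<ominus>\<^bsub>AP\<^esub> P.con (t_R (t_swap (?b k)))) [1..int n]) \<otimes>\<^bsub>AP\<^esub> ?g'"
      using 3 base b P.P.PA.list_prod_conjugate[of ?x ?g ?g' "[1..int n]" "\<lambda>k. P.con (t_R (t_swap (?b k)))"]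
      by (simp add: P.a_inverse P.con_central)
    also have "list_prod AP (map (\<lambda>k. ?x \<ominus>\<^bsub>AP\<^esub> P.con (t_R (t_swap (?b k)))) [1..int n]) = \<zero>\<^bsub>AP\<^esub>"
      using P.a_polynomial[of j i n] 3 m_sym[of i j] by (simp add: R_t_eq t_swap_label[of i j])
    finally show ?thesis using 3 base by simp
  qed
  finally have "Mev.ev l = \<zero>\<^bsub>M2\<^esub>" by (simp add: mat2_simps)
  then show ?thesis
    unfolding 3(6) using ring_hom_zero[OF Mev.ev_hom Ap.FA.ring_axioms M2.ring_axioms] by simp
next
  case (4 b c)
  have "P.con (t_R d) \<otimes>\<^bsub>AP\<^esub> P.con (t_R d') = P.con (t_R d') \<otimes>\<^bsub>AP\<^esub> P.con (t_R d)"
    if "d \<in> t_index I m" "d' \<in> t_index I m" for d d'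
    using that by (intro P.con_central) simp_all
  then have "mat_gen (Tgen b) \<otimes>\<^bsub>M2\<^esub> mat_gen (Tgen c) = mat_gen (Tgen c) \<otimes>\<^bsub>M2\<^esub> mat_gen (Tgen b)"
    using 4(1,2) by (simp add: mat2_simps)
  then show ?thesis
    unfolding 4 using 4(1,2) by (simp add: Mev.ev_mult tg_closed Mev_t del: mat_gen.simps)
next
  case (5 p i j n k)
  let ?b = "t_label m i j k"
  have b: "?b \<in> t_index I m" using t_label_index(2) 5 by blast
  have swap: "t_swap (t_swap ?b) = ?b" by (cases ?b) simp
  have base: "base \<in> I" using base_in 5(1) by blast
  have "mat_gen (Sgen p) \<otimes>\<^bsub>M2\<^esub> mat_gen (Tgen ?b) = mat_gen (Tgen (t_swap ?b)) \<otimes>\<^bsub>M2\<^esub> mat_gen (Sgen p)"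
    using 5(1) b base by (auto simp: mat2_simps swap intro!: P.con_central[symmetric])
  then show ?thesis
    unfolding 5(6,7) t_swap_label[OF 5(2-4)] using 5(1) b
    by (simp add: Mev.ev_mult tg_closed s_elt_closed Mev_s Mev_t del: mat_gen.simps)
qed

text \<open>The first row of the matrix of a product depends on the left factor only through its
  first row. For scalars and words it is given explicitly, since it already records the even and the
  odd part.\<close>

lemma matrix_representation:
  obtains \<Theta> where "\<Theta> \<in> ring_hom A M2"
    and "\<And>r. r \<in> carrier (R_ring I m) \<Longrightarrow> \<exists>z. \<Theta> (phi r) = (P.con r, \<zero>\<^bsub>AP\<^esub>, \<zero>\<^bsub>AP\<^esub>, z)"
    and "\<And>u. u \<in> lists I \<Longrightarrow> \<exists>y z. \<Theta> (T u) =
      (if even (length u) then P.even_word u else \<zero>\<^bsub>AP\<^esub>, if even (length u) then \<zero>\<^bsub>AP\<^esub> else P.even_word (u @ [base]), y, z)"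
proof -
  obtain H where H: "H \<in> ring_hom A M2"
    "\<And>c. c \<in> carrier complex_ring \<Longrightarrow> H (Ap.cls (fa_const complex_ring c)) = mat_const c"
    "\<And>y. y \<in> A_gens I m \<Longrightarrow> H (Ap.cls (fa_gen complex_ring y)) = mat_gen y"
    using pa_universal[OF Ap.presentation_axioms Mev.fa_evaluation_axioms Mev_rel] by blast
  have Hs: "H (s i) = mat_gen (Sgen i)" if "i \<in> I" for i
    using H(3)[of "Sgen i"] that by (simp add: s_elt_def)
  have phi: "\<exists>z\<in>carrier AP. H (phi r) = (P.con r, \<zero>\<^bsub>AP\<^esub>, \<zero>\<^bsub>AP\<^esub>, z)" if "r \<in> carrier (R_ring I m)" for r
    using that[unfolded R_ring]
  proof (induction r rule: Rp.PA_induct)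
    case (const c)
    have "phi (Rp.cls (fa_const complex_ring c)) = Ap.cls (fa_const complex_ring c)"
      by (intro phi(2) Rp.const_closed) simp
    then show ?case using H(2)[of c] by (simp add: mat_const_def Let_def)
  next
    case (gen y)
    then obtain b where b: "b \<in> t_index I m" "y = Tgen b" by (auto simp: R_gens_def)
    then show ?case using H(3)[of y] by (simp add: phi_t)
  next
    case (add x y)
    note xy = add(1,2)[folded R_ring]
    obtain z z' where z: "z \<in> carrier AP" "H (phi x) = (P.con x, \<zero>\<^bsub>AP\<^esub>, \<zero>\<^bsub>AP\<^esub>, z)"
      "z' \<in> carrier AP" "H (phi y) = (P.con y, \<zero>\<^bsub>AP\<^esub>, \<zero>\<^bsub>AP\<^esub>, z')" using add(3,4) by blast
    have "H (phi (x \<oplus>\<^bsub>R_ring I m\<^esub> y)) = (P.con (x \<oplus>\<^bsub>R_ring I m\<^esub> y), \<zero>\<^bsub>AP\<^esub>, \<zero>\<^bsub>AP\<^esub>, z \<oplus>\<^bsub>AP\<^esub> z')"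
      using xy z by (simp add: phi_add ring_hom_add[OF H(1)] con_add mat2_simps)
    then show ?case using z unfolding R_ring[symmetric] by blast
  next
    case (mult x y)
    note xy = mult(1,2)[folded R_ring]
    obtain z z' where z: "z \<in> carrier AP" "H (phi x) = (P.con x, \<zero>\<^bsub>AP\<^esub>, \<zero>\<^bsub>AP\<^esub>, z)"
      "z' \<in> carrier AP" "H (phi y) = (P.con y, \<zero>\<^bsub>AP\<^esub>, \<zero>\<^bsub>AP\<^esub>, z')" using mult(3,4) by blast
    have "H (phi (x \<otimes>\<^bsub>R_ring I m\<^esub> y)) = (P.con (x \<otimes>\<^bsub>R_ring I m\<^esub> y), \<zero>\<^bsub>AP\<^esub>, \<zero>\<^bsub>AP\<^esub>, z \<otimes>\<^bsub>AP\<^esub> z')"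
      using xy z by (simp add: phi_mult ring_hom_mult[OF H(1)] con_mult mat2_simps)
    then show ?case using z unfolding R_ring[symmetric] by blast
  qed
  have T: "\<exists>y\<in>carrier AP. \<exists>z\<in>carrier AP. H (T u) =
      (if even (length u) then P.even_word u else \<zero>\<^bsub>AP\<^esub>, if even (length u) then \<zero>\<^bsub>AP\<^esub> else P.even_word (u @ [base]), y, z)"
    if "u \<in> lists I" for u
    using that
  proof (induction u rule: even_pairs.induct)
    case (1 i j u)
    then have ij: "i \<in> I" "j \<in> I" "u \<in> lists I" by auto
    let ?p = "if even (length u) then P.even_word u else \<zero>\<^bsub>AP\<^esub>"
    let ?q = "if even (length u) then \<zero>\<^bsub>AP\<^esub> else P.even_word (u @ [base])"
    obtain y z where y: "y \<in> carrier AP" "z \<in> carrier AP" "H (T u) = (?p, ?q, y, z)" using 1 ij by blast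
    have pq: "?p \<in> carrier AP" "?q \<in> carrier AP" using ij base_in by auto
    have "H (T (i # j # u)) = (mat_gen (Sgen i) \<otimes>\<^bsub>M2\<^esub> mat_gen (Sgen j)) \<otimes>\<^bsub>M2\<^esub> H (T u)"
      using ij by (simp add: ring_hom_mult[OF H(1)] Hs M2.m_assoc mat_gen_closed ring_hom_closed[OF H(1)] del: mat_gen.simps)
    also have "\<dots> = (P.a i j \<otimes>\<^bsub>AP\<^esub> ?p, P.a i j \<otimes>\<^bsub>AP\<^esub> ?q, (P.a base i \<otimes>\<^bsub>AP\<^esub> P.a j base) \<otimes>\<^bsub>AP\<^esub> y,
        (P.a base i \<otimes>\<^bsub>AP\<^esub> P.a j base) \<otimes>\<^bsub>AP\<^esub> z)"
      unfolding mat_s_mult[OF ij(1,2)] y(3) using ij base_in[OF ij(1)] y pq by (simp add: mat2_simps split del: if_split)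
    finally show ?case using ij base_in[OF ij(1)] y by (auto split: if_splits)
  next
    case "2_1"
    then show ?case by (auto simp: ring_hom_one[OF H(1)] mat2_simps)
  next
    case ("2_2" i)
    then have "H (T [i]) = mat_gen (Sgen i)" by (simp add: Hs del: mat_gen.simps)
    with "2_2" base_in show ?case by auto
  qed
  show thesis
  proof (rule that[OF H(1)])
    show "\<exists>z. H (phi r) = (P.con r, \<zero>\<^bsub>AP\<^esub>, \<zero>\<^bsub>AP\<^esub>, z)" if "r \<in> carrier (R_ring I m)" for r
      using phi[OF that] by blast
    show "\<exists>y z. H (T u) = (if even (length u) then P.even_word u else \<zero>\<^bsub>AP\<^esub>,
        if even (length u) then \<zero>\<^bsub>AP\<^esub> else P.even_word (u @ [base]), y, z)" if "u \<in> lists I" for u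
      using T[OF that] by blast
  qed
qed

text \<open>The coordinates \<open>x\<close> and \<open>y\<close> of \<open>x + y s\<^sub>0\<close>.
  They are linear over \<open>R\<close> because a scalar has first row \<open>(r, 0)\<close>. An odd
  word \<open>u\<close> equals \<open>u s\<^sub>0\<close> times \<open>s\<^sub>0\<close>, so its odd
  part is the even word \<open>u @ [base]\<close>.\<close>

lemma even_odd_parts:
  obtains \<theta>\<^sub>0 \<theta>\<^sub>1 where
    "\<And>x. x \<in> carrier A \<Longrightarrow> \<theta>\<^sub>0 x \<in> carrier AP" "\<And>x. x \<in> carrier A \<Longrightarrow> \<theta>\<^sub>1 x \<in> carrier AP"
    "\<theta>\<^sub>0 \<zero>\<^bsub>A\<^esub> = \<zero>\<^bsub>AP\<^esub>" "\<theta>\<^sub>1 \<zero>\<^bsub>A\<^esub> = \<zero>\<^bsub>AP\<^esub>"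
    "\<And>x y. x \<in> carrier A \<Longrightarrow> y \<in> carrier A \<Longrightarrow> \<theta>\<^sub>0 (x \<oplus>\<^bsub>A\<^esub> y) = \<theta>\<^sub>0 x \<oplus>\<^bsub>AP\<^esub> \<theta>\<^sub>0 y"
    "\<And>x y. x \<in> carrier A \<Longrightarrow> y \<in> carrier A \<Longrightarrow> \<theta>\<^sub>1 (x \<oplus>\<^bsub>A\<^esub> y) = \<theta>\<^sub>1 x \<oplus>\<^bsub>AP\<^esub> \<theta>\<^sub>1 y"
    "\<And>r x. r \<in> carrier (R_ring I m) \<Longrightarrow> x \<in> carrier A \<Longrightarrow> \<theta>\<^sub>0 (phi r \<otimes>\<^bsub>A\<^esub> x) = P.con r \<otimes>\<^bsub>AP\<^esub> \<theta>\<^sub>0 x"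
    "\<And>r x. r \<in> carrier (R_ring I m) \<Longrightarrow> x \<in> carrier A \<Longrightarrow> \<theta>\<^sub>1 (phi r \<otimes>\<^bsub>A\<^esub> x) = P.con r \<otimes>\<^bsub>AP\<^esub> \<theta>\<^sub>1 x"
    "\<And>u. u \<in> lists I \<Longrightarrow> \<theta>\<^sub>0 (T u) = (if even (length u) then P.even_word u else \<zero>\<^bsub>AP\<^esub>)"
    "\<And>u. u \<in> lists I \<Longrightarrow> \<theta>\<^sub>1 (T u) = (if even (length u) then \<zero>\<^bsub>AP\<^esub> else P.even_word (u @ [base]))"
proof -
  obtain \<Theta> where \<Theta>: "\<Theta> \<in> ring_hom A M2"
    and phi: "\<And>r. r \<in> carrier (R_ring I m) \<Longrightarrow> \<exists>z. \<Theta> (phi r) = (P.con r, \<zero>\<^bsub>AP\<^esub>, \<zero>\<^bsub>AP\<^esub>, z)"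
    and T: "\<And>u. u \<in> lists I \<Longrightarrow> \<exists>y z. \<Theta> (T u) =
      (if even (length u) then P.even_word u else \<zero>\<^bsub>AP\<^esub>, if even (length u) then \<zero>\<^bsub>AP\<^esub> else P.even_word (u @ [base]), y, z)"
    using matrix_representation by blast
  have cl: "\<exists>p q r s. \<Theta> x = (p, q, r, s) \<and> p \<in> carrier AP \<and> q \<in> carrier AP \<and> r \<in> carrier AP \<and> s \<in> carrier AP"
    if "x \<in> carrier A" for x
    using ring_hom_closed[OF \<Theta> that] by (cases "\<Theta> x") (auto simp: mat2_simps)
  show thesis
  proof (rule that[of "\<lambda>x. fst (\<Theta> x)" "\<lambda>x. fst (snd (\<Theta> x))"])
    fix x assume x: "x \<in> carrier A"
    obtain p q p' q' where p: "\<Theta> x = (p, q, p', q')" "p \<in> carrier AP" "q \<in> carrier AP" "p' \<in> carrier AP" "q' \<in> carrier AP"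
      using cl[OF x] by blast
    then show "fst (\<Theta> x) \<in> carrier AP" "fst (snd (\<Theta> x)) \<in> carrier AP" by simp_all
    { fix y assume y: "y \<in> carrier A"
      obtain r s r' s' where r: "\<Theta> y = (r, s, r', s')" using cl[OF y] by blast
      have "\<Theta> (x \<oplus>\<^bsub>A\<^esub> y) = \<Theta> x \<oplus>\<^bsub>M2\<^esub> \<Theta> y" using x y by (rule ring_hom_add[OF \<Theta>])
      then show "fst (\<Theta> (x \<oplus>\<^bsub>A\<^esub> y)) = fst (\<Theta> x) \<oplus>\<^bsub>AP\<^esub> fst (\<Theta> y)"
        "fst (snd (\<Theta> (x \<oplus>\<^bsub>A\<^esub> y))) = fst (snd (\<Theta> x)) \<oplus>\<^bsub>AP\<^esub> fst (snd (\<Theta> y))"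
        using p(1) r by (simp_all add: mat2_simps) }
    { fix r assume r: "r \<in> carrier (R_ring I m)"
      obtain z where z: "\<Theta> (phi r) = (P.con r, \<zero>\<^bsub>AP\<^esub>, \<zero>\<^bsub>AP\<^esub>, z)" using phi[OF r] by blast
      have "\<Theta> (phi r \<otimes>\<^bsub>A\<^esub> x) = \<Theta> (phi r) \<otimes>\<^bsub>M2\<^esub> \<Theta> x" using r x by (intro ring_hom_mult[OF \<Theta>] phi_closed)
      then show "fst (\<Theta> (phi r \<otimes>\<^bsub>A\<^esub> x)) = P.con r \<otimes>\<^bsub>AP\<^esub> fst (\<Theta> x)"
        "fst (snd (\<Theta> (phi r \<otimes>\<^bsub>A\<^esub> x))) = P.con r \<otimes>\<^bsub>AP\<^esub> fst (snd (\<Theta> x))"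
        using p r z by (simp_all add: mat2_simps) }
  next
    have "\<Theta> \<zero>\<^bsub>A\<^esub> = \<zero>\<^bsub>M2\<^esub>" by (rule ring_hom_zero[OF \<Theta> Ap.PA.ring_axioms M2.ring_axioms])
    then show "fst (\<Theta> \<zero>\<^bsub>A\<^esub>) = \<zero>\<^bsub>AP\<^esub>" "fst (snd (\<Theta> \<zero>\<^bsub>A\<^esub>)) = \<zero>\<^bsub>AP\<^esub>" by (simp_all add: mat2_simps)
  next
    fix u assume "u \<in> lists I"
    from T[OF this] show "fst (\<Theta> (T u)) = (if even (length u) then P.even_word u else \<zero>\<^bsub>AP\<^esub>)"
      "fst (snd (\<Theta> (T u))) = (if even (length u) then \<zero>\<^bsub>AP\<^esub> else P.even_word (u @ [base]))" by (auto split: if_splits)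
  qed
qed

end

section \<open>Specialization at \<open>\<tau> = 0\<close>\<close>

text \<open>Both sides are monic of degree \<open>n\<close> and vanish at the \<open>n\<close> roots
  of unity, so they coincide.\<close>

lemma prod_roots_of_unity:
  assumes "n > 0"
  shows "(\<Prod>k\<leftarrow>[1..int n]. [:- exp (2 * of_real pi * \<i> * of_int k / of_nat n), 1:]) = monom 1 n - (1 :: complex poly)"
proof -
  let ?z = "\<lambda>k :: int. exp (2 * of_real pi * \<i> * of_int k / of_nat n) :: complex"
  let ?p = "\<Prod>k\<leftarrow>[1..int n]. [:- ?z k, 1:]"
  have p: "?p = (\<Prod>k\<in>{1..int n}. [:- ?z k, 1:])"
    by (subst prod.distinct_set_conv_list[symmetric]) auto
  have root: "poly ?p z = 0" if z: "z ^ n = 1" for z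
  proof -
    obtain k where k: "k < n" "z = cis (2 * pi * real k / real n)"
      using bij_betw_roots_unity[OF assms] z unfolding bij_betw_def by blast
    have "z = ?z (int k)" by (simp add: k(2) cis_conv_exp mult_ac)
    moreover have "?z (int n) = ?z 0" using assms by simp
    \<comment> \<open>The exponents of roots of unity run from \<open>0\<close> to
      \<open>n - 1\<close>, the factors of the product from \<open>1\<close> to
      \<open>n\<close>.\<close>
    ultimately have "z = ?z (if k = 0 then int n else int k)" by simp
    moreover have "(if k = 0 then int n else int k) \<in> {1..int n}" using k(1) assms by auto
    ultimately obtain l where "l \<in> {1..int n}" "z = ?z l" by blast
    then show ?thesis unfolding p poly_prod by (intro prod_zero bexI[of _ l]) auto
  qed
  have deg: "degree ?p = n"
    unfolding p by (subst degree_prod_eq_sum_degree) auto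
  have "lead_coeff ?p = 1"
    unfolding p by (subst lead_coeff_prod) simp
  show ?thesis
  proof (rule poly_eqI_degree_lead_coeff[of _ n _ "{z. z ^ n = 1}"])
    show "n \<le> card {z :: complex. z ^ n = 1}" using card_roots_unity_eq[OF assms] by simp
    show "degree (monom 1 n - 1 :: complex poly) \<le> n" by (intro degree_diff_le) (auto simp: degree_monom_eq)
    show "poly.coeff ?p n = poly.coeff (monom 1 n - 1) n" using \<open>lead_coeff ?p = 1\<close> deg assms by simp
    show "poly ?p z = poly (monom 1 n - 1) z" if "z \<in> {z. z ^ n = 1}" for z
      using root that by (simp add: poly_monom)
  qed (use deg in simp)
qed

text \<open>Additive operators on complex functions, a substitute for the group algebra in which
  translations can be evaluated pointwise and no finite supports have to be controlled. Additivity
  is what one of the distributive laws for composition requires.\<close>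

definition operator_ring :: "(('w \<Rightarrow> complex) \<Rightarrow> ('w \<Rightarrow> complex)) ring" where
  "operator_ring = \<lparr>carrier = {F. \<forall>f g. F (\<lambda>x. f x + g x) = (\<lambda>x. F f x + F g x)},
     monoid.mult = (\<lambda>F G f. F (G f)), monoid.one = (\<lambda>f. f),
     ring.zero = (\<lambda>f x. 0), add = (\<lambda>F G f x. F f x + G f x)\<rparr>"

lemma operator_ring_simps:
  "F \<in> carrier operator_ring \<longleftrightarrow> (\<forall>f g. F (\<lambda>x. f x + g x) = (\<lambda>x. F f x + F g x))"
  "F \<otimes>\<^bsub>operator_ring\<^esub> G = (\<lambda>f. F (G f))" "\<one>\<^bsub>operator_ring\<^esub> = (\<lambda>f. f)"
  "\<zero>\<^bsub>operator_ring\<^esub> = (\<lambda>f x. 0)" "F \<oplus>\<^bsub>operator_ring\<^esub> G = (\<lambda>f x. F f x + G f x)"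
  by (simp_all add: operator_ring_def)

lemma operator_ring_ring: "ring operator_ring"
proof (rule ringI)
  show "abelian_group operator_ring"
  proof (rule abelian_groupI)
    show "\<exists>G\<in>carrier operator_ring. G \<oplus>\<^bsub>operator_ring\<^esub> F = \<zero>\<^bsub>operator_ring\<^esub>"
      if "F \<in> carrier operator_ring" for F :: "('w \<Rightarrow> complex) \<Rightarrow> 'w \<Rightarrow> complex"
      using that by (intro bexI[of _ "\<lambda>f x. - F f x"]) (auto simp: operator_ring_simps)
  qed (auto simp: operator_ring_simps algebra_simps)
  show "monoid operator_ring"
    by (rule monoidI) (auto simp: operator_ring_simps)
qed (auto simp: operator_ring_simps)

lemma operator_ring_minus:
  assumes "F \<in> carrier operator_ring" "G \<in> carrier operator_ring"
  shows "F \<ominus>\<^bsub>operator_ring\<^esub> G = (\<lambda>f x. F f x - G f x)"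
proof -
  interpret ring operator_ring by (rule operator_ring_ring)
  have "\<ominus>\<^bsub>operator_ring\<^esub> G = (\<lambda>f x. - G f x)"
    using assms by (intro minus_equality) (auto simp: operator_ring_simps)
  then show ?thesis by (simp add: a_minus_def operator_ring_simps)
qed

text \<open>The shift along \<open>\<rho>\<close> commutes with scalar multiplication, so the
  product of operators is the polynomial with roots \<open>c k\<close>, evaluated at the
  shift.\<close>

lemma shift_operator_polynomial:
  fixes \<rho> :: "'w \<Rightarrow> 'w" and c :: "'k \<Rightarrow> complex"
  shows "degree (\<Prod>k\<leftarrow>ks. [:- c k, 1:]) \<le> length ks \<and>
    list_prod operator_ring (map (\<lambda>k. (\<lambda>f x. f (\<rho> x)) \<ominus>\<^bsub>operator_ring\<^esub> (\<lambda>f x. c k * f x)) ks) f x =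
    (\<Sum>l\<le>length ks. poly.coeff (\<Prod>k\<leftarrow>ks. [:- c k, 1:]) l * f ((\<rho> ^^ l) x))"
proof (induction ks arbitrary: x)
  case Nil
  then show ?case by (simp add: operator_ring_simps)
next
  case (Cons k ks)
  let ?p = "\<Prod>k\<leftarrow>ks. [:- c k, 1:]" and ?n = "length ks"
  let ?P = "list_prod operator_ring (map (\<lambda>k. (\<lambda>f x. f (\<rho> x)) \<ominus>\<^bsub>operator_ring\<^esub> (\<lambda>f x. c k * f x)) ks)"
  have deg: "degree ?p \<le> ?n" and IH: "\<And>x. ?P f x = (\<Sum>l\<le>?n. poly.coeff ?p l * f ((\<rho> ^^ l) x))"
    using Cons by blast+
  have coeff: "poly.coeff ([:- c k, 1:] * ?p) l = poly.coeff (pCons 0 ?p) l - c k * poly.coeff ?p l" for l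
    by simp
  \<comment> \<open>The degree bound is carried through the induction for this: the sum can be
    extended by one term.\<close>
  have top: "poly.coeff ?p (Suc ?n) = 0" using deg by (intro coeff_eq_0) simp
  have "(\<Sum>l\<le>Suc ?n. poly.coeff ([:- c k, 1:] * ?p) l * f ((\<rho> ^^ l) x)) =
      (\<Sum>l\<le>Suc ?n. poly.coeff (pCons 0 ?p) l * f ((\<rho> ^^ l) x)) - c k * (\<Sum>l\<le>Suc ?n. poly.coeff ?p l * f ((\<rho> ^^ l) x))"
    unfolding coeff by (simp only: left_diff_distrib sum_subtractf sum_distrib_left mult.assoc)
  also have "(\<Sum>l\<le>Suc ?n. poly.coeff (pCons 0 ?p) l * f ((\<rho> ^^ l) x)) = (\<Sum>l\<le>?n. poly.coeff ?p l * f ((\<rho> ^^ l) (\<rho> x)))"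
    unfolding sum.atMost_Suc_shift by (simp add: funpow_swap1)
  also have "(\<Sum>l\<le>Suc ?n. poly.coeff ?p l * f ((\<rho> ^^ l) x)) = (\<Sum>l\<le>?n. poly.coeff ?p l * f ((\<rho> ^^ l) x))"
    using top by simp
  finally have sum: "(\<Sum>l\<le>Suc ?n. poly.coeff ([:- c k, 1:] * ?p) l * f ((\<rho> ^^ l) x)) = ?P f (\<rho> x) - c k * ?P f x"
    by (simp only: IH)
  have "(\<lambda>f x. f (\<rho> x)) \<ominus>\<^bsub>operator_ring\<^esub> (\<lambda>f x. c k * f x) = (\<lambda>f x. f (\<rho> x) - c k * f x)"
    by (rule operator_ring_minus) (auto simp: operator_ring_simps algebra_simps)
  then have "list_prod operator_ring (map (\<lambda>k. (\<lambda>f x. f (\<rho> x)) \<ominus>\<^bsub>operator_ring\<^esub> (\<lambda>f x. c k * f x)) (k # ks)) f x =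
      ?P f (\<rho> x) - c k * ?P f x"
    by (simp add: operator_ring_simps)
  moreover have "degree ([:- c k, 1:] * ?p) \<le> Suc ?n"
    using degree_mult_le[of "[:- c k, 1:]" ?p] deg by simp
  ultimately show ?case using sum by simp
qed

context coxeter_algebras
begin

abbreviation "AQ \<equiv> Q.P.PA"

text \<open>Right translation of elements of \<open>W\<close> by a word; the identity on sets which are not elements
  of \<open>W\<close>, so that the relations hold for these, too.\<close>

definition translate :: "'i list \<Rightarrow> 'i list set \<Rightarrow> 'i list set" where
  "translate v x = (if x \<in> carrier (cox_group I m) then word_class ((SOME u. u \<in> x) @ v) else x)"

lemma word_class_cong: "u \<doteq> v \<Longrightarrow> word_class u = word_class v"
  using word_class_eq_iff eqv_lists(1) by blast

lemma translate_word_class: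
  assumes "u \<in> lists I" "v \<in> lists I"
  shows "translate v (word_class u) = word_class (u @ v)"
proof -
  have "u \<in> word_class u" unfolding word_class_def using eqv_refl[OF assms(1)] by (rule CollectI)
  then have "(SOME w. w \<in> word_class u) \<in> word_class u" by (rule someI)
  then have "u \<doteq> (SOME w. w \<in> word_class u)" by (simp add: word_class_def)
  then have "u @ v \<doteq> (SOME w. w \<in> word_class u) @ v" using assms(2) by (rule eqv_append_right)
  then have "word_class ((SOME w. w \<in> word_class u) @ v) = word_class (u @ v)"
    by (metis word_class_cong)
  then show ?thesis using assms(1) by (simp add: translate_def carrier_cox_group)
qed

lemma translate_translate:
  assumes "v \<in> lists I" "w \<in> lists I"
  shows "translate w (translate v x) = translate (v @ w) x"
proof (cases "x \<in> carrier (cox_group I m)")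
  case True
  then obtain u where "u \<in> lists I" "x = word_class u" by (auto simp: carrier_cox_group simp del: in_lists_conv_set)
  then show ?thesis using assms by (simp add: translate_word_class del: in_lists_conv_set)
qed (simp add: translate_def)

lemma translate_cong:
  assumes "v \<doteq> w"
  shows "translate v = translate w"
proof
  fix x
  show "translate v x = translate w x"
  proof (cases "x \<in> carrier (cox_group I m)")
    case True
    then obtain u where u: "u \<in> lists I" "x = word_class u" by (auto simp: carrier_cox_group simp del: in_lists_conv_set)
    have "u @ v \<doteq> u @ w" using assms u(1) by (rule eqv_append_left)
    then show ?thesis
      unfolding u(2) translate_word_class[OF u(1) eqv_lists(1)[OF assms]] translate_word_class[OF u(1) eqv_lists(2)[OF assms]]
      by (rule word_class_cong)
  qed (simp add: translate_def)
qed

lemma translate_Nil: "translate [] x = x"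
proof (cases "x \<in> carrier (cox_group I m)")
  case True
  then obtain u where "u \<in> lists I" "x = word_class u" by (auto simp: carrier_cox_group simp del: in_lists_conv_set)
  then show ?thesis by (simp add: translate_word_class del: in_lists_conv_set)
qed (simp add: translate_def)

text \<open>Translating the argument on the right makes composition of operators correspond to
  concatenation of words in the same order.\<close>

definition translation :: "'i list \<Rightarrow> ('i list set \<Rightarrow> complex) \<Rightarrow> 'i list set \<Rightarrow> complex" where
  "translation v = (\<lambda>f x. f (translate v x))"

lemma translate_power: "i \<in> I \<Longrightarrow> j \<in> I \<Longrightarrow> (translate [i, j] ^^ l) x = translate (alternating i j (2 * l)) x"
proof (induction l)
  case 0
  then show ?case by (simp add: translate_Nil)
next
  case (Suc l)
  have "alternating i j (2 * Suc l) = alternating i j (2 * l) @ [i, j]"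
    using alternating_add_even[of i j l 2] by (simp add: numeral_2_eq_2)
  then show ?case using Suc by (simp add: translate_translate alternating_in_lists del: in_lists_conv_set alternating.simps)
qed

lemma t_hat_constant_term:
  assumes "i \<in> I" "j \<in> I" "i \<noteq> j" "m i j = enat n"
  shows "t_hat I m i j k {#} = exp (2 * of_real pi * \<i> * of_int k / of_nat n)"
  using assms by (simp add: t_hat_def ps_exp_def ps_one ps_monom_def power_series_ring_def)

text \<open>At \<tau> = 0 the parameters become all the \<open>n\<close>-th roots of unity, and the
  polynomial relation turns into \<open>(s\<^sub>i s\<^sub>j)^n - 1 = 0\<close>, which holds for
  translations of W.\<close>

lemma specialization:
  obtains \<pi> where "\<pi> \<in> ring_hom AQ (operator_ring :: (('i list set \<Rightarrow> complex) \<Rightarrow> 'i list set \<Rightarrow> complex) ring)"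
    "\<And>c. c \<in> carrier (Rhat I m) \<Longrightarrow> \<pi> (Q.con c) = (\<lambda>f x. c {#} * f x)"
    "\<And>u. u \<in> lists I \<Longrightarrow> even (length u) \<Longrightarrow> \<pi> (Q.even_word u) = translation u"
proof -
  let ?E = "operator_ring :: (('i list set \<Rightarrow> complex) \<Rightarrow> 'i list set \<Rightarrow> complex) ring"
  let ?\<kappa> = "\<lambda>c :: ('i \<times> 'i \<times> int) multiset \<Rightarrow> complex. \<lambda>f (x :: 'i list set). c {#} * f x :: complex"
  interpret E: ring ?E by (rule operator_ring_ring)
  have \<kappa>: "?\<kappa> \<in> ring_hom (Rhat I m) ?E"
    by (rule ring_hom_memI)
      (auto simp: operator_ring_simps Rhat_def ps_mult ps_add ps_one ps_monom_def algebra_simps)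
  have tr: "translation v \<in> carrier ?E" for v by (simp add: translation_def operator_ring_simps)
  have tr_mult: "translation v \<otimes>\<^bsub>?E\<^esub> translation w = translation (v @ w)" if "v \<in> lists I" "w \<in> lists I" for v w
    using translate_translate[OF that] by (simp add: translation_def operator_ring_simps)
  have tr_cong: "translation v = translation w" if "v \<doteq> w" for v w
    using translate_cong[OF that] by (simp add: translation_def)
  have tr_one: "translation [] = \<one>\<^bsub>?E\<^esub>" by (simp add: translation_def operator_ring_simps translate_Nil)
  have sq: "[i, i] \<doteq> []" if "i \<in> I" for i using eqv_square[of "[]" i] that by simp
  obtain \<pi> where \<pi>: "\<pi> \<in> ring_hom AQ ?E" "\<And>c. c \<in> carrier (Rhat I m) \<Longrightarrow> \<pi> (Q.con c) = ?\<kappa> c"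
    "\<And>u. u \<in> lists I \<Longrightarrow> \<pi> (Q.even_word u) = list_prod ?E (map (\<lambda>(i, j). translation [i, j]) (even_pairs u))"
  proof (rule Q.hom_out[OF operator_ring_ring \<kappa>, of "\<lambda>i j. translation [i, j]"])
    fix i j p assume ij: "i \<in> I" "j \<in> I" "p \<in> I"
    have "[i] @ [j, j, p] \<doteq> [i] @ [p]" using ij eqv_square[of "[p]" j] by (intro eqv_append_left) auto
    then have "[i, j] @ [j, p] \<doteq> [i, p]" by simp
    then show "translation [i, j] \<otimes>\<^bsub>?E\<^esub> translation [j, p] = translation [i, p]"
      using ij tr_mult[of "[i, j]" "[j, p]"] tr_cong by simp
  next
    fix i assume "i \<in> I"
    then show "translation [i, i] = \<one>\<^bsub>?E\<^esub>" using tr_cong[OF sq] tr_one by simp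
  next
    fix i j n assume ij: "i \<in> I" "j \<in> I" "i \<noteq> j" "m i j = enat n"
    have n: "n > 0" using t_label_index(3)[OF ij] .
    let ?c = "\<lambda>k. exp (2 * of_real pi * \<i> * of_int k / of_nat n) :: complex"
    let ?q = "\<Prod>k\<leftarrow>[1..int n]. [:- ?c k, 1:]"
    have "list_prod ?E (map (\<lambda>k. translation [i, j] \<ominus>\<^bsub>?E\<^esub> ?\<kappa> (t_hat I m i j k)) [1..int n]) f x = 0" for f x
    proof -
      have "list_prod ?E (map (\<lambda>k. translation [i, j] \<ominus>\<^bsub>?E\<^esub> ?\<kappa> (t_hat I m i j k)) [1..int n]) f x =
          (\<Sum>l\<le>length [1..int n]. poly.coeff ?q l * f ((translate [i, j] ^^ l) x))"
        unfolding translation_def t_hat_constant_term[OF ij]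
        using shift_operator_polynomial[where ks = "[1..int n]" and c = ?c and \<rho> = "translate [i, j]" and f = f and x = x] by blast
      also have "\<dots> = (\<Sum>l\<le>n. (if l = n then f ((translate [i, j] ^^ l) x) else 0) - (if l = 0 then f ((translate [i, j] ^^ l) x) else 0))"
        unfolding prod_roots_of_unity[OF n] using n by (intro sum.cong) auto
      also have "\<dots> = f ((translate [i, j] ^^ n) x) - f x"
        by (simp add: sum_subtractf)
      also have "(translate [i, j] ^^ n) x = x"
        using translate_power[OF ij(1,2)] translate_cong[OF eqv_braid_power[OF ij]] translate_Nil by simp
      finally show ?thesis by simp
    qed
    then show "list_prod ?E (map (\<lambda>k. translation [i, j] \<ominus>\<^bsub>?E\<^esub> ?\<kappa> (t_hat I m i j k)) [1..int n]) = \<zero>\<^bsub>?E\<^esub>"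
      by (simp add: operator_ring_simps fun_eq_iff)
  next
    show "?\<kappa> c \<otimes>\<^bsub>?E\<^esub> translation [i, j] = translation [i, j] \<otimes>\<^bsub>?E\<^esub> ?\<kappa> c" for c i j
      by (simp add: operator_ring_simps translation_def)
  qed (use tr in auto)
  have "list_prod ?E (map (\<lambda>(i, j). translation [i, j]) (even_pairs u)) = translation u"
    if "u \<in> lists I" "even (length u)" for u
    using that
  proof (induction u rule: even_pairs.induct)
    case (1 i j u)
    then show ?case using tr_mult[of "[i, j]" u] by simp
  qed (simp_all add: tr_one)
  with \<pi> that show thesis by simp
qed

end

section \<open>Consequences of flatness\<close>

context coxeter_algebras
begin

section \<open>Powers of the ideal of the \<tau>'s and the completed algebra\<close>

abbreviation "N n \<equiv> tau_ideal I m n"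

lemma tau_ideal_eq: "N n = genideal AQ {Q.con (ps_monom \<nu>) | \<nu>. set_mset \<nu> \<subseteq> Yt \<and> size \<nu> = n}"
  by (simp add: tau_ideal_def Q.Aplus_ring Q.Aplus_class)

lemma monom_closed: "set_mset \<nu> \<subseteq> Yt \<Longrightarrow> ps_monom \<nu> \<in> carrier (Rhat I m)"
  unfolding Rhat_def by (rule ps_monom_closed)

lemma tau_gens_closed: "{Q.con (ps_monom \<nu>) | \<nu>. set_mset \<nu> \<subseteq> Yt \<and> size \<nu> = n} \<subseteq> carrier AQ"
  using monom_closed Q.con_closed by blast

lemma N_ideal: "ideal (N n) AQ"
  unfolding tau_ideal_eq by (rule Q.P.PA.genideal_ideal[OF tau_gens_closed])

lemma con_monom_in_N: "set_mset \<nu> \<subseteq> Yt \<Longrightarrow> Q.con (ps_monom \<nu>) \<in> N (size \<nu>)"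
  unfolding tau_ideal_eq using Q.P.PA.genideal_self[OF tau_gens_closed] by blast

lemma N_antimono: "N (Suc n) \<subseteq> N n"
  unfolding tau_ideal_eq[of "Suc n"]
proof (rule Q.P.PA.genideal_minimal[OF N_ideal], clarify)
  fix \<nu> :: "('i \<times> 'i \<times> int) multiset"
  assume \<nu>: "set_mset \<nu> \<subseteq> Yt" "size \<nu> = Suc n"
  then obtain y \<nu>' where y: "\<nu> = add_mset y \<nu>'" by (metis size_eq_Suc_imp_eq_union)
  have "ps_monom {#y#} \<otimes>\<^bsub>Rhat I m\<^esub> ps_monom \<nu>' = ps_monom \<nu>"
    using ps_monom_mult[where c = 1 and \<nu> = "{#y#}" and f = "ps_monom \<nu>'" and Y = Yt]
    by (auto simp: Rhat_def y ps_monom_def fun_eq_iff elim!: mset_add)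
  then have "Q.con (ps_monom \<nu>) = Q.con (ps_monom {#y#}) \<otimes>\<^bsub>AQ\<^esub> Q.con (ps_monom \<nu>')"
    using \<nu> y ring_hom_mult[OF Q.P.const_hom monom_closed monom_closed, of "{#y#}" \<nu>'] by simp
  moreover have "Q.con (ps_monom \<nu>') \<in> N n"
    using con_monom_in_N[of \<nu>'] \<nu> y by simp
  moreover have "Q.con (ps_monom {#y#}) \<in> carrier AQ"
    using \<nu>(1) y by (intro Q.con_closed monom_closed) simp
  ultimately show "Q.con (ps_monom \<nu>) \<in> N n"
    using ideal.I_l_closed[OF N_ideal] by simp
qed

abbreviation "QN n \<equiv> AQ Quot N n"

definition coset :: "nat \<Rightarrow> (('i \<times> 'i) list \<Rightarrow> ('i \<times> 'i \<times> int) multiset \<Rightarrow> complex) set \<Rightarrow> _ set" where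
  "coset n q = N n +>\<^bsub>AQ\<^esub> q"

lemma coset_hom: "coset n \<in> ring_hom AQ (QN n)"
  using ideal.rcos_ring_hom[OF N_ideal] by (simp add: coset_def[abs_def])

lemmas coset_mult = ring_hom_mult[OF coset_hom] and coset_add = ring_hom_add[OF coset_hom]
  and coset_closed = ring_hom_closed[OF coset_hom]

lemma QN_ring: "ring (QN n)"
  by (rule ideal.quotient_is_ring[OF N_ideal])

lemma coset_zero: "coset n \<zero>\<^bsub>AQ\<^esub> = \<zero>\<^bsub>QN n\<^esub>"
  by (rule ring_hom_zero[OF coset_hom Q.P.PA.ring_axioms QN_ring])

lemma QN_zero: "\<zero>\<^bsub>QN n\<^esub> = N n"
  by (simp add: FactRing_def)

lemma QN_cases:
  assumes "x \<in> carrier (QN n)"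
  obtains q where "q \<in> carrier AQ" "x = coset n q"
  using assms unfolding coset_def FactRing_def A_RCOSETS_def RCOSETS_def a_r_coset_def by auto

lemma coset_self: "q \<in> carrier AQ \<Longrightarrow> q \<in> coset n q"
proof -
  assume q: "q \<in> carrier AQ"
  interpret J: ideal "N n" AQ by (rule N_ideal)
  show ?thesis unfolding coset_def by (rule J.a_rcos_self[OF q])
qed

lemma coset_eqI: "q \<in> carrier AQ \<Longrightarrow> q' \<in> coset n q \<Longrightarrow> coset n q' = coset n q"
proof -
  assume q: "q \<in> carrier AQ" "q' \<in> coset n q"
  interpret J: ideal "N n" AQ by (rule N_ideal)
  show ?thesis
    using Q.P.PA.a_repr_independence'[OF q(2)[unfolded coset_def a_r_coset_def] q(1) J.a_subgroup] by (simp add: coset_def a_r_coset_def)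
qed

lemma coset_eq_N_iff: "q \<in> carrier AQ \<Longrightarrow> coset n q = N n \<longleftrightarrow> q \<in> N n"
proof -
  assume q: "q \<in> carrier AQ"
  interpret J: ideal "N n" AQ by (rule N_ideal)
  show ?thesis using coset_self[OF q, of n] J.a_rcos_const[of q] unfolding coset_def by blast
qed

lemma coset_antimono: "coset (Suc n) q \<subseteq> coset n q"
  using N_antimono[of n] unfolding coset_def a_r_coset_def r_coset_def by auto

abbreviation "Ahat \<equiv> Aplus_hat I m"

lemma Ahat_simps:
  "x \<in> carrier Ahat \<longleftrightarrow> (\<forall>n. x n \<in> carrier (QN n) \<and> x (Suc n) \<subseteq> x n)"
  "\<zero>\<^bsub>Ahat\<^esub> = (\<lambda>n. \<zero>\<^bsub>QN n\<^esub>)"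
  "x \<oplus>\<^bsub>Ahat\<^esub> y = (\<lambda>n. x n \<oplus>\<^bsub>QN n\<^esub> y n)"
  "r \<odot>\<^bsub>Ahat\<^esub> x = (\<lambda>n. coset n (Q.con r) \<otimes>\<^bsub>QN n\<^esub> x n)"
  by (simp_all add: Aplus_hat_def completion_def Q.Aplus_ring Q.Aplus_class coset_def)

text \<open>By the nesting of cosets, a representative at level \<open>n + 1\<close> also represents
  level \<open>n\<close>. Closure properties of the completion can thus be checked on elements of
  the uncompleted algebra.\<close>

lemma Ahat_rep:
  assumes "x \<in> carrier Ahat"
  obtains q where "q \<in> carrier AQ" "x n = coset n q" "x (Suc n) = coset (Suc n) q"
proof -
  have "x (Suc n) \<in> carrier (QN (Suc n))" using assms by (simp add: Ahat_simps)
  then obtain q where q: "q \<in> carrier AQ" "x (Suc n) = coset (Suc n) q" by (rule QN_cases)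
  have "x n \<in> carrier (QN n)" using assms by (simp add: Ahat_simps)
  then obtain q' where q': "q' \<in> carrier AQ" "x n = coset n q'" by (rule QN_cases)
  have "q \<in> coset n q'" using coset_self[OF q(1), of "Suc n"] assms q q' unfolding Ahat_simps by blast
  then have "x n = coset n q" using coset_eqI[OF q'(1)] q'(2) by simp
  with q that show thesis by blast
qed

lemma Ahat_add_closed:
  assumes "x \<in> carrier Ahat" "y \<in> carrier Ahat"
  shows "x \<oplus>\<^bsub>Ahat\<^esub> y \<in> carrier Ahat"
  unfolding Ahat_simps
proof (intro allI conjI)
  fix n
  obtain q where q: "q \<in> carrier AQ" "x n = coset n q" "x (Suc n) = coset (Suc n) q" using Ahat_rep[OF assms(1)] .
  obtain q' where q': "q' \<in> carrier AQ" "y n = coset n q'" "y (Suc n) = coset (Suc n) q'" using Ahat_rep[OF assms(2)] .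
  show "x n \<oplus>\<^bsub>QN n\<^esub> y n \<in> carrier (QN n)"
    using q(1) q'(1) by (simp add: q(2) q'(2) coset_closed flip: coset_add)
  show "x (Suc n) \<oplus>\<^bsub>QN (Suc n)\<^esub> y (Suc n) \<subseteq> x n \<oplus>\<^bsub>QN n\<^esub> y n"
    using q(1) q'(1) coset_antimono by (simp add: q(2,3) q'(2,3) flip: coset_add)
qed

lemma Ahat_smult_closed:
  assumes "r \<in> carrier (Rhat I m)" "x \<in> carrier Ahat"
  shows "r \<odot>\<^bsub>Ahat\<^esub> x \<in> carrier Ahat"
  unfolding Ahat_simps
proof (intro allI conjI)
  fix n
  have r: "Q.con r \<in> carrier AQ" using assms(1) by simp
  obtain q where q: "q \<in> carrier AQ" "x n = coset n q" "x (Suc n) = coset (Suc n) q" using Ahat_rep[OF assms(2)] .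
  show "coset n (Q.con r) \<otimes>\<^bsub>QN n\<^esub> x n \<in> carrier (QN n)"
    using q(1) r by (simp add: q(2) coset_closed flip: coset_mult)
  show "coset (Suc n) (Q.con r) \<otimes>\<^bsub>QN (Suc n)\<^esub> x (Suc n) \<subseteq> coset n (Q.con r) \<otimes>\<^bsub>QN n\<^esub> x n"
    using q(1) r coset_antimono by (simp add: q(2,3) flip: coset_mult)
qed

text \<open>The canonical map into the completion. No injectivity is claimed for it.\<close>

definition \<iota> :: "(('i \<times> 'i) list \<Rightarrow> ('i \<times> 'i \<times> int) multiset \<Rightarrow> complex) set \<Rightarrow> nat \<Rightarrow> _ set" where
  "\<iota> q = (\<lambda>n. coset n q)"

lemma \<iota>_closed: "q \<in> carrier AQ \<Longrightarrow> \<iota> q \<in> carrier Ahat"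
  by (simp add: Ahat_simps \<iota>_def coset_closed coset_antimono)

lemma \<iota>_add: "q \<in> carrier AQ \<Longrightarrow> q' \<in> carrier AQ \<Longrightarrow> \<iota> (q \<oplus>\<^bsub>AQ\<^esub> q') = \<iota> q \<oplus>\<^bsub>Ahat\<^esub> \<iota> q'"
  by (simp add: Ahat_simps \<iota>_def coset_add)

lemma \<iota>_smult: "r \<in> carrier (Rhat I m) \<Longrightarrow> q \<in> carrier AQ \<Longrightarrow> \<iota> (Q.con r \<otimes>\<^bsub>AQ\<^esub> q) = r \<odot>\<^bsub>Ahat\<^esub> \<iota> q"
  by (simp add: Ahat_simps \<iota>_def coset_mult)

text \<open>\<open>L q \<mu>\<close> is the coefficient at \<open>\<mu>\<close> of the image of
  \<open>q\<close> in V[[\<tau>]]. The last property says that the constant coefficient is faithful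
  modulo the ideal of the \<tau>'s. It has to be derived algebraically, since the isomorphism is
  only linear over the power series.\<close>

lemma flat_functionals:
  assumes flat: "topologically_free Yt Ahat"
  obtains V :: "(complex, nat \<Rightarrow> (('i \<times> 'i) list \<Rightarrow> ('i \<times> 'i \<times> int) multiset \<Rightarrow> complex) set set) module" and L where
    "module complex_ring V"
    "\<And>q \<mu>. q \<in> carrier AQ \<Longrightarrow> L q \<mu> \<in> carrier V"
    "\<And>q q' \<mu>. q \<in> carrier AQ \<Longrightarrow> q' \<in> carrier AQ \<Longrightarrow> L (q \<oplus>\<^bsub>AQ\<^esub> q') \<mu> = L q \<mu> \<oplus>\<^bsub>V\<^esub> L q' \<mu>"
    "\<And>r q \<mu>. r \<in> carrier (Rhat I m) \<Longrightarrow> q \<in> carrier AQ \<Longrightarrow>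
      L (Q.con r \<otimes>\<^bsub>AQ\<^esub> q) \<mu> = (\<Oplus>\<^bsub>V\<^esub>\<alpha>\<in>{\<alpha>. \<alpha> \<subseteq># \<mu>}. r \<alpha> \<odot>\<^bsub>V\<^esub> L q (\<mu> - \<alpha>))"
    "\<And>q. q \<in> carrier AQ \<Longrightarrow> L q {#} = \<zero>\<^bsub>V\<^esub> \<Longrightarrow> q \<in> N 1"
proof -
  obtain V :: "(complex, nat \<Rightarrow> (('i \<times> 'i) list \<Rightarrow> ('i \<times> 'i \<times> int) multiset \<Rightarrow> complex) set set) module" and h
    where V: "module complex_ring V"
      and bij: "bij_betw h (carrier Ahat) (carrier (power_series_module Yt V))"
      and h_add: "\<And>x y. x \<in> carrier Ahat \<Longrightarrow> y \<in> carrier Ahat \<Longrightarrow> h (x \<oplus>\<^bsub>Ahat\<^esub> y) = h x \<oplus>\<^bsub>power_series_module Yt V\<^esub> h y"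
      and h_smult: "\<And>r x. r \<in> carrier (power_series_ring Yt) \<Longrightarrow> x \<in> carrier Ahat \<Longrightarrow>
        h (r \<odot>\<^bsub>Ahat\<^esub> x) = r \<odot>\<^bsub>power_series_module Yt V\<^esub> h x"
    using flat unfolding topologically_free_def module_isomorphic_def by blast
  interpret V: module complex_ring V by (rule V)
  let ?S = "power_series_module Yt V"
  have S_carrier: "f \<in> carrier ?S \<longleftrightarrow> (\<forall>\<mu>. f \<mu> \<in> carrier V \<and> (\<not> set_mset \<mu> \<subseteq> Yt \<longrightarrow> f \<mu> = \<zero>\<^bsub>V\<^esub>))"
    and S_add: "f \<oplus>\<^bsub>?S\<^esub> g = (\<lambda>\<mu>. f \<mu> \<oplus>\<^bsub>V\<^esub> g \<mu>)"
    and S_smult: "r \<odot>\<^bsub>?S\<^esub> f = (\<lambda>\<mu>. \<Oplus>\<^bsub>V\<^esub>\<alpha>\<in>{\<alpha>. \<alpha> \<subseteq># \<mu>}. r \<alpha> \<odot>\<^bsub>V\<^esub> f (\<mu> - \<alpha>))" for f g r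
    by (simp_all add: power_series_module_def)
  have h_closed: "h x \<in> carrier ?S" if "x \<in> carrier Ahat" for x
    using bij that by (auto simp: bij_betw_def)
  have h_surj: "\<exists>x\<in>carrier Ahat. h x = f" if "f \<in> carrier ?S" for f
  proof -
    have "f \<in> h ` carrier Ahat" using bij that by (simp add: bij_betw_def)
    then show ?thesis by blast
  qed
  have zero: "\<zero>\<^bsub>Ahat\<^esub> \<in> carrier Ahat" using \<iota>_closed[of "\<zero>\<^bsub>AQ\<^esub>"] by (simp add: \<iota>_def coset_zero Ahat_simps(2))
  have h_zero: "h \<zero>\<^bsub>Ahat\<^esub> \<mu> = \<zero>\<^bsub>V\<^esub>" for \<mu>
  proof -
    have "\<zero>\<^bsub>Ahat\<^esub> \<oplus>\<^bsub>Ahat\<^esub> \<zero>\<^bsub>Ahat\<^esub> = \<zero>\<^bsub>Ahat\<^esub>"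
      using \<iota>_add[of "\<zero>\<^bsub>AQ\<^esub>" "\<zero>\<^bsub>AQ\<^esub>"] by (simp add: \<iota>_def coset_zero Ahat_simps(2))
    then have "h \<zero>\<^bsub>Ahat\<^esub> \<mu> \<oplus>\<^bsub>V\<^esub> h \<zero>\<^bsub>Ahat\<^esub> \<mu> = h \<zero>\<^bsub>Ahat\<^esub> \<mu>"
      using h_add[OF zero zero] by (simp add: S_add) metis
    then show ?thesis using h_closed[OF zero] by (simp add: S_carrier)
  qed
  \<comment> \<open>A series whose monomials all involve a variable from \<open>Y\<close> is a
    finite sum of variables times series. Its preimage is then the same combination in the
    completion and vanishes at level one.\<close>
  have divisible: "\<exists>z\<in>carrier Ahat. h z = f \<and> z 1 = N 1"
    if "finite Y" "Y \<subseteq> Yt" "f \<in> carrier ?S" "\<And>\<mu>. f \<mu> \<noteq> \<zero>\<^bsub>V\<^esub> \<Longrightarrow> \<exists>y\<in>Y. y \<in># \<mu>" for Y f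
    using that
  proof (induction Y arbitrary: f rule: finite_induct)
    case empty
    then have "h \<zero>\<^bsub>Ahat\<^esub> = f" using h_zero by (intro ext) (metis empty_iff)
    then show ?case using zero by (intro bexI[of _ "\<zero>\<^bsub>Ahat\<^esub>"]) (simp_all add: Ahat_simps(2) QN_zero)
  next
    case (insert y Y)
    have y: "y \<in> Yt" using insert.prems(1) by simp
    \<comment> \<open>\<open>?f'\<close> is the part of \<open>f\<close> divisible by
      \<open>y\<close>, divided by \<open>y\<close>; \<open>?f''\<close> is the rest, to which the
      induction hypothesis applies.\<close>
    let ?f' = "\<lambda>\<mu>. f (add_mset y \<mu>)" and ?f'' = "\<lambda>\<mu>. if y \<in># \<mu> then \<zero>\<^bsub>V\<^esub> else f \<mu>"
    have fV: "f \<mu> \<in> carrier V" for \<mu> using insert.prems(2) by (simp add: S_carrier)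
    have "?f' \<in> carrier ?S" "?f'' \<in> carrier ?S" using insert.prems(2) y by (auto simp: S_carrier)
    obtain z' where z': "z' \<in> carrier Ahat" "h z' = ?f'" using h_surj[OF \<open>?f' \<in> _\<close>] by blast
    have "\<exists>z\<in>carrier Ahat. h z = ?f'' \<and> z 1 = N 1"
    proof (rule insert.IH[OF _ \<open>?f'' \<in> _\<close>])
      show "\<exists>y'\<in>Y. y' \<in># \<mu>" if "?f'' \<mu> \<noteq> \<zero>\<^bsub>V\<^esub>" for \<mu>
        using that insert.prems(3)[of \<mu>] by (auto split: if_splits)
    qed (use insert.prems in simp)
    then obtain z'' where z'': "z'' \<in> carrier Ahat" "h z'' = ?f''" "z'' 1 = N 1" by blast
    have t: "ps_monom {#y#} \<in> carrier (Rhat I m)" using y by (intro monom_closed) simp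
    let ?z = "ps_monom {#y#} \<odot>\<^bsub>Ahat\<^esub> z' \<oplus>\<^bsub>Ahat\<^esub> z''"
    have cl: "ps_monom {#y#} \<odot>\<^bsub>Ahat\<^esub> z' \<in> carrier Ahat" using Ahat_smult_closed[OF t z'(1)] .
    have "h ?z = f"
    proof
      fix \<mu>
      have "(\<Oplus>\<^bsub>V\<^esub>\<alpha>\<in>{\<alpha>. \<alpha> \<subseteq># \<mu>}. ps_monom {#y#} \<alpha> \<odot>\<^bsub>V\<^esub> ?f' (\<mu> - \<alpha>)) =
          (\<Oplus>\<^bsub>V\<^esub>\<alpha>\<in>{\<alpha>. \<alpha> \<subseteq># \<mu>}. if {#y#} = \<alpha> then ?f' (\<mu> - {#y#}) else \<zero>\<^bsub>V\<^esub>)"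
        using fV V.smult_one[of "f _", unfolded complex_ring_simps] V.smult_l_null[of "f _", unfolded complex_ring_simps]
        by (intro V.M.finsum_cong') (auto simp: ps_monom_def)
      also have "\<dots> = (if y \<in># \<mu> then f \<mu> else \<zero>\<^bsub>V\<^esub>)"
      proof (cases "y \<in># \<mu>")
        case True
        then show ?thesis
          using fV V.M.add.finprod_singleton[of "{#y#}" "{\<alpha>. \<alpha> \<subseteq># \<mu>}" "\<lambda>_. ?f' (\<mu> - {#y#})"]
          by (simp add: finite_submultisets)
      next
        case False
        then have "(\<Oplus>\<^bsub>V\<^esub>\<alpha>\<in>{\<alpha>. \<alpha> \<subseteq># \<mu>}. if {#y#} = \<alpha> then ?f' (\<mu> - {#y#}) else \<zero>\<^bsub>V\<^esub>) = \<zero>\<^bsub>V\<^esub>"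
          by (intro V.M.add.finprod_one_eqI) auto
        with False show ?thesis by simp
      qed
      finally have "h (ps_monom {#y#} \<odot>\<^bsub>Ahat\<^esub> z') \<mu> = (if y \<in># \<mu> then f \<mu> else \<zero>\<^bsub>V\<^esub>)"
        using h_smult[OF t[unfolded Rhat_def] z'(1)] by (simp add: S_smult z'(2))
      then show "h ?z \<mu> = f \<mu>"
        using h_add[OF cl z''(1)] fV by (simp add: S_add z''(2))
    qed
    moreover have "?z 1 = N 1"
    proof -
      interpret Q1: ring "QN 1" by (rule QN_ring)
      have c0: "coset 1 (Q.con (ps_monom {#y#})) = \<zero>\<^bsub>QN 1\<^esub>"
        using con_monom_in_N[of "{#y#}"] y t coset_eq_N_iff[of "Q.con (ps_monom {#y#})" 1] by (simp add: QN_zero)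
      have "z' 1 \<in> carrier (QN 1)" using z'(1) by (simp add: Ahat_simps)
      from Q1.l_null[OF this] have "coset 1 (Q.con (ps_monom {#y#})) \<otimes>\<^bsub>QN 1\<^esub> z' 1 = \<zero>\<^bsub>QN 1\<^esub>"
        by (simp only: c0)
      moreover have "?z 1 = coset 1 (Q.con (ps_monom {#y#})) \<otimes>\<^bsub>QN 1\<^esub> z' 1 \<oplus>\<^bsub>QN 1\<^esub> z'' 1"
        by (simp only: Ahat_simps)
      moreover have "z'' 1 = \<zero>\<^bsub>QN 1\<^esub>" by (simp only: z''(3) QN_zero)
      ultimately have "?z 1 = \<zero>\<^bsub>QN 1\<^esub>" by (simp only: Q1.l_zero[OF Q1.zero_closed])
      then show ?thesis by (simp only: QN_zero)
    qed
    ultimately show ?case using Ahat_add_closed[OF cl z''(1)] by blast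
  qed
  show thesis
  proof (rule that[OF V, of "\<lambda>q. h (\<iota> q)"])
    show "h (\<iota> q) \<mu> \<in> carrier V" if "q \<in> carrier AQ" for q \<mu>
      using h_closed[OF \<iota>_closed[OF that]] by (simp add: S_carrier)
    show "h (\<iota> (q \<oplus>\<^bsub>AQ\<^esub> q')) \<mu> = h (\<iota> q) \<mu> \<oplus>\<^bsub>V\<^esub> h (\<iota> q') \<mu>" if "q \<in> carrier AQ" "q' \<in> carrier AQ" for q q' \<mu>
      using that by (simp add: \<iota>_add h_add \<iota>_closed S_add)
    show "h (\<iota> (Q.con r \<otimes>\<^bsub>AQ\<^esub> q)) \<mu> = (\<Oplus>\<^bsub>V\<^esub>\<alpha>\<in>{\<alpha>. \<alpha> \<subseteq># \<mu>}. r \<alpha> \<odot>\<^bsub>V\<^esub> h (\<iota> q) (\<mu> - \<alpha>))"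
      if "r \<in> carrier (Rhat I m)" "q \<in> carrier AQ" for r q \<mu>
      using that by (simp add: \<iota>_smult h_smult[OF that(1)[unfolded Rhat_def] \<iota>_closed] S_smult)
    show "q \<in> N 1" if q: "q \<in> carrier AQ" and z: "h (\<iota> q) {#} = \<zero>\<^bsub>V\<^esub>" for q
    proof -
      have f: "h (\<iota> q) \<in> carrier ?S" using h_closed[OF \<iota>_closed[OF q]] .
      have "\<exists>y\<in>Yt. y \<in># \<mu>" if "h (\<iota> q) \<mu> \<noteq> \<zero>\<^bsub>V\<^esub>" for \<mu>
      proof -
        have "set_mset \<mu> \<subseteq> Yt" using f that unfolding S_carrier by blast
        moreover have "\<mu> \<noteq> {#}" using that z by metis
        then obtain y where "y \<in># \<mu>" by blast
        ultimately show ?thesis by blast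
      qed
      then obtain x where x: "x \<in> carrier Ahat" "h x = h (\<iota> q)" "x 1 = N 1"
        using divisible[OF finite_tau_vars order_refl f] by blast
      have "x = \<iota> q"
        using bij x(1,2) \<iota>_closed[OF q] unfolding bij_betw_def by (metis inj_onD)
      then show ?thesis using x(3) coset_eq_N_iff[OF q] by (simp add: \<iota>_def)
    qed
  qed
qed

section \<open>Independence of even words\<close>

lemma Aplus_to_AQ:
  obtains H \<gamma> where "H \<in> ring_hom AP AQ" "\<gamma> \<in> ring_hom (R_ring I m) (Rhat I m)"
    "\<And>r. r \<in> carrier (R_ring I m) \<Longrightarrow> \<gamma> r = \<zero>\<^bsub>Rhat I m\<^esub> \<Longrightarrow> r = \<zero>\<^bsub>R_ring I m\<^esub>"
    "\<And>r. r \<in> carrier (R_ring I m) \<Longrightarrow> H (P.con r) = Q.con (\<gamma> r)"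
    "\<And>u. u \<in> lists I \<Longrightarrow> H (P.even_word u) = Q.even_word u"
proof (rule R_to_Rhat)
  fix \<gamma> assume \<gamma>: "\<gamma> \<in> ring_hom (R_ring I m) (Rhat I m)" "\<And>b. b \<in> t_index I m \<Longrightarrow> \<gamma> (t_R b) = t_series b"
    "\<And>r. r \<in> carrier (R_ring I m) \<Longrightarrow> \<gamma> r = \<zero>\<^bsub>Rhat I m\<^esub> \<Longrightarrow> r = \<zero>\<^bsub>R_ring I m\<^esub>"
  have \<gamma>_closed: "\<gamma> r \<in> carrier (Rhat I m)" if "r \<in> carrier (R_ring I m)" for r
    using ring_hom_closed[OF \<gamma>(1) that] .
  have hom: "(\<lambda>r. Q.con (\<gamma> r)) \<in> ring_hom (R_ring I m) AQ"
    using ring_hom_trans[OF \<gamma>(1) Q.P.const_hom] by (simp add: comp_def)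
  obtain H where H: "H \<in> ring_hom AP AQ" "\<And>r. r \<in> carrier (R_ring I m) \<Longrightarrow> H (P.con r) = Q.con (\<gamma> r)"
    "\<And>u. u \<in> lists I \<Longrightarrow> H (P.even_word u) = list_prod AQ (map (\<lambda>(i, j). Q.a i j) (even_pairs u))"
  proof (rule P.hom_out[OF Q.P.PA.ring_axioms hom, of Q.a])
    show "Q.con (\<gamma> c) \<otimes>\<^bsub>AQ\<^esub> Q.a i j = Q.a i j \<otimes>\<^bsub>AQ\<^esub> Q.con (\<gamma> c)"
      if "c \<in> carrier (R_ring I m)" "i \<in> I" "j \<in> I" for c i j
      using that \<gamma>_closed by (intro Q.con_central) simp_all
    show "list_prod AQ (map (\<lambda>k. Q.a i j \<ominus>\<^bsub>AQ\<^esub> Q.con (\<gamma> (R_t I m i j k))) [1..int n]) = \<zero>\<^bsub>AQ\<^esub>"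
      if ij: "i \<in> I" "j \<in> I" "i \<noteq> j" "m i j = enat n" for i j n
      using Q.a_polynomial[OF ij] by (simp add: R_t_eq \<gamma>(2)[OF t_label_index(2)[OF ij]] t_hat_eq_series[OF ij])
  qed (use Q.a_mult in auto)
  show thesis
    by (rule that[OF H(1) \<gamma>(1,3) H(2)]) (use H(3) in \<open>simp_all add: Q.even_word_def\<close>)
qed

text \<open>If all coefficients of degree below that of \<open>\<mu>\<close> vanish, the coefficient
  at \<open>\<mu>\<close> of the relation in V[[\<tau>]] equals the constant coefficient of the
  combination with the complex scalars \<open>?g x \<mu>\<close>. By \<open>L_ker\<close> this
  combination lies in \<open>N 1\<close>, which specialization kills, and distinct translations
  force the scalars to be zero. The family \<open>u\<close> is general because it is applied to
  \<open>w x\<close> for even elements and to \<open>w x @ [base]\<close> for odd ones.\<close>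

theorem even_words_independent:
  assumes flat: "topologically_free Yt Ahat" and S: "finite S" and c: "c \<in> S \<rightarrow> carrier (R_ring I m)"
    and u: "\<And>x. x \<in> S \<Longrightarrow> u x \<in> lists I \<and> even (length (u x))"
    and inj: "\<And>x y. x \<in> S \<Longrightarrow> y \<in> S \<Longrightarrow> u x \<doteq> u y \<Longrightarrow> x = y"
    and zero: "(\<Oplus>\<^bsub>AP\<^esub>x\<in>S. P.con (c x) \<otimes>\<^bsub>AP\<^esub> P.even_word (u x)) = \<zero>\<^bsub>AP\<^esub>"
  shows "\<forall>x\<in>S. c x = \<zero>\<^bsub>R_ring I m\<^esub>"
proof -
  obtain H \<gamma> where H: "H \<in> ring_hom AP AQ" "\<gamma> \<in> ring_hom (R_ring I m) (Rhat I m)"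
    and \<gamma>_inj: "\<And>r. r \<in> carrier (R_ring I m) \<Longrightarrow> \<gamma> r = \<zero>\<^bsub>Rhat I m\<^esub> \<Longrightarrow> r = \<zero>\<^bsub>R_ring I m\<^esub>"
    and H_con: "\<And>r. r \<in> carrier (R_ring I m) \<Longrightarrow> H (P.con r) = Q.con (\<gamma> r)"
    and H_word: "\<And>u. u \<in> lists I \<Longrightarrow> H (P.even_word u) = Q.even_word u"
    by (rule Aplus_to_AQ) (rule that)
  obtain V :: "(complex, nat \<Rightarrow> (('i \<times> 'i) list \<Rightarrow> ('i \<times> 'i \<times> int) multiset \<Rightarrow> complex) set set) module" and L
    where V: "module complex_ring V" and L_closed: "\<And>q \<mu>. q \<in> carrier AQ \<Longrightarrow> L q \<mu> \<in> carrier V"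
    and L_add: "\<And>q q' \<mu>. q \<in> carrier AQ \<Longrightarrow> q' \<in> carrier AQ \<Longrightarrow> L (q \<oplus>\<^bsub>AQ\<^esub> q') \<mu> = L q \<mu> \<oplus>\<^bsub>V\<^esub> L q' \<mu>"
    and L_smult: "\<And>r q \<mu>. r \<in> carrier (Rhat I m) \<Longrightarrow> q \<in> carrier AQ \<Longrightarrow>
      L (Q.con r \<otimes>\<^bsub>AQ\<^esub> q) \<mu> = (\<Oplus>\<^bsub>V\<^esub>\<alpha>\<in>{\<alpha>. \<alpha> \<subseteq># \<mu>}. r \<alpha> \<odot>\<^bsub>V\<^esub> L q (\<mu> - \<alpha>))"
    and L_ker: "\<And>q. q \<in> carrier AQ \<Longrightarrow> L q {#} = \<zero>\<^bsub>V\<^esub> \<Longrightarrow> q \<in> N 1"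
    by (rule flat_functionals[OF flat]) (rule that)
  obtain \<pi> where \<pi>: "\<pi> \<in> ring_hom AQ (operator_ring :: (('i list set \<Rightarrow> complex) \<Rightarrow> 'i list set \<Rightarrow> complex) ring)"
    and \<pi>_con: "\<And>c. c \<in> carrier (Rhat I m) \<Longrightarrow> \<pi> (Q.con c) = (\<lambda>f x. c {#} * f x)"
    and \<pi>_word: "\<And>u. u \<in> lists I \<Longrightarrow> even (length u) \<Longrightarrow> \<pi> (Q.even_word u) = translation u"
    by (rule specialization) (rule that)
  interpret V: module complex_ring V by (rule V)
  let ?E = "operator_ring :: (('i list set \<Rightarrow> complex) \<Rightarrow> 'i list set \<Rightarrow> complex) ring"
  interpret E: ring ?E by (rule operator_ring_ring)
  let ?g = "\<lambda>x. \<gamma> (c x)" and ?w = "\<lambda>x. Q.even_word (u x)"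
  have g: "?g x \<in> carrier (Rhat I m)" if "x \<in> S" for x using c that ring_hom_closed[OF H(2)] by auto
  have w: "?w x \<in> carrier AQ" if "x \<in> S" for x using u[OF that] by simp
  have L_zero: "L \<zero>\<^bsub>AQ\<^esub> \<mu> = \<zero>\<^bsub>V\<^esub>" for \<mu>
    using L_add[of "\<zero>\<^bsub>AQ\<^esub>" "\<zero>\<^bsub>AQ\<^esub>" \<mu>] L_closed[of "\<zero>\<^bsub>AQ\<^esub>" \<mu>] by simp
  have L_sum: "L (finsum AQ f S) \<mu> = (\<Oplus>\<^bsub>V\<^esub>x\<in>S. L (f x) \<mu>)" if "f \<in> S \<rightarrow> carrier AQ" for f \<mu>
    using that by (intro additive_finsum Q.P.PA.abelian_monoid_axioms V.M.abelian_monoid_axioms L_closed L_zero L_add)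
  have relation: "(\<Oplus>\<^bsub>AQ\<^esub>x\<in>S. Q.con (?g x) \<otimes>\<^bsub>AQ\<^esub> ?w x) = \<zero>\<^bsub>AQ\<^esub>"
  proof -
    have cu: "(\<lambda>x. P.con (c x) \<otimes>\<^bsub>AP\<^esub> P.even_word (u x)) \<in> S \<rightarrow> carrier AP"
      using c u by (intro funcsetI P.P.PA.m_closed P.con_closed P.even_word_closed) auto
    have "H (\<Oplus>\<^bsub>AP\<^esub>x\<in>S. P.con (c x) \<otimes>\<^bsub>AP\<^esub> P.even_word (u x)) = (\<Oplus>\<^bsub>AQ\<^esub>x\<in>S. H (P.con (c x) \<otimes>\<^bsub>AP\<^esub> P.even_word (u x)))"
      by (intro additive_finsum[OF P.P.PA.abelian_monoid_axioms Q.P.PA.abelian_monoid_axioms] cu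
          ring_hom_closed[OF H(1)] ring_hom_add[OF H(1)] ring_hom_zero[OF H(1) P.P.PA.ring_axioms Q.P.PA.ring_axioms])
    also have "\<dots> = (\<Oplus>\<^bsub>AQ\<^esub>x\<in>S. Q.con (?g x) \<otimes>\<^bsub>AQ\<^esub> ?w x)"
    proof (rule Q.P.PA.finsum_cong')
      fix x assume x: "x \<in> S"
      have cx: "c x \<in> carrier (R_ring I m)" using c x by auto
      show "H (P.con (c x) \<otimes>\<^bsub>AP\<^esub> P.even_word (u x)) = Q.con (?g x) \<otimes>\<^bsub>AQ\<^esub> ?w x"
        using u[OF x] cx ring_hom_mult[OF H(1) P.con_closed[OF cx] P.even_word_closed[of "u x"]] by (simp add: H_con H_word)
    qed (use g w in auto)
    finally show ?thesis
      using zero ring_hom_zero[OF H(1) P.P.PA.ring_axioms Q.P.PA.ring_axioms] by simp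
  qed
  have specialize: "\<forall>x\<in>S. d x = 0" if "finsum AQ (\<lambda>x. Q.con (ps_const (d x)) \<otimes>\<^bsub>AQ\<^esub> ?w x) S \<in> N 1" for d
  proof -
    have ker_ideal: "ideal (a_kernel AQ ?E \<pi>) AQ"
      using ring_hom_ring.kernel_is_ideal[OF ring_hom_ringI2[OF Q.P.PA.ring_axioms operator_ring_ring \<pi>]] .
    \<comment> \<open>The generators of \<open>N 1\<close> are the variables, which have no constant
      term.\<close>
    have "N 1 \<subseteq> a_kernel AQ ?E \<pi>"
      unfolding tau_ideal_eq
    proof (rule Q.P.PA.genideal_minimal[OF ker_ideal], clarify)
      fix \<nu> :: "('i \<times> 'i \<times> int) multiset" assume \<nu>: "set_mset \<nu> \<subseteq> Yt" "size \<nu> = 1"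
      have "\<pi> (Q.con (ps_monom \<nu>)) = \<zero>\<^bsub>?E\<^esub>"
        using \<nu> unfolding \<pi>_con[OF monom_closed[OF \<nu>(1)]] by (auto simp: ps_monom_def operator_ring_simps)
      then show "Q.con (ps_monom \<nu>) \<in> a_kernel AQ ?E \<pi>"
        unfolding a_kernel_def' using \<nu>(1) monom_closed Q.con_closed by blast
    qed
    then have \<pi>_zero: "\<pi> (finsum AQ (\<lambda>x. Q.con (ps_const (d x)) \<otimes>\<^bsub>AQ\<^esub> ?w x) S) = \<zero>\<^bsub>?E\<^esub>"
      using that unfolding a_kernel_def' by blast
    have pc: "ps_const z \<in> carrier (Rhat I m)" for z unfolding Rhat_def by simp
    have sum: "finsum ?E F S f y = (\<Sum>x\<in>S. F x f y)" if "F \<in> S \<rightarrow> carrier ?E" for F f y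
      using S that
    proof (induction S rule: finite_induct)
      case (insert x S)
      then have "finsum ?E F (insert x S) = F x \<oplus>\<^bsub>?E\<^esub> finsum ?E F S" by (intro E.finsum_insert) auto
      with insert show ?case by (simp add: operator_ring_simps(5))
    qed (simp add: operator_ring_simps(4))
    have summand: "\<pi> (Q.con (ps_const (d x)) \<otimes>\<^bsub>AQ\<^esub> ?w x) = (\<lambda>f y. d x * translation (u x) f y)" if "x \<in> S" for x
      unfolding ring_hom_mult[OF \<pi> Q.con_closed[OF pc] w[OF that]] \<pi>_con[OF pc]
        \<pi>_word[OF conjunct1[OF u[OF that]] conjunct2[OF u[OF that]]]
      by (simp add: operator_ring_simps ps_const_def ps_monom_def)
    have sum_zero: "(\<Sum>x\<in>S. d x * translation (u x) f y) = 0" for f y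
    proof -
      have "\<pi> (finsum AQ (\<lambda>x. Q.con (ps_const (d x)) \<otimes>\<^bsub>AQ\<^esub> ?w x) S) =
          finsum ?E (\<lambda>x. \<pi> (Q.con (ps_const (d x)) \<otimes>\<^bsub>AQ\<^esub> ?w x)) S"
        using w pc ring_hom_closed[OF \<pi>] ring_hom_add[OF \<pi>] ring_hom_zero[OF \<pi> Q.P.PA.ring_axioms operator_ring_ring]
        by (intro additive_finsum Q.P.PA.abelian_monoid_axioms E.abelian_monoid_axioms) auto
      then have "finsum ?E (\<lambda>x. \<pi> (Q.con (ps_const (d x)) \<otimes>\<^bsub>AQ\<^esub> ?w x)) S = \<zero>\<^bsub>?E\<^esub>"
        using \<pi>_zero by simp
      then have "finsum ?E (\<lambda>x. \<pi> (Q.con (ps_const (d x)) \<otimes>\<^bsub>AQ\<^esub> ?w x)) S f y = 0"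
        by (simp add: operator_ring_simps(4))
      moreover have "finsum ?E (\<lambda>x. \<pi> (Q.con (ps_const (d x)) \<otimes>\<^bsub>AQ\<^esub> ?w x)) S f y = (\<Sum>x\<in>S. d x * translation (u x) f y)"
      proof -
        have "(\<lambda>x. \<pi> (Q.con (ps_const (d x)) \<otimes>\<^bsub>AQ\<^esub> ?w x)) \<in> S \<rightarrow> carrier ?E"
          using w pc ring_hom_closed[OF \<pi>] by simp
        then show ?thesis by (simp add: sum summand)
      qed
      ultimately show ?thesis by simp
    qed
    show ?thesis
    proof
      fix x assume x: "x \<in> S"
      \<comment> \<open>Evaluating at the identity and on the indicator function of the class of
        \<open>u x\<close> singles out the coefficient of \<open>x\<close>.\<close>
      have "d y * translation (u y) (\<lambda>z. if z = word_class (u x) then 1 else 0) (word_class []) = (if y = x then d x else 0)"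
        if "y \<in> S" for y
      proof -
        have "translate (u y) (word_class []) = word_class (u y)"
          using translate_word_class[of "[]" "u y"] u[OF that] by simp
        moreover have "word_class (u y) = word_class (u x) \<longleftrightarrow> y = x"
          using word_class_eq_iff[of "u y" "u x"] u[OF that] inj[OF that x] by auto
        ultimately show ?thesis by (simp add: translation_def)
      qed
      then have "(\<Sum>y\<in>S. d y * translation (u y) (\<lambda>z. if z = word_class (u x) then 1 else 0) (word_class [])) = d x"
        using S x by simp
      then show "d x = 0" using sum_zero by simp
    qed
  qed
  have coeff_zero: "\<forall>x\<in>S. ?g x \<mu> = 0" for \<mu>
  \<comment> \<open>All \<open>x\<close> are treated at once: the step for one \<open>\<mu>\<close>
    uses the vanishing of every coefficient of smaller degree.\<close>
  proof (induction "size \<mu>" arbitrary: \<mu> rule: less_induct)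
    case less
    let ?q = "finsum AQ (\<lambda>x. Q.con (ps_const (?g x \<mu>)) \<otimes>\<^bsub>AQ\<^esub> ?w x) S"
    have pc: "ps_const z \<in> carrier (Rhat I m)" for z unfolding Rhat_def by simp
    have Lw: "L (?w x) \<nu> \<in> carrier V" if "x \<in> S" for x \<nu> using L_closed w that by blast
    have one: "L (Q.con (ps_const (?g x \<mu>)) \<otimes>\<^bsub>AQ\<^esub> ?w x) {#} = ?g x \<mu> \<odot>\<^bsub>V\<^esub> L (?w x) {#}" if "x \<in> S" for x
    proof -
      have "{\<alpha>. \<alpha> \<subseteq># {#}} = {{#} :: ('i \<times> 'i \<times> int) multiset}" by auto
      then show ?thesis
        using L_smult[OF pc w[OF that], of "?g x \<mu>" "{#}"] Lw[OF that] by (simp add: ps_const_def ps_monom_def)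
    qed
    have two: "L (Q.con (?g x) \<otimes>\<^bsub>AQ\<^esub> ?w x) \<mu> = ?g x \<mu> \<odot>\<^bsub>V\<^esub> L (?w x) {#}" if x: "x \<in> S" for x
    proof -
      have "L (Q.con (?g x) \<otimes>\<^bsub>AQ\<^esub> ?w x) \<mu> = (\<Oplus>\<^bsub>V\<^esub>\<alpha>\<in>{\<alpha>. \<alpha> \<subseteq># \<mu>}. ?g x \<alpha> \<odot>\<^bsub>V\<^esub> L (?w x) (\<mu> - \<alpha>))"
        by (rule L_smult[OF g[OF x] w[OF x]])
      \<comment> \<open>Proper submultisets of \<open>\<mu>\<close> have smaller size, so their
        coefficients are already known to vanish and only \<open>\<alpha> = \<mu>\<close>
        survives.\<close>
      also have "\<dots> = (\<Oplus>\<^bsub>V\<^esub>\<alpha>\<in>{\<alpha>. \<alpha> \<subseteq># \<mu>}. if \<mu> = \<alpha> then ?g x \<mu> \<odot>\<^bsub>V\<^esub> L (?w x) {#} else \<zero>\<^bsub>V\<^esub>)"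
      proof (rule V.M.finsum_cong')
        fix \<alpha> assume \<alpha>: "\<alpha> \<in> {\<alpha>. \<alpha> \<subseteq># \<mu>}"
        show "?g x \<alpha> \<odot>\<^bsub>V\<^esub> L (?w x) (\<mu> - \<alpha>) = (if \<mu> = \<alpha> then ?g x \<mu> \<odot>\<^bsub>V\<^esub> L (?w x) {#} else \<zero>\<^bsub>V\<^esub>)"
        proof (cases "\<mu> = \<alpha>")
          case False
          then have "size \<alpha> < size \<mu>" using \<alpha> by (simp add: mset_subset_size subset_mset.le_neq_trans)
          then have "?g x \<alpha> = 0" using less x by blast
          then show ?thesis using False V.smult_l_null[OF Lw[OF x]] by simp
        qed simp
      qed (use Lw[OF x] in auto)
      also have "\<dots> = ?g x \<mu> \<odot>\<^bsub>V\<^esub> L (?w x) {#}"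
        using Lw[OF x] V.M.add.finprod_singleton[of \<mu> "{\<alpha>. \<alpha> \<subseteq># \<mu>}" "\<lambda>_. ?g x \<mu> \<odot>\<^bsub>V\<^esub> L (?w x) {#}"]
        by (simp add: finite_submultisets)
      finally show ?thesis .
    qed
    have gw: "(\<lambda>x. Q.con (?g x) \<otimes>\<^bsub>AQ\<^esub> ?w x) \<in> S \<rightarrow> carrier AQ" using g w by auto
    have cw: "(\<lambda>x. Q.con (ps_const (?g x \<mu>)) \<otimes>\<^bsub>AQ\<^esub> ?w x) \<in> S \<rightarrow> carrier AQ" using pc w by auto
    have "L ?q {#} = (\<Oplus>\<^bsub>V\<^esub>x\<in>S. ?g x \<mu> \<odot>\<^bsub>V\<^esub> L (?w x) {#})"
      unfolding L_sum[OF cw] using one Lw by (intro V.M.finsum_cong') auto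
    also have "\<dots> = (\<Oplus>\<^bsub>V\<^esub>x\<in>S. L (Q.con (?g x) \<otimes>\<^bsub>AQ\<^esub> ?w x) \<mu>)"
      using two Lw gw L_closed by (intro V.M.finsum_cong') auto
    also have "\<dots> = L \<zero>\<^bsub>AQ\<^esub> \<mu>"
      unfolding L_sum[OF gw, symmetric] relation ..
    finally have "L ?q {#} = \<zero>\<^bsub>V\<^esub>" by (simp add: L_zero)
    moreover have "?q \<in> carrier AQ" using cw by (rule Q.P.PA.finsum_closed)
    ultimately have "?q \<in> N 1" by (intro L_ker)
    then show ?case by (rule specialize)
  qed
  show ?thesis
  proof
    fix x assume x: "x \<in> S"
    have "?g x = \<zero>\<^bsub>Rhat I m\<^esub>"
      using coeff_zero x by (simp add: Rhat_def ps_zero fun_eq_iff)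
    then show "c x = \<zero>\<^bsub>R_ring I m\<^esub>" using c x by (intro \<gamma>_inj) auto
  qed
qed

end

section \<open>Bases of \<open>A(M)\<close> and \<open>A\<^sub>+(M)\<close>\<close>

context coxeter_algebras
begin

lemma Aplus_alg_eq: "Aplus_alg I m = with_scalars AP (\<lambda>r. P.con r)"
  by (simp add: Aplus_alg_def P.Aplus_ring P.Aplus_class)

sublocale MP: module "R_ring I m" "Aplus_alg I m"
  unfolding Aplus_alg_eq by (intro with_scalars_module R.is_cring P.P.PA.ring_axioms P.P.const_hom)

lemma Aplus_alg_simps [simp]:
  "carrier (Aplus_alg I m) = carrier AP" "\<zero>\<^bsub>Aplus_alg I m\<^esub> = \<zero>\<^bsub>AP\<^esub>"
  "x \<oplus>\<^bsub>Aplus_alg I m\<^esub> y = x \<oplus>\<^bsub>AP\<^esub> y" "r \<odot>\<^bsub>Aplus_alg I m\<^esub> x = P.con r \<otimes>\<^bsub>AP\<^esub> x"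
  by (simp_all add: Aplus_alg_eq)

lemma T_Aplus_eq: "T_Aplus I m u = P.even_word u"
  unfolding T_Aplus_def P.even_word_def P.a_def[abs_def] Aplus_alg_eq list_prod_def P.Aplus_class
  by (simp add: with_scalars_def cong: if_cong)

abbreviation "pspan B \<equiv> module_span (R_ring I m) (Aplus_alg I m) B"
abbreviation "psubmod B \<equiv> submodule B (R_ring I m) (Aplus_alg I m)"

lemma psubmodD:
  assumes "psubmod B"
  shows "B \<subseteq> carrier AP" "\<zero>\<^bsub>AP\<^esub> \<in> B" "\<And>x y. x \<in> B \<Longrightarrow> y \<in> B \<Longrightarrow> x \<oplus>\<^bsub>AP\<^esub> y \<in> B"
    "\<And>r x. r \<in> carrier (R_ring I m) \<Longrightarrow> x \<in> B \<Longrightarrow> P.con r \<otimes>\<^bsub>AP\<^esub> x \<in> B"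
proof -
  interpret submodule B "R_ring I m" "Aplus_alg I m" by fact
  show "B \<subseteq> carrier AP" using subset by simp
  show "\<zero>\<^bsub>AP\<^esub> \<in> B" using one_closed by simp
  show "x \<oplus>\<^bsub>AP\<^esub> y \<in> B" if "x \<in> B" "y \<in> B" for x y using m_closed[OF that] by simp
  show "P.con r \<otimes>\<^bsub>AP\<^esub> x \<in> B" if "r \<in> carrier (R_ring I m)" "x \<in> B" for r x using smult_closed[OF that] by simp
qed

text \<open>Coefficients are central in \<open>A_+(M)\<close> and even words are closed under
  concatenation. The span of their images is hence closed under products, and it contains the
  generators.\<close>

lemma Aplus_spanned_by_words:
  "carrier AP \<subseteq> pspan (P.even_word ` {u \<in> lists I. even (length u)})"
proof
  let ?B = "P.even_word ` {u \<in> lists I. even (length u)}"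
  have B: "?B \<subseteq> carrier (Aplus_alg I m)" using P.even_word_closed by (simp only: Aplus_alg_simps) blast
  note sub = MP.span_submodule[OF B] note base = MP.span_base[OF B]
  have word: "P.even_word u \<in> pspan ?B" if "u \<in> lists I" "even (length u)" for u
    using that by (intro base) blast
  have left: "P.even_word u \<otimes>\<^bsub>AP\<^esub> y \<in> pspan ?B"
    if u: "u \<in> lists I" "even (length u)" and y: "y \<in> pspan ?B" for u y
  proof -
    have "psubmod {y \<in> carrier AP. P.even_word u \<otimes>\<^bsub>AP\<^esub> y \<in> pspan ?B}"
    proof (rule MP.submodule_by_closure)
      fix r y assume r: "r \<in> carrier (R_ring I m)" and y: "y \<in> {y \<in> carrier AP. P.even_word u \<otimes>\<^bsub>AP\<^esub> y \<in> pspan ?B}"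
      have "P.even_word u \<otimes>\<^bsub>AP\<^esub> (P.con r \<otimes>\<^bsub>AP\<^esub> y) = (P.even_word u \<otimes>\<^bsub>AP\<^esub> P.con r) \<otimes>\<^bsub>AP\<^esub> y"
        using u r y by (simp add: P.P.PA.m_assoc)
      also have "\<dots> = P.con r \<otimes>\<^bsub>AP\<^esub> (P.even_word u \<otimes>\<^bsub>AP\<^esub> y)"
        using u r y P.con_central[OF r P.even_word_closed[OF u(1)]] by (simp add: P.P.PA.m_assoc[symmetric])
      finally show "r \<odot>\<^bsub>Aplus_alg I m\<^esub> y \<in> {y \<in> carrier AP. P.even_word u \<otimes>\<^bsub>AP\<^esub> y \<in> pspan ?B}"
        using psubmodD(4)[OF sub r] r y by simp
    qed (use u psubmodD(2,3)[OF sub] in \<open>auto simp: P.P.PA.r_distr\<close>)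
    moreover have "?B \<subseteq> {y \<in> carrier AP. P.even_word u \<otimes>\<^bsub>AP\<^esub> y \<in> pspan ?B}"
    proof (rule image_subsetI)
      fix v assume "v \<in> {u \<in> lists I. even (length u)}"
      then have v: "v \<in> lists I" "even (length v)" by blast+
      have "P.even_word (u @ v) \<in> pspan ?B" using u v by (intro word) auto
      then show "P.even_word v \<in> {y \<in> carrier AP. P.even_word u \<otimes>\<^bsub>AP\<^esub> y \<in> pspan ?B}"
        using u v P.even_word_append[OF u(1) v(1) u(2)] by simp
    qed
    ultimately show ?thesis using MP.span_minimal y by blast
  qed
  fix x assume "x \<in> carrier AP"
  then show "x \<in> pspan ?B"
  proof (induction rule: P.P.PA_induct)
    case (const r)
    have "P.con r \<otimes>\<^bsub>AP\<^esub> P.even_word [] \<in> pspan ?B"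
      by (intro psubmodD(4)[OF sub const] word) auto
    with const show ?case by simp
  next
    case (gen y)
    then obtain i j where ij: "y = (i, j)" "i \<in> I" "j \<in> I" "i \<noteq> j" by (auto simp: Aplus_gens_def)
    have "P.even_word [i, j] \<in> pspan ?B" using ij by (intro word) auto
    moreover have "P.even_word [i, j] = P.P.cls (fa_gen (R_ring I m) y)"
      using ij P.a_closed[OF ij(2,3)] by (simp add: P.a_def)
    ultimately show ?case by simp
  next
    case (add x y)
    then show ?case using psubmodD(3)[OF sub] by blast
  next
    case (mult x y)
    have "psubmod {x \<in> carrier AP. x \<otimes>\<^bsub>AP\<^esub> y \<in> pspan ?B}"
      using mult(2) psubmodD(2,3,4)[OF sub]
      by (intro MP.submodule_by_closure) (auto simp: P.P.PA.l_distr P.P.PA.m_assoc)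
    moreover have "?B \<subseteq> {x \<in> carrier AP. x \<otimes>\<^bsub>AP\<^esub> y \<in> pspan ?B}"
      using left[OF _ _ mult(4)] P.even_word_closed by (intro image_subsetI) blast
    ultimately show ?case using MP.span_minimal mult(3) by blast
  qed
qed

section \<open>Families indexed by group elements\<close>

lemma word_class_w:
  assumes w: "\<And>x. x \<in> carrier (cox_group I m) \<Longrightarrow> reduced_word_for x (w x)" and x: "x \<in> carrier (cox_group I m)"
  shows "w x \<in> lists I" "word_class (w x) = x" "length (w x) = cox_length x"
proof -
  obtain u where u: "u \<in> lists I" "x = word_class u" using x carrier_cox_group by blast
  show "w x \<in> lists I" using w_lists[OF w] x by blast
  show "word_class (w x) = x" using reduced_word_for_class(3)[OF u(1)] w[OF x] u(2) by blast
  show "length (w x) = cox_length x" using w[OF x] by (simp add: reduced_word_for_def)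
qed

lemma cox_plus_iff:
  assumes w: "\<And>x. x \<in> carrier (cox_group I m) \<Longrightarrow> reduced_word_for x (w x)" and x: "x \<in> carrier (cox_group I m)"
  shows "x \<in> cox_plus I m \<longleftrightarrow> even (length (w x))"
  using word_class_in_cox_plus[OF word_class_w(1)[OF w x]] word_class_w(2)[OF w x] by simp

lemma cox_plus_subset: "cox_plus I m \<subseteq> carrier (cox_group I m)"
  by (auto simp: cox_plus_def kernel_def)

lemma w_inequivalent:
  assumes w: "\<And>x. x \<in> carrier (cox_group I m) \<Longrightarrow> reduced_word_for x (w x)"
    and "x \<in> carrier (cox_group I m)" "y \<in> carrier (cox_group I m)" "w x \<doteq> w y"
  shows "x = y"
  using word_class_w(1,2)[OF w assms(2)] word_class_w(2)[OF w assms(3)] word_class_eq_iff[of "w x" "w y"] assms(4) by simp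

lemma finite_length_bounded:
  assumes w: "\<And>x. x \<in> carrier (cox_group I m) \<Longrightarrow> reduced_word_for x (w x)" and "U \<subseteq> carrier (cox_group I m)"
  shows "finite {x \<in> U. cox_length x \<le> n}"
proof (rule finite_subset)
  show "{x \<in> U. cox_length x \<le> n} \<subseteq> word_class ` {u \<in> lists I. length u \<le> n}"
  proof clarify
    fix x assume x: "x \<in> U" "cox_length x \<le> n"
    then have "x \<in> carrier (cox_group I m)" using assms(2) by blast
    from word_class_w[OF w this] x(2) show "x \<in> word_class ` {u \<in> lists I. length u \<le> n}"
      by (intro image_eqI[of _ _ "w x"]) auto
  qed
qed (intro finite_imageI finite_words_length)

text \<open>The elements of \<open>A(M)\<close> whose even part lies in the span form a submodule.
  It contains all \<open>T (w x)\<close>, those of odd length having even part zero, so it is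
  everything. Every even word is the even part of the same word in \<open>A(M)\<close>.\<close>

lemma Aplus_spanned:
  assumes w: "\<And>x. x \<in> carrier (cox_group I m) \<Longrightarrow> reduced_word_for x (w x)"
  shows "carrier AP \<subseteq> pspan ((\<lambda>x. P.even_word (w x)) ` cox_plus I m)"
proof -
  let ?B = "(\<lambda>x. P.even_word (w x)) ` cox_plus I m"
  have B: "?B \<subseteq> carrier (Aplus_alg I m)"
    using word_class_w(1)[OF w] cox_plus_subset by auto
  note sub = MP.span_submodule[OF B]
  obtain \<theta>\<^sub>0 where \<theta>: "\<And>x. x \<in> carrier A \<Longrightarrow> \<theta>\<^sub>0 x \<in> carrier AP" "\<theta>\<^sub>0 \<zero>\<^bsub>A\<^esub> = \<zero>\<^bsub>AP\<^esub>"
    "\<And>x y. x \<in> carrier A \<Longrightarrow> y \<in> carrier A \<Longrightarrow> \<theta>\<^sub>0 (x \<oplus>\<^bsub>A\<^esub> y) = \<theta>\<^sub>0 x \<oplus>\<^bsub>AP\<^esub> \<theta>\<^sub>0 y"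
    "\<And>r x. r \<in> carrier (R_ring I m) \<Longrightarrow> x \<in> carrier A \<Longrightarrow> \<theta>\<^sub>0 (phi r \<otimes>\<^bsub>A\<^esub> x) = P.con r \<otimes>\<^bsub>AP\<^esub> \<theta>\<^sub>0 x"
    "\<And>u. u \<in> lists I \<Longrightarrow> \<theta>\<^sub>0 (T u) = (if even (length u) then P.even_word u else \<zero>\<^bsub>AP\<^esub>)"
    by (rule even_odd_parts) (rule that)
  have "submod {x \<in> carrier A. \<theta>\<^sub>0 x \<in> pspan ?B}"
    using psubmodD(2,3,4)[OF sub] by (intro MA.submodule_by_closure) (auto simp: \<theta>)
  moreover have "T ` w ` carrier (cox_group I m) \<subseteq> {x \<in> carrier A. \<theta>\<^sub>0 x \<in> pspan ?B}"
  proof clarify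
    fix x assume x: "x \<in> carrier (cox_group I m)"
    have "P.even_word (w x) \<in> pspan ?B" if "even (length (w x))"
      using that cox_plus_iff[OF w x] by (intro MP.span_base[OF B]) blast
    then show "T (w x) \<in> carrier A \<and> \<theta>\<^sub>0 (T (w x)) \<in> pspan ?B"
      using word_class_w(1)[OF w x] psubmodD(2)[OF sub] by (simp add: \<theta>(5))
  qed
  ultimately have "rspan (T ` w ` carrier (cox_group I m)) \<subseteq> {x \<in> carrier A. \<theta>\<^sub>0 x \<in> pspan ?B}"
    by (rule MA.span_minimal)
  with A_spanned[OF w] have *: "carrier A \<subseteq> {x \<in> carrier A. \<theta>\<^sub>0 x \<in> pspan ?B}"
    by (rule order_trans)
  have "P.even_word u \<in> pspan ?B" if "u \<in> lists I" "even (length u)" for u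
    using subsetD[OF * T_closed[OF that(1)]] \<theta>(5)[OF that(1)] that(2) by simp
  then have "pspan (P.even_word ` {u \<in> lists I. even (length u)}) \<subseteq> pspan ?B"
    by (intro MP.span_minimal[OF sub]) blast
  then show ?thesis using Aplus_spanned_by_words by blast
qed

lemma Aplus_independent:
  assumes flat: "topologically_free Yt Ahat"
    and w: "\<And>x. x \<in> carrier (cox_group I m) \<Longrightarrow> reduced_word_for x (w x)"
    and S: "finite S" "S \<subseteq> cox_plus I m" and c: "c \<in> S \<rightarrow> carrier (R_ring I m)"
    and zero: "(\<Oplus>\<^bsub>AP\<^esub>x\<in>S. P.con (c x) \<otimes>\<^bsub>AP\<^esub> P.even_word (w x)) = \<zero>\<^bsub>AP\<^esub>"
  shows "\<forall>x\<in>S. c x = \<zero>\<^bsub>R_ring I m\<^esub>"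
proof (rule even_words_independent[OF flat S(1) c _ _ zero])
  have S': "x \<in> carrier (cox_group I m)" if "x \<in> S" for x
    using that S(2) cox_plus_subset by blast
  show "w x \<in> lists I \<and> even (length (w x))" if "x \<in> S" for x
    using word_class_w(1)[OF w S'[OF that]] cox_plus_iff[OF w S'[OF that]] S(2) that by blast
  show "x = y" if "x \<in> S" "y \<in> S" "w x \<doteq> w y" for x y
    using w_inequivalent[OF w S'[OF that(1)] S'[OF that(2)] that(3)] .
qed

text \<open>Taking even and odd parts splits the relation into two relations between even words of
  \<open>A_+(M)\<close>. On the odd elements, multiplication by \<open>s\<^sub>0\<close> keeps
  distinct group elements distinct.\<close>

lemma A_independent:
  assumes flat: "topologically_free Yt Ahat"
    and w: "\<And>x. x \<in> carrier (cox_group I m) \<Longrightarrow> reduced_word_for x (w x)"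
    and S: "finite S" "S \<subseteq> carrier (cox_group I m)" and c: "c \<in> S \<rightarrow> carrier (R_ring I m)"
    and zero: "(\<Oplus>\<^bsub>A\<^esub>x\<in>S. phi (c x) \<otimes>\<^bsub>A\<^esub> T (w x)) = \<zero>\<^bsub>A\<^esub>"
  shows "\<forall>x\<in>S. c x = \<zero>\<^bsub>R_ring I m\<^esub>"
proof -
  obtain \<theta>\<^sub>0 \<theta>\<^sub>1 where \<theta>: "\<And>x. x \<in> carrier A \<Longrightarrow> \<theta>\<^sub>0 x \<in> carrier AP" "\<And>x. x \<in> carrier A \<Longrightarrow> \<theta>\<^sub>1 x \<in> carrier AP"
    "\<theta>\<^sub>0 \<zero>\<^bsub>A\<^esub> = \<zero>\<^bsub>AP\<^esub>" "\<theta>\<^sub>1 \<zero>\<^bsub>A\<^esub> = \<zero>\<^bsub>AP\<^esub>"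
    "\<And>x y. x \<in> carrier A \<Longrightarrow> y \<in> carrier A \<Longrightarrow> \<theta>\<^sub>0 (x \<oplus>\<^bsub>A\<^esub> y) = \<theta>\<^sub>0 x \<oplus>\<^bsub>AP\<^esub> \<theta>\<^sub>0 y"
    "\<And>x y. x \<in> carrier A \<Longrightarrow> y \<in> carrier A \<Longrightarrow> \<theta>\<^sub>1 (x \<oplus>\<^bsub>A\<^esub> y) = \<theta>\<^sub>1 x \<oplus>\<^bsub>AP\<^esub> \<theta>\<^sub>1 y"
    "\<And>r x. r \<in> carrier (R_ring I m) \<Longrightarrow> x \<in> carrier A \<Longrightarrow> \<theta>\<^sub>0 (phi r \<otimes>\<^bsub>A\<^esub> x) = P.con r \<otimes>\<^bsub>AP\<^esub> \<theta>\<^sub>0 x"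
    "\<And>r x. r \<in> carrier (R_ring I m) \<Longrightarrow> x \<in> carrier A \<Longrightarrow> \<theta>\<^sub>1 (phi r \<otimes>\<^bsub>A\<^esub> x) = P.con r \<otimes>\<^bsub>AP\<^esub> \<theta>\<^sub>1 x"
    "\<And>u. u \<in> lists I \<Longrightarrow> \<theta>\<^sub>0 (T u) = (if even (length u) then P.even_word u else \<zero>\<^bsub>AP\<^esub>)"
    "\<And>u. u \<in> lists I \<Longrightarrow> \<theta>\<^sub>1 (T u) = (if even (length u) then \<zero>\<^bsub>AP\<^esub> else P.even_word (u @ [base]))"
    by (rule even_odd_parts) (rule that)
  have S': "x \<in> carrier (cox_group I m)" if "x \<in> S" for x using that S(2) by blast
  have wl: "w x \<in> lists I" if "x \<in> S" for x using word_class_w(1)[OF w S'[OF that]] .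
  have cl: "(\<lambda>x. phi (c x) \<otimes>\<^bsub>A\<^esub> T (w x)) \<in> S \<rightarrow> carrier A" using wl c by (auto simp: Pi_iff)
  have inj: "x = y" if "x \<in> S" "y \<in> S" "w x \<doteq> w y" for x y
    using w_inequivalent[OF w S'[OF that(1)] S'[OF that(2)] that(3)] .
  \<comment> \<open>The common argument for both projections: \<open>Q\<close> selects the parity
    that the projection does not kill, and \<open>e\<close> is the value on the selected
    words.\<close>
  have part: "(\<Oplus>\<^bsub>AP\<^esub>x\<in>{x\<in>S. Q x}. P.con (c x) \<otimes>\<^bsub>AP\<^esub> e x) = \<zero>\<^bsub>AP\<^esub>"
    if \<theta>: "\<And>x. x \<in> carrier A \<Longrightarrow> \<theta> x \<in> carrier AP" "\<theta> \<zero>\<^bsub>A\<^esub> = \<zero>\<^bsub>AP\<^esub>"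
      "\<And>x y. x \<in> carrier A \<Longrightarrow> y \<in> carrier A \<Longrightarrow> \<theta> (x \<oplus>\<^bsub>A\<^esub> y) = \<theta> x \<oplus>\<^bsub>AP\<^esub> \<theta> y"
      "\<And>r x. r \<in> carrier (R_ring I m) \<Longrightarrow> x \<in> carrier A \<Longrightarrow> \<theta> (phi r \<otimes>\<^bsub>A\<^esub> x) = P.con r \<otimes>\<^bsub>AP\<^esub> \<theta> x"
      "\<And>x. x \<in> S \<Longrightarrow> \<theta> (T (w x)) = (if Q x then e x else \<zero>\<^bsub>AP\<^esub>)" for \<theta> Q e
  proof -
    have cc: "c x \<in> carrier (R_ring I m)" if "x \<in> S" for x using that c by blast
    have summand: "\<theta> (phi (c x) \<otimes>\<^bsub>A\<^esub> T (w x)) = (if Q x then P.con (c x) \<otimes>\<^bsub>AP\<^esub> e x else \<zero>\<^bsub>AP\<^esub>)" if "x \<in> S" for x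
      unfolding \<theta>(4)[OF cc[OF that] T_closed[OF wl[OF that]]] \<theta>(5)[OF that] using cc[OF that] by simp
    then have ce: "P.con (c x) \<otimes>\<^bsub>AP\<^esub> e x \<in> carrier AP" if "x \<in> S" "Q x" for x
      using that cl \<theta>(1)[of "phi (c x) \<otimes>\<^bsub>A\<^esub> T (w x)"] by (simp add: Pi_iff)
    have term_closed: "\<theta> (phi (c x) \<otimes>\<^bsub>A\<^esub> T (w x)) \<in> carrier AP" if "x \<in> S" for x
      using cl that by (intro \<theta>(1)) blast
    have "(\<Oplus>\<^bsub>AP\<^esub>x\<in>{x\<in>S. Q x}. P.con (c x) \<otimes>\<^bsub>AP\<^esub> e x) = (\<Oplus>\<^bsub>AP\<^esub>x\<in>{x\<in>S. Q x}. \<theta> (phi (c x) \<otimes>\<^bsub>A\<^esub> T (w x)))"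
      using summand ce by (intro P.P.PA.finsum_cong') (simp_all add: Pi_iff)
    also have "\<dots> = (\<Oplus>\<^bsub>AP\<^esub>x\<in>S. \<theta> (phi (c x) \<otimes>\<^bsub>A\<^esub> T (w x)))"
      using summand term_closed S(1) by (intro P.P.PA.add.finprod_mono_neutral_cong_left) (auto simp: Pi_iff)
    also have "\<dots> = \<theta> (\<Oplus>\<^bsub>A\<^esub>x\<in>S. phi (c x) \<otimes>\<^bsub>A\<^esub> T (w x))"
      using \<theta>(1-3) cl by (intro additive_finsum[symmetric] Ap.PA.abelian_monoid_axioms P.P.PA.abelian_monoid_axioms) auto
    finally show ?thesis using zero \<theta>(2) by simp
  qed
  have even: "\<forall>x\<in>{x\<in>S. even (length (w x))}. c x = \<zero>\<^bsub>R_ring I m\<^esub>"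
  proof (rule even_words_independent[OF flat])
    show "(\<Oplus>\<^bsub>AP\<^esub>x\<in>{x\<in>S. even (length (w x))}. P.con (c x) \<otimes>\<^bsub>AP\<^esub> P.even_word (w x)) = \<zero>\<^bsub>AP\<^esub>"
      by (rule part[OF \<theta>(1,3,5,7)]) (simp_all add: \<theta>(9) wl)
  qed (use S(1) c wl inj in auto)
  have base: "base \<in> I" if "x \<in> S" "odd (length (w x))" for x
    using wl[OF that(1)] that(2) by (cases "w x") (auto intro: base_in)
  have odd: "\<forall>x\<in>{x\<in>S. odd (length (w x))}. c x = \<zero>\<^bsub>R_ring I m\<^esub>"
  proof (rule even_words_independent[OF flat])
    show "(\<Oplus>\<^bsub>AP\<^esub>x\<in>{x\<in>S. odd (length (w x))}. P.con (c x) \<otimes>\<^bsub>AP\<^esub> P.even_word (w x @ [base])) = \<zero>\<^bsub>AP\<^esub>"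
      by (rule part[OF \<theta>(2,4,6,8)]) (simp_all add: \<theta>(10) wl)
    fix x y assume x: "x \<in> {x\<in>S. odd (length (w x))}" and y: "y \<in> {x\<in>S. odd (length (w x))}"
      and xy: "w x @ [base] \<doteq> w y @ [base]"
    have b: "base \<in> I" using base x by blast
    \<comment> \<open>A second letter \<open>base\<close> undoes the first, so equivalence of the
      extended words gives equivalence of the original ones.\<close>
    have sq: "w z @ [base, base] \<doteq> w z" if "z \<in> S" for z
      using cox_eq.square[of "w z" I "[]" base m] wl[OF that] b by simp
    have "w x \<doteq> (w x @ [base]) @ [base]" using sq x eqv_sym by simp
    also have "\<dots> \<doteq> (w y @ [base]) @ [base]" using eqv_append_right[OF xy, of "[base]"] b by simp
    also have "\<dots> \<doteq> w y" using sq y by simp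
    finally show "x = y" using inj x y by blast
  qed (use S(1) c wl base in auto)
  from even odd show ?thesis by blast
qed

end

theorem corollary3p3:
  fixes I :: "'i set" and m :: "'i \<Rightarrow> 'i \<Rightarrow> enat" and w :: "'i list set \<Rightarrow> 'i list"
  assumes "coxeter_matrix I m"
    and "flat_coxeter_matrix I m"
    and "\<And>x. x \<in> carrier (cox_group I m) \<Longrightarrow> reduced_word_for x (w x)"
  shows "free_module (R_ring I m) (A_alg I m) \<and>
    free_module (R_ring I m) (Aplus_alg I m) \<and>
    module_filtration (R_ring I m) (A_alg I m) (filt_A I m w) \<and>
    module_filtration (R_ring I m) (Aplus_alg I m) (filt_Aplus I m w) \<and>
    (\<forall>n\<ge>0.
      fin_gen_module (R_ring I m) (gr_module (A_alg I m) (filt_A I m w) n) \<and>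
      free_module (R_ring I m) (gr_module (A_alg I m) (filt_A I m w) n) \<and>
      fin_gen_module (R_ring I m) (gr_module (Aplus_alg I m) (filt_Aplus I m w) n) \<and>
      free_module (R_ring I m) (gr_module (Aplus_alg I m) (filt_Aplus I m w) n))"
proof -
  interpret coxeter_algebras I m by (intro coxeter_algebras.intro coxeter.intro assms(1))
  have flat: "topologically_free Yt Ahat" using assms(2) by (simp add: flat_coxeter_matrix_def)
  note w = assms(3)
  have A: "T_A I m (w x) \<in> carrier (A_alg I m)" if "x \<in> carrier (cox_group I m)" for x
    using word_class_w(1)[OF w that] by (simp add: T_A_eq)
  have P: "T_Aplus I m (w x) \<in> carrier (Aplus_alg I m)" if "x \<in> cox_plus I m" for x
    using word_class_w(1)[OF w] that cox_plus_subset by (auto simp: T_Aplus_eq)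
  have "(\<lambda>x. T_A I m (w x)) ` carrier (cox_group I m) = T ` w ` carrier (cox_group I m)"
    by (auto simp: T_A_eq)
  then have spanA: "carrier (A_alg I m) \<subseteq> rspan ((\<lambda>x. T_A I m (w x)) ` carrier (cox_group I m))"
    using A_spanned[OF w] by simp
  have spanP: "carrier (Aplus_alg I m) \<subseteq> pspan ((\<lambda>x. T_Aplus I m (w x)) ` cox_plus I m)"
    using Aplus_spanned[OF w] by (simp add: T_Aplus_eq)
  have indA: "\<forall>x\<in>S. c x = \<zero>\<^bsub>R_ring I m\<^esub>"
    if "finite S" "S \<subseteq> carrier (cox_group I m)" "c \<in> S \<rightarrow> carrier (R_ring I m)"
      "(\<Oplus>\<^bsub>A_alg I m\<^esub>x\<in>S. c x \<odot>\<^bsub>A_alg I m\<^esub> T_A I m (w x)) = \<zero>\<^bsub>A_alg I m\<^esub>" for S c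
    using A_independent[OF flat w that(1-3)] that(4) by (simp add: T_A_eq A_alg_eq)
  have indP: "\<forall>x\<in>S. c x = \<zero>\<^bsub>R_ring I m\<^esub>"
    if "finite S" "S \<subseteq> cox_plus I m" "c \<in> S \<rightarrow> carrier (R_ring I m)"
      "(\<Oplus>\<^bsub>Aplus_alg I m\<^esub>x\<in>S. c x \<odot>\<^bsub>Aplus_alg I m\<^esub> T_Aplus I m (w x)) = \<zero>\<^bsub>Aplus_alg I m\<^esub>" for S c
    using Aplus_independent[OF flat w that(1-3)] that(4) by (simp add: T_Aplus_eq Aplus_alg_eq)
  have vA: "(\<lambda>x. T_A I m (w x)) \<in> carrier (cox_group I m) \<rightarrow> carrier (A_alg I m)" using A by blast
  have vP: "(\<lambda>x. T_Aplus I m (w x)) \<in> cox_plus I m \<rightarrow> carrier (Aplus_alg I m)" using P by blast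
  note fA = MA.free_filtration[where v = "\<lambda>x. T_A I m (w x)" and l = cox_length,
      OF vA R_one_not_zero indA spanA finite_length_bounded[OF w order_refl]]
  note fP = MP.free_filtration[where v = "\<lambda>x. T_Aplus I m (w x)" and l = cox_length,
      OF vP R_one_not_zero indP spanP finite_length_bounded[OF w cox_plus_subset]]
  have "filt_A I m w = (\<lambda>n. rspan {T_A I m (w x) | x. x \<in> carrier (cox_group I m) \<and> int (cox_length x) \<le> n})"
    "filt_Aplus I m w = (\<lambda>n. pspan {T_Aplus I m (w x) | x. x \<in> cox_plus I m \<and> int (cox_length x) \<le> n})"
    by (simp_all only: filt_A_def[abs_def] filt_Aplus_def[abs_def])
  then show ?thesis using fA fP by (simp only:) blast
qed

end
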